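(* Let $V$ be an irreducible integrable $\widetilde{LT}$-module on which $K_1,\dots,K_n$ act trivially, and suppose that the linear functional $\overline\lambda\in\mathfrak h_{\overline0}^*$ by which $\mathfrak h_{\overline0}$ acts on the highest weight space $V_+$ is non-zero. Let $\overline V=V/V''$ be the finite-dimensional irreducible $LT$-module defined in the context. Then: (1) $(\overline V\otimes A,\rho(\underline\alpha))$, $\underline\alpha\in\mathbb C^n$, is a completely reducible integrable module for $\widehat{LT}$ with respect to $\widehat{\mathfrak h}=\mathfrak h_{\overline0}\oplus D$. The number of irreducible components occurring in a decomposition of $(\overline V\otimes A,\rho(\underline\alpha))$ as a direct sum of irreducible $\widehat{LT}$-submodules is finite, and all the irreducible components are isomorphic to each other up to a grade shift. (2) For a suitable choice of $\underline\alpha\in\mathbb C^n$, $V$ is isomorphic as an $\widehat{LT}$-module to an irreducible component of $(\overline V\otimes A,\rho(\underline\alpha))$ occurring in a decomposition of $(\overline V\otimes A,\rho(\underline\alpha))$ as a direct sum of finitely many irreducible $\widehat{LT}$-submodules.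
   Context: Everything is over $\mathbb C$; $U(\cdot)$ denotes the universal enveloping algebra. **The Lie torus.** $\mathfrak g$ is a finite-dimensional simple Lie algebra with a symmetric non-degenerate invariant bilinear form $(\cdot|\cdot)$, invariant under all automorphisms of $\mathfrak g$. $n\in\mathbb N$, $A=\mathbb C[t_1^{\pm1},\dots,t_n^{\pm1}]$, $t^{\underline k}=t_1^{k_1}\cdots t_n^{k_n}$ and $x(\underline k)=x\otimes t^{\underline k}$ for $\underline k\in\mathbb Z^n$. $\sigma_1,\dots,\sigma_n$ are commuting automorphisms of $\mathfrak g$ of finite orders $m_1,\dots,m_n$; $\xi_i$ is a primitive $m_i$-th root of unity; $\Gamma=m_1\mathbb Z\oplus\cdots\oplus m_n\mathbb Z$; $\overline k$ is the class of $\underline k$ in $\mathbb Z^n/\Gamma$; $\mathfrak g_{\overline k}=\{x\in\mathfrak g:\sigma_ix=\xi_i^{k_i}x,\ 1\le i\le n\}$. $LT=\bigoplus_{\underline k\in\mathbb Z^n}\mathfrak g_{\overline k}\otimes\mathbb Ct^{\underline k}$ with bracket $[x\otimes f,y\otimes g]=[x,y]\otimes fg$. Standing assumption: $LT$ is a Lie torus, i.e. (1) $\mathfrak g_{\overline 0}$ is a finite-dimensional simple Lie algebra (with Cartan subalgebra $\mathfrak h_{\overline0}$); (2) for $\overline k\ne\overline0$ with $\mathfrak g_{\overline k}\neq0$, as $\mathfrak g_{\overline0}$-module $\mathfrak g_{\overline k}\cong U_{\overline k}\oplus W_{\overline k}$ with $U_{\overline k}$ trivial and $W_{\overline k}$ either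 zero or irreducible of dimension $>1$ with all $\mathfrak h_{\overline0}$-weights in $\Delta_{0,\mathrm{en}}$; (3) $|\langle\sigma_1,\dots,\sigma_n\rangle|=\prod_i m_i$. Here $\Delta_0^\times$ is the set of non-zero roots of $(\mathfrak g_{\overline0},\mathfrak h_{\overline0})$, $\Delta_{0,\mathrm{en}}^\times=\Delta_0^\times\cup2\Delta^\times_{0,\mathrm{sh}}$ ($\mathrm{sh}$ = short roots) if $\Delta_0^\times$ is of type $B_l$ ($l\ge1$, $B_1=A_1$), $\Delta_{0,\mathrm{en}}^\times=\Delta_0^\times$ otherwise, and $\Delta_{0,\mathrm{en}}=\Delta_{0,\mathrm{en}}^\times\cup\{0\}$. For $\alpha\in\mathfrak h_{\overline0}^*$, $\mathfrak g_{\overline k}(\alpha)=\{x\in\mathfrak g_{\overline k}:[h,x]=\alpha(h)x\ \forall h\in\mathfrak h_{\overline0}\}$. Fix simple roots of $\mathfrak g_{\overline0}$; $\Delta_{0,\mathrm{en}}^{\times,\pm}$ are the corresponding positive/negative elements of $\Delta_{0,\mathrm{en}}^\times$. **The graded Lie torus.** $\mathcal Z(\underline m)$ is the space spanned by symbols $t^{\underline k}K_i$ ($\underline k\in\Gamma$, $1\le i\le n$) modulo the relations $\sum_ik_it^{\underline k}K_i=0$; $K_i=t^{\underline0}K_i$. $D$ has basis $d_1,\dots,d_n$. $\widetilde{LT}=LT\oplus\mathcal Z(\underline m)\oplus D$ with $[x(\underline k),y(\underline l)]=[x,y](\underline k+\underline l)+(x|y)\sum_ik_it^{\underline k+\underline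 l}K_i$, $\mathcal Z(\underline m)$ central in $LT\oplus\mathcal Z(\underline m)$, $[d_i,x(\underline k)]=k_ix(\underline k)$, $[d_i,t^{\underline k}K_j]=k_it^{\underline k}K_j$, $[d_i,d_j]=0$. $\widetilde{\mathfrak h}=\mathfrak h_{\overline0}\oplus\sum_i\mathbb CK_i\oplus\sum_i\mathbb Cd_i$. $(\widetilde{LT})_{+}=\bigoplus_{\alpha\in\Delta_{0,\mathrm{en}}^{\times,+},\,\underline k\in\mathbb Z^n}\mathfrak g_{\overline k}(\alpha)\otimes\mathbb Ct^{\underline k}$ and $(LT)_0=\bigoplus_{\underline k\in\mathbb Z^n}\mathfrak g_{\overline k}(0)\otimes\mathbb Ct^{\underline k}$. $\widehat{LT}=LT\oplus D=\widetilde{LT}/\mathcal Z(\underline m)$. **Integrable.** An $\widetilde{LT}$-module $V$ is integrable if it is the direct sum of its weight spaces $V_\lambda$ ($\lambda\in\widetilde{\mathfrak h}^*$), all $V_\lambda$ are finite-dimensional, and every element of $\mathfrak g_{\overline k}(\alpha)\otimes\mathbb Ct^{\underline k}$ with $\alpha\neq0$ acts locally nilpotently on $V$. Integrability of an $\widehat{LT}$-module with respect to $\widehat{\mathfrak h}=\mathfrak h_{\overline0}\oplus D$ is defined in the same way with $\widehat{\mathfrak h}$ in place of $\widetilde{\mathfrak h}$. **The module $\overline V$.** For $V$ as in the claim, $V_+=\{v\in V:(\widetilde{LT})_+.v=0\}$ is non-zero, $\mathfrak h_{\overline0}$ acts on it by a single functional $\overline\lambda$, and $\mathcal Z(\underline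 m)$ acts trivially on $V$, so $V$ is an $\widehat{LT}$-module. A highest central operator of degree $\underline r\in\mathbb Z^n$ is a linear map $z:V_+\to V_+$ commuting with $(LT)_0$ and satisfying $d_iz-zd_i=r_iz$ for all $i$. Let $S\subseteq\Gamma$ be the subgroup generated by all $\underline r\in\Gamma$ such that $h\otimes t^{\underline r}$ acts as a non-zero operator on $V_+$ for some $h\in\mathfrak h_{\overline0}$. Then $S$ has rank $n$, and up to a change of coordinates there are a $\mathbb Z$-basis $f_1,\dots,f_n$ of $\mathbb Z^n$, non-zero integers $l_1,\dots,l_n$ with $S=\bigoplus_i\mathbb Zl_if_i$, and non-zero highest central operators $z_i$ of degree $l_if_i$ ($1\le i\le n$), such that $W_+=\operatorname{span}\{z_iv-v:v\in V_+,\ 1\le i\le n\}$ is a proper $(LT)_0$-submodule of $V_+$. Fix such data; put $V'=U(LT)W_+$, which is a proper $LT$-submodule of $V$ of finite codimension, let $V''$ be a maximal proper $LT$-submodule of $V$ containing $V'$, and $\overline V=V/V''$. **The loop module.** For $\underline\alpha\in\mathbb C^n$, $(\overline V\otimes A,\rho(\underline\alpha))$ is the $\widehat{LT}$-module with $X.(\overline v\otimes t^{\underline s})=(X\overline v)\otimes t^{\underline r+\underline s}$ for $X\in(LT)_{\underline r}=\mathfrak g_{\overline r}\otimes\mathbb Ct^{\underline r}$, and $d_i.(\overline v\otimes t^{\underline s})=(\alpha_i+s_i)(\overline v\otimes t^{\underline s})$. Two $\widehat{LT}$-modules $M,N$ are isomorphic up to a grade shift if $M\cong N\otimes\mathbb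 C_{\underline s}$ for some $\underline s\in\mathbb Z^n$, where $\mathbb C_{\underline s}$ is the one-dimensional $\widehat{LT}$-module on which $LT$ acts by $0$ and $d_i$ acts by $-s_i$. *)

theory Defs
  imports
    "HOL-Analysis.Analysis"
    "HOL-Library.Poly_Mapping"
    "HOL-Computational_Algebra.Group_Closure"
    "HOL-Algebra.Bij"
    "HOL-Algebra.Generated_Groups"
begin

section \<open>Complex vector spaces\<close>

text \<open>
  Complex vector spaces are subspaces of an ambient abelian group type with an explicit scalar
  multiplication satisfying \<^const>\<open>vector_space\<close>; all notions below are relative to such carriers.
\<close>

definition direct_sum ::
  "(complex \<Rightarrow> 'a::ab_group_add \<Rightarrow> 'a) \<Rightarrow> 'i set \<Rightarrow> ('i \<Rightarrow> 'a set) \<Rightarrow> 'a set \<Rightarrow> bool" where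
  "direct_sum s I U M \<longleftrightarrow>
     M = module.span s (\<Union>i\<in>I. U i) \<and>
     (\<forall>F x. F \<subseteq> I \<longrightarrow> finite F \<longrightarrow> (\<forall>i\<in>F. x i \<in> U i) \<longrightarrow> (\<Sum>i\<in>F. x i) = 0 \<longrightarrow> (\<forall>i\<in>F. x i = 0))"

definition fin_dim :: "(complex \<Rightarrow> 'a::ab_group_add \<Rightarrow> 'a) \<Rightarrow> 'a set \<Rightarrow> bool" where
  "fin_dim s W \<longleftrightarrow> (\<exists>B. finite B \<and> W = module.span s B)"

text \<open>A functional on the subspace \<open>H\<close> is extended by \<open>0\<close> outside \<open>H\<close>, so that equality of
  functionals is equality of functions.\<close>

definition dual :: "(complex \<Rightarrow> 'a::ab_group_add \<Rightarrow> 'a) \<Rightarrow> 'a set \<Rightarrow> ('a \<Rightarrow> complex) set" where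
  "dual s H = {\<alpha>. (\<forall>x\<in>H. \<forall>y\<in>H. \<alpha> (x + y) = \<alpha> x + \<alpha> y) \<and>
                  (\<forall>c. \<forall>x\<in>H. \<alpha> (s c x) = c * \<alpha> x) \<and> (\<forall>x. x \<notin> H \<longrightarrow> \<alpha> x = 0)}"

abbreviation zero_fun :: "'a \<Rightarrow> complex" where
  "zero_fun \<equiv> (\<lambda>_. 0)"

text \<open>The operator \<open>x \<otimes> t\<^sup>k \<mapsto> \<phi>(k) x \<otimes> t\<^sup>k\<close> on the space \<open>\<int>\<^sup>n \<Rightarrow>\<^sub>0 'a\<close>, which models
  \<open>'a \<otimes> \<complex>[t\<^sub>1\<^sup>\<plusminus>, \<dots>, t\<^sub>n\<^sup>\<plusminus>]\<close>.\<close>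

definition pm_weight ::
  "(complex \<Rightarrow> 'a::ab_group_add \<Rightarrow> 'a) \<Rightarrow> ('k \<Rightarrow> complex) \<Rightarrow> ('k \<Rightarrow>\<^sub>0 'a) \<Rightarrow> ('k \<Rightarrow>\<^sub>0 'a)" where
  "pm_weight s \<phi> p =
     (\<Sum>k\<in>Poly_Mapping.keys p. Poly_Mapping.single k (s (\<phi> k) (Poly_Mapping.lookup p k)))"

abbreviation pm_scale ::
  "(complex \<Rightarrow> 'a::ab_group_add \<Rightarrow> 'a) \<Rightarrow> complex \<Rightarrow> ('k \<Rightarrow>\<^sub>0 'a) \<Rightarrow> ('k \<Rightarrow>\<^sub>0 'a)" where
  "pm_scale s c \<equiv> pm_weight s (\<lambda>_. c)"

lemma lookup_pm_weight:
  assumes "vector_space s"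
  shows "Poly_Mapping.lookup (pm_weight s \<phi> p) k = s (\<phi> k) (Poly_Mapping.lookup p k)"
proof -
  interpret vector_space s by fact
  have "Poly_Mapping.lookup (pm_weight s \<phi> p) k =
      (\<Sum>j\<in>Poly_Mapping.keys p. (s (\<phi> j) (Poly_Mapping.lookup p j) when j = k))"
    by (simp add: pm_weight_def lookup_sum lookup_single)
  also have "\<dots> = (\<Sum>j\<in>Poly_Mapping.keys p. if j = k then s (\<phi> k) (Poly_Mapping.lookup p k) else 0)"
    by (rule sum.cong) (auto simp: when_def)
  also have "\<dots> = s (\<phi> k) (Poly_Mapping.lookup p k)"
    by (auto simp: sum.delta in_keys_iff scale_zero_right)
  finally show ?thesis .
qed

lemma vector_space_pm_scale: "vector_space s \<Longrightarrow> vector_space (pm_scale s)"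
  unfolding vector_space_def
  by (auto intro!: poly_mapping_eqI simp: lookup_pm_weight[unfolded vector_space_def] lookup_add)

lemma vector_space_vec: "vector_space ((*s) :: complex \<Rightarrow> complex^'n \<Rightarrow> _)"
  by (rule vec.vector_space_axioms)


section \<open>Lie algebras and their modules\<close>

record 'l lie_alg =
  lcarrier :: "'l set"
  lscale :: "complex \<Rightarrow> 'l \<Rightarrow> 'l"
  lbr :: "'l \<Rightarrow> 'l \<Rightarrow> 'l"

definition lie_algebra :: "'l::ab_group_add lie_alg \<Rightarrow> bool" where
  "lie_algebra L \<longleftrightarrow>
     vector_space (lscale L) \<and> module.subspace (lscale L) (lcarrier L) \<and>
     (\<forall>x\<in>lcarrier L. \<forall>y\<in>lcarrier L. lbr L x y \<in> lcarrier L) \<and>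
     (\<forall>x\<in>lcarrier L. \<forall>y\<in>lcarrier L. \<forall>z\<in>lcarrier L.
        lbr L (x + y) z = lbr L x z + lbr L y z \<and> lbr L x (y + z) = lbr L x y + lbr L x z) \<and>
     (\<forall>c. \<forall>x\<in>lcarrier L. \<forall>y\<in>lcarrier L.
        lbr L (lscale L c x) y = lscale L c (lbr L x y) \<and>
        lbr L x (lscale L c y) = lscale L c (lbr L x y)) \<and>
     (\<forall>x\<in>lcarrier L. lbr L x x = 0) \<and>
     (\<forall>x\<in>lcarrier L. \<forall>y\<in>lcarrier L. \<forall>z\<in>lcarrier L.
        lbr L x (lbr L y z) + lbr L y (lbr L z x) + lbr L z (lbr L x y) = 0)"

definition lie_subalgebra :: "'l::ab_group_add lie_alg \<Rightarrow> 'l set \<Rightarrow> bool" where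
  "lie_subalgebra L H \<longleftrightarrow> H \<subseteq> lcarrier L \<and> module.subspace (lscale L) H \<and>
     (\<forall>x\<in>H. \<forall>y\<in>H. lbr L x y \<in> H)"

definition lie_ideal :: "'l::ab_group_add lie_alg \<Rightarrow> 'l set \<Rightarrow> bool" where
  "lie_ideal L I \<longleftrightarrow> I \<subseteq> lcarrier L \<and> module.subspace (lscale L) I \<and>
     (\<forall>x\<in>lcarrier L. \<forall>y\<in>I. lbr L x y \<in> I)"

definition simple_lie_algebra :: "'l::ab_group_add lie_alg \<Rightarrow> bool" where
  "simple_lie_algebra L \<longleftrightarrow> lie_algebra L \<and>
     (\<exists>x\<in>lcarrier L. \<exists>y\<in>lcarrier L. lbr L x y \<noteq> 0) \<and>
     (\<forall>I. lie_ideal L I \<longrightarrow> I = {0} \<or> I = lcarrier L)"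

primrec lower_central :: "'l::ab_group_add lie_alg \<Rightarrow> 'l set \<Rightarrow> nat \<Rightarrow> 'l set" where
  "lower_central L H 0 = H"
| "lower_central L H (Suc j) =
     module.span (lscale L) {lbr L x y | x y. x \<in> H \<and> y \<in> lower_central L H j}"

definition cartan_subalgebra :: "'l::ab_group_add lie_alg \<Rightarrow> 'l set \<Rightarrow> bool" where
  "cartan_subalgebra L H \<longleftrightarrow> lie_subalgebra L H \<and> (\<exists>j. lower_central L H j = {0}) \<and>
     {x \<in> lcarrier L. \<forall>y\<in>H. lbr L x y \<in> H} = H"

definition lie_automorphism :: "'l::ab_group_add lie_alg \<Rightarrow> ('l \<Rightarrow> 'l) \<Rightarrow> bool" where
  "lie_automorphism L \<tau> \<longleftrightarrow> bij_betw \<tau> (lcarrier L) (lcarrier L) \<and>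
     (\<forall>x\<in>lcarrier L. \<forall>y\<in>lcarrier L. \<tau> (x + y) = \<tau> x + \<tau> y \<and> \<tau> (lbr L x y) = lbr L (\<tau> x) (\<tau> y)) \<and>
     (\<forall>c. \<forall>x\<in>lcarrier L. \<tau> (lscale L c x) = lscale L c (\<tau> x))"

record ('l, 'v) lmod =
  mcarrier :: "'v set"
  mscale :: "complex \<Rightarrow> 'v \<Rightarrow> 'v"
  mact :: "'l \<Rightarrow> 'v \<Rightarrow> 'v"

definition linear_on ::
  "(complex \<Rightarrow> 'a::ab_group_add \<Rightarrow> 'a) \<Rightarrow> 'a set \<Rightarrow> (complex \<Rightarrow> 'b::ab_group_add \<Rightarrow> 'b) \<Rightarrow> ('a \<Rightarrow> 'b) \<Rightarrow> bool" where
  "linear_on s M s' f \<longleftrightarrow> (\<forall>v\<in>M. \<forall>w\<in>M. f (v + w) = f v + f w) \<and> (\<forall>c. \<forall>v\<in>M. f (s c v) = s' c (f v))"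

definition lie_module :: "'l::ab_group_add lie_alg \<Rightarrow> ('l, 'v::ab_group_add) lmod \<Rightarrow> bool" where
  "lie_module L M \<longleftrightarrow>
     vector_space (mscale M) \<and> module.subspace (mscale M) (mcarrier M) \<and>
     (\<forall>x\<in>lcarrier L. mact M x ` mcarrier M \<subseteq> mcarrier M \<and>
                     linear_on (mscale M) (mcarrier M) (mscale M) (mact M x)) \<and>
     (\<forall>v\<in>mcarrier M. linear_on (lscale L) (lcarrier L) (mscale M) (\<lambda>x. mact M x v)) \<and>
     (\<forall>x\<in>lcarrier L. \<forall>y\<in>lcarrier L. \<forall>v\<in>mcarrier M.
        mact M (lbr L x y) v = mact M x (mact M y v) - mact M y (mact M x v))"

definition submodule :: "'l lie_alg \<Rightarrow> ('l, 'v::ab_group_add) lmod \<Rightarrow> 'v set \<Rightarrow> bool" where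
  "submodule L M U \<longleftrightarrow> U \<subseteq> mcarrier M \<and> module.subspace (mscale M) U \<and>
     (\<forall>x\<in>lcarrier L. \<forall>v\<in>U. mact M x v \<in> U)"

definition irreducible_module :: "'l lie_alg \<Rightarrow> ('l, 'v::ab_group_add) lmod \<Rightarrow> bool" where
  "irreducible_module L M \<longleftrightarrow> mcarrier M \<noteq> {0} \<and>
     (\<forall>U. submodule L M U \<longrightarrow> U = {0} \<or> U = mcarrier M)"

definition maximal_submodule :: "'l lie_alg \<Rightarrow> ('l, 'v::ab_group_add) lmod \<Rightarrow> 'v set \<Rightarrow> bool" where
  "maximal_submodule L M U \<longleftrightarrow> submodule L M U \<and> U \<noteq> mcarrier M \<and>
     (\<forall>W. submodule L M W \<longrightarrow> U \<subseteq> W \<longrightarrow> W = U \<or> W = mcarrier M)"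

text \<open>\<open>U(L) W\<close>: the enveloping algebra is spanned by the monomials \<open>x\<^sub>1 \<cdots> x\<^sub>r\<close> in elements of \<open>L\<close>.\<close>

definition envelope_span :: "'l lie_alg \<Rightarrow> ('l, 'v::ab_group_add) lmod \<Rightarrow> 'v set \<Rightarrow> 'v set" where
  "envelope_span L M W =
     module.span (mscale M) {foldr (mact M) xs w | xs w. set xs \<subseteq> lcarrier L \<and> w \<in> W}"

definition module_iso ::
  "'l lie_alg \<Rightarrow> ('l, 'v::ab_group_add) lmod \<Rightarrow> ('l, 'w::ab_group_add) lmod \<Rightarrow> bool" where
  "module_iso L M N \<longleftrightarrow> (\<exists>\<phi>. bij_betw \<phi> (mcarrier M) (mcarrier N) \<and>
     linear_on (mscale M) (mcarrier M) (mscale N) \<phi> \<and>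
     (\<forall>x\<in>lcarrier L. \<forall>v\<in>mcarrier M. \<phi> (mact M x v) = mact N x (\<phi> v)))"

text \<open>\<open>(Q, \<pi>)\<close> is the quotient module \<open>M/U\<close> with its canonical projection.  As \<open>U\<close> is a value and
  not a type, the quotient is given by its projection; a theorem about all such \<open>(Q, \<pi>)\<close> is a
  theorem about every realisation of \<open>M/U\<close>, and one always exists (lemma \<open>quotient_module_exists\<close>).\<close>

definition quotient_module ::
  "'l lie_alg \<Rightarrow> ('l, 'v::ab_group_add) lmod \<Rightarrow> 'v set \<Rightarrow> ('l, 'q::ab_group_add) lmod \<Rightarrow> ('v \<Rightarrow> 'q) \<Rightarrow> bool" where
  "quotient_module L M U Q \<pi> \<longleftrightarrow>
     vector_space (mscale Q) \<and> linear_on (mscale M) (mcarrier M) (mscale Q) \<pi> \<and>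
     \<pi> ` mcarrier M = mcarrier Q \<and> {v \<in> mcarrier M. \<pi> v = 0} = U \<and>
     (\<forall>x\<in>lcarrier L. \<forall>v\<in>mcarrier M. mact Q x (\<pi> v) = \<pi> (mact M x v))"

lemma quotient_module_exists:
  fixes M :: "('l::ab_group_add, 'v::ab_group_add) lmod"
  assumes M: "lie_module L M" and U: "submodule L M U"
  shows "\<exists>(Q :: ('l, 'v) lmod) \<pi>. quotient_module L M U Q \<pi>"
proof -
  let ?s = "mscale M"
  interpret vector_space ?s using M by (simp add: lie_module_def)
  interpret p: vector_space_pair ?s ?s ..
  have subM: "subspace (mcarrier M)" using M by (simp add: lie_module_def)
  have UM: "U \<subseteq> mcarrier M" and subU: "subspace U"
    and stable: "\<And>x v. x \<in> lcarrier L \<Longrightarrow> v \<in> U \<Longrightarrow> mact M x v \<in> U"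
    using U by (auto simp: submodule_def)
  obtain B where B: "B \<subseteq> U" "independent B" "U \<subseteq> span B"
    using maximal_independent_subset[of U] by blast
  let ?E = "extend_basis B"
  obtain \<pi> where lin: "Vector_Spaces.linear ?s ?s \<pi>"
    and \<pi>: "\<And>x. x \<in> ?E \<Longrightarrow> \<pi> x = (if x \<in> B then 0 else x)"
    using p.linear_independent_extend[OF independent_extend_basis[OF B(2)],
        of "\<lambda>x. if x \<in> B then 0 else x"] by blast
  interpret \<pi>: Vector_Spaces.linear ?s ?s \<pi> by fact
  have diff: "v - \<pi> v \<in> U" for v
  proof -
    have "v \<in> span ?E" by (simp add: B(2) span_extend_basis)
    then show ?thesis
    proof (induction v rule: span_induct_alt)
      case base
      show ?case using subU by (simp add: \<pi>.zero subspace_0)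
    next
      case (step c x y)
      have "x - \<pi> x \<in> U" using \<pi>[OF step(1)] B(1) subspace_0[OF subU] by auto
      moreover have "(?s c x + y) - \<pi> (?s c x + y) = ?s c (x - \<pi> x) + (y - \<pi> y)"
        by (simp add: \<pi>.add \<pi>.scale scale_right_diff_distrib algebra_simps)
      ultimately show ?case
        using subspace_add[OF subU subspace_scale[OF subU] step(2)] by (simp only:)
    qed
  qed
  have kerU: "\<pi> v = 0" if "v \<in> U" for v
  proof -
    have "v \<in> span B" using that B(3) by blast
    then show ?thesis
    proof (induction v rule: span_induct_alt)
      case base
      show ?case by (simp add: \<pi>.zero)
    next
      case (step c x y)
      then have "\<pi> x = 0" using \<pi>[of x] extend_basis_superset[OF B(2)] by auto
      then show ?case using step by (simp add: \<pi>.add \<pi>.scale)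
    qed
  qed
  let ?Q = "\<lparr>mcarrier = \<pi> ` mcarrier M, mscale = ?s, mact = (\<lambda>x q. \<pi> (mact M x q))\<rparr>"
  have "\<pi> (mact M x (\<pi> v)) = \<pi> (mact M x v)" if x: "x \<in> lcarrier L" and v: "v \<in> mcarrier M" for x v
  proof -
    have \<pi>v: "\<pi> v \<in> mcarrier M"
      using subspace_diff[OF subM v, of "v - \<pi> v"] diff UM by auto
    have "linear_on ?s (mcarrier M) ?s (mact M x)" using M x by (simp add: lie_module_def)
    then have "mact M x (\<pi> v + (v - \<pi> v)) = mact M x (\<pi> v) + mact M x (v - \<pi> v)"
      unfolding linear_on_def using \<pi>v diff UM by blast
    then have "mact M x v = mact M x (\<pi> v) + mact M x (v - \<pi> v)" by simp
    then show ?thesis using kerU[OF stable[OF x diff]] by (simp add: \<pi>.add)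
  qed
  moreover have "{v \<in> mcarrier M. \<pi> v = 0} = U"
  proof
    show "{v \<in> mcarrier M. \<pi> v = 0} \<subseteq> U"
    proof
      fix v assume "v \<in> {v \<in> mcarrier M. \<pi> v = 0}"
      then show "v \<in> U" using diff[of v] by simp
    qed
  qed (use kerU UM in auto)
  moreover have "linear_on ?s (mcarrier M) ?s \<pi>"
    by (simp add: linear_on_def \<pi>.add \<pi>.scale)
  ultimately have "quotient_module L M U ?Q \<pi>"
    by (simp add: quotient_module_def vector_space_axioms)
  then show ?thesis by blast
qed

text \<open>A decomposition into a direct sum of irreducible submodules.  Such summands are non-zero and
  hence pairwise distinct, so a set of submodules loses no multiplicities.\<close>

definition irreducible_decomposition ::
  "'l lie_alg \<Rightarrow> ('l, 'v::ab_group_add) lmod \<Rightarrow> 'v set set \<Rightarrow> bool" where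
  "irreducible_decomposition L M C \<longleftrightarrow>
     (\<forall>U\<in>C. submodule L M U \<and> irreducible_module L (M\<lparr>mcarrier := U\<rparr>)) \<and>
     direct_sum (mscale M) C id (mcarrier M)"

definition completely_reducible :: "'l lie_alg \<Rightarrow> ('l, 'v::ab_group_add) lmod \<Rightarrow> bool" where
  "completely_reducible L M \<longleftrightarrow> (\<exists>C. irreducible_decomposition L M C)"

definition weight_space :: "'l set \<Rightarrow> ('l, 'v::ab_group_add) lmod \<Rightarrow> ('l \<Rightarrow> complex) \<Rightarrow> 'v set" where
  "weight_space H M \<mu> = {v \<in> mcarrier M. \<forall>h\<in>H. mact M h v = mscale M (\<mu> h) v}"

text \<open>\<open>H\<close> is the Cartan subalgebra and \<open>N\<close> the set of elements required to act locally nilpotently.\<close>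

definition integrable_module ::
  "'l::ab_group_add lie_alg \<Rightarrow> 'l set \<Rightarrow> 'l set \<Rightarrow> ('l, 'v::ab_group_add) lmod \<Rightarrow> bool" where
  "integrable_module L H N M \<longleftrightarrow>
     direct_sum (mscale M) (dual (lscale L) H) (weight_space H M) (mcarrier M) \<and>
     (\<forall>\<mu>\<in>dual (lscale L) H. fin_dim (mscale M) (weight_space H M \<mu>)) \<and>
     (\<forall>x\<in>N. \<forall>v\<in>mcarrier M. \<exists>j. (mact M x ^^ j) v = 0)"


section \<open>The Lie torus\<close>

text \<open>The simple Lie algebra \<open>\<gg>\<close> is the whole type \<open>'g\<close>, and the index set \<open>{1, \<dots>, n}\<close> is the
  type \<open>'n\<close>.\<close>

record ('g, 'n) torus_data =
  gscale :: "complex \<Rightarrow> 'g \<Rightarrow> 'g"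
  gbr :: "'g \<Rightarrow> 'g \<Rightarrow> 'g"
  gform :: "'g \<Rightarrow> 'g \<Rightarrow> complex"
  gsig :: "'n \<Rightarrow> 'g \<Rightarrow> 'g"                   \<comment> \<open>the automorphisms \<open>\<sigma>\<^sub>i\<close>\<close>
  gord :: "'n \<Rightarrow> nat"                         \<comment> \<open>their orders \<open>m\<^sub>i\<close>\<close>
  gxi :: "'n \<Rightarrow> complex"                     \<comment> \<open>the roots of unity \<open>\<xi>\<^sub>i\<close>\<close>
  gcartan :: "'g set"                        \<comment> \<open>the Cartan subalgebra of the fixed point algebra\<close>
  gbase :: "('g \<Rightarrow> complex) set"             \<comment> \<open>the simple roots\<close>

definition g_alg :: "('g, 'n::finite) torus_data \<Rightarrow> 'g lie_alg" where
  "g_alg T = \<lparr>lcarrier = UNIV, lscale = gscale T, lbr = gbr T\<rparr>"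

definition Gam :: "('g, 'n::finite) torus_data \<Rightarrow> (int^'n) set" where
  "Gam T = {k. \<forall>i. int (gord T i) dvd k $ i}"

definition grade :: "('g, 'n::finite) torus_data \<Rightarrow> int^'n \<Rightarrow> 'g set" where
  "grade T k = {x. \<forall>i. gsig T i x = gscale T (gxi T i powi (k $ i)) x}"

definition g0_alg :: "('g, 'n::finite) torus_data \<Rightarrow> 'g lie_alg" where
  "g0_alg T = \<lparr>lcarrier = grade T 0, lscale = gscale T, lbr = gbr T\<rparr>"

abbreviation cartan_dual :: "('g::ab_group_add, 'n::finite) torus_data \<Rightarrow> ('g \<Rightarrow> complex) set" where
  "cartan_dual T \<equiv> dual (gscale T) (gcartan T)"

definition root_space :: "('g, 'n::finite) torus_data \<Rightarrow> int^'n \<Rightarrow> ('g \<Rightarrow> complex) \<Rightarrow> 'g set" where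
  "root_space T k \<alpha> = {x \<in> grade T k. \<forall>h\<in>gcartan T. gbr T h x = gscale T (\<alpha> h) x}"

definition roots :: "('g::ab_group_add, 'n::finite) torus_data \<Rightarrow> ('g \<Rightarrow> complex) set" where
  "roots T = {\<alpha> \<in> cartan_dual T. \<alpha> \<noteq> zero_fun \<and> root_space T 0 \<alpha> \<noteq> {0}}"

text \<open>\<open>(\<alpha>|\<alpha>)\<close> for the form on the dual of the Cartan subalgebra transported from \<open>(\<cdot>|\<cdot>)\<close>.\<close>

definition sq_length :: "('g, 'n::finite) torus_data \<Rightarrow> ('g \<Rightarrow> complex) \<Rightarrow> complex" where
  "sq_length T \<alpha> =
     (let t = (THE t. t \<in> gcartan T \<and> (\<forall>h\<in>gcartan T. gform T t h = \<alpha> h)) in gform T t t)"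

text \<open>The form is only determined up to a complex factor; quotients of square lengths of roots are
  positive rationals independent of that factor.  If all roots have the same length they are all
  short.\<close>

definition short_roots :: "('g::ab_group_add, 'n::finite) torus_data \<Rightarrow> ('g \<Rightarrow> complex) set" where
  "short_roots T = {\<alpha> \<in> roots T. \<forall>\<beta>\<in>roots T. Re (sq_length T \<alpha> / sq_length T \<beta>) \<le> 1}"

text \<open>The standard realisation \<open>{\<plusminus>\<epsilon>\<^sub>i} \<union> {\<plusminus>\<epsilon>\<^sub>i \<plusminus> \<epsilon>\<^sub>j | i \<noteq> j}\<close> of the root system \<open>B\<^sub>l\<close>, \<open>l \<ge> 1\<close>.\<close>

definition type_B :: "('g \<Rightarrow> complex) set \<Rightarrow> bool" where
  "type_B R \<longleftrightarrow> (\<exists>l\<ge>1. \<exists>e :: nat \<Rightarrow> 'g \<Rightarrow> complex.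
     (\<forall>c. (\<forall>h. (\<Sum>i<l. c i * e i h) = 0) \<longrightarrow> (\<forall>i<l. c i = 0)) \<and>
     R = {(\<lambda>h. a * e i h) | a i. i < l \<and> a \<in> {1, -1}} \<union>
         {(\<lambda>h. a * e i h + b * e j h) | a b i j.
            i < l \<and> j < l \<and> i \<noteq> j \<and> a \<in> {1, -1} \<and> b \<in> {1, -1}})"

definition en_roots :: "('g::ab_group_add, 'n::finite) torus_data \<Rightarrow> ('g \<Rightarrow> complex) set" where
  "en_roots T = (if type_B (roots T)
     then roots T \<union> {(\<lambda>h. 2 * \<alpha> h) | \<alpha>. \<alpha> \<in> short_roots T} else roots T)"

definition nonneg_combination :: "('g \<Rightarrow> complex) set \<Rightarrow> ('g \<Rightarrow> complex) \<Rightarrow> bool" where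
  "nonneg_combination B \<alpha> \<longleftrightarrow> (\<exists>c :: _ \<Rightarrow> nat. \<forall>h. \<alpha> h = (\<Sum>\<beta>\<in>B. of_nat (c \<beta>) * \<beta> h))"

definition is_base :: "('g \<Rightarrow> complex) set \<Rightarrow> ('g \<Rightarrow> complex) set \<Rightarrow> bool" where
  "is_base R B \<longleftrightarrow> finite B \<and> B \<subseteq> R \<and>
     (\<forall>c. (\<forall>h. (\<Sum>\<beta>\<in>B. c \<beta> * \<beta> h) = 0) \<longrightarrow> (\<forall>\<beta>\<in>B. c \<beta> = 0)) \<and>
     (\<forall>\<alpha>\<in>R. nonneg_combination B \<alpha> \<or> nonneg_combination B (\<lambda>h. - \<alpha> h))"

definition en_pos_roots :: "('g::ab_group_add, 'n::finite) torus_data \<Rightarrow> ('g \<Rightarrow> complex) set" where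
  "en_pos_roots T = {\<alpha> \<in> en_roots T. nonneg_combination (gbase T) \<alpha>}"

definition has_order :: "('a \<Rightarrow> 'a) \<Rightarrow> nat \<Rightarrow> bool" where
  "has_order f m \<longleftrightarrow> 0 < m \<and> f ^^ m = id \<and> (\<forall>j. 0 < j \<and> j < m \<longrightarrow> f ^^ j \<noteq> id)"

definition primitive_root_of_unity :: "nat \<Rightarrow> complex \<Rightarrow> bool" where
  "primitive_root_of_unity m \<xi> \<longleftrightarrow> \<xi> ^ m = 1 \<and> (\<forall>j. 0 < j \<and> j < m \<longrightarrow> \<xi> ^ j \<noteq> 1)"

definition invariant_form :: "('g::ab_group_add, 'n::finite) torus_data \<Rightarrow> bool" where
  "invariant_form T \<longleftrightarrow>
     (\<forall>x y z. gform T (x + y) z = gform T x z + gform T y z) \<and>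
     (\<forall>c x y. gform T (gscale T c x) y = c * gform T x y) \<and>
     (\<forall>x y. gform T x y = gform T y x) \<and>
     (\<forall>x. (\<forall>y. gform T x y = 0) \<longrightarrow> x = 0) \<and>
     (\<forall>x y z. gform T (gbr T x y) z = gform T x (gbr T y z)) \<and>
     (\<forall>\<tau>. lie_automorphism (g_alg T) \<tau> \<longrightarrow> (\<forall>x y. gform T (\<tau> x) (\<tau> y) = gform T x y))"

text \<open>The homogeneous components are submodules for the adjoint action of the fixed point algebra.\<close>

definition adjoint_on :: "('g, 'n::finite) torus_data \<Rightarrow> 'g set \<Rightarrow> ('g, 'g) lmod" where
  "adjoint_on T W = \<lparr>mcarrier = W, mscale = gscale T, mact = gbr T\<rparr>"

definition lie_torus :: "('g::ab_group_add, 'n::finite) torus_data \<Rightarrow> bool" where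
  "lie_torus T \<longleftrightarrow>
     simple_lie_algebra (g_alg T) \<and> fin_dim (gscale T) UNIV \<and> invariant_form T \<and>
     (\<forall>i. lie_automorphism (g_alg T) (gsig T i) \<and> has_order (gsig T i) (gord T i) \<and>
          primitive_root_of_unity (gord T i) (gxi T i)) \<and>
     (\<forall>i j. gsig T i \<circ> gsig T j = gsig T j \<circ> gsig T i) \<and>
     simple_lie_algebra (g0_alg T) \<and> cartan_subalgebra (g0_alg T) (gcartan T) \<and>
     is_base (roots T) (gbase T) \<and>
     (\<forall>k. k \<notin> Gam T \<longrightarrow> grade T k \<noteq> {0} \<longrightarrow>
        (\<exists>U W. submodule (g0_alg T) (adjoint_on T (grade T k)) U \<and>
               submodule (g0_alg T) (adjoint_on T (grade T k)) W \<and>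
               U \<inter> W = {0} \<and> {u + w | u w. u \<in> U \<and> w \<in> W} = grade T k \<and>
               (\<forall>x\<in>grade T 0. \<forall>u\<in>U. gbr T x u = 0) \<and>
               (W = {0} \<or>
                 irreducible_module (g0_alg T) (adjoint_on T W) \<and>
                 vector_space.dim (gscale T) W > 1 \<and>
                 (\<forall>\<mu>\<in>cartan_dual T. weight_space (gcartan T) (adjoint_on T W) \<mu> \<noteq> {0} \<longrightarrow>
                    \<mu> \<in> en_roots T \<union> {zero_fun})))) \<and>
     card (generate (BijGroup UNIV) (range (gsig T))) = (\<Prod>i\<in>UNIV. gord T i)"


section \<open>The centre\<close>

definition ivec :: "int^'n \<Rightarrow> complex^'n" where
  "ivec k = (\<chi> i. of_int (k $ i))"

definition pairing :: "complex^'n \<Rightarrow> complex^'n \<Rightarrow> complex" where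
  "pairing d a = (\<Sum>i\<in>UNIV. d $ i * a $ i)"

text \<open>The symbol \<open>t\<^sup>k K\<^sub>i\<close> is \<open>single k (axis i 1)\<close>, so \<open>\<Sum>\<^sub>i k\<^sub>i t\<^sup>k K\<^sub>i\<close> is \<open>single k (ivec k)\<close>.  The
  type below has symbols for all \<open>k \<in> \<int>\<^sup>n\<close>.  The relations are homogeneous, so the space
  \<open>\<Z>(m)\<close>, where only \<open>k \<in> \<Gamma>\<close> is allowed, is the subspace \<open>center_space\<close> of it.\<close>

abbreviation symbol_relations :: "(int^'n \<Rightarrow>\<^sub>0 complex^'n) set" where
  "symbol_relations \<equiv> module.span (pm_scale (*s)) (range (\<lambda>k. Poly_Mapping.single k (ivec k)))"

definition center_rel :: "(int^'n \<Rightarrow>\<^sub>0 complex^'n) \<Rightarrow> (int^'n \<Rightarrow>\<^sub>0 complex^'n) \<Rightarrow> bool" where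
  "center_rel f g \<longleftrightarrow> f - g \<in> symbol_relations"

interpretation symb: vector_space "pm_scale ((*s) :: complex \<Rightarrow> complex^'n \<Rightarrow> _) ::
    complex \<Rightarrow> ('k \<Rightarrow>\<^sub>0 complex^'n) \<Rightarrow> _"
  by (rule vector_space_pm_scale[OF vector_space_vec])

lemma equivp_center_rel: "equivp (center_rel :: (int^'n \<Rightarrow>\<^sub>0 complex^'n) \<Rightarrow> _)"
proof (rule equivpI)
  show "reflp (center_rel :: (int^'n \<Rightarrow>\<^sub>0 _) \<Rightarrow> _)" by (simp add: reflp_def center_rel_def symb.span_zero)
  show "symp (center_rel :: (int^'n \<Rightarrow>\<^sub>0 _) \<Rightarrow> _)"
  proof (rule sympI)
    fix f g :: "int^'n \<Rightarrow>\<^sub>0 complex^'n"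
    assume "center_rel f g"
    then have "- (f - g) \<in> symbol_relations" unfolding center_rel_def by (rule symb.span_neg)
    then show "center_rel g f" unfolding center_rel_def by simp
  qed
  show "transp (center_rel :: (int^'n \<Rightarrow>\<^sub>0 _) \<Rightarrow> _)"
  proof (rule transpI)
    fix f g h :: "int^'n \<Rightarrow>\<^sub>0 complex^'n"
    assume "center_rel f g" "center_rel g h"
    then have "(f - g) + (g - h) \<in> symbol_relations" unfolding center_rel_def by (rule symb.span_add)
    then show "center_rel f h" unfolding center_rel_def by simp
  qed
qed

quotient_type (overloaded) 'n center = "(int^'n::finite) \<Rightarrow>\<^sub>0 (complex^'n)" / center_rel
  by (rule equivp_center_rel)

instantiation center :: (finite) ab_group_add
begin

lift_definition zero_center :: "'a center" is 0 .

lift_definition plus_center :: "'a center \<Rightarrow> 'a center \<Rightarrow> 'a center" is "(+)"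
  unfolding center_rel_def by (subst add_diff_add, rule symb.span_add)

lift_definition uminus_center :: "'a center \<Rightarrow> 'a center" is uminus
  unfolding center_rel_def by (drule symb.span_neg, simp add: minus_diff_commute)

lift_definition minus_center :: "'a center \<Rightarrow> 'a center \<Rightarrow> 'a center" is "(-)"
  unfolding center_rel_def by (drule (1) symb.span_diff, simp add: algebra_simps)

instance
  by standard (transfer, simp add: center_rel_def symb.span_zero algebra_simps)+

end

lift_definition center_scale :: "complex \<Rightarrow> 'n::finite center \<Rightarrow> 'n center" is "pm_scale (*s)"
  unfolding center_rel_def by (subst symb.scale_right_diff_distrib[symmetric], rule symb.span_scale)

lemma vector_space_center_scale: "vector_space (center_scale :: complex \<Rightarrow> 'n::finite center \<Rightarrow> _)"
  unfolding vector_space_def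
  by (intro conjI allI; transfer;
      simp add: center_rel_def symb.span_zero symb.scale_right_distrib symb.scale_left_distrib)

lift_definition tK :: "int^'n::finite \<Rightarrow> 'n \<Rightarrow> 'n center" is
  "\<lambda>k i. Poly_Mapping.single k (axis i 1)" .

lemma tK_relation: "(\<Sum>i\<in>UNIV. center_scale (of_int (k $ i)) (tK k i)) = (0 :: 'n::finite center)"
proof -
  have sum_abs: "(\<Sum>i\<in>F. abs_center (p i)) = abs_center (\<Sum>i\<in>F. p i)"
    for F :: "'n set" and p :: "'n \<Rightarrow> int^'n \<Rightarrow>\<^sub>0 complex^'n"
    by (induction F rule: infinite_finite_induct)
      (simp_all add: zero_center.abs_eq plus_center.abs_eq)
  have "(\<Sum>i\<in>UNIV. pm_scale (*s) (of_int (k $ i)) (Poly_Mapping.single k (axis i 1))) =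
      Poly_Mapping.single k (ivec k)"
    by (rule poly_mapping_eqI)
      (auto simp: lookup_sum lookup_pm_weight[OF vector_space_vec] lookup_single when_def
        ivec_def vec_eq_iff axis_def if_distrib cong: if_cong)
  moreover have "center_rel (Poly_Mapping.single k (ivec k)) 0"
    by (simp add: center_rel_def symb.span_base)
  ultimately show ?thesis
    by (simp add: tK.abs_eq center_scale.abs_eq sum_abs zero_center.abs_eq center.abs_eq_iff)
qed

text \<open>The derivation \<open>\<Sum>\<^sub>i (d $ i) d\<^sub>i\<close> of the centre: \<open>t\<^sup>k K\<^sub>j \<mapsto> (\<Sum>\<^sub>i (d $ i) k\<^sub>i) t\<^sup>k K\<^sub>j\<close>.\<close>

lemma pm_weight_relations:
  assumes "p \<in> (symbol_relations :: (int^'n \<Rightarrow>\<^sub>0 complex^'n) set)"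
  shows "pm_weight (*s) \<phi> p \<in> symbol_relations"
  using assms
proof (induction p rule: symb.span_induct_alt)
  case base
  have "pm_weight (*s) \<phi> (0 :: int^'n \<Rightarrow>\<^sub>0 complex^'n) = 0" by (simp add: pm_weight_def)
  then show ?case by (simp only: symb.span_zero)
next
  case (step c x y)
  from step obtain k where x: "x = Poly_Mapping.single k (ivec k)" by auto
  have "pm_weight (*s) \<phi> (pm_scale (*s) c x + y) = pm_scale (*s) (\<phi> k * c) x + pm_weight (*s) \<phi> y"
    by (rule poly_mapping_eqI)
      (auto simp: x lookup_pm_weight[OF vector_space_vec] lookup_add lookup_single when_def
        vector_ssub_ldistrib vec.scale_right_distrib)
  moreover have "pm_scale (*s) (\<phi> k * c) x \<in> symbol_relations"
    unfolding x by (intro symb.span_scale symb.span_base rangeI)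
  ultimately show ?case using step by (simp only: symb.span_add)
qed

lift_definition center_deriv :: "complex^'n::finite \<Rightarrow> 'n center \<Rightarrow> 'n center" is
  "\<lambda>d. pm_weight (*s) (\<lambda>k. pairing d (ivec k))"
proof -
  fix d :: "complex^'n" and f g :: "int^'n \<Rightarrow>\<^sub>0 complex^'n"
  let ?D = "pm_weight (*s) (\<lambda>k. pairing d (ivec k))"
  assume "center_rel f g"
  then have "?D (f - g) \<in> symbol_relations"
    unfolding center_rel_def by (rule pm_weight_relations)
  moreover have "?D (f - g) = ?D f - ?D g"
    by (rule poly_mapping_eqI)
      (simp add: lookup_pm_weight[OF vector_space_vec] lookup_minus vec.scale_right_diff_distrib)
  ultimately show "center_rel (?D f) (?D g)" by (simp add: center_rel_def)
qed

definition center_space :: "('g, 'n::finite) torus_data \<Rightarrow> 'n center set" where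
  "center_space T = module.span center_scale {tK k i | k i. k \<in> Gam T}"


section \<open>The graded Lie torus\<close>

text \<open>An element \<open>\<Sum>\<^sub>k x\<^sub>k \<otimes> t\<^sup>k\<close> of \<open>\<gg> \<otimes> A\<close> is the finitely supported function \<open>k \<mapsto> x\<^sub>k\<close>.  A triple
  \<open>(x, z, d)\<close> is the element \<open>x + z + \<Sum>\<^sub>i (d $ i) d\<^sub>i\<close> of the graded Lie torus, and a pair
  \<open>(x, d)\<close> is the element \<open>x + \<Sum>\<^sub>i (d $ i) d\<^sub>i\<close> of its quotient by the centre.\<close>

type_synonym ('g, 'n) mloop = "(int^'n) \<Rightarrow>\<^sub>0 'g"
type_synonym ('g, 'n) tilde = "('g, 'n) mloop \<times> 'n center \<times> (complex^'n)"
type_synonym ('g, 'n) hat = "('g, 'n) mloop \<times> (complex^'n)"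

definition loop_br :: "('g::ab_group_add, 'n::finite) torus_data \<Rightarrow>
    ('g, 'n) mloop \<Rightarrow> ('g, 'n) mloop \<Rightarrow> ('g, 'n) mloop" where
  "loop_br T x y = (\<Sum>k\<in>Poly_Mapping.keys x. \<Sum>l\<in>Poly_Mapping.keys y.
     Poly_Mapping.single (k + l) (gbr T (Poly_Mapping.lookup x k) (Poly_Mapping.lookup y l)))"

definition cocycle :: "('g::ab_group_add, 'n::finite) torus_data \<Rightarrow>
    ('g, 'n) mloop \<Rightarrow> ('g, 'n) mloop \<Rightarrow> 'n center" where
  "cocycle T x y = (\<Sum>k\<in>Poly_Mapping.keys x. \<Sum>l\<in>Poly_Mapping.keys y.
     center_scale (gform T (Poly_Mapping.lookup x k) (Poly_Mapping.lookup y l))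
       (\<Sum>i\<in>UNIV. center_scale (of_int (k $ i)) (tK (k + l) i)))"

lemma bracket_homogeneous:
  fixes T :: "('a::ab_group_add, 'b::finite) torus_data"
  assumes "lie_algebra (g_alg T)" "invariant_form T"
  shows "loop_br T (Poly_Mapping.single k x) (Poly_Mapping.single l y) =
      Poly_Mapping.single (k + l) (gbr T x y)"
    and "cocycle T (Poly_Mapping.single k x) (Poly_Mapping.single l y) =
      center_scale (gform T x y) (\<Sum>i\<in>UNIV. center_scale (of_int (k $ i)) (tK (k + l) i))"
proof -
  have b: "gbr T (u + v) w = gbr T u w + gbr T v w" "gbr T w (u + v) = gbr T w u + gbr T w v" for u v w
    using assms(1) by (simp_all add: lie_algebra_def g_alg_def)
  have c1: "\<forall>x y z. gform T (x + y) z = gform T x z + gform T y z"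
    and c2: "\<forall>x y. gform T x y = gform T y x"
    using assms(2) unfolding invariant_form_def by - (elim conjE, assumption)+
  have [simp]: "gbr T 0 w = 0" "gbr T w 0 = 0" for w
    using b(1)[of 0 0 w] b(2)[of w 0 0] by simp_all
  have f1: "gform T 0 w = 0" for w
    using c1[rule_format, of 0 0 w] by simp
  have f2: "gform T w 0 = 0" for w
    using c2[rule_format, of w 0] f1[of w] by (rule trans)
  note [simp] = f1 f2
  interpret cen: vector_space "center_scale :: complex \<Rightarrow> 'b center \<Rightarrow> _"
    by (rule vector_space_center_scale)
  show "loop_br T (Poly_Mapping.single k x) (Poly_Mapping.single l y) =
      Poly_Mapping.single (k + l) (gbr T x y)"
    by (cases "x = 0"; cases "y = 0") (simp_all add: loop_br_def)
  show "cocycle T (Poly_Mapping.single k x) (Poly_Mapping.single l y) =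
      center_scale (gform T x y) (\<Sum>i\<in>UNIV. center_scale (of_int (k $ i)) (tK (k + l) i))"
    by (cases "x = 0"; cases "y = 0") (simp_all add: cocycle_def)
qed

definition loop_deriv :: "('g::ab_group_add, 'n::finite) torus_data \<Rightarrow>
    complex^'n \<Rightarrow> ('g, 'n) mloop \<Rightarrow> ('g, 'n) mloop" where
  "loop_deriv T d = pm_weight (gscale T) (\<lambda>k. pairing d (ivec k))"

definition LT :: "('g::ab_group_add, 'n::finite) torus_data \<Rightarrow> ('g, 'n) mloop set" where
  "LT T = {x. \<forall>k. Poly_Mapping.lookup x k \<in> grade T k}"

definition LT_zero :: "('g::ab_group_add, 'n::finite) torus_data \<Rightarrow> ('g, 'n) mloop set" where
  "LT_zero T = {x. \<forall>k. Poly_Mapping.lookup x k \<in> root_space T k zero_fun}"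

definition LT_plus :: "('g::ab_group_add, 'n::finite) torus_data \<Rightarrow> ('g, 'n) mloop set" where
  "LT_plus T = module.span (pm_scale (gscale T))
     {Poly_Mapping.single k x | k x \<alpha>. \<alpha> \<in> en_pos_roots T \<and> x \<in> root_space T k \<alpha>}"

definition LT_alg :: "('g::ab_group_add, 'n::finite) torus_data \<Rightarrow> ('g, 'n) mloop lie_alg" where
  "LT_alg T = \<lparr>lcarrier = LT T, lscale = pm_scale (gscale T), lbr = loop_br T\<rparr>"

definition LT_zero_alg :: "('g::ab_group_add, 'n::finite) torus_data \<Rightarrow> ('g, 'n) mloop lie_alg" where
  "LT_zero_alg T = \<lparr>lcarrier = LT_zero T, lscale = pm_scale (gscale T), lbr = loop_br T\<rparr>"

definition tilde_alg :: "('g::ab_group_add, 'n::finite) torus_data \<Rightarrow> ('g, 'n) tilde lie_alg" where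
  "tilde_alg T =
     \<lparr>lcarrier = {(x, z, d). x \<in> LT T \<and> z \<in> center_space T},
      lscale = (\<lambda>c (x, z, d). (pm_scale (gscale T) c x, center_scale c z, c *s d)),
      lbr = (\<lambda>(x, z, d) (y, w, e).
        (loop_br T x y + loop_deriv T d y - loop_deriv T e x,
         cocycle T x y + center_deriv d w - center_deriv e z, 0))\<rparr>"

definition hat_alg :: "('g::ab_group_add, 'n::finite) torus_data \<Rightarrow> ('g, 'n) hat lie_alg" where
  "hat_alg T =
     \<lparr>lcarrier = {(x, d). x \<in> LT T},
      lscale = (\<lambda>c (x, d). (pm_scale (gscale T) c x, c *s d)),
      lbr = (\<lambda>(x, d) (y, e). (loop_br T x y + loop_deriv T d y - loop_deriv T e x, 0))\<rparr>"

definition tilde_cartan :: "('g::ab_group_add, 'n::finite) torus_data \<Rightarrow> ('g, 'n) tilde set" where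
  "tilde_cartan T = {(Poly_Mapping.single 0 h, \<Sum>i\<in>UNIV. center_scale (a $ i) (tK 0 i), d) | h a d.
     h \<in> gcartan T}"

definition hat_cartan :: "('g::ab_group_add, 'n::finite) torus_data \<Rightarrow> ('g, 'n) hat set" where
  "hat_cartan T = {(Poly_Mapping.single 0 h, d) | h d. h \<in> gcartan T}"

definition root_elements :: "('g::ab_group_add, 'n::finite) torus_data \<Rightarrow> ('g, 'n) mloop set" where
  "root_elements T = {Poly_Mapping.single k x | k x \<alpha>.
     \<alpha> \<in> cartan_dual T \<and> \<alpha> \<noteq> zero_fun \<and> x \<in> root_space T k \<alpha>}"

definition tilde_integrable ::
  "('g::ab_group_add, 'n::finite) torus_data \<Rightarrow> (('g, 'n) tilde, 'v::ab_group_add) lmod \<Rightarrow> bool" where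
  "tilde_integrable T =
     integrable_module (tilde_alg T) (tilde_cartan T) ((\<lambda>x. (x, 0, 0)) ` root_elements T)"

definition hat_integrable ::
  "('g::ab_group_add, 'n::finite) torus_data \<Rightarrow> (('g, 'n) hat, 'v::ab_group_add) lmod \<Rightarrow> bool" where
  "hat_integrable T =
     integrable_module (hat_alg T) (hat_cartan T) ((\<lambda>x. (x, 0)) ` root_elements T)"


section \<open>The highest weight space and the loop module\<close>

text \<open>\<open>restrict_LT V\<close> is \<open>V\<close> with the action of \<open>LT\<close> only.  \<open>restrict_hat V\<close> is \<open>V\<close> with the action of
  \<open>\<^term>\<open>hat_alg T\<close>\<close>, the quotient of \<open>\<^term>\<open>tilde_alg T\<close>\<close> by the centre, acting through
  representatives; it is a module when the centre acts by \<open>0\<close>.\<close>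

definition restrict_LT :: "(('g::ab_group_add, 'n::finite) tilde, 'v) lmod \<Rightarrow> (('g, 'n) mloop, 'v) lmod" where
  "restrict_LT V = \<lparr>mcarrier = mcarrier V, mscale = mscale V, mact = (\<lambda>x. mact V (x, 0, 0))\<rparr>"

definition restrict_hat :: "(('g::ab_group_add, 'n::finite) tilde, 'v) lmod \<Rightarrow> (('g, 'n) hat, 'v) lmod" where
  "restrict_hat V = \<lparr>mcarrier = mcarrier V, mscale = mscale V, mact = (\<lambda>(x, d). mact V (x, 0, d))\<rparr>"

definition highest_space :: "('g::ab_group_add, 'n::finite) torus_data \<Rightarrow>
    (('g, 'n) tilde, 'v::ab_group_add) lmod \<Rightarrow> 'v set" where
  "highest_space T V = {v \<in> mcarrier V. \<forall>x\<in>LT_plus T. mact V (x, 0, 0) v = 0}"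

definition highest_central_operator :: "('g::ab_group_add, 'n::finite) torus_data \<Rightarrow>
    (('g, 'n) tilde, 'v::ab_group_add) lmod \<Rightarrow> int^'n \<Rightarrow> ('v \<Rightarrow> 'v) \<Rightarrow> bool" where
  "highest_central_operator T V r z \<longleftrightarrow>
     z ` highest_space T V \<subseteq> highest_space T V \<and>
     linear_on (mscale V) (highest_space T V) (mscale V) z \<and>
     (\<forall>x\<in>LT_zero T. \<forall>v\<in>highest_space T V. z (mact V (x, 0, 0) v) = mact V (x, 0, 0) (z v)) \<and>
     (\<forall>i. \<forall>v\<in>highest_space T V.
        mact V (0, 0, axis i 1) (z v) - z (mact V (0, 0, axis i 1) v) = mscale V (of_int (r $ i)) (z v))"

definition degree_group :: "('g::ab_group_add, 'n::finite) torus_data \<Rightarrow>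
    (('g, 'n) tilde, 'v::ab_group_add) lmod \<Rightarrow> (int^'n) set" where
  "degree_group T V = group_closure {r \<in> Gam T. \<exists>h\<in>gcartan T. \<exists>v\<in>highest_space T V.
     mact V (Poly_Mapping.single r h, 0, 0) v \<noteq> 0}"

definition int_basis :: "('n::finite \<Rightarrow> int^'n) \<Rightarrow> bool" where
  "int_basis f \<longleftrightarrow> (\<forall>k. \<exists>!c :: 'n \<Rightarrow> int. k = (\<Sum>i\<in>UNIV. c i *s f i))"

definition W_plus :: "('g::ab_group_add, 'n::finite) torus_data \<Rightarrow>
    (('g, 'n) tilde, 'v::ab_group_add) lmod \<Rightarrow> ('n \<Rightarrow> 'v \<Rightarrow> 'v) \<Rightarrow> 'v set" where
  "W_plus T V z = module.span (mscale V) {z i v - v | i v. v \<in> highest_space T V}"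

text \<open>The basis \<open>f\<close> of \<open>\<int>\<^sup>n\<close> is arbitrary, so no change of coordinates is needed to bring
  \<^const>\<open>degree_group\<close> into diagonal form.\<close>

definition reduction_data :: "('g::ab_group_add, 'n::finite) torus_data \<Rightarrow>
    (('g, 'n) tilde, 'v::ab_group_add) lmod \<Rightarrow> ('n \<Rightarrow> int^'n) \<Rightarrow> ('n \<Rightarrow> int) \<Rightarrow> ('n \<Rightarrow> 'v \<Rightarrow> 'v) \<Rightarrow> bool" where
  "reduction_data T V f l z \<longleftrightarrow>
     int_basis f \<and> (\<forall>i. l i \<noteq> 0) \<and>
     degree_group T V = {(\<Sum>i\<in>UNIV. (a i * l i) *s f i) | a :: 'n \<Rightarrow> int. True} \<and>
     (\<forall>i. highest_central_operator T V (l i *s f i) (z i) \<and> (\<exists>v\<in>highest_space T V. z i v \<noteq> 0)) \<and>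
     submodule (LT_zero_alg T) ((restrict_LT V)\<lparr>mcarrier := highest_space T V\<rparr>) (W_plus T V z) \<and>
     W_plus T V z \<noteq> highest_space T V"

definition V_prime :: "('g::ab_group_add, 'n::finite) torus_data \<Rightarrow>
    (('g, 'n) tilde, 'v::ab_group_add) lmod \<Rightarrow> ('n \<Rightarrow> 'v \<Rightarrow> 'v) \<Rightarrow> 'v set" where
  "V_prime T V z = envelope_span (LT_alg T) (restrict_LT V) (W_plus T V z)"

text \<open>The module \<open>(Q \<otimes> A, \<rho>(a))\<close>; \<open>q \<otimes> t\<^sup>s\<close> is \<open>single s q\<close>.\<close>

definition loop_module :: "complex^'n::finite \<Rightarrow> (('g::ab_group_add, 'n) mloop, 'q::ab_group_add) lmod \<Rightarrow>
    (('g, 'n) hat, (int^'n) \<Rightarrow>\<^sub>0 'q) lmod" where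
  "loop_module a Q =
     \<lparr>mcarrier = {p. \<forall>s. Poly_Mapping.lookup p s \<in> mcarrier Q},
      mscale = pm_scale (mscale Q),
      mact = (\<lambda>(x, d) p.
        (\<Sum>r\<in>Poly_Mapping.keys x. \<Sum>s\<in>Poly_Mapping.keys p. Poly_Mapping.single (r + s)
           (mact Q (Poly_Mapping.single r (Poly_Mapping.lookup x r)) (Poly_Mapping.lookup p s)))
        + pm_weight (mscale Q) (\<lambda>s. pairing d (a + ivec s)) p)\<rparr>"

text \<open>\<open>N \<otimes> \<complex>\<^sub>s\<close>, on the space \<open>N\<close>: on the one-dimensional factor \<open>(x, d)\<close> acts by \<open>- \<Sum>\<^sub>i d\<^sub>i s\<^sub>i\<close>.\<close>

definition grade_shift :: "int^'n::finite \<Rightarrow> (('g, 'n) hat, 'v::ab_group_add) lmod \<Rightarrow> (('g, 'n) hat, 'v) lmod" where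
  "grade_shift s N =
     N\<lparr>mact := (\<lambda>(x, d) v. mact N (x, d) v + mscale N (- pairing d (ivec s)) v)\<rparr>"

definition iso_up_to_grade_shift :: "('g::ab_group_add, 'n::finite) torus_data \<Rightarrow>
    (('g, 'n) hat, 'v::ab_group_add) lmod \<Rightarrow> (('g, 'n) hat, 'w::ab_group_add) lmod \<Rightarrow> bool" where
  "iso_up_to_grade_shift T M N \<longleftrightarrow> (\<exists>s. module_iso (hat_alg T) M (grade_shift s N))"

end

(*
  The Cartan subalgebra acts faithfully and diagonalisably on V, because V is a sum of weight spaces
  and \<open>\<lambda> \<noteq> 0\<close>; hence it acts diagonalisably on the whole Lie torus, and the triangular decomposition
  follows without any structure theory of semisimple Lie algebras.  Words in negative root vectors
  applied to the highest weight space span V, and a principal \<open>\<ss>\<ll>\<^sub>2\<close> of the fixed point algebra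
  bounds the heights of the weights from below, so that finitely many weights of the Cartan
  subalgebra occur.  The central operators make the images in the quotient \<open>V/V''\<close> of the components of
  V periodic in the degree, so the quotient is finite-dimensional.  On it a central element is
  both a scalar and a commutator, hence \<open>0\<close>, and so the centre acts trivially on V.

  With \<open>\<pi>\<close> the projection onto the quotient, \<open>v \<mapsto> \<pi>(v) \<otimes> t\<^sup>r\<^sup>-\<^sup>s\<close> for v of degree r embeds V into the loop
  module for every s.  The images are irreducible, isomorphic up to grade shifts, and by periodicity
  finitely many of them span the loop module, which is therefore a finite direct sum of such images.
*)

theory Submission
  imports Defs "HOL-Computational_Algebra.Fundamental_Theorem_Algebra"
begin

text \<open>The order of the deductions is the obstacle. A Cartan subalgebra is given only as
  nilpotent and self-normalising, so the root space facts for \<open>G 0\<close> are read off from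
  V: an identity in \<open>G 0\<close> is tested on weight vectors, where H acts by scalars. Until
  the quotient is known to be finite-dimensional the centre may act non-trivially, LT acts on V only
  projectively, and moving one operator past another costs a cocycle term; the spanning sets are
  therefore built to be closed under the centre. In submodules the centre takes care of itself,
  since each t^k K_i acts as a multiple of a commutator of two elements h tensor t^p. The bound on
  heights requires a lowering operator that is nilpotent on each vector, but a sum of locally
  nilpotent operators need not be one; root vectors are adjoined singly, from the deepest roots
  upwards, inside finite-dimensional stable subspaces. Finally \<open>V''\<close> is not stable
  under the d_i: homogeneous vectors of different degrees can have equal images. Periodicity
  measures this, and the exponent of t in the loop module restores the lost degree.\<close>

section \<open>Linear algebra relative to a carrier subspace\<close>

locale complex_vs = vector_space sc for sc :: "complex \<Rightarrow> 'v::ab_group_add \<Rightarrow> 'v"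
begin

text \<open>Module operators are functions on a whole type but are controlled on the carrier only,
  so linearity is always relative to a subspace that the operator preserves.\<close>

definition endo_on :: "'v set \<Rightarrow> ('v \<Rightarrow> 'v) \<Rightarrow> bool" where
  "endo_on W f \<longleftrightarrow> (\<forall>x\<in>W. f x \<in> W) \<and> linear_on sc W sc f"

lemma endo_onI:
  assumes "\<And>x. x \<in> W \<Longrightarrow> f x \<in> W" "\<And>x y. x \<in> W \<Longrightarrow> y \<in> W \<Longrightarrow> f (x + y) = f x + f y"
    "\<And>c x. x \<in> W \<Longrightarrow> f (sc c x) = sc c (f x)"
  shows "endo_on W f"
  using assms by (simp add: endo_on_def linear_on_def)

lemma linear_on_0: "linear_on sc W s' f \<Longrightarrow> vector_space s' \<Longrightarrow> x \<in> W \<Longrightarrow> f 0 = 0"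
proof -
  assume lin: "linear_on sc W s' f" and s': "vector_space s'" and x: "x \<in> W"
  interpret v: vector_space s' by fact
  have "f (sc 0 x) = s' 0 (f x)" using lin x by (simp only: linear_on_def)
  then show "f 0 = 0" by simp
qed

lemma linear_on_sum:
  assumes lin: "linear_on sc W s' f" and s': "vector_space s'" and W: "subspace W"
    and mem: "\<And>i. i \<in> F \<Longrightarrow> x i \<in> W"
  shows "f (\<Sum>i\<in>F. x i) = (\<Sum>i\<in>F. f (x i))"
  using mem
proof (induction F rule: infinite_finite_induct)
  case (insert i F)
  have "(\<Sum>i\<in>F. x i) \<in> W" using insert W by (simp add: subspace_sum)
  then show ?case using insert lin by (simp add: linear_on_def)
qed (use linear_on_0[OF lin s' subspace_0[OF W]] in auto)

lemma linear_on_diff: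
  assumes lin: "linear_on sc W s' f" and s': "vector_space s'" and W: "subspace W"
    and xy: "x \<in> W" "y \<in> W"
  shows "f (x - y) = f x - f y"
proof -
  have "x - y \<in> W" using xy W by (simp add: subspace_diff)
  then have "f ((x - y) + y) = f (x - y) + f y" using lin xy by (simp only: linear_on_def)
  then show ?thesis by simp
qed

lemma endo_on_mem: "endo_on W f \<Longrightarrow> x \<in> W \<Longrightarrow> f x \<in> W"
  by (simp add: endo_on_def)
lemma endo_on_add: "endo_on W f \<Longrightarrow> x \<in> W \<Longrightarrow> y \<in> W \<Longrightarrow> f (x + y) = f x + f y"
  by (simp add: endo_on_def linear_on_def)
lemma endo_on_scale: "endo_on W f \<Longrightarrow> x \<in> W \<Longrightarrow> f (sc c x) = sc c (f x)"
  by (simp add: endo_on_def linear_on_def)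
lemma endo_on_diff: "endo_on W f \<Longrightarrow> subspace W \<Longrightarrow> x \<in> W \<Longrightarrow> y \<in> W \<Longrightarrow> f (x - y) = f x - f y"
  by (rule linear_on_diff[OF _ vector_space_axioms]) (simp_all add: endo_on_def)
lemma endo_on_0: "endo_on W f \<Longrightarrow> subspace W \<Longrightarrow> f 0 = 0"
  by (rule linear_on_0[OF _ vector_space_axioms subspace_0]) (simp_all add: endo_on_def)
lemma endo_on_sum: "endo_on W f \<Longrightarrow> subspace W \<Longrightarrow> (\<And>i. i \<in> F \<Longrightarrow> x i \<in> W) \<Longrightarrow> f (\<Sum>i\<in>F. x i) = (\<Sum>i\<in>F. f (x i))"
  by (rule linear_on_sum[OF _ vector_space_axioms]) (simp_all add: endo_on_def)

lemma endo_on_funpow: "endo_on W f \<Longrightarrow> x \<in> W \<Longrightarrow> (f ^^ n) x \<in> W"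
  by (induction n) (simp_all add: endo_on_mem)

lemma endo_on_subset: "endo_on W f \<Longrightarrow> U \<subseteq> W \<Longrightarrow> (\<And>x. x \<in> U \<Longrightarrow> f x \<in> U) \<Longrightarrow> endo_on U f"
  by (auto simp: endo_on_def linear_on_def subset_iff)

lemma endo_on_span_closed:
  assumes f: "endo_on W f" and W: "subspace W" and B: "B \<subseteq> W" and U: "subspace U"
    and gen: "\<And>x. x \<in> B \<Longrightarrow> f x \<in> U" and x: "x \<in> span B"
  shows "f x \<in> U"
proof -
  \<comment> \<open>Membership in \<open>W\<close> is carried along because linearity of f is known
    only there.\<close>
  have "x \<in> W \<and> f x \<in> U" using x
  proof (induction x rule: span_induct_alt)
    case base
    show ?case using endo_on_0[OF f W] W U by (simp add: subspace_0)
  next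
    case (step c x y)
    then show ?case using W U B f gen[of x]
      by (auto simp: subspace_add subspace_scale endo_on_add endo_on_scale subset_iff)
  qed
  then show ?thesis ..
qed

subsection \<open>Finite dimension\<close>

lemma fin_dim_subspace:
  assumes U: "fin_dim sc U" and W: "subspace W" "W \<subseteq> U"
  shows "fin_dim sc W"
proof -
  obtain B where B: "finite B" "U = span B" using U by (auto simp: fin_dim_def)
  obtain C where C: "C \<subseteq> W" "independent C" "W \<subseteq> span C" using maximal_independent_subset by blast
  have "finite C" using independent_span_bound[OF B(1) C(2)] C(1) W B by auto
  moreover have "span C = W" using C W(1) by (simp add: span_minimal subset_antisym)
  ultimately show ?thesis unfolding fin_dim_def by metis
qed

lemma fin_dim_span_subset: "finite B \<Longrightarrow> subspace W \<Longrightarrow> W \<subseteq> span B \<Longrightarrow> fin_dim sc W"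
  using fin_dim_subspace[of "span B" W] by (auto simp: fin_dim_def)

lemma subspace_fin_dim: "fin_dim sc U \<Longrightarrow> subspace U"
  by (auto simp: fin_dim_def)

lemma fin_dim_span_UN:
  assumes I: "finite I" and fd: "\<And>i. i \<in> I \<Longrightarrow> fin_dim sc (U i)"
  shows "fin_dim sc (span (\<Union>i\<in>I. U i))"
proof -
  have "\<forall>i\<in>I. \<exists>B. finite B \<and> U i = span B" using fd by (simp add: fin_dim_def)
  then obtain B where B: "\<And>i. i \<in> I \<Longrightarrow> finite (B i)" "\<And>i. i \<in> I \<Longrightarrow> U i = span (B i)" by metis
  have "(\<Union>i\<in>I. U i) \<subseteq> span (\<Union>i\<in>I. B i)"
  proof
    fix x assume "x \<in> (\<Union>i\<in>I. U i)"
    then obtain i where "i \<in> I" "x \<in> span (B i)" using B(2) by auto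
    then show "x \<in> span (\<Union>i\<in>I. B i)" using span_mono[of "B i" "\<Union>i\<in>I. B i"] by blast
  qed
  then have "span (\<Union>i\<in>I. U i) \<subseteq> span (\<Union>i\<in>I. B i)" by (simp add: span_minimal)
  then show ?thesis using fin_dim_span_subset[of "\<Union>i\<in>I. B i"] I B(1) by simp
qed

lemma fin_dim_image:
  assumes f: "linear_on sc W s' f" and s': "vector_space s'" and W: "fin_dim sc W"
  shows "fin_dim s' (f ` W)"
proof -
  interpret v: vector_space s' by fact
  obtain B where B: "finite B" "W = span B" using W by (auto simp: fin_dim_def)
  have "f ` span B = v.span (f ` B)"
  proof (intro subset_antisym image_subsetI)
    fix x assume "x \<in> span B"
    then have "x \<in> span B \<and> f x \<in> v.span (f ` B)"
    proof (induction x rule: span_induct_alt)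
      case base
      show ?case using linear_on_0[OF f s', of 0] B by (simp add: span_zero v.span_zero)
    next
      case (step c x y)
      have "x \<in> W" using step B by (simp add: span_base)
      then have "f (sc c x + y) = s' c (f x) + f y" "sc c x + y \<in> span B"
        using f step B by (auto simp: linear_on_def span_add span_scale)
      then show ?case using step by (simp add: v.span_add v.span_scale v.span_base)
    qed
    then show "f x \<in> v.span (f ` B)" ..
  next
    have "v.subspace (f ` span B)"
    proof (rule v.subspaceI)
      show "0 \<in> f ` span B" using linear_on_0[OF f s', of 0] B by (force simp: span_zero)
      fix x y c assume "x \<in> f ` span B" "y \<in> f ` span B"
      then obtain u w where "u \<in> W" "w \<in> W" "x = f u" "y = f w" using B by auto
      moreover have "u + w \<in> W" "sc c u \<in> W" using \<open>u \<in> W\<close> \<open>w \<in> W\<close> B by (auto simp: span_add span_scale)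
      ultimately show "x + y \<in> f ` span B" "s' c x \<in> f ` span B"
        using f B unfolding linear_on_def by (metis imageI)+
    qed
    moreover have "f ` B \<subseteq> f ` span B" by (simp add: image_mono span_superset)
    ultimately show "v.span (f ` B) \<subseteq> f ` span B" by (simp add: v.span_minimal)
  qed
  then show ?thesis unfolding fin_dim_def using B by blast
qed

text \<open>Independence of a family and not of its range: equal vectors at two indices count as a
  dependence. For the iterates of an operator on a vector the difference matters.\<close>

definition indep_family :: "'i set \<Rightarrow> ('i \<Rightarrow> 'v) \<Rightarrow> bool" where
  "indep_family I v \<longleftrightarrow> (\<forall>F c. finite F \<longrightarrow> F \<subseteq> I \<longrightarrow> (\<Sum>i\<in>F. sc (c i) (v i)) = 0 \<longrightarrow> (\<forall>i\<in>F. c i = 0))"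

lemma indep_family_finite:
  assumes ind: "indep_family I v" and W: "fin_dim sc W" and mem: "\<And>i. i \<in> I \<Longrightarrow> v i \<in> W"
  shows "finite I"
proof -
  have inj: "inj_on v I"
  proof (rule inj_onI, rule ccontr)
    fix i j assume ij: "i \<in> I" "j \<in> I" "v i = v j" "i \<noteq> j"
    \<comment> \<open>A repeated vector yields the relation with coefficients 1 and -1.\<close>
    have "(\<Sum>k\<in>{i, j}. sc (if k = i then 1 else -1) (v k)) = 0" using ij by simp
    then have "\<forall>k\<in>{i, j}. (if k = i then 1 else -1) = (0::complex)"
      using ind[unfolded indep_family_def, rule_format, of "{i, j}" "\<lambda>k. if k = i then 1 else -1"] ij by auto
    then show False by auto
  qed
  have "independent (v ` I)"
  proof
    assume "dependent (v ` I)"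
    then obtain t u w where t: "finite t" "t \<subseteq> v ` I" "(\<Sum>x\<in>t. sc (u x) x) = 0" "w \<in> t" "u w \<noteq> 0"
      unfolding dependent_explicit by blast
    obtain F where F: "F \<subseteq> I" "t = v ` F" "inj_on v F" using t(2) inj by (meson subset_image_inj inj_on_subset)
    have "finite F" using t(1) F finite_image_iff by blast
    moreover have "(\<Sum>i\<in>F. sc (u (v i)) (v i)) = 0" using t(3) F by (simp add: sum.reindex)
    ultimately have "\<forall>i\<in>F. u (v i) = 0" using ind[unfolded indep_family_def, rule_format, of F "u \<circ> v"] F by auto
    then show False using t F by auto
  qed
  moreover obtain B where "finite B" "W = span B" using W by (auto simp: fin_dim_def)
  ultimately have "finite (v ` I)" using independent_span_bound[of B "v ` I"] mem by auto
  then show ?thesis using inj finite_image_iff by blast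
qed

subsection \<open>Simultaneous eigenvectors\<close>

text \<open>The summands other than \<open>v i\<close> are removed one at a time by an operator that
  separates the two weights. With \<open>U = {0}\<close> this is the independence of weight spaces;
  for a stable subspace it says that weight components do not leave it.\<close>

lemma weight_extract:
  assumes M: "subspace M" and lin: "\<And>h. h \<in> H \<Longrightarrow> linear_on sc M sc (T h)"
    and U: "subspace U" and stab: "\<And>h w. h \<in> H \<Longrightarrow> w \<in> U \<Longrightarrow> T h w \<in> U"
    and F: "finite F" and mem: "\<And>i. i \<in> F \<Longrightarrow> v i \<in> M"
    and eig: "\<And>i h. i \<in> F \<Longrightarrow> h \<in> H \<Longrightarrow> T h (v i) = sc (\<mu> i h) (v i)"
    and distinct: "\<And>i j. i \<in> F \<Longrightarrow> j \<in> F \<Longrightarrow> i \<noteq> j \<Longrightarrow> \<exists>h\<in>H. \<mu> i h \<noteq> \<mu> j h"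
    and sum: "(\<Sum>i\<in>F. v i) \<in> U" and i: "i \<in> F"
  shows "v i \<in> U"
proof -
  have step: "v i \<in> U" if "finite G" "i \<notin> G" "G \<subseteq> F" and
    "\<And>j. j \<in> F \<Longrightarrow> v j \<in> M" "\<And>j h. j \<in> F \<Longrightarrow> h \<in> H \<Longrightarrow> T h (v j) = sc (\<mu> j h) (v j)"
    "v i + (\<Sum>j\<in>G. v j) \<in> U" for G v
    using that
  proof (induction G arbitrary: v rule: finite_induct)
    case (insert j G)
    then obtain h where h: "h \<in> H" "\<mu> i h \<noteq> \<mu> j h" using distinct[of i j] i by auto
    \<comment> \<open>The effect of T h - \<mu> j h on the summands: the j-th disappears, the i-th
      is multiplied by a non-zero number that is divided out at the end.\<close>
    define w where "w k = sc (\<mu> k h - \<mu> j h) (v k)" for k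
    let ?s = "v i + (\<Sum>k\<in>insert j G. v k)"
    have GF: "finite (insert j G)" "insert j G \<subseteq> F" using insert by auto
    have sM: "(\<Sum>k\<in>insert j G. v k) \<in> M" using insert.prems GF M by (intro subspace_sum) auto
    have "T h (\<Sum>k\<in>insert j G. v k) = (\<Sum>k\<in>insert j G. T h (v k))"
      by (rule linear_on_sum[OF lin[OF h(1)] vector_space_axioms M]) (use insert.prems GF in auto)
    then have "T h ?s = T h (v i) + (\<Sum>k\<in>insert j G. T h (v k))"
      using lin[OF h(1)] sM insert.prems(3)[OF i] unfolding linear_on_def by metis
    also have "\<dots> = sc (\<mu> i h) (v i) + (\<Sum>k\<in>insert j G. sc (\<mu> k h) (v k))"
      using insert.prems i h GF by (auto intro!: sum.cong)
    finally have "T h ?s - sc (\<mu> j h) ?s = w i + (\<Sum>k\<in>insert j G. w k)"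
      by (simp add: w_def scale_left_diff_distrib scale_right_distrib scale_sum_right sum_subtractf
          algebra_simps)
    moreover have "(\<Sum>k\<in>insert j G. w k) = (\<Sum>k\<in>G. w k)" using insert by (simp add: w_def)
    ultimately have "w i + (\<Sum>k\<in>G. w k) = T h ?s - sc (\<mu> j h) ?s" by simp
    then have "w i + (\<Sum>k\<in>G. w k) \<in> U"
      using insert.prems stab[OF h(1)] U by (simp add: subspace_diff subspace_scale)
    moreover have "w k \<in> M" "T h' (w k) = sc (\<mu> k h') (w k)" if "k \<in> F" "h' \<in> H" for k h'
      using that insert.prems lin[of h'] M unfolding w_def linear_on_def
      by (auto simp: subspace_scale mult.commute)
    ultimately have "w i \<in> U" using insert.IH[of w] insert.prems insert.hyps h(1) by auto
    then have "sc (inverse (\<mu> i h - \<mu> j h)) (w i) \<in> U" using U by (simp add: subspace_scale)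
    then show ?case using h by (simp add: w_def)
  qed simp
  have "(\<Sum>j\<in>F. v j) = v i + (\<Sum>j\<in>F - {i}. v j)" using F i by (simp add: sum.remove)
  then show ?thesis using step[of "F - {i}" v] F mem eig sum by auto
qed

lemma eigenvectors_indep_family:
  assumes M: "subspace M" and lin: "linear_on sc M sc f"
    and mem: "\<And>i. i \<in> I \<Longrightarrow> v i \<in> M" and nz: "\<And>i. i \<in> I \<Longrightarrow> v i \<noteq> 0"
    and eig: "\<And>i. i \<in> I \<Longrightarrow> f (v i) = sc (c i) (v i)" and inj: "inj_on c I"
  shows "indep_family I v"
  unfolding indep_family_def
proof (intro allI impI ballI)
  fix F a i assume F: "finite F" "F \<subseteq> I" "(\<Sum>i\<in>F. sc (a i) (v i)) = 0" "i \<in> F"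
  have "sc (a i) (v i) \<in> {0}"
  \<comment> \<open>A single operator is treated as a family over a one-element index set.\<close>
  proof (rule weight_extract[where M = M and H = "{()}" and T = "\<lambda>_. f" and F = F and \<mu> = "\<lambda>i _. c i"
        and v = "\<lambda>i. sc (a i) (v i)"])
    show "f (sc (a i) (v i)) = sc (c i) (sc (a i) (v i))" if "i \<in> F" for i
      using that F mem eig lin by (auto simp: linear_on_def mult.commute)
    show "f w \<in> {0}" if "w \<in> {0}" for w
      using that linear_on_0[OF lin vector_space_axioms subspace_0[OF M]] by simp
  qed (use F mem M lin inj in \<open>auto simp: subspace_scale subset_iff inj_on_def\<close>)
  then show "a i = 0" using nz F by auto
qed

text \<open>Non-zero eigenvectors to infinitely many eigenvalues would be independent in a
  finite-dimensional space. This is what stops the raising and lowering strings further on.\<close>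

lemma eigenvector_chain_zero:
  assumes M: "subspace M" and lin: "linear_on sc M sc f" and W: "fin_dim sc W" "W \<subseteq> M"
    and mem: "\<And>i::nat. v i \<in> W" and eig: "\<And>i. f (v i) = sc (c i) (v i)" and inj: "inj c"
  shows "\<exists>i. v i = 0"
proof (rule ccontr)
  assume "\<nexists>i. v i = 0"
  then have "indep_family UNIV v" using W mem
    by (intro eigenvectors_indep_family[OF M lin _ _ eig inj]) auto
  then show False using indep_family_finite[of UNIV v W] W mem by simp
qed

subsection \<open>Eigenvectors of endomorphisms of finite-dimensional spaces\<close>

definition peval :: "complex poly \<Rightarrow> ('v \<Rightarrow> 'v) \<Rightarrow> 'v \<Rightarrow> 'v" where
  "peval p f x = (\<Sum>i\<le>degree p. sc (coeff p i) ((f ^^ i) x))"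

lemma peval_altdef: "degree p \<le> n \<Longrightarrow> peval p f x = (\<Sum>i\<le>n. sc (coeff p i) ((f ^^ i) x))"
  unfolding peval_def by (rule sum.mono_neutral_left) (auto simp: coeff_eq_0)

text \<open>Splitting off a root c replaces the vector x by (f - c) x. Inductions on the degree can
  thus change the vector and avoid a calculus of polynomials in operators.\<close>

lemma peval_linear_factor:
  assumes f: "endo_on W f" and W: "subspace W" and x: "x \<in> W"
  shows "peval ([:-c, 1:] * q) f x = peval q f (f x - sc c x)"
proof -
  let ?n = "Suc (degree q)"
  have lin: "(f ^^ i) (f x - sc c x) = (f ^^ Suc i) x - sc c ((f ^^ i) x)" for i
    by (induction i)
      (use x W f endo_on_funpow[OF f x] in
        \<open>auto simp: endo_on_diff endo_on_scale endo_on_mem subspace_scale endo_on_funpow\<close>)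
  have "degree ([:-c, 1:] * q) \<le> ?n" using degree_mult_le[of "[:-c, 1:]" q] by simp
  then have "peval ([:-c, 1:] * q) f x = (\<Sum>i\<le>?n. sc (coeff ([:-c, 1:] * q) i) ((f ^^ i) x))"
    by (rule peval_altdef)
  also have "\<dots> = (\<Sum>i\<le>?n. sc (coeff (pCons 0 q) i) ((f ^^ i) x)) - (\<Sum>i\<le>?n. sc (c * coeff q i) ((f ^^ i) x))"
    by (simp add: scale_left_diff_distrib sum_subtractf[symmetric] algebra_simps del: sum.atMost_Suc)
  also have "(\<Sum>i\<le>?n. sc (coeff (pCons 0 q) i) ((f ^^ i) x)) = (\<Sum>i\<le>degree q. sc (coeff q i) ((f ^^ Suc i) x))"
    by (simp add: sum.atMost_Suc_shift del: sum.atMost_Suc)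
  also have "(\<Sum>i\<le>?n. sc (c * coeff q i) ((f ^^ i) x)) = (\<Sum>i\<le>degree q. sc (c * coeff q i) ((f ^^ i) x))"
    by (simp add: coeff_eq_0)
  finally show ?thesis
    unfolding peval_def lin by (simp add: scale_right_diff_distrib sum_subtractf mult.commute)
qed

text \<open>The iterates of f on x form an infinite family in a finite-dimensional space; the
  coefficients of a relation among them are those of the polynomial.\<close>

lemma annihilating_poly:
  assumes f: "endo_on W f" and W: "fin_dim sc W" and x: "x \<in> W"
  shows "\<exists>p. p \<noteq> 0 \<and> peval p f x = 0"
proof -
  have "\<not> indep_family UNIV (\<lambda>i. (f ^^ i) x)"
    using indep_family_finite[of "UNIV :: nat set" "\<lambda>i. (f ^^ i) x" W] W endo_on_funpow[OF f x] by auto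
  then obtain F c where F: "finite F" "(\<Sum>i\<in>F. sc (c i) ((f ^^ i) x)) = 0" "\<exists>i\<in>F. c i \<noteq> 0"
    by (auto simp: indep_family_def)
  define p where "p = (\<Sum>i\<in>F. monom (c i) i)"
  have cp: "coeff p i = (if i \<in> F then c i else 0)" for i
    using F(1) by (simp add: p_def coeff_sum if_distrib sum.delta cong: if_cong)
  have "p \<noteq> 0" using F(3) cp by (metis coeff_0)
  moreover have "peval p f x = (\<Sum>i\<in>F. sc (c i) ((f ^^ i) x))"
  proof -
    have "peval p f x = (\<Sum>i\<le>max (degree p) (Max (insert 0 F)). sc (coeff p i) ((f ^^ i) x))" by (rule peval_altdef) simp
    also have "\<dots> = (\<Sum>i\<in>F. sc (coeff p i) ((f ^^ i) x))"
      using F(1) by (intro sum.mono_neutral_right) (auto simp: cp Max_ge_iff le_max_iff_disj)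
    finally show ?thesis by (simp add: cp)
  qed
  ultimately show ?thesis using F(2) by auto
qed

lemma root_factor:
  fixes p :: "complex poly"
  assumes "degree p = Suc n"
  shows "\<exists>c q. p = [:-c, 1:] * q \<and> q \<noteq> 0 \<and> degree q = n"
proof -
  have "\<not> constant (poly p)" using assms by (simp add: constant_degree)
  then obtain c where "poly p c = 0" using fundamental_theorem_of_algebra by blast
  then obtain q where q: "p = [:-c, 1:] * q" by (auto simp: poly_eq_0_iff_dvd dvd_def)
  then have "q \<noteq> 0" using assms by auto
  then have "degree p = 1 + degree q" using q by (subst q, subst degree_mult_eq) auto
  then show ?thesis using q \<open>q \<noteq> 0\<close> assms by auto
qed

text \<open>Let c be a root of a polynomial that annihilates x. Either x is an eigenvector for c, or
  (f - c) x is a non-zero vector annihilated by a polynomial of smaller degree.\<close>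

lemma eigenvector_exists:
  assumes f: "endo_on W f" and W: "fin_dim sc W" and nz: "W \<noteq> {0}"
  shows "\<exists>x\<in>W. \<exists>c. x \<noteq> 0 \<and> f x = sc c x"
proof -
  have sub: "subspace W" using W by (rule subspace_fin_dim)
  obtain x where x: "x \<in> W" "x \<noteq> 0" using nz subspace_0[OF sub] by blast
  obtain p where p: "p \<noteq> 0" "peval p f x = 0" using annihilating_poly[OF f W x(1)] by blast
  from x p show ?thesis
  proof (induction "degree p" arbitrary: p x)
    case 0
    then obtain a where "p = [:a:]" using degree_0_id by metis
    then show ?case using 0 by (auto simp: peval_def)
  next
    case (Suc n)
    obtain c q where q: "p = [:-c, 1:] * q" "q \<noteq> 0" "degree q = n"
      using root_factor[of p n] Suc by metis
    show ?case
    proof (cases "f x - sc c x = 0")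
      case True
      then show ?thesis using Suc.prems by auto
    next
      case False
      have "f x - sc c x \<in> W" using Suc.prems f sub by (simp add: endo_on_mem subspace_diff subspace_scale)
      moreover have "peval q f (f x - sc c x) = 0"
        using Suc.prems q peval_linear_factor[OF f sub, of x c q] by simp
      ultimately show ?thesis using Suc.hyps(1)[of q] q False by auto
    qed
  qed
qed

lemma eigenvalues_finite:
  assumes f: "endo_on W f" and W: "fin_dim sc W"
  shows "finite {c. \<exists>x\<in>W. x \<noteq> 0 \<and> f x = sc c x}" (is "finite ?E")
proof -
  obtain v where v: "\<And>c. c \<in> ?E \<Longrightarrow> v c \<in> W \<and> v c \<noteq> 0 \<and> f (v c) = sc c (v c)"
    using bchoice[of ?E "\<lambda>c x. x \<in> W \<and> x \<noteq> 0 \<and> f x = sc c x"] by blast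
  have "indep_family ?E v"
    by (rule eigenvectors_indep_family[where M = W and f = f and c = "\<lambda>c. c"])
      (use v f subspace_fin_dim[OF W] in \<open>auto simp: endo_on_def\<close>)
  then show ?thesis using indep_family_finite W v by blast
qed

text \<open>Assumption \<open>ss\<close> says that (f - c)^2 and f - c have the same kernel, that
  is, no Jordan block exceeds size one. By induction (f - c) x is a sum of eigenvectors; those for d
  \<noteq> c are lifted along f - c through division by d - c, and \<open>ss\<close> deals with the
  rest.\<close>

lemma semisimple_span_eigenvectors:
  assumes f: "endo_on W f" and W: "fin_dim sc W"
    and ss: "\<And>c x. x \<in> W \<Longrightarrow> f (f x - sc c x) = sc c (f x - sc c x) \<Longrightarrow> f x = sc c x"
    and x: "x \<in> W"
  shows "x \<in> span {y \<in> W. \<exists>c. f y = sc c y}"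
proof -
  have sub: "subspace W" using W by (rule subspace_fin_dim)
  let ?E = "{y \<in> W. \<exists>c. f y = sc c y}"
  obtain p where p: "p \<noteq> 0" "peval p f x = 0" using annihilating_poly[OF f W x] by blast
  have "\<exists>F u. finite F \<and> (\<forall>c\<in>F. u c \<in> W \<and> f (u c) = sc c (u c)) \<and> x = (\<Sum>c\<in>F. u c)"
    using x p
  proof (induction "degree p" arbitrary: p x)
    case 0
    then obtain a where "p = [:a:]" using degree_0_id by metis
    then have "x = 0" using 0 by (auto simp: peval_def)
    then show ?case by (intro exI[of _ "{}"]) simp
  next
    case (Suc n)
    obtain c q where q: "p = [:-c, 1:] * q" "q \<noteq> 0" "degree q = n"
      using root_factor[of p n] Suc by metis
    let ?y = "f x - sc c x"
    have "?y \<in> W" using Suc.prems f sub by (simp add: endo_on_mem subspace_diff subspace_scale)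
    moreover have "peval q f ?y = 0" using Suc.prems q peval_linear_factor[OF f sub, of x c q] by simp
    ultimately obtain F u where Fu: "finite F" "\<And>c. c \<in> F \<Longrightarrow> u c \<in> W" "\<And>c. c \<in> F \<Longrightarrow> f (u c) = sc c (u c)" "?y = (\<Sum>c\<in>F. u c)"
      using Suc.hyps(1)[of q ?y] q by auto
    define w where "w d = sc (inverse (d - c)) (u d)" for d
    have wW: "w d \<in> W" "f (w d) = sc d (w d)" if "d \<in> F - {c}" for d
      using that Fu f sub by (auto simp: w_def subspace_scale endo_on_scale mult.commute)
    let ?s = "\<Sum>d\<in>F - {c}. w d"
    have sW: "?s \<in> W" using wW sub by (intro subspace_sum) auto
    have "f ?s = (\<Sum>d\<in>F - {c}. sc d (w d))" using wW endo_on_sum[OF f sub, of "F - {c}" w] by simp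
    then have "f ?s - sc c ?s = (\<Sum>d\<in>F - {c}. sc (d - c) (w d))"
      by (simp add: scale_sum_right scale_left_diff_distrib sum_subtractf)
    also have "\<dots> = (\<Sum>d\<in>F - {c}. u d)" by (rule sum.cong) (auto simp: w_def)
    finally have fs: "f ?s - sc c ?s = (\<Sum>d\<in>F - {c}. u d)" .
    let ?x = "x - ?s"
    have xW: "?x \<in> W" using Suc.prems sW sub by (simp add: subspace_diff)
    have "f ?x - sc c ?x = ?y - (f ?s - sc c ?s)"
      using Suc.prems sW by (simp add: endo_on_diff[OF f sub] scale_right_diff_distrib)
    also have "\<dots> = (\<Sum>d\<in>F. u d) - (\<Sum>d\<in>F - {c}. u d)" by (simp only: Fu fs)
    also have "\<dots> = (if c \<in> F then u c else 0)" using Fu(1) by (simp add: sum_diff1)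
    finally have "f ?x - sc c ?x = (if c \<in> F then u c else 0)" .
    \<comment> \<open>Here (f - c) \<open>?x\<close> is 0 or an eigenvector for c, so (f - c)^2
      annihilates \<open>?x\<close>.\<close>
    then have fx: "f ?x = sc c ?x" using ss[OF xW, of c] Fu endo_on_0[OF f sub] by auto
    define u' where "u' d = (if d = c then ?x else w d)" for d
    have "(\<Sum>d\<in>F - {c}. u' d) = ?s" by (rule sum.cong) (auto simp: u'_def)
    then have "x = (\<Sum>d\<in>insert c (F - {c}). u' d)"
      using Fu(1) sum.insert[of "F - {c}" c u'] by (simp add: u'_def)
    moreover have "\<forall>d\<in>insert c (F - {c}). u' d \<in> W \<and> f (u' d) = sc d (u' d)"
      using xW fx wW by (auto simp: u'_def)
    moreover have "finite (insert c (F - {c}))" using Fu(1) by simp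
    ultimately show ?case by blast
  qed
  then obtain F u where Fu: "\<And>c. c \<in> F \<Longrightarrow> u c \<in> W" "\<And>c. c \<in> F \<Longrightarrow> f (u c) = sc c (u c)" "x = (\<Sum>c\<in>F. u c)"
    by blast
  show ?thesis unfolding Fu(3) using Fu(1,2) by (intro span_sum span_base) blast
qed

lemma subspace_common_eigenspace:
  assumes "subspace W" "\<And>b. b \<in> B \<Longrightarrow> endo_on W (f b)"
  shows "subspace {x \<in> W. \<forall>b\<in>B. f b x = sc (\<mu> b) x}"
proof (rule subspaceI)
  show "0 \<in> {x \<in> W. \<forall>b\<in>B. f b x = sc (\<mu> b) x}"
    using assms(1) endo_on_0[OF assms(2) assms(1)] by (simp add: subspace_0)
  fix x y c assume "x \<in> {x \<in> W. \<forall>b\<in>B. f b x = sc (\<mu> b) x}" "y \<in> {x \<in> W. \<forall>b\<in>B. f b x = sc (\<mu> b) x}"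
  then show "x + y \<in> {x \<in> W. \<forall>b\<in>B. f b x = sc (\<mu> b) x}" "sc c x \<in> {x \<in> W. \<forall>b\<in>B. f b x = sc (\<mu> b) x}"
    using assms(1) endo_on_add[OF assms(2)] endo_on_scale[OF assms(2)]
    by (simp_all add: subspace_add subspace_scale scale_right_distrib mult.commute)
qed

text \<open>Commuting operators preserve each other's eigenspaces, so the next operator has an
  eigenvector inside the common eigenspace reached so far.\<close>

lemma common_eigenvector:
  assumes B: "finite B" and f: "\<And>b. b \<in> B \<Longrightarrow> endo_on W (f b)"
    and comm: "\<And>a b x. a \<in> B \<Longrightarrow> b \<in> B \<Longrightarrow> x \<in> W \<Longrightarrow> f a (f b x) = f b (f a x)"
    and W: "fin_dim sc W" and nz: "W \<noteq> {0}"
  shows "\<exists>x\<in>W. x \<noteq> 0 \<and> (\<forall>b\<in>B. \<exists>c. f b x = sc c x)"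
proof -
  have sub: "subspace W" using W by (rule subspace_fin_dim)
  have "\<exists>\<mu>. {x \<in> W. \<forall>b\<in>B. f b x = sc (\<mu> b) x} \<noteq> {0}" using B f comm
  proof (induction B rule: finite_induct)
    case empty
    then show ?case using nz by simp
  next
    case (insert a B)
    obtain \<mu> where \<mu>: "{x \<in> W. \<forall>b\<in>B. f b x = sc (\<mu> b) x} \<noteq> {0}" (is "?E \<noteq> _")
      using insert.IH insert.prems by auto
    have E: "subspace ?E"
      by (rule subspace_common_eigenspace[OF sub]) (use insert.prems(1) in auto)
    then have fE: "fin_dim sc ?E" using fin_dim_subspace[OF W E] by auto
    have "f a x \<in> ?E" if "x \<in> ?E" for x
      using that insert.prems(2)[of _ a x] insert.prems(1) by (auto simp: endo_on_mem endo_on_scale[of W "f a"])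
    then have "endo_on ?E (f a)"
      using insert.prems(1) by (intro endo_on_subset[of W "f a" ?E]) auto
    from eigenvector_exists[OF this fE \<mu>] obtain x c
      where x: "x \<in> ?E" "x \<noteq> 0" "f a x = sc c x" by blast
    have "x \<in> {x \<in> W. \<forall>b\<in>insert a B. f b x = sc ((\<mu>(a := c)) b) x}" using x insert.hyps by auto
    then show ?case using x(2) by (intro exI[of _ "\<mu>(a := c)"]) blast
  qed
  then obtain \<mu> where \<mu>: "{x \<in> W. \<forall>b\<in>B. f b x = sc (\<mu> b) x} \<noteq> {0}" (is "?E \<noteq> _") by blast
  moreover have "0 \<in> ?E" using sub endo_on_0[OF f sub] by (simp add: subspace_0)
  ultimately obtain x where "x \<in> ?E" "x \<noteq> 0" by blast
  then show ?thesis by auto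
qed

text \<open>A common eigenvector for B lies in a joint eigenspace, which the new operator preserves
  and on which it is again semisimple; splitting it there refines the decomposition.\<close>

lemma simultaneous_eigenvectors:
  assumes B: "finite B" and f: "\<And>b. b \<in> B \<Longrightarrow> endo_on W (f b)"
    and comm: "\<And>a b x. a \<in> B \<Longrightarrow> b \<in> B \<Longrightarrow> x \<in> W \<Longrightarrow> f a (f b x) = f b (f a x)"
    and W: "fin_dim sc W"
    and ss: "\<And>b c x. b \<in> B \<Longrightarrow> x \<in> W \<Longrightarrow> f b (f b x - sc c x) = sc c (f b x - sc c x) \<Longrightarrow> f b x = sc c x"
  shows "W \<subseteq> span {x \<in> W. \<forall>b\<in>B. \<exists>c. f b x = sc c x}"
  using B f comm ss
proof (induction B rule: finite_induct)
  case empty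
  then show ?case by (auto intro: span_base)
next
  case (insert a B)
  have sub: "subspace W" using W by (rule subspace_fin_dim)
  let ?S = "{x \<in> W. \<forall>b\<in>insert a B. \<exists>c. f b x = sc c x}"
  have "x \<in> span ?S" if x: "x \<in> W" "\<forall>b\<in>B. \<exists>c. f b x = sc c x" for x
  proof -
    from bchoice[OF x(2)] obtain \<mu> where \<mu>: "\<forall>b\<in>B. f b x = sc (\<mu> b) x" ..
    let ?E = "{x \<in> W. \<forall>b\<in>B. f b x = sc (\<mu> b) x}"
    have E: "subspace ?E"
      by (rule subspace_common_eigenspace[OF sub]) (use insert.prems(1) in auto)
    then have fE: "fin_dim sc ?E" using fin_dim_subspace[OF W E] by auto
    have "f a x \<in> ?E" if "x \<in> ?E" for x
      using that insert.prems(2)[of _ a x] insert.prems(1) by (auto simp: endo_on_mem endo_on_scale[of W "f a"])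
    then have "endo_on ?E (f a)"
      using insert.prems(1) by (intro endo_on_subset[of W "f a" ?E]) auto
    then have "x \<in> span {y \<in> ?E. \<exists>c. f a y = sc c y}"
      using insert.prems(3)[of a] x \<mu> by (intro semisimple_span_eigenvectors[OF _ fE]) auto
    moreover have "{y \<in> ?E. \<exists>c. f a y = sc c y} \<subseteq> ?S" by auto
    ultimately show ?thesis using span_mono by blast
  qed
  then have "span {x \<in> W. \<forall>b\<in>B. \<exists>c. f b x = sc c x} \<subseteq> span ?S" by (intro span_minimal) auto
  moreover have "W \<subseteq> span {x \<in> W. \<forall>b\<in>B. \<exists>c. f b x = sc c x}"
    by (rule insert.IH) (use insert.prems in auto)
  ultimately show ?case by blast
qed

text \<open>The eigenvalues of \<open>g f\<close> would be closed under \<open>\<mu> \<mapsto> \<mu> + b\<close> or under \<open>\<mu> \<mapsto> \<mu> - b\<close>.\<close>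

lemma commutator_scalar_zero:
  assumes f: "endo_on W f" and g: "endo_on W g" and W: "fin_dim sc W" "W \<noteq> {0}"
    and comm: "\<And>x. x \<in> W \<Longrightarrow> f (g x) - g (f x) = sc b x"
  shows "b = 0"
proof (rule ccontr)
  assume b: "b \<noteq> 0"
  have sub: "subspace W" using W by (intro subspace_fin_dim)
  let ?n = "\<lambda>x. g (f x)"
  have n: "endo_on W ?n" using f g by (intro endo_onI) (simp_all add: endo_on_mem endo_on_add endo_on_scale)
  obtain x c where x: "x \<in> W" "x \<noteq> 0" "?n x = sc c x" using eigenvector_exists[OF n W] by blast
  have fg: "f (g x) = g (f x) + sc b x" if "x \<in> W" for x using comm[OF that] by (simp add: algebra_simps)
  have mem: "(f ^^ i) x \<in> W" "(g ^^ i) x \<in> W" for i using f g x by (simp_all add: endo_on_funpow)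
  have ef: "?n ((f ^^ i) x) = sc (c - of_nat i * b) ((f ^^ i) x)" for i
  proof (induction i)
    case (Suc i)
    let ?y = "(f ^^ i) x"
    have "f (g (f ?y)) = g (f (f ?y)) + sc b (f ?y)" using fg[of "f ?y"] mem f by (simp add: endo_on_mem)
    then have "g (f (f ?y)) = f (?n ?y) - sc b (f ?y)" by (simp add: algebra_simps)
    also have "\<dots> = sc (c - of_nat (Suc i) * b) (f ?y)"
      unfolding Suc endo_on_scale[OF f mem(1)] by (simp add: scale_left_diff_distrib scale_left_distrib algebra_simps)
    finally show ?case by simp
  qed (use x in simp)
  \<comment> \<open>As b is non-zero, the strings of f and of g run through pairwise different
    eigenvalues of g f, so both must reach 0.\<close>
  have inj: "inj (\<lambda>i::nat. c - of_nat i * b)" "inj (\<lambda>i::nat. c + of_nat i * b)" using b by (auto simp: inj_def)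
  have eg: "?n ((g ^^ i) x) = sc (c + of_nat i * b) ((g ^^ i) x)" for i
  proof (induction i)
    case (Suc i)
    let ?y = "(g ^^ i) x"
    have "g (f (g ?y)) = g (?n ?y) + sc b (g ?y)"
      using fg[of ?y] mem f g sub by (simp add: endo_on_add endo_on_mem endo_on_scale subspace_scale)
    also have "\<dots> = sc (c + of_nat (Suc i) * b) (g ?y)"
      unfolding Suc endo_on_scale[OF g mem(2)] by (simp add: scale_left_distrib algebra_simps)
    finally show ?case by simp
  qed (use x in simp)
  have lin: "linear_on sc W sc ?n" using n by (simp add: endo_on_def)
  obtain i where "(f ^^ i) x = 0" using eigenvector_chain_zero[OF sub lin W(1) _ mem(1) ef inj(1)] by auto
  define m where "m = (LEAST i. (f ^^ i) x = 0)"
  have m0: "(f ^^ m) x = 0" unfolding m_def using \<open>(f ^^ i) x = 0\<close> by (rule LeastI)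
  then obtain j where j: "m = Suc j" using x(2) by (cases m) auto
  have jn: "(f ^^ j) x \<noteq> 0" using not_less_Least[of j "\<lambda>i. (f ^^ i) x = 0"] j by (simp add: m_def)
  \<comment> \<open>The last non-zero iterate of f gives c = j b; the last non-zero iterate of g
    will give c = -(l + 1) b. Together (j + l + 1) b = 0.\<close>
  have "sc (c - of_nat j * b) ((f ^^ j) x) = 0" using ef[of j] m0 j endo_on_0[OF g sub] by simp
  then have c: "c = of_nat j * b" using jn by simp
  obtain i where "(g ^^ i) x = 0" using eigenvector_chain_zero[OF sub lin W(1) _ mem(2) eg inj(2)] by auto
  define k where "k = (LEAST i. (g ^^ i) x = 0)"
  have k0: "(g ^^ k) x = 0" unfolding k_def using \<open>(g ^^ i) x = 0\<close> by (rule LeastI)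
  then obtain l where l: "k = Suc l" using x(2) by (cases k) auto
  have ln: "(g ^^ l) x \<noteq> 0" using not_less_Least[of l "\<lambda>i. (g ^^ i) x = 0"] l by (simp add: k_def)
  have "f (g ((g ^^ l) x)) = sc (c + of_nat l * b) ((g ^^ l) x) + sc b ((g ^^ l) x)"
    using fg[OF mem(2)] eg by simp
  then have "sc (c + of_nat l * b + b) ((g ^^ l) x) = 0" using k0 l endo_on_0[OF f sub]
    by (simp add: scale_left_distrib)
  then have "c + of_nat l * b + b = 0" using ln by (simp only: scale_eq_0_iff) simp
  then have "of_nat (j + l + 1) * b = 0" using c by (simp add: algebra_simps)
  then show False using b by (simp del: of_nat_add of_nat_Suc)
qed

text \<open>Built one functional at a time. Independence on H yields a vector that can be corrected
  to lie in the kernel of the old functionals but not of the new one; after normalisation it is used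
  to correct the old dual vectors.\<close>

lemma dual_vectors:
  assumes B: "finite B" and H: "subspace H"
    and lin: "\<And>\<beta> x y. \<beta> \<in> B \<Longrightarrow> x \<in> H \<Longrightarrow> y \<in> H \<Longrightarrow> \<beta> (x + y) = \<beta> x + \<beta> y"
      "\<And>\<beta> c x. \<beta> \<in> B \<Longrightarrow> x \<in> H \<Longrightarrow> \<beta> (sc c x) = c * \<beta> x"
    and ind: "\<And>c. (\<And>h. h \<in> H \<Longrightarrow> (\<Sum>\<beta>\<in>B. c \<beta> * \<beta> h) = 0) \<Longrightarrow> \<forall>\<beta>\<in>B. c \<beta> = 0"
  shows "\<exists>d. \<forall>\<beta>\<in>B. d \<beta> \<in> H \<and> (\<forall>\<gamma>\<in>B. \<gamma> (d \<beta>) = (if \<gamma> = \<beta> then 1 else (0::complex)))"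
  using B lin ind
proof (induction B rule: finite_induct)
  case (insert \<beta> B)
  have lin: "\<gamma> (x + y) = \<gamma> x + \<gamma> y" "\<gamma> (sc c x) = c * \<gamma> x" if "\<gamma> \<in> insert \<beta> B" "x \<in> H" "y \<in> H" for \<gamma> x y c
    using insert.prems(1,2) that by auto
  have lin0: "\<gamma> 0 = 0" if "\<gamma> \<in> insert \<beta> B" for \<gamma>
    using lin(2)[OF that, of 0 0 0] H by (simp add: subspace_0)
  have linsum: "\<gamma> (\<Sum>i\<in>F. x i) = (\<Sum>i\<in>F. \<gamma> (x i))"
    if "\<gamma> \<in> insert \<beta> B" "\<And>i. i \<in> F \<Longrightarrow> x i \<in> H" for \<gamma> F and x :: "('v \<Rightarrow> complex) \<Rightarrow> 'v"
    using that(2)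
  proof (induction F rule: infinite_finite_induct)
    case (insert i F)
    then show ?case using lin(1)[OF that(1), of "x i" "\<Sum>i\<in>F. x i"] H by (simp add: subspace_sum)
  qed (use lin0 that in auto)
  have indB: "\<forall>\<beta>\<in>B. c \<beta> = 0" if "\<And>h. h \<in> H \<Longrightarrow> (\<Sum>\<beta>\<in>B. c \<beta> * \<beta> h) = 0" for c
  proof -
    have "\<forall>\<gamma>\<in>insert \<beta> B. (if \<gamma> = \<beta> then 0 else c \<gamma>) = 0"
    proof (rule insert.prems(3))
      fix h assume "h \<in> H"
      have "(\<Sum>\<gamma>\<in>insert \<beta> B. (if \<gamma> = \<beta> then 0 else c \<gamma>) * \<gamma> h) = (\<Sum>\<gamma>\<in>B. c \<gamma> * \<gamma> h)"
        using insert.hyps by (simp, intro sum.cong) auto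
      then show "(\<Sum>\<gamma>\<in>insert \<beta> B. (if \<gamma> = \<beta> then 0 else c \<gamma>) * \<gamma> h) = 0" using that[OF \<open>h \<in> H\<close>] by simp
    qed
    then show ?thesis using insert.hyps by (metis insertCI)
  qed
  obtain d where d: "\<And>\<gamma>. \<gamma> \<in> B \<Longrightarrow> d \<gamma> \<in> H" "\<And>\<gamma> \<delta>. \<gamma> \<in> B \<Longrightarrow> \<delta> \<in> B \<Longrightarrow> \<delta> (d \<gamma>) = (if \<delta> = \<gamma> then 1 else 0)"
  proof -
    have "\<exists>d. \<forall>\<beta>\<in>B. d \<beta> \<in> H \<and> (\<forall>\<gamma>\<in>B. \<gamma> (d \<beta>) = (if \<gamma> = \<beta> then 1 else 0))"
      by (rule insert.IH) (use lin indB in auto)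
    then show ?thesis using that by blast
  qed
  \<comment> \<open>The coefficients of \<beta> - \<Sum> \<beta>(d \<gamma>) \<gamma>, whose value
    at h is the value of \<beta> at the corrected vector \<open>k\<close>.\<close>
  define c where "c \<gamma> = (if \<gamma> = \<beta> then 1 else - \<beta> (d \<gamma>))" for \<gamma>
  have "\<exists>h\<in>H. (\<Sum>\<gamma>\<in>insert \<beta> B. c \<gamma> * \<gamma> h) \<noteq> 0"
    using insert.prems(3)[of c] by (auto simp: c_def)
  then obtain h where h: "h \<in> H" "(\<Sum>\<gamma>\<in>insert \<beta> B. c \<gamma> * \<gamma> h) \<noteq> 0" by blast
  define k where "k = h - (\<Sum>\<gamma>\<in>B. sc (\<gamma> h) (d \<gamma>))"
  have sH: "(\<Sum>\<gamma>\<in>B. sc (\<gamma> h) (d \<gamma>)) \<in> H" using d H by (intro subspace_sum) (simp_all add: subspace_scale)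
  have kH: "k \<in> H" using h sH H by (simp add: k_def subspace_diff)
  have \<gamma>k: "\<gamma> k = \<gamma> h - (\<Sum>\<delta>\<in>B. \<delta> h * \<gamma> (d \<delta>))" if "\<gamma> \<in> insert \<beta> B" for \<gamma>
  proof -
    have "\<gamma> (k + (\<Sum>\<gamma>\<in>B. sc (\<gamma> h) (d \<gamma>))) = \<gamma> k + \<gamma> (\<Sum>\<gamma>\<in>B. sc (\<gamma> h) (d \<gamma>))"
      using lin(1)[OF that kH sH] .
    moreover have "\<gamma> (\<Sum>\<delta>\<in>B. sc (\<delta> h) (d \<delta>)) = (\<Sum>\<delta>\<in>B. \<delta> h * \<gamma> (d \<delta>))"
      using linsum[OF that, of B "\<lambda>\<delta>. sc (\<delta> h) (d \<delta>)"] d(1) H lin(2)[OF that d(1) h(1)]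
      by (simp add: subspace_scale)
    ultimately show ?thesis by (simp add: k_def)
  qed
  have k0: "\<gamma> k = 0" if "\<gamma> \<in> B" for \<gamma>
  proof -
    have "(\<Sum>\<delta>\<in>B. \<delta> h * \<gamma> (d \<delta>)) = (\<Sum>\<delta>\<in>B. if \<gamma> = \<delta> then \<delta> h else 0)"
      by (intro sum.cong) (auto simp: d(2)[OF _ that])
    then show ?thesis using \<gamma>k[of \<gamma>] that insert.hyps by simp
  qed
  have "\<beta> k = (\<Sum>\<gamma>\<in>insert \<beta> B. c \<gamma> * \<gamma> h)"
  proof -
    have "(\<Sum>\<gamma>\<in>B. c \<gamma> * \<gamma> h) = - (\<Sum>\<gamma>\<in>B. \<gamma> h * \<beta> (d \<gamma>))"
      using insert.hyps by (auto simp: c_def sum_negf[symmetric] intro!: sum.cong)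
    then show ?thesis using \<gamma>k[of \<beta>] insert.hyps by (simp add: c_def)
  qed
  then have k1: "\<beta> k \<noteq> 0" using h by simp
  define e where "e = sc (inverse (\<beta> k)) k"
  have e: "e \<in> H" "\<beta> e = 1" using kH H k1 lin(2)[of \<beta> k k] by (auto simp: e_def subspace_scale)
  have e0: "\<gamma> e = 0" if "\<gamma> \<in> B" for \<gamma>
    using that kH k0[OF that] lin(2)[of \<gamma> k k] by (simp add: e_def)
  define d' where "d' \<gamma> = (if \<gamma> = \<beta> then e else d \<gamma> + sc (- \<beta> (d \<gamma>)) e)" for \<gamma>
  have "d' \<gamma> \<in> H \<and> (\<forall>\<delta>\<in>insert \<beta> B. \<delta> (d' \<gamma>) = (if \<delta> = \<gamma> then 1 else 0))" if "\<gamma> \<in> insert \<beta> B" for \<gamma>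
  proof (cases "\<gamma> = \<beta>")
    case True
    then show ?thesis using e e0 insert.hyps by (auto simp: d'_def)
  next
    case False
    then have \<gamma>: "\<gamma> \<in> B" using that by simp
    then have dg: "d \<gamma> \<in> H" "sc (- \<beta> (d \<gamma>)) e \<in> H" using d e H by (auto simp del: scale_minus_left intro!: subspace_scale)
    have d'\<delta>: "\<delta> (d' \<gamma>) = \<delta> (d \<gamma>) + (- \<beta> (d \<gamma>)) * \<delta> e" if "\<delta> \<in> insert \<beta> B" for \<delta>
      using lin(1)[OF that dg] lin(2)[OF that e(1) e(1), of "- \<beta> (d \<gamma>)"] False by (simp add: d'_def)
    have "\<delta> (d' \<gamma>) = (if \<delta> = \<gamma> then 1 else 0)" if "\<delta> \<in> insert \<beta> B" for \<delta>
      using that e e0[of \<delta>] d(2)[OF \<gamma>, of \<delta>] False insert.hyps d'\<delta>[OF that] by (cases "\<delta> = \<beta>") auto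
    moreover have "d' \<gamma> \<in> H" using False dg H by (simp add: d'_def subspace_add del: scale_minus_left)
    ultimately show ?thesis by blast
  qed
  then show ?case by blast
qed simp

end

section \<open>Functionals on a subspace, extended by 0\<close>

lemma dual_zero_outside: "\<alpha> \<in> dual s H \<Longrightarrow> x \<notin> H \<Longrightarrow> \<alpha> x = 0"
  by (simp add: dual_def)

lemma dual_add: "\<alpha> \<in> dual s H \<Longrightarrow> x \<in> H \<Longrightarrow> y \<in> H \<Longrightarrow> \<alpha> (x + y) = \<alpha> x + \<alpha> y"
  by (simp add: dual_def)

lemma dual_scale: "\<alpha> \<in> dual s H \<Longrightarrow> x \<in> H \<Longrightarrow> \<alpha> (s c x) = c * \<alpha> x"
  by (simp add: dual_def)

lemma dual_plus: "\<alpha> \<in> dual s H \<Longrightarrow> \<beta> \<in> dual s H \<Longrightarrow> (\<lambda>h. \<alpha> h + \<beta> h) \<in> dual s H"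
  by (simp add: dual_def algebra_simps)

lemma dual_mult: "\<alpha> \<in> dual s H \<Longrightarrow> (\<lambda>h. c * \<alpha> h) \<in> dual s H"
  by (simp add: dual_def algebra_simps)

lemma dual_uminus: "\<alpha> \<in> dual s H \<Longrightarrow> (\<lambda>h. - \<alpha> h) \<in> dual s H"
  using dual_mult[of \<alpha> s H "-1"] by simp

lemma dual_zero: "zero_fun \<in> dual s H"
  by (simp add: dual_def)

lemma dual_nonzero: "\<alpha> \<in> dual s H \<Longrightarrow> \<alpha> \<noteq> zero_fun \<Longrightarrow> \<exists>h\<in>H. \<alpha> h \<noteq> 0"
  by (metis dual_zero_outside ext)

section \<open>The finite-dimensional algebra: form, grading, root spaces\<close>

locale torus =
  fixes T :: "('g::ab_group_add, 'n::finite) torus_data"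
  assumes torus: "lie_torus T"
begin

abbreviation sg where "sg \<equiv> gscale T"
abbreviation br where "br \<equiv> gbr T"
abbreviation form where "form \<equiv> gform T"
abbreviation H where "H \<equiv> gcartan T"
abbreviation G where "G \<equiv> grade T"
abbreviation RS where "RS \<equiv> root_space T"

lemma simple_g: "simple_lie_algebra (g_alg T)"
  and fin_dim_g: "fin_dim sg UNIV"
  and inv_form: "invariant_form T"
  and automorphism: "lie_automorphism (g_alg T) (gsig T i)"
  and has_order: "has_order (gsig T i) (gord T i)"
  and primitive: "primitive_root_of_unity (gord T i) (gxi T i)"
  and sig_commute: "gsig T i \<circ> gsig T j = gsig T j \<circ> gsig T i"
  and simple_g0: "simple_lie_algebra (g0_alg T)"
  and cartan: "cartan_subalgebra (g0_alg T) H"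
  and base: "is_base (roots T) (gbase T)"
  using torus by (simp_all add: lie_torus_def)

sublocale g: complex_vs sg
  using simple_g by (simp add: complex_vs_def simple_lie_algebra_def lie_algebra_def g_alg_def)

lemma br_add: "br (x + y) z = br x z + br y z" "br x (y + z) = br x y + br x z"
  and br_scale: "br (sg c x) y = sg c (br x y)" "br x (sg c y) = sg c (br x y)"
  and br_self: "br x x = 0"
  and jacobi: "br x (br y z) + br y (br z x) + br z (br x y) = 0"
  using simple_g by (simp_all add: simple_lie_algebra_def lie_algebra_def g_alg_def)

lemma br_zero [simp]: "br 0 x = 0" "br x 0 = 0"
  using br_scale(1)[of 0 0 x] br_scale(2)[of x 0 0] by simp_all

lemma br_anti: "br x y = - br y x"
proof -
  have "br (x + y) (x + y) = 0" by (rule br_self)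
  then have "br x y + br y x = 0" unfolding br_add by (simp add: br_self add.commute)
  then show ?thesis by (simp add: eq_neg_iff_add_eq_0)
qed

lemma br_minus: "br (- x) y = - br x y" "br x (- y) = - br x y"
  using br_add(1)[of x "-x" y] br_add(2)[of x y "-y"] by (simp_all add: eq_neg_iff_add_eq_0 add.commute)

lemma br_derivation: "br h (br x y) = br (br h x) y + br x (br h y)"
proof -
  have "br x (br y h) = - br x (br h y)" by (subst br_anti[of y h]) (simp add: br_minus)
  moreover have "br y (br h x) = - br (br h x) y" by (rule br_anti)
  ultimately have "br h (br x y) - br x (br h y) - br (br h x) y = 0" using jacobi[of h x y] by simp
  then show ?thesis by (simp add: diff_eq_eq)
qed

lemma br_sum: "br (\<Sum>i\<in>F. x i) y = (\<Sum>i\<in>F. br (x i) y)" "br y (\<Sum>i\<in>F. x i) = (\<Sum>i\<in>F. br y (x i))"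
  by (induction F rule: infinite_finite_induct) (simp_all add: br_add)

lemma endo_br: "(\<And>y. y \<in> W \<Longrightarrow> br x y \<in> W) \<Longrightarrow> g.endo_on W (br x)"
  by (rule g.endo_onI) (simp_all add: br_add br_scale)

lemmas form_facts = inv_form[unfolded invariant_form_def]
lemmas form_add = form_facts[THEN conjunct1, rule_format]
lemmas form_scale = form_facts[THEN conjunct2, THEN conjunct1, rule_format]
lemmas form_sym = form_facts[THEN conjunct2, THEN conjunct2, THEN conjunct1, rule_format]
lemmas form_nondeg = form_facts[THEN conjunct2, THEN conjunct2, THEN conjunct2, THEN conjunct1, rule_format]
lemmas form_inv = form_facts[THEN conjunct2, THEN conjunct2, THEN conjunct2, THEN conjunct2, THEN conjunct1, rule_format]
lemmas form_auto = form_facts[THEN conjunct2, THEN conjunct2, THEN conjunct2, THEN conjunct2, THEN conjunct2, rule_format]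

lemma form_add2: "form z (x + y) = form z x + form z y"
  using form_add[of x y z] form_sym[of z] by simp

lemma form_scale2: "form x (sg c y) = c * form x y"
  using form_scale[of c y x] form_sym[of x] by simp

lemma form_zero [simp]: "form 0 x = 0" "form x 0 = 0"
  using form_scale[of 0 0 x] form_scale2[of x 0 0] by simp_all

lemma form_sum2: "form z (\<Sum>i\<in>F. x i) = (\<Sum>i\<in>F. form z (x i))"
  by (induction F rule: infinite_finite_induct) (simp_all add: form_add2)

lemma form_zero_span:
  assumes "\<And>y. y \<in> B \<Longrightarrow> form x y = 0" "y \<in> g.span B"
  shows "form x y = 0"
  using assms(2) by (induction y rule: g.span_induct_alt) (simp_all add: assms(1) form_add2 form_scale2)

lemma sig_add: "gsig T i (x + y) = gsig T i x + gsig T i y"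
  and sig_br: "gsig T i (br x y) = br (gsig T i x) (gsig T i y)"
  and sig_scale: "gsig T i (sg c x) = sg c (gsig T i x)"
  using automorphism[of i] by (simp_all add: lie_automorphism_def g_alg_def)

lemma sig_zero [simp]: "gsig T i 0 = 0"
  using sig_scale[of i 0 0] by simp

lemma sig_sum: "gsig T i (\<Sum>j\<in>F. x j) = (\<Sum>j\<in>F. gsig T i (x j))"
  by (induction F rule: infinite_finite_induct) (simp_all add: sig_add)

lemma gord_pos: "gord T i > 0"
  using has_order by (simp add: has_order_def)

lemma xi_power: "gxi T i ^ gord T i = 1"
  using primitive by (simp add: primitive_root_of_unity_def)

lemma xi_nonzero [simp]: "gxi T i \<noteq> 0"
  using xi_power[of i] gord_pos[of i] by (metis power_0_left less_numeral_extra(3) zero_neq_one)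

text \<open>Primitivity speaks of exponents strictly between 0 and the order; an integer exponent is
  first reduced modulo the order.\<close>

lemma xi_powi_eq_1_iff: "gxi T i powi k = 1 \<longleftrightarrow> int (gord T i) dvd k"
proof -
  let ?m = "int (gord T i)"
  have m1: "gxi T i powi ?m = 1" using xi_power by (simp add: power_int_of_nat)
  have "gxi T i powi k = gxi T i powi (?m * (k div ?m) + k mod ?m)" by simp
  also have "\<dots> = gxi T i powi (k mod ?m)"
    using m1 by (simp only: power_int_add power_int_mult xi_nonzero simp_thms power_int_1_left mult_1)
  also have "\<dots> = gxi T i ^ nat (k mod ?m)"
    using gord_pos[of i] by (simp add: power_int_def)
  finally have eq: "gxi T i powi k = gxi T i ^ nat (k mod ?m)" .
  show ?thesis
  proof
    assume "gxi T i powi k = 1"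
    moreover have "nat (k mod ?m) < gord T i" using gord_pos[of i] by (simp add: nat_less_iff)
    ultimately have "nat (k mod ?m) = 0"
      using eq primitive[of i] unfolding primitive_root_of_unity_def by (metis neq0_conv)
    moreover have "k mod ?m \<ge> 0" using gord_pos[of i] by simp
    ultimately show "?m dvd k" by (simp add: dvd_eq_mod_eq_0)
  next
    assume "?m dvd k"
    then show "gxi T i powi k = 1" using eq by simp
  qed
qed

lemma Gam_0 [simp]: "0 \<in> Gam T"
  and Gam_diff: "k \<in> Gam T \<Longrightarrow> l \<in> Gam T \<Longrightarrow> k - l \<in> Gam T"
  by (simp_all add: Gam_def)

lemma subspace_grade: "g.subspace (G k)"
  by (rule g.subspaceI) (simp_all add: grade_def sig_add sig_scale g.scale_right_distrib mult.commute)

lemma br_grade: "x \<in> G k \<Longrightarrow> y \<in> G l \<Longrightarrow> br x y \<in> G (k + l)"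
  by (simp add: grade_def sig_br br_scale power_int_add)

lemma grade_add_Gam: "l \<in> Gam T \<Longrightarrow> G (k + l) = G k"
proof -
  assume "l \<in> Gam T"
  then have "gxi T i powi (l $ i) = 1" for i using xi_powi_eq_1_iff[of i "l $ i"] by (simp add: Gam_def)
  then show ?thesis by (simp add: grade_def power_int_add)
qed

lemma grade_Gam: "k \<in> Gam T \<Longrightarrow> G k = G 0"
  using grade_add_Gam[of k 0] by simp

text \<open>Each automorphism preserves the form and multiplies (x|y) by \<xi>_i to the power k_i +
  l_i, so a non-zero value forces these factors to be 1. This places the cocycle in
  \<open>center_space\<close>.\<close>

lemma form_grade:
  assumes "x \<in> G k" "y \<in> G l" "form x y \<noteq> 0"
  shows "k + l \<in> Gam T"
proof -
  have "int (gord T i) dvd (k + l) $ i" for i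
  proof -
    have "form (gsig T i x) (gsig T i y) = form x y" using form_auto[OF automorphism] .
    moreover have "gsig T i x = sg (gxi T i powi (k $ i)) x" "gsig T i y = sg (gxi T i powi (l $ i)) y"
      using assms by (simp_all add: grade_def)
    ultimately have "gxi T i powi (k $ i) * gxi T i powi (l $ i) * form x y = form x y"
      by (simp only: form_scale form_scale2 mult_ac)
    then have "gxi T i powi (k $ i) * gxi T i powi (l $ i) = 1"
      using assms(3) mult_right_cancel[of "form x y" "gxi T i powi (k $ i) * gxi T i powi (l $ i)" 1] by simp
    then show ?thesis using xi_powi_eq_1_iff[of i "(k + l) $ i"] by (simp add: power_int_add)
  qed
  then show ?thesis by (simp add: Gam_def)
qed

text \<open>Averaging over the finite group generated by the \<open>\<sigma>\<^sub>i\<close> projects onto the fixed points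
  without changing the pairing with a fixed point.\<close>

lemma form_nondeg_grade_0:
  assumes x: "x \<in> G 0" and orth: "\<And>y. y \<in> G 0 \<Longrightarrow> form x y = 0"
  shows "x = 0"
proof (rule form_nondeg)
  fix y
  have fix_x: "gsig T i x = x" for i using x by (simp add: grade_def)
  have "\<exists>y'. (\<forall>i\<in>F. gsig T i y' = y') \<and> form x y' = form x y" if "finite F" for F
    using that
  proof (induction F rule: finite_induct)
    case (insert i F)
    then obtain y' where y': "\<And>j. j \<in> F \<Longrightarrow> gsig T j y' = y'" "form x y' = form x y" by blast
    let ?m = "gord T i" and ?s = "gsig T i"
    \<comment> \<open>The sum over one period of \<sigma>_i. Adding \<open>y'\<close> on both sides
      turns its invariance into two ways of splitting a sum over 0, ..., m.\<close>
    define u where "u = (\<Sum>j<?m. (?s ^^ j) y')"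
    have "?s u = (\<Sum>j<?m. (?s ^^ Suc j) y')" by (simp add: u_def sig_sum)
    also have "\<dots> + y' = (\<Sum>j<Suc ?m. (?s ^^ j) y')" by (simp add: sum.lessThan_Suc_shift del: sum.lessThan_Suc)
    also have "\<dots> = u + y'" using has_order[of i] by (simp add: u_def has_order_def)
    finally have su: "?s u = u" by simp
    have com: "gsig T j ((?s ^^ n) w) = (?s ^^ n) (gsig T j w)" for j n w
      using sig_commute[of j i] by (induction n) (simp_all add: fun_eq_iff)
    have sj: "gsig T j u = u" if "j \<in> F" for j
      unfolding u_def sig_sum com y'(1)[OF that] ..
    have fj: "form x ((?s ^^ n) y') = form x y'" for n
    proof (induction n)
      case (Suc n)
      have "form x ((?s ^^ Suc n) y') = form (?s x) (?s ((?s ^^ n) y'))" by (simp add: fix_x)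
      then show ?case using Suc form_auto[OF automorphism] by simp
    qed simp
    have "form x u = of_nat ?m * form x y" by (simp add: u_def form_sum2 fj y')
    then have "form x (sg (inverse (of_nat ?m)) u) = form x y"
      using gord_pos[of i] by (simp add: form_scale2)
    moreover have "\<forall>j\<in>insert i F. gsig T j (sg (inverse (of_nat ?m)) u) = sg (inverse (of_nat ?m)) u"
      using su sj by (simp add: sig_scale)
    ultimately show ?case by blast
  qed auto
  from this[of UNIV] obtain y' where y': "\<And>i. gsig T i y' = y'" "form x y' = form x y" by auto
  then have "y' \<in> G 0" by (simp add: grade_def)
  then show "form x y = 0" using orth y'(2) by metis
qed

lemma H_sub_grade: "H \<subseteq> G 0"
  and subspace_H: "g.subspace H"
  and H_normalizer: "x \<in> G 0 \<Longrightarrow> (\<And>h. h \<in> H \<Longrightarrow> br x h \<in> H) \<Longrightarrow> x \<in> H"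
  using cartan unfolding cartan_subalgebra_def lie_subalgebra_def g0_alg_def by auto

lemma fin_dim_sub: "g.subspace W \<Longrightarrow> fin_dim sg W"
  using g.fin_dim_subspace[OF fin_dim_g] by simp

lemma H_basis: "\<exists>B. finite B \<and> B \<subseteq> H \<and> H = g.span B"
  using fin_dim_sub[OF subspace_H] unfolding fin_dim_def by (metis g.span_superset)

lemma RS_grade: "x \<in> RS k \<alpha> \<Longrightarrow> x \<in> G k"
  by (simp add: root_space_def)

lemma RS_act: "x \<in> RS k \<alpha> \<Longrightarrow> h \<in> H \<Longrightarrow> br h x = sg (\<alpha> h) x"
  by (simp add: root_space_def)

lemma subspace_RS: "g.subspace (RS k \<alpha>)"
  using subspace_grade[of k] by (intro g.subspaceI)
    (auto simp: root_space_def g.subspace_0 g.subspace_add g.subspace_scale br_add br_scale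
      g.scale_right_distrib mult.commute)

lemma RS_br: "x \<in> RS k \<alpha> \<Longrightarrow> y \<in> RS l \<beta> \<Longrightarrow> br x y \<in> RS (k + l) (\<lambda>h. \<alpha> h + \<beta> h)"
  by (simp add: root_space_def br_grade br_derivation br_scale g.scale_left_distrib)

lemma RS_Gam: "k \<in> Gam T \<Longrightarrow> RS k \<alpha> = RS 0 \<alpha>"
  using grade_Gam[of k] by (simp add: root_space_def)

lemma form_RS:
  assumes "x \<in> RS k \<alpha>" "y \<in> RS l \<beta>" "form x y \<noteq> 0" "h \<in> H"
  shows "\<alpha> h + \<beta> h = 0"
proof -
  have "form (br h x) y = - form x (br h y)"
    using form_inv[of x h y] form_scale[of "-1" "br x h" y] br_anti[of h x] by simp
  then have "\<alpha> h * form x y = - (\<beta> h * form x y)"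
    using assms by (simp add: RS_act form_scale form_scale2)
  then have "(\<alpha> h + \<beta> h) * form x y = 0" by (simp add: algebra_simps)
  then show ?thesis using assms(3) by simp
qed

text \<open>Since x is non-zero, the eigenvalue of each h on x is unique, and uniqueness makes the
  chosen function linear on H.\<close>

lemma weight_functional:
  assumes B: "H = g.span B" and x: "x \<noteq> 0" "\<And>b. b \<in> B \<Longrightarrow> \<exists>c. br b x = sg c x"
  shows "\<exists>\<alpha>\<in>cartan_dual T. \<forall>h\<in>H. br h x = sg (\<alpha> h) x"
proof -
  have ex: "\<exists>c. br h x = sg c x" if "h \<in> g.span B" for h
    using that
  proof (induction h rule: g.span_induct_alt)
    case base
    show ?case by (intro exI[of _ 0]) simp
  next
    case (step c b h)
    then obtain d e where "br b x = sg d x" "br h x = sg e x" using x(2) by blast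
    then have "br (sg c b + h) x = sg (c * d + e) x" by (simp add: br_add br_scale g.scale_left_distrib)
    then show ?case ..
  qed
  define \<alpha> where "\<alpha> h = (if h \<in> H then SOME c. br h x = sg c x else 0)" for h
  have \<alpha>: "br h x = sg (\<alpha> h) x" if "h \<in> H" for h
    using someI_ex[OF ex[of h]] that B by (simp add: \<alpha>_def)
  have uniq: "c = \<alpha> h" if "h \<in> H" "br h x = sg c x" for c h
    using \<alpha>[OF that(1)] that(2) x(1) by simp
  have "\<alpha> \<in> cartan_dual T"
    unfolding dual_def
  proof (safe)
    fix h k c assume "h \<in> H" "k \<in> H"
    then show "\<alpha> (h + k) = \<alpha> h + \<alpha> k"
      using uniq[of "h + k" "\<alpha> h + \<alpha> k"] subspace_H \<alpha>
      by (simp add: g.subspace_add br_add g.scale_left_distrib)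
  next
    fix c h assume "h \<in> H"
    then show "\<alpha> (sg c h) = c * \<alpha> h"
      using uniq[of "sg c h" "c * \<alpha> h"] subspace_H \<alpha> by (simp add: g.subspace_scale br_scale)
  qed (simp add: \<alpha>_def)
  then show ?thesis using \<alpha> by blast
qed

definition neg_roots :: "('g \<Rightarrow> complex) set" where
  "neg_roots = {\<alpha> \<in> en_roots T. nonneg_combination (gbase T) (\<lambda>h. - \<alpha> h)}"

lemma finite_base: "finite (gbase T)"
  and base_roots: "gbase T \<subseteq> roots T"
  and base_cases: "\<alpha> \<in> roots T \<Longrightarrow> nonneg_combination (gbase T) \<alpha> \<or> nonneg_combination (gbase T) (\<lambda>h. - \<alpha> h)"
  and base_indep: "(\<And>h. (\<Sum>\<beta>\<in>gbase T. c \<beta> * \<beta> h) = 0) \<Longrightarrow> \<forall>\<beta>\<in>gbase T. c \<beta> = 0"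
  using base by (auto simp: is_base_def)

lemma roots_dual: "\<alpha> \<in> roots T \<Longrightarrow> \<alpha> \<in> cartan_dual T" "\<alpha> \<in> roots T \<Longrightarrow> \<alpha> \<noteq> zero_fun"
  by (simp_all add: roots_def)

lemma base_dual: "\<beta> \<in> gbase T \<Longrightarrow> \<beta> \<in> cartan_dual T"
  using base_roots roots_dual by blast

lemma en_rootsE:
  assumes "\<alpha> \<in> en_roots T"
  obtains "\<alpha> \<in> roots T" | \<beta> where "\<beta> \<in> roots T" "\<alpha> = (\<lambda>h. 2 * \<beta> h)"
  using assms by (auto simp: en_roots_def short_roots_def split: if_splits)

lemma en_roots_dual: "\<alpha> \<in> en_roots T \<Longrightarrow> \<alpha> \<in> cartan_dual T"
  by (erule en_rootsE) (simp_all add: roots_dual dual_mult)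

lemma en_roots_nonzero: "\<alpha> \<in> en_roots T \<Longrightarrow> \<alpha> \<noteq> zero_fun"
  by (erule en_rootsE) (auto simp: roots_def fun_eq_iff)

lemma nonneg_combination_mult:
  assumes "nonneg_combination B \<alpha>"
  shows "nonneg_combination B (\<lambda>h. of_nat n * \<alpha> h)"
proof -
  obtain c :: "_ \<Rightarrow> nat" where "\<And>h. \<alpha> h = (\<Sum>\<beta>\<in>B. of_nat (c \<beta>) * \<beta> h)"
    using assms by (auto simp: nonneg_combination_def)
  then show ?thesis unfolding nonneg_combination_def
    by (intro exI[of _ "\<lambda>\<beta>. n * c \<beta>"]) (simp add: sum_distrib_left mult.assoc)
qed

lemma nonneg_combination_add:
  assumes "nonneg_combination B \<alpha>" "nonneg_combination B \<gamma>"
  shows "nonneg_combination B (\<lambda>h. \<alpha> h + \<gamma> h)"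
proof -
  obtain c d :: "_ \<Rightarrow> nat" where "\<And>h. \<alpha> h = (\<Sum>\<beta>\<in>B. of_nat (c \<beta>) * \<beta> h)" "\<And>h. \<gamma> h = (\<Sum>\<beta>\<in>B. of_nat (d \<beta>) * \<beta> h)"
    using assms by (auto simp: nonneg_combination_def)
  then show ?thesis unfolding nonneg_combination_def
    by (intro exI[of _ "\<lambda>\<beta>. c \<beta> + d \<beta>"]) (simp add: sum.distrib algebra_simps)
qed

lemma en_roots_cases: "\<alpha> \<in> en_roots T \<Longrightarrow> \<alpha> \<in> en_pos_roots T \<or> \<alpha> \<in> neg_roots"
proof -
  assume \<alpha>: "\<alpha> \<in> en_roots T"
  then have "nonneg_combination (gbase T) \<alpha> \<or> nonneg_combination (gbase T) (\<lambda>h. - \<alpha> h)"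
  proof (cases rule: en_rootsE)
    case 1
    then show ?thesis by (rule base_cases)
  next
    case (2 \<beta>)
    then show ?thesis
      using base_cases[OF 2(1)] nonneg_combination_mult[of "gbase T" \<beta> 2]
        nonneg_combination_mult[of "gbase T" "\<lambda>h. - \<beta> h" 2] by auto
  qed
  then show ?thesis using \<alpha> by (auto simp: en_pos_roots_def neg_roots_def)
qed

end

text \<open>Both properties belong to the structure theory of semisimple Lie algebras. They are
  isolated here because the representation V will supply them; roots and form can then be studied
  without mentioning V.\<close>

locale split_torus = torus T for T :: "('g::ab_group_add, 'n::finite) torus_data" +
  assumes H_abelian: "\<And>h k. h \<in> H \<Longrightarrow> k \<in> H \<Longrightarrow> br h k = 0"
    and grade_0_diag: "G 0 \<subseteq> g.span (\<Union>\<alpha>\<in>cartan_dual T. RS 0 \<alpha>)"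
begin

text \<open>Elements of weight 0 commute with H, hence normalise it, and a Cartan subalgebra is its
  own normaliser.\<close>

lemma H_eq: "H = RS 0 zero_fun"
proof
  show "H \<subseteq> RS 0 zero_fun" using H_sub_grade H_abelian by (auto simp: root_space_def)
  show "RS 0 zero_fun \<subseteq> H"
  proof
    fix x assume x: "x \<in> RS 0 zero_fun"
    then have "br x h \<in> H" if "h \<in> H" for h
      using that br_anti[of x h] subspace_H by (simp add: RS_act g.subspace_0)
    then show "x \<in> H" using H_normalizer RS_grade[OF x] by blast
  qed
qed

lemma root_cases:
  assumes "x \<in> RS 0 \<alpha>" "x \<noteq> 0" "\<alpha> \<in> cartan_dual T"
  shows "\<alpha> = zero_fun \<or> \<alpha> \<in> roots T"
  using assms by (auto simp: roots_def)

text \<open>H is orthogonal to the root spaces of non-zero weight, so an element of H orthogonal to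
  H is orthogonal to all of \<open>G 0\<close>.\<close>

lemma form_nondeg_H:
  assumes t: "t \<in> H" and orth: "\<And>h. h \<in> H \<Longrightarrow> form t h = 0"
  shows "t = 0"
proof (rule form_nondeg_grade_0)
  show "t \<in> G 0" using t H_sub_grade by blast
  fix y assume "y \<in> G 0"
  then have "y \<in> g.span (\<Union>\<alpha>\<in>cartan_dual T. RS 0 \<alpha>)" using grade_0_diag by blast
  then show "form t y = 0"
  proof (rule form_zero_span[rotated], clarify)
    fix y \<alpha> assume \<alpha>: "\<alpha> \<in> cartan_dual T" "y \<in> RS 0 \<alpha>"
    show "form t y = 0"
    proof (cases "\<alpha> = zero_fun")
      case True
      then show ?thesis using \<alpha> orth H_eq by simp
    next
      case False
      then obtain h where h: "h \<in> H" "\<alpha> h \<noteq> 0" using dual_nonzero \<alpha> by blast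
      have "t \<in> RS 0 zero_fun" using t H_eq by simp
      then show ?thesis using form_RS[OF _ \<alpha>(2), of t 0 zero_fun h] h by auto
    qed
  qed
qed

lemma center_g0:
  assumes x: "x \<in> G 0" and zero: "\<And>y. y \<in> G 0 \<Longrightarrow> br y x = 0"
  shows "x = 0"
proof -
  let ?I = "{x \<in> G 0. \<forall>y\<in>G 0. br y x = 0}"
  have "lie_ideal (g0_alg T) ?I"
    unfolding lie_ideal_def using subspace_grade[of 0]
    by (auto simp: g0_alg_def br_add br_scale g.subspace_0 g.subspace_add g.subspace_scale intro!: g.subspaceI)
  then consider "?I = {0}" | "?I = G 0"
    using simple_g0 by (auto simp: simple_lie_algebra_def g0_alg_def)
  then show ?thesis
  proof cases
    case 1
    then show ?thesis using x zero by blast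
  next
    case 2
    obtain y z where "y \<in> G 0" "z \<in> G 0" "br y z \<noteq> 0"
      using simple_g0 by (auto simp: simple_lie_algebra_def g0_alg_def)
    then show ?thesis using 2 by blast
  qed
qed

text \<open>All roots are combinations of simple ones, so such an element acts by 0 on every root
  space and is central in the simple algebra \<open>G 0\<close>.\<close>

lemma base_separates:
  assumes h: "h \<in> H" and zero: "\<And>\<beta>. \<beta> \<in> gbase T \<Longrightarrow> \<beta> h = 0"
  shows "h = 0"
proof (rule center_g0)
  show "h \<in> G 0" using h H_sub_grade by blast
  fix y assume "y \<in> G 0"
  then have "y \<in> g.span (\<Union>\<alpha>\<in>cartan_dual T. RS 0 \<alpha>)" using grade_0_diag by blast
  then have "br h y = 0"
  proof (induction y rule: g.span_induct_alt)
    case (step c x y)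
    then obtain \<alpha> where \<alpha>: "\<alpha> \<in> cartan_dual T" "x \<in> RS 0 \<alpha>" by blast
    have "\<alpha> h = 0" if "x \<noteq> 0"
    proof (cases "\<alpha> = zero_fun")
      case False
      then have "\<alpha> \<in> roots T" using root_cases \<alpha> that by blast
      then consider "nonneg_combination (gbase T) \<alpha>" | "nonneg_combination (gbase T) (\<lambda>h. - \<alpha> h)"
        using base_cases by blast
      then show ?thesis
      proof cases
        case 1
        then obtain c :: "_ \<Rightarrow> nat" where "\<alpha> h = (\<Sum>\<beta>\<in>gbase T. of_nat (c \<beta>) * \<beta> h)"
          by (auto simp: nonneg_combination_def)
        moreover have "\<dots> = 0" by (rule sum.neutral) (auto dest: zero)
        ultimately show ?thesis by simp
      next
        case 2
        then obtain c :: "_ \<Rightarrow> nat" where "- \<alpha> h = (\<Sum>\<beta>\<in>gbase T. of_nat (c \<beta>) * \<beta> h)"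
          by (auto simp: nonneg_combination_def)
        moreover have "\<dots> = 0" by (rule sum.neutral) (auto dest: zero)
        ultimately show ?thesis by simp
      qed
    qed simp
    then have "br h x = 0" using RS_act[OF \<alpha>(2) h] by auto
    then show ?case using step by (simp add: br_add br_scale)
  qed simp
  then show "br y h = 0" using br_anti[of y h] by simp
qed

text \<open>The vectors \<open>d \<beta>\<close> are the fundamental coweights.\<close>

lemma dual_base:
  "\<exists>d. \<forall>\<beta>\<in>gbase T. d \<beta> \<in> H \<and> (\<forall>\<gamma>\<in>gbase T. \<gamma> (d \<beta>) = (if \<gamma> = \<beta> then 1 else (0::complex)))"
proof (rule g.dual_vectors[OF finite_base subspace_H])
  fix c assume c: "\<And>h. h \<in> H \<Longrightarrow> (\<Sum>\<beta>\<in>gbase T. c \<beta> * \<beta> h) = 0"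
  \<comment> \<open>Simple roots vanish outside H, so a relation on H is a relation
    everywhere.\<close>
  have "(\<Sum>\<beta>\<in>gbase T. c \<beta> * \<beta> h) = 0" for h
  proof (cases "h \<in> H")
    case False
    then show ?thesis using base_dual dual_zero_outside by (metis (no_types, lifting) mult_zero_right sum.neutral)
  qed (use c in auto)
  then show "\<forall>\<beta>\<in>gbase T. c \<beta> = 0" using base_indep by blast
qed (use base_dual dual_add dual_scale in blast)+

lemma dual_sum:
  assumes "\<alpha> \<in> cartan_dual T" "\<And>i. i \<in> F \<Longrightarrow> x i \<in> H"
  shows "\<alpha> (\<Sum>i\<in>F. x i) = (\<Sum>i\<in>F. \<alpha> (x i))"
  using assms(2)
proof (induction F rule: infinite_finite_induct)
  case (insert i F)
  then show ?case using dual_add[OF assms(1), of "x i" "\<Sum>i\<in>F. x i"] subspace_H by (simp add: g.subspace_sum)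
qed (use dual_scale[OF assms(1), of 0 0] subspace_H in \<open>auto simp: g.subspace_0\<close>)

lemma rho_exists: "\<exists>\<rho>\<in>H. \<forall>\<beta>\<in>gbase T. \<beta> \<rho> = 1"
proof -
  obtain d where d: "\<And>\<beta>. \<beta> \<in> gbase T \<Longrightarrow> d \<beta> \<in> H"
    "\<And>\<beta> \<gamma>. \<beta> \<in> gbase T \<Longrightarrow> \<gamma> \<in> gbase T \<Longrightarrow> \<gamma> (d \<beta>) = (if \<gamma> = \<beta> then 1 else (0::complex))"
    using dual_base by blast
  have "\<gamma> (\<Sum>\<beta>\<in>gbase T. d \<beta>) = 1" if \<gamma>: "\<gamma> \<in> gbase T" for \<gamma>
  proof -
    have "\<gamma> (\<Sum>\<beta>\<in>gbase T. d \<beta>) = (\<Sum>\<beta>\<in>gbase T. \<gamma> (d \<beta>))" using dual_sum base_dual[OF \<gamma>] d(1) by blast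
    also have "\<dots> = (\<Sum>\<beta>\<in>gbase T. if \<gamma> = \<beta> then 1 else 0)" by (intro sum.cong) (auto simp: d(2)[OF _ \<gamma>])
    finally show ?thesis using \<gamma> finite_base by simp
  qed
  moreover have "(\<Sum>\<beta>\<in>gbase T. d \<beta>) \<in> H" using d(1) subspace_H by (intro g.subspace_sum)
  ultimately show ?thesis by blast
qed

text \<open>The sum of the fundamental coweights, often written \<rho> with a check. Its value at a
  root is the height of the root, and its eigenvalues will measure heights on V.\<close>

definition rho :: 'g where "rho = (SOME \<rho>. \<rho> \<in> H \<and> (\<forall>\<beta>\<in>gbase T. \<beta> \<rho> = 1))"

lemma rho_H: "rho \<in> H" and base_rho: "\<beta> \<in> gbase T \<Longrightarrow> \<beta> rho = 1"
  using someI_ex[of "\<lambda>\<rho>. \<rho> \<in> H \<and> (\<forall>\<beta>\<in>gbase T. \<beta> \<rho> = 1)"] rho_exists by (auto simp: rho_def)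

lemma rho_combination: "(\<Sum>\<beta>\<in>gbase T. of_nat (c \<beta>) * \<beta> rho) = of_nat (\<Sum>\<beta>\<in>gbase T. c \<beta>)"
  unfolding of_nat_sum by (rule sum.cong) (auto dest: base_rho)

lemma nonneg_combination_rho:
  assumes "nonneg_combination (gbase T) \<alpha>"
  shows "\<exists>n::nat. \<alpha> rho = of_nat n \<and> (n = 0 \<longrightarrow> \<alpha> = zero_fun)"
proof -
  obtain c :: "_ \<Rightarrow> nat" where c: "\<And>h. \<alpha> h = (\<Sum>\<beta>\<in>gbase T. of_nat (c \<beta>) * \<beta> h)"
    using assms by (auto simp: nonneg_combination_def)
  have "\<alpha> rho = of_nat (\<Sum>\<beta>\<in>gbase T. c \<beta>)" using c rho_combination by simp
  moreover have "\<alpha> = zero_fun" if "(\<Sum>\<beta>\<in>gbase T. c \<beta>) = 0"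
    using that finite_base by (auto simp: c)
  ultimately show ?thesis by (intro exI[of _ "\<Sum>\<beta>\<in>gbase T. c \<beta>"]) simp
qed

text \<open>For k outside \<open>Gam T\<close> the Lie torus axiom limits the weights occurring in W
  but does not say that weight vectors span W. Their span is a submodule over \<open>G 0\<close>, it
  is non-zero by \<open>common_eigenvector\<close>, and irreducibility makes it all of W.\<close>

lemma grade_diag: "G k \<subseteq> g.span (\<Union>\<alpha>\<in>insert zero_fun (en_roots T). RS k \<alpha>)"
proof (cases "k \<in> Gam T")
  case True
  have "(\<Union>\<alpha>\<in>cartan_dual T. RS 0 \<alpha>) \<subseteq> g.span (\<Union>\<alpha>\<in>insert zero_fun (en_roots T). RS 0 \<alpha>)"
  proof clarify
    fix x \<alpha> assume x: "\<alpha> \<in> cartan_dual T" "x \<in> RS 0 \<alpha>"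
    show "x \<in> g.span (\<Union>\<alpha>\<in>insert zero_fun (en_roots T). RS 0 \<alpha>)"
    proof (cases "x = 0")
      case False
      then have "\<alpha> \<in> insert zero_fun (en_roots T)" using root_cases[OF x(2) _ x(1)] by (auto simp: en_roots_def)
      then show ?thesis using x by (blast intro: g.span_base)
    qed (simp add: g.span_zero)
  qed
  then have "g.span (\<Union>\<alpha>\<in>cartan_dual T. RS 0 \<alpha>) \<subseteq> g.span (\<Union>\<alpha>\<in>insert zero_fun (en_roots T). RS 0 \<alpha>)"
    by (simp add: g.span_minimal)
  then show ?thesis using grade_0_diag by (simp add: grade_Gam[OF True] RS_Gam[OF True])
next
  case False
  show ?thesis
  proof (cases "G k = {0}")
    case True
    then show ?thesis by (simp add: g.span_zero)
  next
    case nz: False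
    let ?R = "g.span (\<Union>\<alpha>\<in>insert zero_fun (en_roots T). RS k \<alpha>)"
    have "\<forall>k. k \<notin> Gam T \<longrightarrow> G k \<noteq> {0} \<longrightarrow>
        (\<exists>U W. submodule (g0_alg T) (adjoint_on T (grade T k)) U \<and>
               submodule (g0_alg T) (adjoint_on T (grade T k)) W \<and>
               U \<inter> W = {0} \<and> {u + w | u w. u \<in> U \<and> w \<in> W} = grade T k \<and>
               (\<forall>x\<in>grade T 0. \<forall>u\<in>U. gbr T x u = 0) \<and>
               (W = {0} \<or>
                 irreducible_module (g0_alg T) (adjoint_on T W) \<and>
                 vector_space.dim (gscale T) W > 1 \<and>
                 (\<forall>\<mu>\<in>cartan_dual T. weight_space (gcartan T) (adjoint_on T W) \<mu> \<noteq> {0} \<longrightarrow>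
                    \<mu> \<in> en_roots T \<union> {zero_fun})))"
      using torus unfolding lie_torus_def by (elim conjE) assumption
    from this[rule_format, OF False nz] obtain U W where all:
      "submodule (g0_alg T) (adjoint_on T (G k)) U \<and> submodule (g0_alg T) (adjoint_on T (G k)) W \<and>
        U \<inter> W = {0} \<and> {u + w | u w. u \<in> U \<and> w \<in> W} = G k \<and> (\<forall>x\<in>G 0. \<forall>u\<in>U. br x u = 0) \<and>
        (W = {0} \<or> irreducible_module (g0_alg T) (adjoint_on T W) \<and> g.dim W > 1 \<and>
          (\<forall>\<mu>\<in>cartan_dual T. weight_space H (adjoint_on T W) \<mu> \<noteq> {0} \<longrightarrow> \<mu> \<in> en_roots T \<union> {zero_fun}))"
      by (elim exE)
    have UW: "submodule (g0_alg T) (adjoint_on T (G k)) U" "submodule (g0_alg T) (adjoint_on T (G k)) W"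
      "{u + w | u w. u \<in> U \<and> w \<in> W} = G k" using all by simp_all
    have Utriv: "\<And>x u. x \<in> G 0 \<Longrightarrow> u \<in> U \<Longrightarrow> br x u = 0" using all by simp
    have W: "W = {0} \<or> irreducible_module (g0_alg T) (adjoint_on T W) \<and>
         (\<forall>\<mu>\<in>cartan_dual T. weight_space H (adjoint_on T W) \<mu> \<noteq> {0} \<longrightarrow> \<mu> \<in> en_roots T \<union> {zero_fun})"
      using all by (elim conjE disjE) simp_all
    have Ug: "U \<subseteq> G k" and Wg: "W \<subseteq> G k" and subW: "g.subspace W"
      and Wst: "\<And>x w. x \<in> G 0 \<Longrightarrow> w \<in> W \<Longrightarrow> br x w \<in> W"
      using UW by (auto simp: submodule_def g0_alg_def adjoint_on_def)
    have UR: "U \<subseteq> ?R"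
    proof
      fix u assume u: "u \<in> U"
      then have "u \<in> RS k zero_fun" using Ug Utriv H_sub_grade by (auto simp: root_space_def)
      then show "u \<in> ?R" by (blast intro: g.span_base)
    qed
    have WR: "W \<subseteq> ?R"
    proof (cases "W = {0}")
      case True
      then show ?thesis by (simp add: g.span_zero)
    next
      case False
      obtain B where B: "finite B" "B \<subseteq> H" "H = g.span B" using H_basis by blast
      let ?E = "{w \<in> W. \<exists>\<mu>\<in>cartan_dual T. \<forall>h\<in>H. br h w = sg (\<mu> h) w}"
      have sub: "submodule (g0_alg T) (adjoint_on T W) (g.span ?E)"
      proof -
        have "br x w \<in> g.span ?E" if x: "x \<in> G 0" and w: "w \<in> g.span ?E" for x w
        proof (rule g.endo_on_span_closed[where f = "br x" and W = W and B = ?E])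
          show "g.endo_on W (br x)" using Wst[OF x] by (rule endo_br)
          fix w assume "w \<in> ?E"
          then obtain \<mu> where w: "w \<in> W" "\<mu> \<in> cartan_dual T" "\<And>h. h \<in> H \<Longrightarrow> br h w = sg (\<mu> h) w" by blast
          \<comment> \<open>It suffices to apply root vectors, which shift the weight of w.\<close>
          have "x \<in> g.span (\<Union>\<alpha>\<in>cartan_dual T. RS 0 \<alpha>)" using x grade_0_diag by blast
          then show "br x w \<in> g.span ?E"
          proof (induction x rule: g.span_induct_alt)
            case (step c x y)
            then obtain \<alpha> where \<alpha>: "\<alpha> \<in> cartan_dual T" "x \<in> RS 0 \<alpha>" by blast
            have "br h (br x w) = sg (\<alpha> h + \<mu> h) (br x w)" if "h \<in> H" for h
              using that w \<alpha> by (simp add: br_derivation RS_act br_scale g.scale_left_distrib)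
            moreover have "br x w \<in> W" using Wst w RS_grade[OF \<alpha>(2)] by blast
            ultimately have "br x w \<in> W \<and> (\<exists>\<mu>\<in>cartan_dual T. \<forall>h\<in>H. br h (br x w) = sg (\<mu> h) (br x w))"
              using dual_plus[OF \<alpha>(1) w(2)] by (intro conjI bexI[of _ "\<lambda>h. \<alpha> h + \<mu> h"]) auto
            then have "br x w \<in> ?E" by simp
            then show ?case using step by (simp add: br_add br_scale g.span_add g.span_scale g.span_base)
          qed (simp add: g.span_zero)
        qed (use subW w in auto)
        moreover have "g.span ?E \<subseteq> W" using subW by (intro g.span_minimal) auto
        ultimately show ?thesis by (auto simp: submodule_def g0_alg_def adjoint_on_def)
      qed
      have "\<exists>x\<in>W. x \<noteq> 0 \<and> (\<forall>b\<in>B. \<exists>c. br b x = sg c x)"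
      proof (rule g.common_eigenvector[OF B(1) _ _ fin_dim_sub[OF subW] False])
        fix a b x assume ab: "a \<in> B" "b \<in> B"
        have "br a (br b x) = br (br a b) x + br b (br a x)" by (rule br_derivation)
        moreover have "br a b = 0" using ab B(2) H_abelian by blast
        ultimately show "br a (br b x) = br b (br a x)" by simp
      qed (use B(2) H_sub_grade Wst in \<open>auto intro!: endo_br\<close>)
      then obtain x where x: "x \<in> W" "x \<noteq> 0" "\<And>b. b \<in> B \<Longrightarrow> \<exists>c. br b x = sg c x" by blast
      have "x \<in> ?E" using weight_functional[OF B(3) x(2,3)] x(1) by blast
      then have "g.span ?E \<noteq> {0}" using x(2) g.span_base[of x ?E] by auto
      then have "g.span ?E = W"
        using W False sub by (auto simp: irreducible_module_def adjoint_on_def)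
      moreover have "?E \<subseteq> ?R"
      proof
        fix w assume "w \<in> ?E"
        then obtain \<mu> where w: "w \<in> W" "\<mu> \<in> cartan_dual T" "\<And>h. h \<in> H \<Longrightarrow> br h w = sg (\<mu> h) w" by blast
        show "w \<in> ?R"
        proof (cases "w = 0")
          case nw: False
          have "w \<in> weight_space H (adjoint_on T W) \<mu>" using w by (simp add: weight_space_def adjoint_on_def)
          then have "\<mu> \<in> insert zero_fun (en_roots T)" using W False w(2) nw by blast
          moreover have "w \<in> RS k \<mu>" using w Wg by (auto simp: root_space_def)
          ultimately show ?thesis by (blast intro: g.span_base)
        qed (simp add: g.span_zero)
      qed
      ultimately show ?thesis using g.span_minimal[of ?E ?R] by simp
    qed
    show ?thesis
    proof
      fix x assume "x \<in> G k"
      then obtain u w where "x = u + w" "u \<in> U" "w \<in> W" using UW(3) by blast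
      then show "x \<in> ?R" using UR WR by (blast intro: g.span_add)
    qed
  qed
qed

text \<open>At the fundamental coweights of \<beta> and \<gamma> the difference takes the values 1
  and -1, whereas the coefficients of a root in the simple roots have one sign.\<close>

lemma base_diff_not_root:
  assumes \<beta>\<gamma>: "\<beta> \<in> gbase T" "\<gamma> \<in> gbase T" "\<beta> \<noteq> \<gamma>"
    and x: "x \<in> RS 0 (\<lambda>h. \<beta> h + - \<gamma> h)"
  shows "x = 0"
proof (rule ccontr)
  assume x0: "x \<noteq> 0"
  let ?\<alpha> = "\<lambda>h. \<beta> h + - \<gamma> h"
  obtain d where d: "\<And>\<beta>. \<beta> \<in> gbase T \<Longrightarrow> d \<beta> \<in> H"
    "\<And>\<beta> \<gamma>. \<beta> \<in> gbase T \<Longrightarrow> \<gamma> \<in> gbase T \<Longrightarrow> \<gamma> (d \<beta>) = (if \<gamma> = \<beta> then 1 else (0::complex))"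
    using dual_base by blast
  have dv: "?\<alpha> (d \<beta>) = 1" "?\<alpha> (d \<gamma>) = -1" using d(2)[of \<beta> \<gamma>] d(2)[of \<gamma> \<beta>] d(2)[of \<beta> \<beta>] d(2)[of \<gamma> \<gamma>] \<beta>\<gamma> by auto
  have comb: "\<exists>n::nat. \<alpha> (d \<delta>) = of_nat n" if nn: "nonneg_combination (gbase T) \<alpha>" and \<delta>: "\<delta> \<in> gbase T" for \<alpha> \<delta>
  proof -
    obtain c :: "_ \<Rightarrow> nat" where "\<forall>h. \<alpha> h = (\<Sum>\<beta>\<in>gbase T. of_nat (c \<beta>) * \<beta> h)"
      using nn by (auto simp: nonneg_combination_def)
    then have "\<alpha> (d \<delta>) = (\<Sum>\<beta>\<in>gbase T. of_nat (c \<beta>) * \<beta> (d \<delta>))" ..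
    also have "\<dots> = (\<Sum>\<beta>\<in>gbase T. if \<beta> = \<delta> then of_nat (c \<beta>) else 0)"
      by (intro sum.cong) (auto simp: d(2)[OF \<delta>])
    finally show ?thesis using \<delta> finite_base by auto
  qed
  have "?\<alpha> \<in> cartan_dual T" using dual_plus[OF base_dual[OF \<beta>\<gamma>(1)] dual_uminus[OF base_dual[OF \<beta>\<gamma>(2)]]] .
  moreover have "?\<alpha> \<noteq> zero_fun" using dv(1) by (metis zero_neq_one)
  ultimately have "?\<alpha> \<in> roots T" using root_cases[OF x x0] by blast
  then consider "nonneg_combination (gbase T) ?\<alpha>" | "nonneg_combination (gbase T) (\<lambda>h. - ?\<alpha> h)"
    using base_cases by blast
  then show False
  proof cases
    case 1
    from comb[OF this \<beta>\<gamma>(2)] obtain n where "(-1::complex) = of_nat n" using dv by auto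
    then have "Re (-1) = Re (of_nat n)" by (simp only:)
    then show False by simp
  next
    case 2
    from comb[OF this \<beta>\<gamma>(1)] obtain n where "- (\<beta> (d \<beta>) + - \<gamma> (d \<beta>)) = of_nat n" by blast
    then have "(-1::complex) = of_nat n" unfolding dv(1) .
    then have "Re (-1) = Re (of_nat n)" by (simp only:)
    then show False by simp
  qed
qed

text \<open>A principal \<open>\<ss>\<ll>\<^sub>2\<close>: since the coefficients of \<open>(2\<rho>|\<cdot>)\<close> in the simple roots can be prescribed as the
  values \<open>(e\<^sub>\<beta>|f\<^sub>\<beta>)\<close>, no coroots are needed.\<close>

lemma principal_sl2:
  "\<exists>e F. e \<in> G 0 \<and> br rho e = e \<and> (\<forall>\<beta>\<in>gbase T. F \<beta> \<in> RS 0 (\<lambda>h. - \<beta> h)) \<and>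
     br e (\<Sum>\<beta>\<in>gbase T. F \<beta>) = sg 2 rho"
proof -
  obtain d where d: "\<And>\<beta>. \<beta> \<in> gbase T \<Longrightarrow> d \<beta> \<in> H"
    "\<And>\<beta> \<gamma>. \<beta> \<in> gbase T \<Longrightarrow> \<gamma> \<in> gbase T \<Longrightarrow> \<gamma> (d \<beta>) = (if \<gamma> = \<beta> then 1 else (0::complex))"
    using dual_base by blast
  \<comment> \<open>The coefficient of \<beta> in the functional (2\<rho>|.) on H, as
    \<open>expand\<close> confirms: simple roots separate the points of H.\<close>
  define c where "c \<beta> = form (sg 2 rho) (d \<beta>)" for \<beta>
  have H2: "sg 2 rho \<in> H" using rho_H subspace_H by (rule g.subspace_scale[rotated])
  have expand: "form (sg 2 rho) h = (\<Sum>\<beta>\<in>gbase T. c \<beta> * \<beta> h)" if h: "h \<in> H" for h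
  proof -
    let ?s = "\<Sum>\<beta>\<in>gbase T. sg (\<beta> h) (d \<beta>)"
    have sH: "?s \<in> H" using d(1) subspace_H by (intro g.subspace_sum) (simp_all add: g.subspace_scale)
    have "\<gamma> (h - ?s) = 0" if \<gamma>: "\<gamma> \<in> gbase T" for \<gamma>
    proof -
      have "\<gamma> ?s = (\<Sum>\<beta>\<in>gbase T. \<gamma> (sg (\<beta> h) (d \<beta>)))"
        by (rule dual_sum[OF base_dual[OF \<gamma>]]) (use d(1) subspace_H in \<open>simp add: g.subspace_scale\<close>)
      also have "\<dots> = (\<Sum>\<beta>\<in>gbase T. if \<gamma> = \<beta> then \<beta> h else 0)"
        by (intro sum.cong) (auto simp: dual_scale[OF base_dual[OF \<gamma>] d(1)] d(2)[OF _ \<gamma>])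
      also have "\<dots> = \<gamma> h" using \<gamma> finite_base by simp
      finally have "\<gamma> ?s = \<gamma> h" .
      moreover have "\<gamma> ((h - ?s) + ?s) = \<gamma> (h - ?s) + \<gamma> ?s"
        by (rule dual_add[OF base_dual[OF \<gamma>]]) (use h sH subspace_H in \<open>simp_all add: g.subspace_diff\<close>)
      ultimately show ?thesis by simp
    qed
    then have "h - ?s = 0" using h sH subspace_H by (intro base_separates) (simp_all add: g.subspace_diff)
    then have "form (sg 2 rho) h = form (sg 2 rho) ?s" by simp
    also have "\<dots> = (\<Sum>\<beta>\<in>gbase T. c \<beta> * \<beta> h)"
      unfolding form_sum2 form_scale2 c_def by (simp add: mult.commute)
    finally show ?thesis .
  qed
  \<comment> \<open>Non-degeneracy on \<open>G 0\<close> supplies a root vector that pairs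
    non-trivially with e, invariance forces its weight to be -\<beta>, and rescaling produces the
    prescribed value.\<close>
  have "\<exists>e f. e \<in> RS 0 \<beta> \<and> f \<in> RS 0 (\<lambda>h. - \<beta> h) \<and> form e f = c \<beta>" if \<beta>: "\<beta> \<in> gbase T" for \<beta>
  proof -
    have "RS 0 \<beta> \<noteq> {0}" using \<beta> base_roots by (auto simp: roots_def)
    then obtain e where e: "e \<in> RS 0 \<beta>" "e \<noteq> 0" using g.subspace_0[OF subspace_RS] by blast
    have "\<exists>f \<alpha>. f \<in> RS 0 \<alpha> \<and> form e f \<noteq> 0 \<and> \<alpha> \<in> cartan_dual T"
    proof (rule ccontr)
      assume no: "\<nexists>f \<alpha>. f \<in> RS 0 \<alpha> \<and> form e f \<noteq> 0 \<and> \<alpha> \<in> cartan_dual T"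
      have "form e y = 0" if "y \<in> G 0" for y
        by (rule form_zero_span[where B = "\<Union>\<alpha>\<in>cartan_dual T. RS 0 \<alpha>"]) (use no that grade_0_diag in blast)+
      then show False using form_nondeg_grade_0[OF RS_grade[OF e(1)]] e(2) by blast
    qed
    then obtain f \<alpha> where f: "f \<in> RS 0 \<alpha>" "form e f \<noteq> 0" by blast
    have "\<alpha> h = - \<beta> h" if "h \<in> H" for h
      using form_RS[OF e(1) f that] by (simp add: add_eq_0_iff)
    then have "f \<in> RS 0 (\<lambda>h. - \<beta> h)" using f(1) by (simp add: root_space_def)
    then have "sg (c \<beta> / form e f) f \<in> RS 0 (\<lambda>h. - \<beta> h)" "form e (sg (c \<beta> / form e f) f) = c \<beta>"
      using f(2) subspace_RS by (simp_all add: g.subspace_scale form_scale2)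
    then show ?thesis using e(1) by blast
  qed
  then have "\<forall>\<beta>\<in>gbase T. \<exists>ef. fst ef \<in> RS 0 \<beta> \<and> snd ef \<in> RS 0 (\<lambda>h. - \<beta> h) \<and> form (fst ef) (snd ef) = c \<beta>"
    by (metis fst_conv snd_conv)
  from bchoice[OF this] obtain ef where ef: "\<forall>\<beta>\<in>gbase T. fst (ef \<beta>) \<in> RS 0 \<beta> \<and>
    snd (ef \<beta>) \<in> RS 0 (\<lambda>h. - \<beta> h) \<and> form (fst (ef \<beta>)) (snd (ef \<beta>)) = c \<beta>" ..
  define E F where "E \<beta> = fst (ef \<beta>)" and "F \<beta> = snd (ef \<beta>)" for \<beta>
  have E: "E \<beta> \<in> RS 0 \<beta>" and F: "F \<beta> \<in> RS 0 (\<lambda>h. - \<beta> h)" and EF: "form (E \<beta>) (F \<beta>) = c \<beta>" if "\<beta> \<in> gbase T" for \<beta>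
    using ef that by (simp_all add: E_def F_def)
  \<comment> \<open>The bracket has weight \<beta> - \<gamma>, which is not a root.\<close>
  have EF0: "br (E \<beta>) (F \<gamma>) = 0" if "\<beta> \<in> gbase T" "\<gamma> \<in> gbase T" "\<beta> \<noteq> \<gamma>" for \<beta> \<gamma>
    using base_diff_not_root[OF that] RS_br[OF E F, OF that(1,2)] by simp
  have EFH: "br (E \<beta>) (F \<beta>) \<in> H" if "\<beta> \<in> gbase T" for \<beta>
    using RS_br[OF E F, OF that that] unfolding H_eq by simp
  let ?e = "\<Sum>\<beta>\<in>gbase T. E \<beta>" and ?f = "\<Sum>\<beta>\<in>gbase T. F \<beta>"
  have "br ?e ?f = (\<Sum>\<beta>\<in>gbase T. \<Sum>\<gamma>\<in>gbase T. br (E \<beta>) (F \<gamma>))" unfolding br_sum by (rule sum.swap)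
  also have "\<dots> = (\<Sum>\<beta>\<in>gbase T. \<Sum>\<gamma>\<in>gbase T. if \<gamma> = \<beta> then br (E \<beta>) (F \<beta>) else 0)"
    by (intro sum.cong) (auto simp: EF0)
  also have "\<dots> = (\<Sum>\<beta>\<in>gbase T. br (E \<beta>) (F \<beta>))" using finite_base by simp
  finally have bef: "br ?e ?f = (\<Sum>\<beta>\<in>gbase T. br (E \<beta>) (F \<beta>))" .
  have befH: "br ?e ?f \<in> H" unfolding bef using EFH subspace_H by (intro g.subspace_sum)
  \<comment> \<open>Two elements of H are compared through the form: by invariance
    (h|[E \<beta>, F \<beta>]) = \<beta>(h) c \<beta>, and these numbers add up to
    (h|2\<rho>).\<close>
  have "br ?e ?f - sg 2 rho = 0"
  proof (rule form_nondeg_H)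
    show "br ?e ?f - sg 2 rho \<in> H" using befH H2 subspace_H by (simp add: g.subspace_diff)
    fix h assume h: "h \<in> H"
    have "form h (br ?e ?f) = (\<Sum>\<beta>\<in>gbase T. \<beta> h * c \<beta>)"
      unfolding bef form_sum2
    proof (rule sum.cong[OF refl])
      fix \<beta> assume \<beta>: "\<beta> \<in> gbase T"
      show "form h (br (E \<beta>) (F \<beta>)) = \<beta> h * c \<beta>"
        unfolding form_inv[symmetric] using RS_act[OF E[OF \<beta>] h] EF[OF \<beta>] by (simp add: form_scale)
    qed
    then have "form h (br ?e ?f) = form h (sg 2 rho)" using expand[OF h] form_sym[of h] by (simp add: mult.commute)
    then show "form (br ?e ?f - sg 2 rho) h = 0"
      using form_add[of "br ?e ?f - sg 2 rho" "sg 2 rho" h] form_sym[of h] by simp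
  qed
  moreover have "br rho ?e = ?e" unfolding br_sum by (intro sum.cong) (auto simp: RS_act[OF E rho_H] base_rho)
  moreover have "?e \<in> G 0" using E RS_grade subspace_grade by (intro g.subspace_sum) blast+
  ultimately show ?thesis using F by (intro exI[of _ ?e] exI[of _ F]) auto
qed

end

section \<open>Diagonalisable operators without a bound on the dimension\<close>

context complex_vs
begin

lemma span_UN_subspaces:
  assumes sub: "\<And>i. i \<in> I \<Longrightarrow> subspace (U i)" and x: "x \<in> span (\<Union>i\<in>I. U i)"
  shows "\<exists>F u. finite F \<and> F \<subseteq> I \<and> (\<forall>i\<in>F. u i \<in> U i) \<and> x = (\<Sum>i\<in>F. u i)"
  using x
proof (induction x rule: span_induct_alt)
  case base
  show ?case by (intro exI[of _ "{}"]) simp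
next
  case (step c y x)
  then obtain F u j where Fu: "finite F" "F \<subseteq> I" "\<And>i. i \<in> F \<Longrightarrow> u i \<in> U i" "x = (\<Sum>i\<in>F. u i)"
    and j: "j \<in> I" "y \<in> U j" by blast
  define w where "w i = (if i \<in> F then u i else 0)" for i
  define u' where "u' i = (if i = j then sc c y + w i else w i)" for i
  have "w i \<in> U i" if "i \<in> I" for i using that Fu(3) sub subspace_0 by (auto simp: w_def)
  then have "u' i \<in> U i" if "i \<in> I" for i
    using that j sub by (auto simp: u'_def intro!: subspace_add subspace_scale)
  moreover have "(\<Sum>i\<in>insert j F. u' i) = sc c y + (\<Sum>i\<in>insert j F. w i)"
  proof -
    have "(\<Sum>i\<in>insert j F. u' i) = (\<Sum>i\<in>insert j F. (if i = j then sc c y else 0) + w i)"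
      by (rule sum.cong) (auto simp: u'_def)
    then show ?thesis using Fu(1) by (simp add: sum.distrib)
  qed
  moreover have "(\<Sum>i\<in>insert j F. w i) = (\<Sum>i\<in>F. w i)"
    by (rule sum.mono_neutral_right) (use Fu(1) in \<open>auto simp: w_def\<close>)
  moreover have "(\<Sum>i\<in>F. w i) = (\<Sum>i\<in>F. u i)" by (rule sum.cong) (auto simp: w_def)
  ultimately show ?case using Fu j by (intro exI[of _ "insert j F"] exI[of _ u']) auto
qed

lemma endo_on_zero_on_span:
  assumes "endo_on W f" "subspace W" "B \<subseteq> W" "\<And>x. x \<in> B \<Longrightarrow> f x = 0" "x \<in> span B"
  shows "f x = 0"
  using endo_on_span_closed[OF assms(1-3) subspace_single_0 _ assms(5)] assms(4) by simp

text \<open>The converse direction to \<open>semisimple_span_eigenvectors\<close>: in an expansion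
  of x into eigenvectors \<open>u d\<close>, the equation (f - c)^2 x = 0 gives (d - c)^2
  \<open>u d\<close> = 0 for each d separately. It carries diagonalisability from V over to adjoint
  operators.\<close>

lemma semisimple_if_spanned:
  assumes f: "endo_on M f" and M: "subspace M" and x: "x \<in> span {y \<in> M. \<exists>c. f y = sc c y}"
    and sq: "f (f x - sc c x) = sc c (f x - sc c x)"
  shows "f x = sc c x"
proof -
  let ?U = "\<lambda>d. {y \<in> M. f y = sc d y}"
  have sub: "subspace (?U d)" for d
    using subspace_common_eigenspace[of M "{()}" "\<lambda>_. f" "\<lambda>_. d"] M f by simp
  have "{y \<in> M. \<exists>c. f y = sc c y} = (\<Union>d\<in>UNIV. ?U d)" by auto
  then have "\<exists>F u. finite F \<and> F \<subseteq> UNIV \<and> (\<forall>i\<in>F. u i \<in> ?U i) \<and> x = (\<Sum>i\<in>F. u i)"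
    using sub x by (intro span_UN_subspaces) auto
  then obtain F u where F: "finite F" "\<forall>d\<in>F. u d \<in> ?U d" "x = (\<Sum>d\<in>F. u d)" by blast
  then have Fu: "finite F" "\<And>d. d \<in> F \<Longrightarrow> u d \<in> M" "\<And>d. d \<in> F \<Longrightarrow> f (u d) = sc d (u d)"
    "x = (\<Sum>d\<in>F. u d)" by auto
  have fx: "f x - sc c x = (\<Sum>d\<in>F. sc (d - c) (u d))"
  proof -
    have "f x = (\<Sum>d\<in>F. f (u d))" unfolding Fu(4) by (rule endo_on_sum[OF f M]) (rule Fu(2))
    then have "f x = (\<Sum>d\<in>F. sc d (u d))" by (simp add: Fu(3))
    moreover have "sc c x = (\<Sum>d\<in>F. sc c (u d))" unfolding Fu(4) by (rule scale_sum_right)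
    ultimately show ?thesis by (simp add: scale_left_diff_distrib sum_subtractf)
  qed
  have mem: "sc (d - c) (u d) \<in> M" if "d \<in> F" for d using that Fu(2) M by (simp add: subspace_scale)
  have "f (f x - sc c x) - sc c (f x - sc c x) = (\<Sum>d\<in>F. sc (d - c) (sc (d - c) (u d)))"
  proof -
    have "f (f x - sc c x) = (\<Sum>d\<in>F. f (sc (d - c) (u d)))" unfolding fx by (rule endo_on_sum[OF f M]) (rule mem)
    also have "\<dots> = (\<Sum>d\<in>F. sc d (sc (d - c) (u d)))"
      by (rule sum.cong) (use Fu(2,3) endo_on_scale[OF f] in \<open>auto simp: mult.commute\<close>)
    finally have "f (f x - sc c x) - sc c (f x - sc c x) =
        (\<Sum>d\<in>F. sc d (sc (d - c) (u d))) - (\<Sum>d\<in>F. sc c (sc (d - c) (u d)))"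
      by (simp only: fx scale_sum_right)
    then show ?thesis by (simp only: sum_subtractf[symmetric] scale_left_diff_distrib[symmetric])
  qed
  then have s0: "(\<Sum>d\<in>F. sc (d - c) (sc (d - c) (u d))) \<in> {0}" using sq by simp
  have "sc (d - c) (sc (d - c) (u d)) \<in> {0}" if "d \<in> F" for d
  proof (rule weight_extract[where M = M and H = "{()}" and T = "\<lambda>_. f" and F = F and \<mu> = "\<lambda>i _. i"])
    show "f w \<in> {0}" if "w \<in> {0}" for w using that endo_on_0[OF f M] by simp
    show "f (sc (i - c) (sc (i - c) (u i))) = sc i (sc (i - c) (sc (i - c) (u i)))" if "i \<in> F" for i
      using that Fu(2,3) endo_on_scale[OF f] M by (simp add: subspace_scale mult.commute mult.left_commute)
  qed (use that M f Fu s0 in \<open>auto simp: endo_on_def subspace_scale\<close>)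
  then have "sc (d - c) (u d) = 0" if "d \<in> F" for d using that by auto
  then have "f x - sc c x = 0" unfolding fx by (intro sum.neutral) blast
  then show ?thesis by simp
qed

end

section \<open>Degrees, loop algebra and centre on homogeneous elements\<close>

lemma pm_weight_single:
  assumes "vector_space s"
  shows "pm_weight s \<phi> (Poly_Mapping.single k x) = Poly_Mapping.single k (s (\<phi> k) x)"
proof -
  interpret vector_space s by fact
  show ?thesis
    by (rule poly_mapping_eqI) (auto simp: lookup_pm_weight[OF assms] lookup_single when_def)
qed

lemma pm_weight_zero [simp]: "pm_weight s \<phi> 0 = 0"
  by (simp add: pm_weight_def)

lemma pm_weight_zero_fun:
  assumes "vector_space s"
  shows "pm_weight s (\<lambda>_. 0) p = 0"
proof -
  interpret vector_space s by fact
  show ?thesis by (rule poly_mapping_eqI) (simp add: lookup_pm_weight[OF assms])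
qed

lemma pairing_zero [simp]: "pairing 0 a = 0" "pairing d 0 = 0"
  by (simp_all add: pairing_def)

lemma pairing_add: "pairing (d + e) a = pairing d a + pairing e a"
  by (simp add: pairing_def sum.distrib algebra_simps)

lemma pairing_add2: "pairing d (a + b) = pairing d a + pairing d b"
  by (simp add: pairing_def sum.distrib algebra_simps)

lemma pairing_diff2: "pairing d (a - b) = pairing d a - pairing d b"
  by (simp add: pairing_def sum_subtractf algebra_simps)

lemma pairing_scale: "pairing (c *s d) a = c * pairing d a"
  by (simp add: pairing_def sum_distrib_left mult.assoc)

lemma pairing_axis: "pairing (axis i 1) a = a $ i"
proof -
  have "pairing (axis i 1) a = (\<Sum>j\<in>UNIV. if j = i then a $ j else 0)"
    unfolding pairing_def by (rule sum.cong) (auto simp: axis_def)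
  then show ?thesis by simp
qed

lemma pairing_eq_iff: "(\<forall>d. pairing d a = pairing d b) \<longleftrightarrow> a = b"
  by (metis pairing_axis vec_eq_iff)

lemma ivec_add: "ivec (k + l) = ivec k + ivec l"
  by (simp add: ivec_def vec_eq_iff)

lemma ivec_diff: "ivec (k - l) = ivec k - ivec l"
  by (simp add: ivec_def vec_eq_iff)

lemma ivec_0 [simp]: "ivec 0 = 0"
  by (simp add: ivec_def vec_eq_iff)

lemma ivec_eq_iff [simp]: "ivec k = ivec l \<longleftrightarrow> k = l"
  by (simp add: ivec_def vec_eq_iff)

lemma linear_functional_pairing:
  fixes f :: "complex^'n::finite \<Rightarrow> complex"
  assumes "\<And>d e. f (d + e) = f d + f e" "\<And>c d. f (c *s d) = c * (f d :: complex)"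
  shows "f d = pairing d (\<chi> i. f (axis i 1))"
proof -
  have f0: "f 0 = 0" using assms(2)[of 0 0] by simp
  have fs: "f (\<Sum>i\<in>F. e i) = (\<Sum>i\<in>F. f (e i))" for F and e :: "'n \<Rightarrow> complex^'n"
    by (induction F rule: infinite_finite_induct) (simp_all add: f0 assms)
  have "f d = f (\<Sum>i\<in>UNIV. (d $ i) *s axis i 1)" by (simp add: basis_expansion)
  then show ?thesis by (simp add: fs assms(2) pairing_def)
qed

interpretation cen: vector_space "center_scale :: complex \<Rightarrow> 'n::finite center \<Rightarrow> _"
  by (rule vector_space_center_scale)

lemma center_deriv_zero [simp]: "center_deriv d 0 = 0"
  by (simp add: zero_center_def center_deriv.abs_eq)

lemma center_deriv_0 [simp]: "center_deriv 0 z = 0"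
  by (induction z) (simp add: zero_center_def center_deriv.abs_eq pm_weight_zero_fun[OF vector_space_vec])

lemma center_deriv_tK: "center_deriv d (tK k i) = center_scale (pairing d (ivec k)) (tK k i)"
  by (simp add: tK.abs_eq center_deriv.abs_eq center_scale.abs_eq pm_weight_single[OF vector_space_vec])

context torus
begin

lemma loop_deriv_single: "loop_deriv T d (Poly_Mapping.single k x) = Poly_Mapping.single k (sg (pairing d (ivec k)) x)"
  by (simp add: loop_deriv_def pm_weight_single[OF g.vector_space_axioms])

lemma loop_deriv_0 [simp]: "loop_deriv T 0 x = 0" "loop_deriv T d 0 = 0"
  by (simp_all add: loop_deriv_def pm_weight_zero_fun[OF g.vector_space_axioms])

lemma loop_br_0 [simp]: "loop_br T 0 x = 0" "loop_br T x 0 = 0" "cocycle T 0 x = 0" "cocycle T x 0 = 0"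
  by (simp_all add: loop_br_def cocycle_def)

lemma loop_br_single: "loop_br T (Poly_Mapping.single k x) (Poly_Mapping.single l y) = Poly_Mapping.single (k + l) (br x y)"
  and cocycle_single: "cocycle T (Poly_Mapping.single k x) (Poly_Mapping.single l y) =
      center_scale (form x y) (\<Sum>i\<in>UNIV. center_scale (of_int (k $ i)) (tK (k + l) i))"
  using bracket_homogeneous[of T] simple_g inv_form by (simp_all add: simple_lie_algebra_def)

lemma LT_single: "x \<in> G k \<Longrightarrow> Poly_Mapping.single k x \<in> LT T"
  using g.subspace_0[OF subspace_grade] by (auto simp: LT_def lookup_single when_def)

lemma zero_LT [simp]: "0 \<in> LT T"
  using g.subspace_0[OF subspace_grade] by (simp add: LT_def)

lemma LT_lookup: "x \<in> LT T \<Longrightarrow> Poly_Mapping.lookup x k \<in> G k"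
  by (simp add: LT_def)

lemma LT_add: "x \<in> LT T \<Longrightarrow> y \<in> LT T \<Longrightarrow> x + y \<in> LT T"
  using g.subspace_add[OF subspace_grade] by (simp add: LT_def lookup_add)

lemma poly_mapping_expand: "x = (\<Sum>k\<in>Poly_Mapping.keys x. Poly_Mapping.single k (Poly_Mapping.lookup x k))"
  by (rule poly_mapping_eqI)
    (simp add: lookup_sum lookup_single when_def in_keys_iff sum.delta cong: if_cong)

lemma zero_center_space [simp]: "0 \<in> center_space T"
  by (simp add: center_space_def cen.span_zero)

lemma tK_center_space: "k \<in> Gam T \<Longrightarrow> tK k i \<in> center_space T"
  by (auto simp: center_space_def intro: cen.span_base)

lemma cocycle_center_space:
  assumes "x \<in> G k" "y \<in> G l"
  shows "cocycle T (Poly_Mapping.single k x) (Poly_Mapping.single l y) \<in> center_space T"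
proof (cases "form x y = 0")
  case False
  then have "k + l \<in> Gam T" using form_grade assms by blast
  then show ?thesis unfolding cocycle_single center_space_def
    by (intro cen.span_scale cen.span_sum cen.span_base) auto
qed (simp add: cocycle_single)

end

section \<open>The representation V through homogeneous operators\<close>

locale torus_rep = torus T for T :: "('g::ab_group_add, 'n::finite) torus_data" +
  fixes V :: "(('g, 'n) tilde, 'v::ab_group_add) lmod" and lam :: "'g \<Rightarrow> complex"
  assumes V_mod: "lie_module (tilde_alg T) V"
    and V_irr: "irreducible_module (tilde_alg T) V"
    and V_int: "tilde_integrable T V"
    and K_zero: "\<And>i v. v \<in> mcarrier V \<Longrightarrow> mact V (0, tK 0 i, 0) v = 0"
    and lam_dual: "lam \<in> cartan_dual T"
    and lam_act: "\<And>h v. h \<in> gcartan T \<Longrightarrow> v \<in> highest_space T V \<Longrightarrow>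
           mact V (Poly_Mapping.single 0 h, 0, 0) v = mscale V (lam h) v"
    and lam_nonzero: "lam \<noteq> zero_fun"
    and highest_nonzero: "\<exists>v\<in>highest_space T V. v \<noteq> 0"
begin

abbreviation sv where "sv \<equiv> mscale V"
abbreviation Vc where "Vc \<equiv> mcarrier V"

definition X :: "int^'n \<Rightarrow> 'g \<Rightarrow> 'v \<Rightarrow> 'v" where "X k x = mact V (Poly_Mapping.single k x, 0, 0)"
definition D :: "complex^'n \<Rightarrow> 'v \<Rightarrow> 'v" where "D d = mact V (0, 0, d)"
definition Z :: "'n center \<Rightarrow> 'v \<Rightarrow> 'v" where "Z z = mact V (0, z, 0)"

sublocale v: complex_vs sv
  using V_mod by (simp add: complex_vs_def lie_module_def)

lemma subspace_V: "v.subspace Vc"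
  using V_mod by (simp add: lie_module_def)

lemma tilde_carrier: "(x, z, d) \<in> lcarrier (tilde_alg T) \<longleftrightarrow> x \<in> LT T \<and> z \<in> center_space T"
  by (simp add: tilde_alg_def)

lemma act_endo: "a \<in> lcarrier (tilde_alg T) \<Longrightarrow> v.endo_on Vc (mact V a)"
  using V_mod unfolding lie_module_def v.endo_on_def by blast

lemma act_add: "a \<in> lcarrier (tilde_alg T) \<Longrightarrow> b \<in> lcarrier (tilde_alg T) \<Longrightarrow> v \<in> Vc \<Longrightarrow>
    mact V (a + b) v = mact V a v + mact V b v"
  and act_scale: "a \<in> lcarrier (tilde_alg T) \<Longrightarrow> v \<in> Vc \<Longrightarrow>
    mact V (lscale (tilde_alg T) c a) v = sv c (mact V a v)"
  using V_mod unfolding lie_module_def linear_on_def by blast+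

lemma act_br: "a \<in> lcarrier (tilde_alg T) \<Longrightarrow> b \<in> lcarrier (tilde_alg T) \<Longrightarrow> v \<in> Vc \<Longrightarrow>
    mact V (lbr (tilde_alg T) a b) v = mact V a (mact V b v) - mact V b (mact V a v)"
  using V_mod unfolding lie_module_def by blast

lemma X_endo: "x \<in> G k \<Longrightarrow> v.endo_on Vc (X k x)"
  unfolding X_def by (rule act_endo) (simp add: tilde_carrier LT_single)

lemma D_endo: "v.endo_on Vc (D d)"
  unfolding D_def by (rule act_endo) (simp add: tilde_carrier)

lemma Z_endo: "z \<in> center_space T \<Longrightarrow> v.endo_on Vc (Z z)"
  unfolding Z_def by (rule act_endo) (simp add: tilde_carrier)

lemmas X_mem = v.endo_on_mem[OF X_endo]
lemmas D_mem = v.endo_on_mem[OF D_endo]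
lemmas Z_mem = v.endo_on_mem[OF Z_endo]

lemma X_add: "x \<in> G k \<Longrightarrow> y \<in> G k \<Longrightarrow> v \<in> Vc \<Longrightarrow> X k (x + y) v = X k x v + X k y v"
  using act_add[of "(Poly_Mapping.single k x, 0, 0)" "(Poly_Mapping.single k y, 0, 0)" v]
  by (simp add: X_def tilde_carrier LT_single single_add)

lemma X_scale: "x \<in> G k \<Longrightarrow> v \<in> Vc \<Longrightarrow> X k (sg c x) v = sv c (X k x v)"
  using act_scale[of "(Poly_Mapping.single k x, 0, 0)" v c]
  by (simp add: X_def tilde_carrier LT_single)
    (simp add: tilde_alg_def pm_weight_single[OF g.vector_space_axioms])

lemma Z_add: "z \<in> center_space T \<Longrightarrow> w \<in> center_space T \<Longrightarrow> v \<in> Vc \<Longrightarrow> Z (z + w) v = Z z v + Z w v"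
  using act_add[of "(0, z, 0)" "(0, w, 0)" v] by (simp add: Z_def tilde_carrier)

lemma Z_scale: "z \<in> center_space T \<Longrightarrow> v \<in> Vc \<Longrightarrow> Z (center_scale c z) v = sv c (Z z v)"
  using act_scale[of "(0, z, 0)" v c]
  by (simp add: Z_def tilde_carrier) (simp add: tilde_alg_def pm_weight_def)

lemma X_zero: "v \<in> Vc \<Longrightarrow> X k 0 v = 0"
  using X_scale[of 0 k v 0] g.subspace_0[OF subspace_grade] by simp

lemma Z_zero: "v \<in> Vc \<Longrightarrow> Z 0 v = 0"
  using Z_scale[of 0 v 0] by simp

text \<open>Reduces questions about the whole algebra to the homogeneous operators \<open>X\<close>,
  \<open>Z\<close> and \<open>D\<close>.\<close>

lemma act_decompose:
  assumes "x \<in> LT T" "z \<in> center_space T" "v \<in> Vc"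
  shows "mact V (x, z, d) v = (\<Sum>k\<in>Poly_Mapping.keys x. X k (Poly_Mapping.lookup x k) v) + Z z v + D d v"
proof -
  have sum: "mact V ((\<Sum>k\<in>F. Poly_Mapping.single k (Poly_Mapping.lookup x k)), 0, 0) v =
      (\<Sum>k\<in>F. X k (Poly_Mapping.lookup x k) v) \<and> (\<Sum>k\<in>F. Poly_Mapping.single k (Poly_Mapping.lookup x k)) \<in> LT T"
    if "finite F" for F
    using that
  proof (induction F rule: finite_induct)
    case empty
    show ?case using Z_zero[OF assms(3)] by (simp add: Z_def)
  next
    case (insert k F)
    have "Poly_Mapping.single k (Poly_Mapping.lookup x k) \<in> LT T" using assms(1) LT_lookup LT_single by blast
    then show ?case
      using insert act_add[of "(Poly_Mapping.single k (Poly_Mapping.lookup x k), 0, 0)"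
          "((\<Sum>k\<in>F. Poly_Mapping.single k (Poly_Mapping.lookup x k)), 0, 0)" v] assms(3)
      by (simp add: tilde_carrier X_def LT_add)
  qed
  have "mact V (x, z, d) v = mact V (x, 0, 0) v + Z z v + D d v"
    using act_add[of "(x, 0, 0)" "(0, z, 0)" v] act_add[of "(x, z, 0)" "(0, 0, d)" v] assms
    by (simp add: tilde_carrier Z_def D_def)
  moreover have "mact V (x, 0, 0) v = (\<Sum>k\<in>Poly_Mapping.keys x. X k (Poly_Mapping.lookup x k) v)"
    using sum[of "Poly_Mapping.keys x"] poly_mapping_expand[of x] by simp
  ultimately show ?thesis by simp
qed

lemma XX:
  assumes "x \<in> G k" "y \<in> G l" "v \<in> Vc"
  shows "X k x (X l y v) = X l y (X k x v) + X (k + l) (br x y) v +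
    Z (center_scale (form x y) (\<Sum>i\<in>UNIV. center_scale (of_int (k $ i)) (tK (k + l) i))) v"
proof -
  have br: "Poly_Mapping.single (k + l) (br x y) \<in> LT T" using assms br_grade LT_single by blast
  have cc: "center_scale (form x y) (\<Sum>i\<in>UNIV. center_scale (of_int (k $ i)) (tK (k + l) i)) \<in> center_space T"
    using cocycle_center_space[OF assms(1,2)] by (simp add: cocycle_single)
  have "X k x (X l y v) - X l y (X k x v) = mact V (Poly_Mapping.single (k + l) (br x y),
      center_scale (form x y) (\<Sum>i\<in>UNIV. center_scale (of_int (k $ i)) (tK (k + l) i)), 0) v"
    using act_br[of "(Poly_Mapping.single k x, 0, 0)" "(Poly_Mapping.single l y, 0, 0)" v] assms
    by (simp add: X_def tilde_carrier LT_single) (simp add: tilde_alg_def loop_br_single cocycle_single)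
  also have "\<dots> = X (k + l) (br x y) v + Z (center_scale (form x y) (\<Sum>i\<in>UNIV. center_scale (of_int (k $ i)) (tK (k + l) i))) v"
    using act_add[of "(Poly_Mapping.single (k + l) (br x y), 0, 0)"
       "(0, center_scale (form x y) (\<Sum>i\<in>UNIV. center_scale (of_int (k $ i)) (tK (k + l) i)), 0)" v] br cc assms(3)
    by (simp add: X_def Z_def tilde_carrier)
  finally show ?thesis by (simp add: algebra_simps)
qed

text \<open>The cocycle is (x|y) times the sum of the k_i t^(k+l) K_i, so it vanishes for k = 0 as
  well: the elements of \<open>G 0\<close> act without central correction.\<close>

lemma XX_no_center:
  assumes "x \<in> G k" "y \<in> G l" "v \<in> Vc" "form x y = 0 \<or> k = 0"
  shows "X k x (X l y v) = X l y (X k x v) + X (k + l) (br x y) v"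
  using XX[OF assms(1-3)] assms(4) Z_zero[OF assms(3)] by auto

lemma DX:
  assumes "x \<in> G k" "v \<in> Vc"
  shows "D d (X k x v) = X k x (D d v) + sv (pairing d (ivec k)) (X k x v)"
proof -
  have "D d (X k x v) - X k x (D d v) = X k (sg (pairing d (ivec k)) x) v"
    using act_br[of "(0, 0, d)" "(Poly_Mapping.single k x, 0, 0)" v] assms
    by (simp add: X_def D_def tilde_carrier LT_single) (simp add: tilde_alg_def loop_deriv_single)
  then show ?thesis using X_scale assms by (simp add: algebra_simps)
qed

lemma XZ: "x \<in> G k \<Longrightarrow> z \<in> center_space T \<Longrightarrow> v \<in> Vc \<Longrightarrow> X k x (Z z v) = Z z (X k x v)"
  using act_br[of "(Poly_Mapping.single k x, 0, 0)" "(0, z, 0)" v] Z_zero[of v]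
  by (simp add: X_def Z_def tilde_carrier LT_single) (simp add: tilde_alg_def)

lemma DZ:
  assumes "k \<in> Gam T" "v \<in> Vc"
  shows "D d (Z (tK k i) v) = Z (tK k i) (D d v) + sv (pairing d (ivec k)) (Z (tK k i) v)"
proof -
  have "D d (Z (tK k i) v) - Z (tK k i) (D d v) = Z (center_scale (pairing d (ivec k)) (tK k i)) v"
    using act_br[of "(0, 0, d)" "(0, tK k i, 0)" v] assms
    by (simp add: Z_def D_def tilde_carrier tK_center_space) (simp add: tilde_alg_def center_deriv_tK)
  then show ?thesis using Z_scale assms tK_center_space by (simp add: algebra_simps)
qed

subsection \<open>Weights\<close>

text \<open>A weight is recorded as a functional on H together with the vector b of eigenvalues of
  the d_i. The K_i act by 0 and contribute no further coordinate.\<close>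

definition wtsp :: "('g \<Rightarrow> complex) \<Rightarrow> complex^'n \<Rightarrow> 'v set" where
  "wtsp \<alpha> b = {v \<in> Vc. (\<forall>h\<in>H. X 0 h v = sv (\<alpha> h) v) \<and> (\<forall>d. D d v = sv (pairing d b) v)}"

lemma wtsp_V: "v \<in> wtsp \<alpha> b \<Longrightarrow> v \<in> Vc"
  and wtsp_H: "v \<in> wtsp \<alpha> b \<Longrightarrow> h \<in> H \<Longrightarrow> X 0 h v = sv (\<alpha> h) v"
  and wtsp_D: "v \<in> wtsp \<alpha> b \<Longrightarrow> D d v = sv (pairing d b) v"
  by (simp_all add: wtsp_def)

lemma H_grade: "h \<in> H \<Longrightarrow> h \<in> G 0"
  using H_sub_grade by blast

lemma subspace_wtsp: "v.subspace (wtsp \<alpha> b)"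
proof (rule v.subspaceI)
  show "0 \<in> wtsp \<alpha> b"
    using subspace_V v.endo_on_0[OF D_endo subspace_V] v.endo_on_0[OF X_endo subspace_V] H_grade
    by (simp add: wtsp_def v.subspace_0)
  fix v w c assume v: "v \<in> wtsp \<alpha> b" and w: "w \<in> wtsp \<alpha> b"
  show "v + w \<in> wtsp \<alpha> b"
    using v w subspace_V v.endo_on_add[OF X_endo[OF H_grade]] v.endo_on_add[OF D_endo]
    by (simp add: wtsp_def v.subspace_add v.scale_right_distrib)
  show "sv c v \<in> wtsp \<alpha> b"
    using v subspace_V v.endo_on_scale[OF X_endo[OF H_grade]] v.endo_on_scale[OF D_endo]
    by (simp add: wtsp_def v.subspace_scale mult.commute)
qed

lemma X_wtsp:
  assumes "x \<in> RS k \<gamma>" "v \<in> wtsp \<alpha> b"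
  shows "X k x v \<in> wtsp (\<lambda>h. \<alpha> h + \<gamma> h) (b + ivec k)"
proof -
  have x: "x \<in> G k" and v: "v \<in> Vc" using assms RS_grade wtsp_V by blast+
  have "X 0 h (X k x v) = sv (\<alpha> h + \<gamma> h) (X k x v)" if h: "h \<in> H" for h
  proof -
    have "X 0 h (X k x v) = X k x (X 0 h v) + X k (br h x) v"
      using XX_no_center[OF H_grade[OF h] x v] by simp
    also have "\<dots> = sv (\<alpha> h) (X k x v) + sv (\<gamma> h) (X k x v)"
      using wtsp_H[OF assms(2) h] RS_act[OF assms(1) h] X_scale[OF x v] v.endo_on_scale[OF X_endo[OF x] v] by simp
    finally show ?thesis by (simp add: v.scale_left_distrib)
  qed
  moreover have "D d (X k x v) = sv (pairing d (b + ivec k)) (X k x v)" for d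
    using DX[OF x v, of d] wtsp_D[OF assms(2), of d] v.endo_on_scale[OF X_endo[OF x] v]
    by (simp add: pairing_add2 v.scale_left_distrib)
  ultimately show ?thesis using X_mem[OF x v] by (simp add: wtsp_def)
qed

lemma Z_wtsp:
  assumes k: "k \<in> Gam T" and v: "v \<in> wtsp \<alpha> b"
  shows "Z (tK k i) v \<in> wtsp \<alpha> (b + ivec k)"
proof -
  note z = tK_center_space[OF k, of i] and vV = wtsp_V[OF v]
  have "X 0 h (Z (tK k i) v) = sv (\<alpha> h) (Z (tK k i) v)" if "h \<in> H" for h
    using XZ[OF H_grade[OF that] z vV] wtsp_H[OF v that] v.endo_on_scale[OF Z_endo[OF z] vV] by simp
  moreover have "D d (Z (tK k i) v) = sv (pairing d (b + ivec k)) (Z (tK k i) v)" for d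
    using DZ[OF k vV, of d i] wtsp_D[OF v, of d] v.endo_on_scale[OF Z_endo[OF z] vV]
    by (simp add: pairing_add2 v.scale_left_distrib)
  ultimately show ?thesis using Z_mem[OF z vV] by (simp add: wtsp_def)
qed

lemma K_combination_zero: "v \<in> Vc \<Longrightarrow> Z (\<Sum>i\<in>F. center_scale (a $ i) (tK 0 i)) v = 0"
proof -
  assume v: "v \<in> Vc"
  have "(\<Sum>i\<in>F. center_scale (a $ i) (tK 0 i)) \<in> center_space T \<and> Z (\<Sum>i\<in>F. center_scale (a $ i) (tK 0 i)) v = 0"
  proof (induction F rule: infinite_finite_induct)
    case (insert i F)
    have "center_scale (a $ i) (tK 0 i) \<in> center_space T"
      using tK_center_space[of 0 i] by (simp add: center_space_def cen.span_scale)
    moreover have "Z (center_scale (a $ i) (tK 0 i)) v = 0"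
      using Z_scale[OF tK_center_space v, of 0] K_zero[OF v] by (simp add: Z_def)
    ultimately show ?case using insert Z_add v by (simp add: center_space_def cen.span_add)
  qed (simp_all add: Z_zero v)
  then show ?thesis ..
qed

lemma tilde_cartan_D: "(0, 0, d) \<in> tilde_cartan T"
  and tilde_cartan_H: "h \<in> H \<Longrightarrow> (Poly_Mapping.single 0 h, 0, 0) \<in> tilde_cartan T"
proof -
  have 1: "(0, 0, d) = (Poly_Mapping.single 0 0, \<Sum>i\<in>UNIV. center_scale ((0::complex^'n) $ i) (tK 0 i), d)" by simp
  show "(0, 0, d) \<in> tilde_cartan T" unfolding tilde_cartan_def
    using 1 g.subspace_0[OF subspace_H] by blast
  have 2: "(Poly_Mapping.single 0 h, 0, 0) = (Poly_Mapping.single 0 h, \<Sum>i\<in>UNIV. center_scale ((0::complex^'n) $ i) (tK 0 i), 0)" by simp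
  show "h \<in> H \<Longrightarrow> (Poly_Mapping.single 0 h, 0, 0) \<in> tilde_cartan T" unfolding tilde_cartan_def using 2 by blast
qed

lemma V_weights: "direct_sum sv (dual (lscale (tilde_alg T)) (tilde_cartan T)) (weight_space (tilde_cartan T) V) Vc"
  "\<mu> \<in> dual (lscale (tilde_alg T)) (tilde_cartan T) \<Longrightarrow> fin_dim sv (weight_space (tilde_cartan T) V \<mu>)"
  "x \<in> root_elements T \<Longrightarrow> v \<in> Vc \<Longrightarrow> \<exists>j. (mact V (x, 0, 0) ^^ j) v = 0"
  using V_int by (auto simp: tilde_integrable_def integrable_module_def)

lemma X_locally_nilpotent:
  assumes "\<alpha> \<in> cartan_dual T" "\<alpha> \<noteq> zero_fun" "x \<in> RS k \<alpha>" "v \<in> Vc"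
  shows "\<exists>j. (X k x ^^ j) v = 0"
proof -
  have "Poly_Mapping.single k x \<in> root_elements T" using assms by (auto simp: root_elements_def)
  then show ?thesis using V_weights(3) assms(4) by (simp add: X_def)
qed

lemma V_span: "Vc = v.span (\<Union>\<alpha>\<in>cartan_dual T. \<Union>b. wtsp \<alpha> b)"
proof
  let ?S = "v.span (\<Union>\<alpha>\<in>cartan_dual T. \<Union>b. wtsp \<alpha> b)"
  show "?S \<subseteq> Vc" using subspace_V wtsp_V by (intro v.span_minimal) auto
  have "weight_space (tilde_cartan T) V \<mu> \<subseteq> ?S" if \<mu>: "\<mu> \<in> dual (lscale (tilde_alg T)) (tilde_cartan T)" for \<mu>
  proof
    fix v assume v: "v \<in> weight_space (tilde_cartan T) V \<mu>"
    define \<alpha> where "\<alpha> h = (if h \<in> H then \<mu> (Poly_Mapping.single 0 h, 0, 0) else 0)" for h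
    have sc: "lscale (tilde_alg T) c (Poly_Mapping.single 0 h, 0, d) = (Poly_Mapping.single 0 (sg c h), 0, c *s d)" for c h d
      by (simp add: tilde_alg_def pm_weight_single[OF g.vector_space_axioms])
    have "\<alpha> \<in> cartan_dual T"
      unfolding dual_def
    proof safe
      fix h k assume hk: "h \<in> H" "k \<in> H"
      then show "\<alpha> (h + k) = \<alpha> h + \<alpha> k"
        using dual_add[OF \<mu> tilde_cartan_H tilde_cartan_H, of h k] subspace_H
        by (simp add: \<alpha>_def g.subspace_add single_add)
    next
      fix c h assume h: "h \<in> H"
      then show "\<alpha> (sg c h) = c * \<alpha> h"
        using dual_scale[OF \<mu> tilde_cartan_H[OF h], of c] sc[of c h 0] subspace_H
        by (simp add: \<alpha>_def g.subspace_scale)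
    qed (simp add: \<alpha>_def)
    moreover have "\<mu> (0, 0, d) = pairing d (\<chi> i. \<mu> (0, 0, axis i 1))" for d
      by (rule linear_functional_pairing)
        (use dual_add[OF \<mu> tilde_cartan_D tilde_cartan_D] dual_scale[OF \<mu> tilde_cartan_D] sc[of _ 0] in auto)
    then have "D d v = sv (pairing d (\<chi> i. \<mu> (0, 0, axis i 1))) v" for d
      using v tilde_cartan_D[of d] unfolding weight_space_def D_def by (metis (mono_tags, lifting) mem_Collect_eq)
    moreover have "X 0 h v = sv (\<alpha> h) v" if "h \<in> H" for h
      using v tilde_cartan_H[OF that] that by (simp add: weight_space_def X_def \<alpha>_def)
    moreover have "v \<in> Vc" using v by (simp add: weight_space_def)
    ultimately have "\<alpha> \<in> cartan_dual T \<and> v \<in> wtsp \<alpha> (\<chi> i. \<mu> (0, 0, axis i 1))" by (simp add: wtsp_def)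
    then have "v \<in> (\<Union>\<alpha>\<in>cartan_dual T. \<Union>b. wtsp \<alpha> b)" by (intro UN_I[of \<alpha>] UN_I[OF UNIV_I]) auto
    then show "v \<in> ?S" by (rule v.span_base)
  qed
  then have "(\<Union>\<mu>\<in>dual (lscale (tilde_alg T)) (tilde_cartan T). weight_space (tilde_cartan T) V \<mu>) \<subseteq> ?S" by blast
  then show "Vc \<subseteq> ?S"
    using V_weights(1) v.span_minimal[of "\<Union>\<mu>\<in>dual (lscale (tilde_alg T)) (tilde_cartan T). weight_space (tilde_cartan T) V \<mu>" ?S]
    by (simp add: direct_sum_def)
qed

lemma V_span_induct:
  assumes "v \<in> Vc" "v.endo_on Vc f" "\<And>\<alpha> b v. \<alpha> \<in> cartan_dual T \<Longrightarrow> v \<in> wtsp \<alpha> b \<Longrightarrow> f v = 0"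
  shows "f v = 0"
  by (rule v.endo_on_zero_on_span[OF assms(2) subspace_V, of "\<Union>\<alpha>\<in>cartan_dual T. \<Union>b. wtsp \<alpha> b"])
    (use assms V_span wtsp_V in auto)

lemma wtsp_fin_dim:
  assumes \<alpha>: "\<alpha> \<in> cartan_dual T"
  shows "fin_dim sv (wtsp \<alpha> b)"
proof -
  \<comment> \<open>The coefficient at exponent 0 recovers the element of H; the value on the K_i is
    0, in accordance with their trivial action.\<close>
  define \<mu> where "\<mu> a = (if a \<in> tilde_cartan T then \<alpha> (Poly_Mapping.lookup (fst a) 0) + pairing (snd (snd a)) b else 0)" for a
  have \<mu>_eq: "\<mu> (Poly_Mapping.single 0 h, \<Sum>i\<in>UNIV. center_scale (a $ i) (tK 0 i), d) = \<alpha> h + pairing d b" if "h \<in> H" for h a d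
    using that by (auto simp: \<mu>_def tilde_cartan_def)
  have "\<mu> \<in> dual (lscale (tilde_alg T)) (tilde_cartan T)"
    unfolding dual_def
  proof safe
    fix x z d x' z' d' assume "(x, z, d) \<in> tilde_cartan T" "(x', z', d') \<in> tilde_cartan T"
    then obtain h a h' a' where h: "h \<in> H" "x = Poly_Mapping.single 0 h" "z = (\<Sum>i\<in>UNIV. center_scale (a $ i) (tK 0 i))"
      and h': "h' \<in> H" "x' = Poly_Mapping.single 0 h'" "z' = (\<Sum>i\<in>UNIV. center_scale (a' $ i) (tK 0 i))"
      by (auto simp: tilde_cartan_def)
    have "(x, z, d) + (x', z', d') = (Poly_Mapping.single 0 (h + h'), \<Sum>i\<in>UNIV. center_scale ((a + a') $ i) (tK 0 i), d + d')"
      using h h' by (simp add: single_add cen.scale_left_distrib sum.distrib)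
    then show "\<mu> ((x, z, d) + (x', z', d')) = \<mu> (x, z, d) + \<mu> (x', z', d')"
      using h h' \<mu>_eq subspace_H dual_add[OF \<alpha>] by (simp only: g.subspace_add) (simp add: pairing_add)
  next
    fix c x z d assume "(x, z, d) \<in> tilde_cartan T"
    then obtain h a where h: "h \<in> H" "x = Poly_Mapping.single 0 h" "z = (\<Sum>i\<in>UNIV. center_scale (a $ i) (tK 0 i))"
      by (auto simp: tilde_cartan_def)
    have "lscale (tilde_alg T) c (x, z, d) = (Poly_Mapping.single 0 (sg c h), \<Sum>i\<in>UNIV. center_scale ((c *s a) $ i) (tK 0 i), c *s d)"
      using h by (simp add: tilde_alg_def pm_weight_single[OF g.vector_space_axioms] cen.scale_sum_right)
    then show "\<mu> (lscale (tilde_alg T) c (x, z, d)) = c * \<mu> (x, z, d)"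
      using h \<mu>_eq subspace_H dual_scale[OF \<alpha>] by (simp only: g.subspace_scale) (simp add: pairing_scale algebra_simps)
  qed (simp add: \<mu>_def)
  then have "fin_dim sv (weight_space (tilde_cartan T) V \<mu>)" by (rule V_weights(2))
  moreover have "wtsp \<alpha> b \<subseteq> weight_space (tilde_cartan T) V \<mu>"
  proof
    fix v assume v: "v \<in> wtsp \<alpha> b"
    have "mact V a v = sv (\<mu> a) v" if "a \<in> tilde_cartan T" for a
    proof -
      obtain h c d where a: "h \<in> H" "a = (Poly_Mapping.single 0 h, \<Sum>i\<in>UNIV. center_scale (c $ i) (tK 0 i), d)"
        using \<open>a \<in> tilde_cartan T\<close> by (auto simp: tilde_cartan_def)
      let ?z = "\<Sum>i\<in>UNIV. center_scale (c $ i) (tK 0 i)"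
      have z: "?z \<in> center_space T"
        unfolding center_space_def by (intro cen.span_sum cen.span_scale cen.span_base) auto
      have "mact V a v = X 0 h v + Z ?z v + D d v"
        using act_add[of "(Poly_Mapping.single 0 h, 0, 0)" "(0, ?z, 0)" v]
          act_add[of "(Poly_Mapping.single 0 h, ?z, 0)" "(0, 0, d)" v] wtsp_V[OF v] z a LT_single[OF H_grade[OF a(1)]]
        by (simp add: tilde_carrier X_def Z_def D_def)
      then show ?thesis
        using K_combination_zero[OF wtsp_V[OF v]] wtsp_H[OF v a(1)] wtsp_D[OF v] \<mu>_eq[OF a(1)] a(2)
        by (simp add: v.scale_left_distrib)
    qed
    then show "v \<in> weight_space (tilde_cartan T) V \<mu>" using wtsp_V[OF v] by (simp add: weight_space_def)
  qed
  ultimately show ?thesis using v.fin_dim_subspace subspace_wtsp by blast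
qed

subsection \<open>The Cartan subalgebra acts semisimply\<close>

text \<open>The kernel is an ideal of the simple algebra \<open>G 0\<close>. It is not everything,
  because some h acts on a non-zero highest weight vector by the non-zero number
  \<open>lam h\<close>.\<close>

lemma faithful:
  assumes x: "x \<in> G 0" and zero: "\<And>v. v \<in> Vc \<Longrightarrow> X 0 x v = 0"
  shows "x = 0"
proof -
  let ?I = "{x \<in> G 0. \<forall>v\<in>Vc. X 0 x v = 0}"
  have "br y z \<in> ?I" if y: "y \<in> G 0" and z: "z \<in> ?I" for y z
  proof -
    have "X 0 (br y z) v = 0" if v: "v \<in> Vc" for v
      using XX_no_center[OF y, of z 0 v] z v X_mem[OF y v] v.endo_on_0[OF X_endo[OF y] subspace_V] by simp
    then show ?thesis using br_grade[of y 0 z 0] y z by simp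
  qed
  moreover have "g.subspace ?I"
    using subspace_grade[of 0] by (intro g.subspaceI)
      (auto simp: g.subspace_0 g.subspace_add g.subspace_scale X_zero X_add X_scale)
  ultimately have "lie_ideal (g0_alg T) ?I" by (simp add: lie_ideal_def g0_alg_def)
  then consider "?I = {0}" | "?I = G 0" using simple_g0 by (auto simp: simple_lie_algebra_def g0_alg_def)
  then show ?thesis
  proof cases
    case 1
    then show ?thesis using x zero by blast
  next
    case 2
    obtain h where h: "h \<in> H" "lam h \<noteq> 0" using dual_nonzero[OF lam_dual lam_nonzero] by blast
    obtain v where v: "v \<in> highest_space T V" "v \<noteq> 0" using highest_nonzero by blast
    then have "X 0 h v = sv (lam h) v" using lam_act h by (simp add: X_def)
    moreover have "X 0 h v = 0" using 2 H_grade[OF h(1)] v by (auto simp: highest_space_def)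
    ultimately show ?thesis using h v by simp
  qed
qed

text \<open>On weight vectors h and k act by scalars, so their bracket acts by 0 on V. The
  definition of a Cartan subalgebra by itself provides nilpotency only.\<close>

lemma cartan_commutes: "h \<in> H \<Longrightarrow> k \<in> H \<Longrightarrow> br h k = 0"
proof -
  assume h: "h \<in> H" and k: "k \<in> H"
  have g: "br h k \<in> G 0" using br_grade[of h 0 k 0] h k H_grade by simp
  show "br h k = 0"
  proof (rule faithful[OF g])
    fix v assume "v \<in> Vc"
    then show "X 0 (br h k) v = 0"
    proof (rule V_span_induct[OF _ X_endo[OF g]])
      fix \<alpha> b v assume v: "v \<in> wtsp \<alpha> b"
      note vV = wtsp_V[OF v]
      have "X 0 h (X 0 k v) = X 0 k (X 0 h v) + X 0 (br h k) v"
        using XX_no_center[OF H_grade[OF h] H_grade[OF k] vV] by simp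
      then show "X 0 (br h k) v = 0"
        using wtsp_H[OF v] h k v.endo_on_scale[OF X_endo[OF H_grade] vV] by (simp add: mult.commute)
    qed
  qed
qed

text \<open>On a weight vector v of H-weight \<alpha> the element [h,x] - c x acts as (h - \<kappa>)
  x with \<kappa> = \<alpha>(h) + c. The assumption thus becomes (h - \<kappa>)^2 x v = 0, and h is
  diagonalisable on V, so (h - \<kappa>) x v = 0; \<open>faithful\<close> concludes.\<close>

lemma ad_semisimple:
  assumes h: "h \<in> H" and x: "x \<in> G 0" and sq: "br h (br h x - sg c x) = sg c (br h x - sg c x)"
  shows "br h x = sg c x"
proof -
  let ?y = "br h x - sg c x"
  have bg: "br h x \<in> G 0" using br_grade[of h 0 x 0] H_grade[OF h] x by simp
  have yg: "?y \<in> G 0" using bg x subspace_grade by (simp add: g.subspace_diff g.subspace_scale)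
  have "?y = 0"
  proof (rule faithful[OF yg])
    fix v assume "v \<in> Vc"
    then show "X 0 ?y v = 0"
    proof (rule V_span_induct[OF _ X_endo[OF yg]])
      fix \<alpha> b v assume v: "v \<in> wtsp \<alpha> b"
      note vV = wtsp_V[OF v]
      let ?\<kappa> = "\<alpha> h + c" and ?w = "X 0 x v"
      have wV: "?w \<in> Vc" using X_mem[OF x vV] .
      have "X 0 ((br h x - sg c x) + sg c x) v = X 0 ?y v + X 0 (sg c x) v"
        by (rule X_add[OF yg _ vV]) (use x subspace_grade in \<open>simp add: g.subspace_scale\<close>)
      then have Xy: "X 0 ?y v = X 0 (br h x) v - sv c ?w" using X_scale[OF x vV] by simp
      have "X 0 h ?w = X 0 x (X 0 h v) + X 0 (br h x) v"
        using XX_no_center[OF H_grade[OF h] x vV] by simp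
      then have "X 0 (br h x) v = X 0 h ?w - sv (\<alpha> h) ?w"
        using wtsp_H[OF v h] v.endo_on_scale[OF X_endo[OF x] vV] by simp
      then have yv: "X 0 ?y v = X 0 h ?w - sv ?\<kappa> ?w" using Xy by (simp add: v.scale_left_distrib)
      have "X 0 h (X 0 ?y v) = X 0 ?y (X 0 h v) + X 0 (br h ?y) v"
        using XX_no_center[OF H_grade[OF h] yg vV] by simp
      also have "\<dots> = sv ?\<kappa> (X 0 ?y v)"
        using wtsp_H[OF v h] v.endo_on_scale[OF X_endo[OF yg] vV] sq X_scale[OF yg vV]
        by (simp add: v.scale_left_distrib)
      finally have "X 0 h (X 0 h ?w - sv ?\<kappa> ?w) = sv ?\<kappa> (X 0 h ?w - sv ?\<kappa> ?w)" unfolding yv .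
      moreover have "?w \<in> v.span {u \<in> Vc. \<exists>c. X 0 h u = sv c u}"
      proof -
        have "(\<Union>\<alpha>\<in>cartan_dual T. \<Union>b. wtsp \<alpha> b) \<subseteq> {u \<in> Vc. \<exists>c. X 0 h u = sv c u}"
          using wtsp_V wtsp_H h by blast
        then show ?thesis using wV V_span v.span_mono by blast
      qed
      ultimately have "X 0 h ?w = sv ?\<kappa> ?w"
        using v.semisimple_if_spanned[OF X_endo[OF H_grade[OF h]] subspace_V] by blast
      then show "X 0 ?y v = 0" using yv by simp
    qed
  qed
  then show ?thesis by simp
qed

text \<open>A finite spanning set of H acts on \<open>G 0\<close> by commuting semisimple
  operators.\<close>

lemma grade_0_weights: "G 0 \<subseteq> g.span (\<Union>\<alpha>\<in>cartan_dual T. RS 0 \<alpha>)"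
proof -
  obtain B where B: "finite B" "B \<subseteq> H" "H = g.span B" using H_basis by blast
  have "G 0 \<subseteq> g.span {x \<in> G 0. \<forall>b\<in>B. \<exists>c. br b x = sg c x}"
  proof (rule g.simultaneous_eigenvectors[OF B(1) _ _ fin_dim_sub[OF subspace_grade]])
    fix a b x assume ab: "a \<in> B" "b \<in> B"
    have "br a (br b x) = br (br a b) x + br b (br a x)" by (rule br_derivation)
    moreover have "br a b = 0" using ab B(2) cartan_commutes by blast
    ultimately show "br a (br b x) = br b (br a x)" by simp
  next
    fix b assume "b \<in> B"
    then have "b \<in> G 0" using B(2) H_grade by blast
    then show "g.endo_on (G 0) (br b)" using br_grade[of b 0 _ 0] by (intro endo_br) simp
  qed (use B(2) ad_semisimple in blast)
  also have "\<dots> \<subseteq> g.span (\<Union>\<alpha>\<in>cartan_dual T. RS 0 \<alpha>)"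
  proof (rule g.span_minimal)
    show "{x \<in> G 0. \<forall>b\<in>B. \<exists>c. br b x = sg c x} \<subseteq> g.span (\<Union>\<alpha>\<in>cartan_dual T. RS 0 \<alpha>)"
    proof
      fix x assume x: "x \<in> {x \<in> G 0. \<forall>b\<in>B. \<exists>c. br b x = sg c x}"
      show "x \<in> g.span (\<Union>\<alpha>\<in>cartan_dual T. RS 0 \<alpha>)"
      proof (cases "x = 0")
        case False
        then obtain \<alpha> where "\<alpha> \<in> cartan_dual T" "\<forall>h\<in>H. br h x = sg (\<alpha> h) x"
          using weight_functional[OF B(3), of x] x by blast
        then have "x \<in> (\<Union>\<alpha>\<in>cartan_dual T. RS 0 \<alpha>)" using x by (auto simp: root_space_def)
        then show ?thesis by (rule g.span_base)
      qed (simp add: g.span_zero)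
    qed
  qed simp
  finally show ?thesis .
qed

text \<open>Both axioms have been obtained from V, so roots, \<open>rho\<close> and the principal
  triple become available.\<close>

sublocale split_torus T
  by unfold_locales (use cartan_commutes grade_0_weights in auto)

subsection \<open>Submodules\<close>

lemma form_nonzero_on_H: "\<exists>h\<in>H. \<exists>k\<in>H. form h k \<noteq> 0"
proof -
  obtain h where h: "h \<in> H" "lam h \<noteq> 0" using dual_nonzero[OF lam_dual lam_nonzero] by blast
  then have "h \<noteq> 0" using dual_scale[OF lam_dual h(1), of 0] by auto
  then show ?thesis using form_nondeg_H[OF h(1)] h(1) by blast
qed

text \<open>\<open>[h \<otimes> t\<^sup>p, h' \<otimes> t\<^sup>q] = (h|h') \<Sum>\<^sub>j p\<^sub>j t\<^sup>p\<^sup>+\<^sup>q K\<^sub>j\<close>, where \<open>p\<close> is a multiple of a unit vector.\<close>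

lemma center_commutator:
  assumes k: "k \<in> Gam T"
  shows "\<exists>p q h h' c. p \<in> Gam T \<and> q \<in> Gam T \<and> p + q = k \<and> h \<in> H \<and> h' \<in> H \<and>
     (\<forall>v\<in>Vc. Z (tK k i) v = sv c (X p h (X q h' v) - X q h' (X p h v)))"
proof -
  obtain h h' where h: "h \<in> H" "h' \<in> H" "form h h' \<noteq> 0" using form_nonzero_on_H by blast
  \<comment> \<open>The factor m_i puts p into \<open>Gam T\<close>, so that h tensor t^p and h'
    tensor t^(k - p) both belong to LT.\<close>
  define p where "p = (axis i (int (gord T i)) :: int^'n)"
  have p: "p \<in> Gam T" by (simp add: p_def Gam_def axis_def)
  have q: "k - p \<in> Gam T" using Gam_diff k p .
  let ?m = "of_nat (gord T i) :: complex"
  have "(\<Sum>j\<in>UNIV. center_scale (of_int (p $ j)) (tK k j)) = (\<Sum>j\<in>UNIV. if j = i then center_scale ?m (tK k j) else 0)"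
    by (rule sum.cong) (auto simp: p_def axis_def)
  then have s: "(\<Sum>j\<in>UNIV. center_scale (of_int (p $ j)) (tK k j)) = center_scale ?m (tK k i)" by simp
  have hg: "h \<in> G p" "h' \<in> G (k - p)" using h H_grade grade_Gam[OF p] grade_Gam[OF q] by auto
  have "Z (tK k i) v = sv (inverse (form h h' * ?m)) (X p h (X (k - p) h' v) - X (k - p) h' (X p h v))"
    if v: "v \<in> Vc" for v
  proof -
    have "X p h (X (k - p) h' v) - X (k - p) h' (X p h v) = Z (center_scale (form h h' * ?m) (tK k i)) v"
      using XX[OF hg v] H_abelian[OF h(1,2)] X_zero[OF v] s by simp
    also have "\<dots> = sv (form h h' * ?m) (Z (tK k i) v)" using Z_scale[OF tK_center_space[OF k] v] .
    finally have "sv (inverse (form h h' * ?m)) (X p h (X (k - p) h' v) - X (k - p) h' (X p h v)) =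
        sv (inverse (form h h' * ?m) * (form h h' * ?m)) (Z (tK k i) v)" by simp
    moreover have "form h h' * ?m \<noteq> 0" using h(3) gord_pos[of i] by simp
    then have "inverse (form h h' * ?m) * (form h h' * ?m) = 1" by (rule left_inverse)
    ultimately show ?thesis by (simp only: v.scale_one)
  qed
  then show ?thesis using p q h
    by (intro exI[of _ p] exI[of _ "k - p"] exI[of _ h] exI[of _ h'] exI[of _ "inverse (form h h' * ?m)"]) auto
qed

abbreviation wt_roots where "wt_roots \<equiv> insert zero_fun (en_roots T)"

lemma wt_roots_dual: "\<alpha> \<in> wt_roots \<Longrightarrow> \<alpha> \<in> cartan_dual T"
  using en_roots_dual dual_zero by auto

lemma X_in_of_RS:
  assumes U: "v.subspace U" and v: "v \<in> Vc"
    and RS: "\<And>\<alpha> x. \<alpha> \<in> wt_roots \<Longrightarrow> x \<in> RS k \<alpha> \<Longrightarrow> X k x v \<in> U" and x: "x \<in> G k"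
  shows "X k x v \<in> U"
proof -
  have "x \<in> g.span (\<Union>\<alpha>\<in>wt_roots. RS k \<alpha>)" using x grade_diag by blast
  then have "x \<in> G k \<and> X k x v \<in> U"
  proof (induction x rule: g.span_induct_alt)
    case base
    show ?case using X_zero[OF v] U g.subspace_0[OF subspace_grade] by (simp add: v.subspace_0)
  next
    case (step c x y)
    then obtain \<alpha> where \<alpha>: "\<alpha> \<in> wt_roots" "x \<in> RS k \<alpha>" by blast
    then have xg: "x \<in> G k" using RS_grade by blast
    have "sg c x \<in> G k" using xg subspace_grade by (simp add: g.subspace_scale)
    then show ?case using step RS[OF \<alpha>] X_add X_scale[OF xg v] v U subspace_grade[of k]
      by (simp add: g.subspace_add v.subspace_add v.subspace_scale)
  qed
  then show ?thesis ..
qed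

text \<open>Each t^k K_i acts as a multiple of a commutator of two operators \<open>X\<close>, so
  stability under all \<open>X\<close> brings stability under the centre with it.\<close>

lemma Z_in_of_X:
  assumes U: "v.subspace U" "U \<subseteq> Vc" and X: "\<And>k x v. x \<in> G k \<Longrightarrow> v \<in> U \<Longrightarrow> X k x v \<in> U"
    and z: "z \<in> center_space T" and v: "v \<in> U"
  shows "Z z v \<in> U"
proof -
  have vV: "v \<in> Vc" using v U by blast
  have "z \<in> center_space T \<and> Z z v \<in> U" using z[unfolded center_space_def]
  proof (induction z rule: cen.span_induct_alt)
    case base
    show ?case using Z_zero[OF vV] U by (simp add: v.subspace_0)
  next
    case (step c x y)
    then obtain k i where k: "k \<in> Gam T" "x = tK k i" by blast
    obtain p q h h' c' where pq: "p \<in> Gam T" "q \<in> Gam T" "h \<in> H" "h' \<in> H"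
      "\<And>v. v \<in> Vc \<Longrightarrow> Z (tK k i) v = sv c' (X p h (X q h' v) - X q h' (X p h v))"
      using center_commutator[OF k(1), of i] by blast
    have "h \<in> G p" "h' \<in> G q" using H_grade[OF pq(3)] H_grade[OF pq(4)] grade_Gam[OF pq(1)] grade_Gam[OF pq(2)] by auto
    then have "Z x v \<in> U" using pq(5)[OF vV] k X v U(1) by (simp add: v.subspace_scale v.subspace_diff)
    moreover have "x \<in> center_space T" using k tK_center_space by simp
    moreover have "center_scale c x \<in> center_space T"
      using calculation(2) by (simp add: center_space_def cen.span_scale)
    ultimately show ?case using step Z_add Z_scale vV U(1)
      by (simp add: v.subspace_add v.subspace_scale) (simp add: center_space_def cen.span_add)
  qed
  then show ?thesis ..
qed

lemma tilde_submodule: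
  assumes U: "v.subspace U" "U \<subseteq> Vc" and X: "\<And>k x v. x \<in> G k \<Longrightarrow> v \<in> U \<Longrightarrow> X k x v \<in> U"
    and D: "\<And>d v. v \<in> U \<Longrightarrow> D d v \<in> U"
  shows "submodule (tilde_alg T) V U"
  unfolding submodule_def
proof (intro conjI ballI)
  fix a v assume a: "a \<in> lcarrier (tilde_alg T)" and v: "v \<in> U"
  obtain x z d where xzd: "a = (x, z, d)" by (cases a)
  then have xz: "x \<in> LT T" "z \<in> center_space T" using a tilde_carrier by auto
  have vV: "v \<in> Vc" using U v by blast
  show "mact V a v \<in> U"
    unfolding xzd act_decompose[OF xz vV]
    using X[OF LT_lookup[OF xz(1)] v] Z_in_of_X[OF U X xz(2) v] D[OF v] U(1)
    by (intro v.subspace_add v.subspace_sum) auto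
qed (use U in auto)

lemma irreducible_X:
  assumes U: "v.subspace U" "U \<subseteq> Vc" and X: "\<And>k x v. x \<in> G k \<Longrightarrow> v \<in> U \<Longrightarrow> X k x v \<in> U"
    and D: "\<And>d v. v \<in> U \<Longrightarrow> D d v \<in> U" and nz: "u \<in> U" "u \<noteq> 0"
  shows "U = Vc"
proof -
  have "U = {0} \<or> U = Vc"
    using V_irr tilde_submodule[OF U X D] unfolding irreducible_module_def by blast
  then show ?thesis using nz by auto
qed

text \<open>The form in which irreducibility is mostly applied: properties of all of V are obtained
  by exhibiting a set of vectors that root vectors and derivations do not lead out of, up to linear
  combinations.\<close>

lemma irreducible_span:
  assumes B: "B \<subseteq> Vc" and RS: "\<And>k \<alpha> x v. \<alpha> \<in> wt_roots \<Longrightarrow> x \<in> RS k \<alpha> \<Longrightarrow> v \<in> B \<Longrightarrow> X k x v \<in> v.span B"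
    and D: "\<And>d v. v \<in> B \<Longrightarrow> D d v \<in> v.span B" and nz: "u \<in> B" "u \<noteq> 0"
  shows "v.span B = Vc"
proof (rule irreducible_X)
  show "v.span B \<subseteq> Vc" using B subspace_V by (simp add: v.span_minimal)
  fix v assume v: "v \<in> v.span B"
  show "D d v \<in> v.span B" for d
    by (rule v.endo_on_span_closed[OF D_endo subspace_V B v.subspace_span D v])
  show "X k x v \<in> v.span B" if x: "x \<in> G k" for k x
  proof (rule v.endo_on_span_closed[OF X_endo[OF x] subspace_V B v.subspace_span _ v])
    fix w assume w: "w \<in> B"
    then have wV: "w \<in> Vc" using B by blast
    show "X k x w \<in> v.span B" by (rule X_in_of_RS[OF v.subspace_span wV RS x]) (use w in auto)
  qed
qed (use nz v.span_base in auto)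

subsection \<open>Decomposition into weight vectors\<close>

abbreviation wts :: "('g \<Rightarrow> complex) \<times> (complex^'n) \<Rightarrow> 'v set" where "wts i \<equiv> wtsp (fst i) (snd i)"
abbreviation allwts :: "(('g \<Rightarrow> complex) \<times> (complex^'n)) set" where "allwts \<equiv> cartan_dual T \<times> UNIV"

lemma V_span_wts: "Vc = v.span (\<Union>i\<in>allwts. wts i)"
proof -
  have "(\<Union>i\<in>allwts. wts i) = (\<Union>\<alpha>\<in>cartan_dual T. \<Union>b. wtsp \<alpha> b)" by auto blast
  then show ?thesis using V_span by simp
qed

lemma wts_extract:
  assumes U: "v.subspace U" and H: "\<And>h w. h \<in> H \<Longrightarrow> w \<in> U \<Longrightarrow> X 0 h w \<in> U"
    and D: "\<And>d w. w \<in> U \<Longrightarrow> D d w \<in> U"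
    and F: "finite F" "F \<subseteq> allwts" and u: "\<And>i. i \<in> F \<Longrightarrow> u i \<in> wts i"
    and sum: "(\<Sum>i\<in>F. u i) \<in> U" and i: "i \<in> F"
  shows "u i \<in> U"
proof -
  \<comment> \<open>The sum type merges the operators of H with the derivations into one family, so
    that \<open>weight_extract\<close> separates both kinds of weights at once.\<close>
  define op where "op = case_sum (X 0) D"
  define ev where "ev i = case_sum (fst i) (\<lambda>d. pairing d (snd i))" for i :: "('g \<Rightarrow> complex) \<times> (complex^'n)"
  show ?thesis
  proof (rule v.weight_extract[where M = Vc and H = "Inl ` H \<union> range Inr" and T = op and \<mu> = ev and F = F and v = u])
    show "linear_on sv Vc sv (op h)" if "h \<in> Inl ` H \<union> range Inr" for h
      using that X_endo[OF H_grade] D_endo by (auto simp: op_def v.endo_on_def)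
    show "op h w \<in> U" if "h \<in> Inl ` H \<union> range Inr" "w \<in> U" for h w
      using that H D by (auto simp: op_def)
    show "u j \<in> Vc" if "j \<in> F" for j using u[OF that] wtsp_V by blast
    show "op h (u j) = sv (ev j h) (u j)" if "j \<in> F" "h \<in> Inl ` H \<union> range Inr" for j h
      using that u[OF that(1)] wtsp_H wtsp_D by (auto simp: op_def ev_def)
    show "\<exists>h\<in>Inl ` H \<union> range Inr. ev j h \<noteq> ev l h" if jl: "j \<in> F" "l \<in> F" "j \<noteq> l" for j l
    proof (cases "snd j = snd l")
      case True
      then have "fst j \<noteq> fst l" using jl by (simp add: prod_eq_iff)
      then obtain h where h: "fst j h \<noteq> fst l h" by blast
      then have "h \<in> H" using F(2) jl dual_zero_outside[of "fst j" sg H h] dual_zero_outside[of "fst l" sg H h] by force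
      then show ?thesis using h by (intro bexI[of _ "Inl h"]) (auto simp: ev_def)
    next
      case False
      then obtain d where "pairing d (snd j) \<noteq> pairing d (snd l)" using pairing_eq_iff by blast
      then show ?thesis by (intro bexI[of _ "Inr d"]) (auto simp: ev_def)
    qed
  qed (use subspace_V U F sum i in auto)
qed

lemma wts_decompose:
  assumes v: "v \<in> v.span (\<Union>i\<in>I. wts i)"
  obtains F u where "finite F" "F \<subseteq> I" "\<forall>i\<in>F. u i \<in> wts i" "v = (\<Sum>i\<in>F. u i)"
proof -
  have "\<exists>F u. finite F \<and> F \<subseteq> I \<and> (\<forall>i\<in>F. u i \<in> wts i) \<and> v = (\<Sum>i\<in>F. u i)"
    using v by (intro v.span_UN_subspaces subspace_wtsp)
  then show ?thesis using that by (elim exE conjE) blast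
qed

lemma wts_component:
  assumes F: "finite F" "F \<subseteq> allwts" and u: "\<And>i. i \<in> F \<Longrightarrow> u i \<in> wts i"
    and j: "j \<in> allwts" and v: "(\<Sum>i\<in>F. u i) \<in> wts j"
  shows "(\<Sum>i\<in>F. u i) = (if j \<in> F then u j else 0)"
proof -
  let ?v = "\<Sum>i\<in>F. u i"
  \<comment> \<open>Subtracting the whole sum at index j gives a family of weight vectors with sum
    0, whose entry at j must vanish; the inner case distinction allows j outside F.\<close>
  define w where "w i = (if i = j then (if j \<in> F then u j else 0) - ?v else u i)" for i
  have "(\<Sum>i\<in>insert j F. w i) = w j + (\<Sum>i\<in>F - {j}. w i)"
    using F(1) by (simp add: sum.insert_remove)
  also have "(\<Sum>i\<in>F - {j}. w i) = (\<Sum>i\<in>F - {j}. u i)" by (rule sum.cong) (auto simp: w_def)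
  also have "\<dots> = ?v - (if j \<in> F then u j else 0)" using F(1) by (simp add: sum_diff1)
  finally have s: "(\<Sum>i\<in>insert j F. w i) \<in> {0}" by (simp add: w_def)
  have "w j \<in> {0}"
  proof (rule wts_extract[OF v.subspace_single_0 _ _ _ _ _ s])
    show "w i \<in> wts i" if "i \<in> insert j F" for i
      using that u[of i] u[of j] v subspace_wtsp by (auto simp: w_def v.subspace_diff v.subspace_0 v.subspace_neg)
    show "X 0 h w \<in> {0}" if "h \<in> H" "w \<in> {0}" for h w
      using that v.endo_on_0[OF X_endo[OF H_grade] subspace_V] by simp
    show "D d w \<in> {0}" if "w \<in> {0}" for d w
      using that v.endo_on_0[OF D_endo subspace_V] by simp
  qed (use F j in auto)
  then show ?thesis by (simp add: w_def)
qed

lemma wts_support: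
  assumes span: "Vc = v.span (\<Union>i\<in>I. wts i)" and I: "I \<subseteq> allwts"
    and v: "v \<in> wts j" "v \<noteq> 0" and j: "j \<in> allwts"
  shows "j \<in> I"
proof -
  have "v \<in> v.span (\<Union>i\<in>I. wts i)" using v wtsp_V span by blast
  then obtain F u where "finite F" "F \<subseteq> I" "\<forall>i\<in>F. u i \<in> wts i" "v = (\<Sum>i\<in>F. u i)"
    by (rule wts_decompose)
  then show ?thesis using wts_component[of F u j] v j I by (auto split: if_splits)
qed

subsection \<open>The highest weight space\<close>

abbreviation HS where "HS \<equiv> highest_space T V"

lemma HS_V: "v \<in> HS \<Longrightarrow> v \<in> Vc"
  by (simp add: highest_space_def)

lemma HS_iff: "v \<in> HS \<longleftrightarrow> v \<in> Vc \<and> (\<forall>k \<alpha> x. \<alpha> \<in> en_pos_roots T \<longrightarrow> x \<in> RS k \<alpha> \<longrightarrow> X k x v = 0)"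
proof
  interpret pm: vector_space "pm_scale sg :: complex \<Rightarrow> ('g, 'n) mloop \<Rightarrow> _"
    by (rule vector_space_pm_scale[OF g.vector_space_axioms])
  assume v: "v \<in> HS"
  have "Poly_Mapping.single k x \<in> LT_plus T" if "\<alpha> \<in> en_pos_roots T" "x \<in> RS k \<alpha>" for k \<alpha> x
    using that unfolding LT_plus_def by (intro pm.span_base) blast
  then show "v \<in> Vc \<and> (\<forall>k \<alpha> x. \<alpha> \<in> en_pos_roots T \<longrightarrow> x \<in> RS k \<alpha> \<longrightarrow> X k x v = 0)"
    using v by (auto simp: highest_space_def X_def)
next
  interpret pm: vector_space "pm_scale sg :: complex \<Rightarrow> ('g, 'n) mloop \<Rightarrow> _"
    by (rule vector_space_pm_scale[OF g.vector_space_axioms])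
  assume v: "v \<in> Vc \<and> (\<forall>k \<alpha> x. \<alpha> \<in> en_pos_roots T \<longrightarrow> x \<in> RS k \<alpha> \<longrightarrow> X k x v = 0)"
  have "x \<in> LT T \<and> mact V (x, 0, 0) v = 0" if "x \<in> LT_plus T" for x
    using that unfolding LT_plus_def
  proof (induction x rule: pm.span_induct_alt)
    case base
    show ?case using Z_zero[of v] v by (simp add: Z_def)
  next
    case (step c x y)
    then obtain k \<alpha> x' where x: "x = Poly_Mapping.single k x'" "\<alpha> \<in> en_pos_roots T" "x' \<in> RS k \<alpha>" by blast
    have cx: "pm_scale sg c x = Poly_Mapping.single k (sg c x')" using x by (simp add: pm_weight_single[OF g.vector_space_axioms])
    have cg: "sg c x' \<in> G k" using RS_grade[OF x(3)] subspace_grade by (simp add: g.subspace_scale)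
    have "X k (sg c x') v = 0" using X_scale[OF RS_grade[OF x(3)], of v c] v x by simp
    then show ?case
      using step cx LT_single[OF cg] LT_add act_add[of "(Poly_Mapping.single k (sg c x'), 0, 0)" "(y, 0, 0)" v] v
      by (simp add: tilde_carrier X_def)
  qed
  then show "v \<in> HS" using v by (simp add: highest_space_def)
qed

lemma en_pos_en: "\<alpha> \<in> en_pos_roots T \<Longrightarrow> \<alpha> \<in> en_roots T"
  by (simp add: en_pos_roots_def)

lemma neg_en: "\<alpha> \<in> neg_roots \<Longrightarrow> \<alpha> \<in> en_roots T"
  by (simp add: neg_roots_def)

lemma subspace_HS: "v.subspace HS"
proof (rule v.subspaceI)
  show "0 \<in> HS"
    unfolding HS_iff using v.subspace_0[OF subspace_V] v.endo_on_0[OF X_endo subspace_V] RS_grade by blast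
  fix v w c assume vw: "v \<in> HS" "w \<in> HS"
  have "X k x (v + w) = 0" if "\<alpha> \<in> en_pos_roots T" "x \<in> RS k \<alpha>" for k \<alpha> x
    using vw that v.endo_on_add[OF X_endo[OF RS_grade[OF that(2)]], of v w] by (auto simp: HS_iff)
  then show "v + w \<in> HS" using vw v.subspace_add[OF subspace_V] HS_iff by blast
  have "X k x (sv c v) = 0" if "\<alpha> \<in> en_pos_roots T" "x \<in> RS k \<alpha>" for k \<alpha> x
    using vw that v.endo_on_scale[OF X_endo[OF RS_grade[OF that(2)]], of v c] by (auto simp: HS_iff)
  then show "sv c v \<in> HS" using vw v.subspace_scale[OF subspace_V] HS_iff by blast
qed

lemma HS_D: "v \<in> HS \<Longrightarrow> D d v \<in> HS"
proof -
  assume v: "v \<in> HS"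
  have "X k x (D d v) = 0" if "\<alpha> \<in> en_pos_roots T" "x \<in> RS k \<alpha>" for k \<alpha> x
    using v that DX[OF RS_grade[OF that(2)] HS_V[OF v], of d] v.endo_on_0[OF D_endo subspace_V] by (auto simp: HS_iff)
  then show "D d v \<in> HS" using D_mem[OF HS_V[OF v]] HS_iff by blast
qed

lemma HS_H: "v \<in> HS \<Longrightarrow> h \<in> H \<Longrightarrow> X 0 h v = sv (lam h) v"
  using lam_act by (simp add: X_def)

text \<open>Let y have positive weight \<alpha>. The form (y|x) vanishes, so no central term arises
  when y is moved past x, and [y,x] has weight \<alpha> again; both remaining terms vanish on
  v.\<close>

lemma HS_X_zero:
  assumes x: "x \<in> RS k zero_fun" and v: "v \<in> HS"
  shows "X k x v \<in> HS"
  unfolding HS_iff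
proof (intro conjI allI impI)
  note xg = RS_grade[OF x] and vV = HS_V[OF v]
  show "X k x v \<in> Vc" using X_mem xg vV .
  fix l \<alpha> y assume \<alpha>: "\<alpha> \<in> en_pos_roots T" and y: "y \<in> RS l \<alpha>"
  obtain h where h: "h \<in> H" "\<alpha> h \<noteq> 0"
    using dual_nonzero[OF en_roots_dual en_roots_nonzero] en_pos_en[OF \<alpha>] by blast
  have "form y x = 0" using form_RS[OF y x _ h(1)] h(2) by auto
  then have "X l y (X k x v) = X k x (X l y v) + X (l + k) (br y x) v"
    using XX_no_center[OF RS_grade[OF y] xg vV] by simp
  moreover have "br y x \<in> RS (l + k) \<alpha>" using RS_br[OF y x] by simp
  ultimately show "X l y (X k x v) = 0"
    using v \<alpha> y v.endo_on_0[OF X_endo[OF xg] subspace_V] by (auto simp: HS_iff)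
qed

lemma HS_Z:
  assumes k: "k \<in> Gam T" and v: "v \<in> HS"
  shows "Z (tK k i) v \<in> HS"
  unfolding HS_iff
proof (intro conjI allI impI)
  note z = tK_center_space[OF k, of i] and vV = HS_V[OF v]
  show "Z (tK k i) v \<in> Vc" using Z_mem z vV .
  fix l \<alpha> y assume \<alpha>: "\<alpha> \<in> en_pos_roots T" and y: "y \<in> RS l \<alpha>"
  then show "X l y (Z (tK k i) v) = 0"
    using XZ[OF RS_grade[OF y] z vV] v v.endo_on_0[OF Z_endo[OF z] subspace_V] by (auto simp: HS_iff)
qed

text \<open>The weight components of a vector of V_+ stay in V_+, where the only possible H-weight
  is \<open>lam\<close>.\<close>

lemma HS_span:
  assumes v: "v \<in> HS"
  shows "v \<in> v.span (\<Union>b. HS \<inter> wtsp lam b)"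
proof -
  have "v \<in> v.span (\<Union>i\<in>allwts. wts i)" using HS_V[OF v] V_span_wts by simp
  then obtain F u where F: "finite F" "F \<subseteq> allwts" "\<forall>i\<in>F. u i \<in> wts i" "v = (\<Sum>i\<in>F. u i)"
    by (rule wts_decompose)
  note F = F(1,2) F(3)[rule_format] F(4)
  have uH: "u i \<in> HS" if "i \<in> F" for i
    by (rule wts_extract[OF subspace_HS _ HS_D F(1,2,3) _ that])
      (use HS_H subspace_HS v F(4) in \<open>auto simp: v.subspace_scale\<close>)
  have "u i \<in> v.span (\<Union>b. HS \<inter> wtsp lam b)" if i: "i \<in> F" for i
  proof (cases "u i = 0")
    case False
    have "fst i = lam"
    proof
      fix h
      show "fst i h = lam h"
      proof (cases "h \<in> H")
        case True
        then have "sv (fst i h) (u i) = sv (lam h) (u i)" using HS_H[OF uH[OF i] True] wtsp_H[OF F(3)[OF i] True] by simp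
        then show ?thesis using False by simp
      next
        case False
        then show ?thesis
          using F(2) i dual_zero_outside[of "fst i" sg H h] dual_zero_outside[OF lam_dual] by force
      qed
    qed
    then have "u i \<in> (\<Union>b. HS \<inter> wtsp lam b)" using uH[OF i] F(3)[OF i] by auto
    then show ?thesis by (rule v.span_base)
  qed (simp add: v.span_zero)
  then show ?thesis unfolding F(4) by (rule v.span_sum)
qed

lemma highest_homogeneous: "\<exists>b u. u \<in> HS \<and> u \<noteq> 0 \<and> u \<in> wtsp lam b"
proof (rule ccontr)
  assume no: "\<nexists>b u. u \<in> HS \<and> u \<noteq> 0 \<and> u \<in> wtsp lam b"
  obtain v where v: "v \<in> HS" "v \<noteq> 0" using highest_nonzero by blast
  have "(\<Union>b. HS \<inter> wtsp lam b) \<subseteq> {0}" using no by blast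
  then have "v.span (\<Union>b. HS \<inter> wtsp lam b) \<subseteq> {0}" by (rule v.span_minimal) simp
  then show False using HS_span[OF v(1)] v(2) by blast
qed

text \<open>The degree of one homogeneous highest weight vector, fixed once and for all. The degrees
  of V turn out to lie in a0 + Z^n, and a0 is the parameter of the loop module in which V is finally
  found.\<close>

definition a0 :: "complex^'n" where "a0 = (SOME b. \<exists>u. u \<in> HS \<and> u \<noteq> 0 \<and> u \<in> wtsp lam b)"

lemma highest_vector: "\<exists>u. u \<in> HS \<and> u \<noteq> 0 \<and> u \<in> wtsp lam a0"
  unfolding a0_def by (rule someI_ex[OF highest_homogeneous])

subsection \<open>Words in negative root vectors\<close>

text \<open>Words start from all homogeneous vectors of V_+ with degree in a0 + Z^n instead of a
  single generator; this makes the starting set stable under operators of weight 0 and under the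
  centre.\<close>

inductive_set Wd :: "'v set" where
  base: "u \<in> HS \<Longrightarrow> u \<in> wtsp lam (a0 + ivec r) \<Longrightarrow> u \<in> Wd"
| step: "w \<in> Wd \<Longrightarrow> \<alpha> \<in> neg_roots \<Longrightarrow> y \<in> RS k \<alpha> \<Longrightarrow> X k y w \<in> Wd"

definition low_weights :: "(('g \<Rightarrow> complex) \<times> (complex^'n)) set" where
  "low_weights = {(\<lambda>h. lam h - \<gamma> h, a0 + ivec r) | \<gamma> r. \<gamma> \<in> cartan_dual T \<and> nonneg_combination (gbase T) \<gamma>}"

lemma low_weights_allwts: "low_weights \<subseteq> allwts"
  using dual_plus[OF lam_dual dual_uminus] by (auto simp: low_weights_def)

lemma Wd_weight: "w \<in> Wd \<Longrightarrow> \<exists>i\<in>low_weights. w \<in> wts i"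
proof (induction rule: Wd.induct)
  case (base u r)
  have "nonneg_combination (gbase T) zero_fun" unfolding nonneg_combination_def by (intro exI[of _ "\<lambda>_. 0"]) simp
  then have "(\<lambda>h. lam h - zero_fun h, a0 + ivec r) \<in> low_weights"
    unfolding low_weights_def by (intro CollectI exI[of _ zero_fun] exI[of _ r]) (simp add: dual_zero)
  then show ?case using base by (intro bexI[of _ "(\<lambda>h. lam h - zero_fun h, a0 + ivec r)"]) auto
next
  case (step w \<alpha> y k)
  then obtain \<gamma> r where \<gamma>: "\<gamma> \<in> cartan_dual T" "nonneg_combination (gbase T) \<gamma>"
    "w \<in> wtsp (\<lambda>h. lam h - \<gamma> h) (a0 + ivec r)" by (auto simp: low_weights_def)
  let ?\<gamma> = "\<lambda>h. \<gamma> h + - \<alpha> h"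
  have "X k y w \<in> wtsp (\<lambda>h. (lam h - \<gamma> h) + \<alpha> h) (a0 + ivec r + ivec k)" using X_wtsp[OF step.hyps(3) \<gamma>(3)] .
  moreover have "(\<lambda>h. (lam h - \<gamma> h) + \<alpha> h) = (\<lambda>h. lam h - ?\<gamma> h)" by auto
  moreover have "a0 + ivec r + ivec k = a0 + ivec (r + k)" by (simp add: ivec_add add.assoc)
  ultimately have "X k y w \<in> wtsp (\<lambda>h. lam h - ?\<gamma> h) (a0 + ivec (r + k))" by simp
  moreover have "?\<gamma> \<in> cartan_dual T" using dual_plus[OF \<gamma>(1) dual_uminus[OF en_roots_dual[OF neg_en[OF step.hyps(2)]]]] .
  moreover have "nonneg_combination (gbase T) ?\<gamma>"
    by (rule nonneg_combination_add[OF \<gamma>(2)]) (use step.hyps(2) in \<open>simp add: neg_roots_def\<close>)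
  ultimately have "X k y w \<in> wts (\<lambda>h. lam h - ?\<gamma> h, a0 + ivec (r + k))"
    "?\<gamma> \<in> cartan_dual T \<and> nonneg_combination (gbase T) ?\<gamma>" by simp_all
  then show ?case
    unfolding low_weights_def
    by (intro bexI[of _ "(\<lambda>h. lam h - ?\<gamma> h, a0 + ivec (r + k))"] CollectI exI[of _ ?\<gamma>] exI[of _ "r + k"]) auto
qed

lemma Wd_V: "Wd \<subseteq> Vc"
  using Wd_weight wtsp_V by blast

text \<open>The centre may still act non-trivially at this stage. Central terms created by commuting
  operators must therefore remain in the span of the words.\<close>

lemma Wd_Z: "w \<in> Wd \<Longrightarrow> k \<in> Gam T \<Longrightarrow> Z (tK k i) w \<in> Wd"
proof (induction rule: Wd.induct)
  case (base u r)
  then have "Z (tK k i) u \<in> wtsp lam (a0 + ivec (r + k))" using Z_wtsp[OF base(3,2)] by (simp add: ivec_add add.assoc)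
  then show ?case using HS_Z[OF base(3,1)] by (rule Wd.base[rotated])
next
  case (step w \<alpha> y l)
  have "Z (tK k i) (X l y w) = X l y (Z (tK k i) w)"
    using XZ[OF RS_grade[OF step.hyps(3)] tK_center_space[OF step.prems]] step.hyps(1) Wd_V by auto
  then show ?case using Wd.step[OF step.IH[OF step.prems] step.hyps(2,3)] by simp
qed

lemma Wd_cocycle:
  assumes w: "w \<in> Wd" and xy: "x \<in> G k" "y \<in> G l"
  shows "Z (center_scale (form x y) (\<Sum>i\<in>UNIV. center_scale (of_int (k $ i)) (tK (k + l) i))) w \<in> v.span Wd"
proof (cases "form x y = 0")
  case True
  then show ?thesis using Z_zero w Wd_V by (auto simp: v.span_zero)
next
  case False
  then have kl: "k + l \<in> Gam T" using form_grade xy by blast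
  have wV: "w \<in> Vc" using w Wd_V by blast
  let ?s = "\<lambda>F. \<Sum>i\<in>F. center_scale (of_int (k $ i)) (tK (k + l) i)"
  have "?s F \<in> center_space T \<and> Z (?s F) w \<in> v.span Wd" for F
  proof (induction F rule: infinite_finite_induct)
    case (insert i F)
    have c: "center_scale (of_int (k $ i)) (tK (k + l) i) \<in> center_space T"
      using tK_center_space[OF kl] by (simp add: center_space_def cen.span_scale)
    have "Z (center_scale (of_int (k $ i)) (tK (k + l) i)) w \<in> v.span Wd"
      using Z_scale[OF tK_center_space[OF kl] wV] Wd_Z[OF w kl] by (simp add: v.span_scale v.span_base)
    then show ?case using insert c Z_add[OF c _ wV] by (simp add: v.span_add) (simp add: center_space_def cen.span_add)
  qed (use Z_zero[OF wV] in \<open>simp_all add: v.span_zero\<close>)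
  from this[of UNIV] show ?thesis using Z_scale[OF _ wV] by (simp add: v.span_scale)
qed

lemma neg_span_Wd:
  assumes "\<alpha> \<in> neg_roots" "y \<in> RS k \<alpha>" "w \<in> v.span Wd"
  shows "X k y w \<in> v.span Wd"
  by (rule v.endo_on_span_closed[OF X_endo[OF RS_grade[OF assms(2)]] subspace_V Wd_V v.subspace_span _ assms(3)])
    (use Wd.step[OF _ assms(1,2)] in \<open>auto intro: v.span_base\<close>)

text \<open>Takes the place of the PBW theorem. The operator is moved to the right, x y w = y x w +
  [x,y] w + central term; the induction covers arbitrary degrees and elements, so it applies to x
  and to [x,y] alike.\<close>

lemma X_Wd: "w \<in> Wd \<Longrightarrow> x \<in> G k \<Longrightarrow> X k x w \<in> v.span Wd"
proof (induction arbitrary: k x rule: Wd.induct)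
  case (base u r)
  show ?case
  proof (rule X_in_of_RS[OF v.subspace_span HS_V[OF base(1)] _ base(3)])
    fix \<alpha> x assume \<alpha>: "\<alpha> \<in> wt_roots" and x: "x \<in> RS k \<alpha>"
    then consider "\<alpha> = zero_fun" | "\<alpha> \<in> en_pos_roots T" | "\<alpha> \<in> neg_roots" using en_roots_cases by blast
    then show "X k x u \<in> v.span Wd"
    proof cases
      case 1
      have "X k x u \<in> wtsp lam (a0 + ivec (r + k))" using X_wtsp[OF x base(2)] 1 by (simp add: ivec_add add.assoc)
      moreover have "X k x u \<in> HS" using HS_X_zero x 1 base(1) by blast
      ultimately have "X k x u \<in> Wd" by (rule Wd.base[rotated])
      then show ?thesis by (rule v.span_base)
    next
      case 2
      then have "X k x u = 0" using base(1) x HS_iff by blast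
      then show ?thesis by (simp add: v.span_zero)
    next
      case 3
      then show ?thesis using Wd.step[OF Wd.base[OF base(1,2)] 3 x] by (intro v.span_base)
    qed
  qed
next
  case (step w \<alpha> y l)
  note yg = RS_grade[OF step.hyps(3)]
  have wV: "w \<in> Vc" using step.hyps(1) Wd_V by blast
  have "X l y (X k x w) \<in> v.span Wd" using neg_span_Wd[OF step.hyps(2,3) step.IH[OF step.prems]] .
  moreover have "X (k + l) (br x y) w \<in> v.span Wd" using step.IH[OF br_grade[OF step.prems yg]] .
  ultimately show ?case
    unfolding XX[OF step.prems yg wV] using Wd_cocycle[OF step.hyps(1) step.prems yg] by (intro v.span_add)
qed

lemma span_Wd: "v.span Wd = Vc"
proof -
  obtain u where u: "u \<in> HS" "u \<noteq> 0" "u \<in> wtsp lam a0" using highest_vector by blast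
  then have uW: "u \<in> Wd" using Wd.base[of u 0] by simp
  show ?thesis
  proof (rule irreducible_span[OF Wd_V _ _ uW u(2)])
    fix d w assume w: "w \<in> Wd"
    then obtain i where "w \<in> wts i" using Wd_weight by blast
    then show "D d w \<in> v.span Wd" using wtsp_D w by (simp add: v.span_scale v.span_base)
  qed (use X_Wd RS_grade in blast)
qed

lemma V_span_low: "Vc = v.span (\<Union>i\<in>low_weights. wts i)"
proof
  have "Wd \<subseteq> (\<Union>i\<in>low_weights. wts i)" using Wd_weight by blast
  then show "Vc \<subseteq> v.span (\<Union>i\<in>low_weights. wts i)" using span_Wd v.span_mono by blast
  show "v.span (\<Union>i\<in>low_weights. wts i) \<subseteq> Vc" using subspace_V wtsp_V by (intro v.span_minimal) blast+
qed

subsection \<open>Heights are bounded\<close>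

abbreviation rh where "rh \<equiv> X 0 rho"

lemma rho_grade: "rho \<in> G 0"
  using rho_H H_grade by blast

text \<open>V is the sum of the eigenspaces of \<open>rh\<close> to the values lam rho - n, and an
  eigenvector for any other value would be independent of them.\<close>

lemma rho_eigenvalue:
  assumes v: "v \<in> Vc" "v \<noteq> 0" "rh v = sv c v"
  shows "\<exists>n::nat. c = lam rho - of_nat n"
proof (rule ccontr)
  assume no: "\<nexists>n::nat. c = lam rho - of_nat n"
  let ?E = "\<lambda>n::nat. {v \<in> Vc. rh v = sv (lam rho - of_nat n) v}"
  have sub: "v.subspace (?E n)" for n
    using v.subspace_common_eigenspace[of Vc "{()}" "\<lambda>_. rh" "\<lambda>_. lam rho - of_nat n"] subspace_V X_endo[OF rho_grade] by simp
  have "(\<Union>i\<in>low_weights. wts i) \<subseteq> (\<Union>n\<in>UNIV. ?E n)"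
  proof clarsimp
    fix \<alpha> b w assume "(\<alpha>, b) \<in> low_weights" and w: "w \<in> wtsp \<alpha> b"
    then obtain \<gamma> where \<gamma>: "nonneg_combination (gbase T) \<gamma>" "\<alpha> = (\<lambda>h. lam h - \<gamma> h)" by (auto simp: low_weights_def)
    obtain n :: nat where "\<gamma> rho = of_nat n" using nonneg_combination_rho[OF \<gamma>(1)] by blast
    then have "rh w = sv (lam rho - of_nat n) w" using wtsp_H[OF w rho_H] \<gamma>(2) by simp
    then show "w \<in> Vc \<and> (\<exists>n. rh w = sv (lam rho - complex_of_nat n) w)" using wtsp_V[OF w] by blast
  qed
  then have "v \<in> v.span (\<Union>n\<in>UNIV. ?E n)" using V_span_low v(1) v.span_mono by blast
  then have "\<exists>F u. finite F \<and> F \<subseteq> UNIV \<and> (\<forall>i\<in>F. u i \<in> ?E i) \<and> v = (\<Sum>i\<in>F. u i)"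
    using sub by (intro v.span_UN_subspaces)
  then obtain F u where F: "finite F" "\<forall>n\<in>F. u n \<in> ?E n" "v = (\<Sum>n\<in>F. u n)" by blast
  \<comment> \<open>The index \<open>None\<close> carries -v, so the family of eigenvectors sums to
    0.\<close>
  define w where "w = case_option (- v) u"
  define e where "e = case_option c (\<lambda>n. lam rho - of_nat n)"
  have "w None \<in> {0}"
  proof (rule v.weight_extract[where M = Vc and H = "{()}" and T = "\<lambda>_. rh" and \<mu> = "\<lambda>i _. e i" and F = "insert None (Some ` F)"])
    have "(\<Sum>i\<in>insert None (Some ` F). w i) = - v + (\<Sum>n\<in>F. u n)"
      using F(1) by (simp add: w_def sum.reindex)
    then show "(\<Sum>i\<in>insert None (Some ` F). w i) \<in> {0}" using F(3) by simp
    show "\<exists>h\<in>{()}. e i \<noteq> e j" if "i \<in> insert None (Some ` F)" "j \<in> insert None (Some ` F)" "i \<noteq> j" for i j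
      using that no by (auto simp: e_def)
    show "rh w \<in> {0}" if "w \<in> {0}" for w using that v.endo_on_0[OF X_endo[OF rho_grade] subspace_V] by simp
    show "rh (w i) = sv (e i) (w i)" if "i \<in> insert None (Some ` F)" for i
      using that F(2) v v.endo_on_scale[OF X_endo[OF rho_grade] v(1), of "-1"] by (auto simp: w_def e_def)
    show "w i \<in> Vc" if "i \<in> insert None (Some ` F)" for i
      using that F(2) v v.subspace_neg[OF subspace_V] by (auto simp: w_def)
  qed (use F(1) subspace_V X_endo[OF rho_grade] in \<open>auto simp: v.endo_on_def\<close>)
  then show False using v(2) by (simp add: w_def)
qed

text \<open>Local nilpotency does not pass to sums of operators. Finite-dimensional subspaces stable
  under many root vectors at once do serve for sums, and they will yield nilpotency of the principal
  lowering operator on each vector.\<close>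

definition locfin :: "'g set \<Rightarrow> bool" where
  "locfin A \<longleftrightarrow> (\<forall>v\<in>Vc. \<exists>F. fin_dim sv F \<and> F \<subseteq> Vc \<and> v \<in> F \<and> (\<forall>a\<in>A. \<forall>w\<in>F. X 0 a w \<in> F))"

lemma locfin_mono: "locfin A \<Longrightarrow> B \<subseteq> A \<Longrightarrow> locfin B"
  unfolding locfin_def by (meson subsetD)

lemma locfin_span:
  assumes A: "locfin A" "A \<subseteq> G 0"
  shows "locfin (g.span A)"
  unfolding locfin_def
proof
  fix v assume "v \<in> Vc"
  then obtain F where F: "fin_dim sv F" "F \<subseteq> Vc" "v \<in> F" "\<And>a w. a \<in> A \<Longrightarrow> w \<in> F \<Longrightarrow> X 0 a w \<in> F"
    using A(1) unfolding locfin_def by meson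
  have sF: "v.subspace F" using v.subspace_fin_dim[OF F(1)] .
  have "a \<in> G 0 \<and> X 0 a w \<in> F" if "a \<in> g.span A" and w: "w \<in> F" for a w
    using that(1)
  proof (induction a rule: g.span_induct_alt)
    case base
    have "w \<in> Vc" using w F(2) by blast
    then show ?case using X_zero sF g.subspace_0[OF subspace_grade] by (simp add: v.subspace_0)
  next
    case (step c x y)
    have "w \<in> Vc" "x \<in> G 0" using w F(2) step(1) A(2) by blast+
    moreover have "sg c x \<in> G 0" using calculation(2) subspace_grade by (simp add: g.subspace_scale)
    ultimately show ?case using step F(4)[OF step(1) w] sF subspace_grade[of 0] X_add X_scale
      by (simp add: g.subspace_add v.subspace_add v.subspace_scale)
  qed
  then show "\<exists>F. fin_dim sv F \<and> F \<subseteq> Vc \<and> v \<in> F \<and> (\<forall>a\<in>g.span A. \<forall>w\<in>F. X 0 a w \<in> F)" using F by blast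
qed

text \<open>The subspace spanned by all x^i F is finite-dimensional because x is nilpotent on a
  finite spanning set of F. It is stable under a in A since a x^(i+1) = x a x^i + [a,x] x^i and
  [a,x] is again in A.\<close>

lemma locfin_insert:
  assumes A: "locfin A" "A \<subseteq> G 0" and x: "x \<in> G 0" and ax: "\<And>a. a \<in> A \<Longrightarrow> br a x \<in> A"
    and nil: "\<And>v. v \<in> Vc \<Longrightarrow> \<exists>j. (X 0 x ^^ j) v = 0"
  shows "locfin (insert x A)"
  unfolding locfin_def
proof
  fix v assume v: "v \<in> Vc"
  then obtain F where F: "fin_dim sv F" "F \<subseteq> Vc" "v \<in> F" "\<And>a w. a \<in> A \<Longrightarrow> w \<in> F \<Longrightarrow> X 0 a w \<in> F"
    using A(1) unfolding locfin_def by meson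
  let ?f = "X 0 x"
  have f: "v.endo_on Vc ?f" using X_endo[OF x] .
  have fp: "v.endo_on Vc (?f ^^ j)" for j
  proof (induction j)
    case (Suc j)
    then show ?case using f by (intro v.endo_onI) (simp_all add: v.endo_on_mem v.endo_on_add v.endo_on_scale)
  qed (simp add: v.endo_onI)
  let ?S = "\<Union>i. (?f ^^ i) ` F"
  have SV: "?S \<subseteq> Vc" using v.endo_on_mem[OF fp] F(2) by blast
  obtain B where B: "finite B" "F = v.span B" using F(1) by (auto simp: fin_dim_def)
  have "\<forall>b\<in>B. \<exists>j. (?f ^^ j) b = 0" using nil F(2) B(2) v.span_base by blast
  then obtain j where j: "\<And>b. b \<in> B \<Longrightarrow> (?f ^^ j b) b = 0" by metis
  define N where "N = Max (insert 0 (j ` B))"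
  have zero: "(?f ^^ i) w = 0" if "i \<ge> N" "w \<in> F" for i w
  proof (rule v.endo_on_zero_on_span[OF fp subspace_V])
    show "B \<subseteq> Vc" using F(2) B(2) v.span_superset by blast
    fix b assume b: "b \<in> B"
    then have "j b \<le> N" using B(1) by (simp add: N_def)
    then have "i = (i - j b) + j b" using that by simp
    then have "(?f ^^ i) b = (?f ^^ (i - j b)) ((?f ^^ j b) b)" by (metis comp_apply funpow_add)
    then show "(?f ^^ i) b = 0" using j[OF b] v.endo_on_0[OF fp subspace_V] by simp
  qed (use that B in simp)
  have "v.span ?S \<subseteq> v.span (\<Union>i\<in>{..<N}. (?f ^^ i) ` F)"
  proof (rule v.span_minimal)
    show "?S \<subseteq> v.span (\<Union>i\<in>{..<N}. (?f ^^ i) ` F)"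
    proof clarify
      fix i w assume w: "w \<in> F"
      show "(?f ^^ i) w \<in> v.span (\<Union>i\<in>{..<N}. (?f ^^ i) ` F)"
      proof (cases "i < N")
        case True
        then show ?thesis using w by (intro v.span_base) blast
      qed (use zero w in \<open>simp add: v.span_zero\<close>)
    qed
  qed simp
  moreover have "fin_dim sv (v.span (\<Union>i\<in>{..<N}. (?f ^^ i) ` F))"
  proof (rule v.fin_dim_span_UN)
    fix i
    have "linear_on sv F sv (?f ^^ i)" using fp[of i] F(2) unfolding v.endo_on_def linear_on_def by blast
    then show "fin_dim sv ((?f ^^ i) ` F)" using v.fin_dim_image v.vector_space_axioms F(1) by blast
  qed simp
  ultimately have "fin_dim sv (v.span ?S)" using v.fin_dim_subspace by (meson v.subspace_span)
  moreover have "v.span ?S \<subseteq> Vc" using SV subspace_V by (simp add: v.span_minimal)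
  moreover have "v \<in> v.span ?S" using F(3) by (intro v.span_base UN_I[of 0]) auto
  moreover have fS: "?f w \<in> v.span ?S" if "w \<in> v.span ?S" for w
  proof (rule v.endo_on_span_closed[OF f subspace_V SV v.subspace_span _ that])
    fix u assume "u \<in> ?S"
    then obtain i w where "w \<in> F" "u = (?f ^^ i) w" by blast
    then have "?f u = (?f ^^ Suc i) w" by simp
    then show "?f u \<in> v.span ?S" using \<open>w \<in> F\<close> by (intro v.span_base) blast
  qed
  moreover have "X 0 a w \<in> v.span ?S" if a: "a \<in> A" and w: "w \<in> v.span ?S" for a w
  proof (rule v.endo_on_span_closed[OF _ subspace_V SV v.subspace_span _ w])
    show "v.endo_on Vc (X 0 a)" using X_endo a A(2) by blast
    \<comment> \<open>The induction on i treats all a in A together, because [a,x] takes the place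
      of a.\<close>
    have "X 0 a ((?f ^^ i) w) \<in> v.span ?S" if "w \<in> F" "a \<in> A" for i a w
      using that(2)
    proof (induction i arbitrary: a)
      case 0
      then show ?case using F(4)[OF 0 that(1)] by (intro v.span_base UN_I[of 0]) auto
    next
      case (Suc i)
      have wV: "(?f ^^ i) w \<in> Vc" using v.endo_on_mem[OF fp] that(1) F(2) by blast
      have ag: "a \<in> G 0" using Suc.prems A(2) by blast
      have "X 0 a (?f ((?f ^^ i) w)) = ?f (X 0 a ((?f ^^ i) w)) + X 0 (br a x) ((?f ^^ i) w)"
        using XX_no_center[OF ag x wV] by simp
      then show ?case using fS[OF Suc.IH[OF Suc.prems]] Suc.IH[OF ax[OF Suc.prems]] by (simp add: v.span_add)
    qed
    then show "X 0 a u \<in> v.span ?S" if "u \<in> ?S" for u using that a by blast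
  qed
  ultimately show "\<exists>F. fin_dim sv F \<and> F \<subseteq> Vc \<and> v \<in> F \<and> (\<forall>a\<in>insert x A. \<forall>w\<in>F. X 0 a w \<in> F)" by blast
qed

text \<open>A filtration of the lower triangular part of \<open>G 0\<close> by height. It consists
  of root vectors and not of their sums, since local nilpotency is known for root vectors
  only.\<close>

definition depth_roots :: "nat \<Rightarrow> 'g set" where
  "depth_roots j = {y. \<exists>\<alpha>\<in>cartan_dual T. \<exists>i\<ge>j. \<alpha> rho = - of_nat i \<and> y \<in> RS 0 \<alpha>}"

lemma depth_roots_grade: "depth_roots j \<subseteq> G 0"
  using RS_grade by (auto simp: depth_roots_def)

lemma depth_roots_mono: "i \<le> j \<Longrightarrow> depth_roots j \<subseteq> depth_roots i"
  by (auto simp: depth_roots_def) (meson order_trans)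

lemma depth_roots_br:
  assumes x: "x \<in> depth_roots i" and y: "y \<in> depth_roots j"
  shows "br x y \<in> depth_roots (i + j)"
proof -
  obtain \<alpha> m where \<alpha>: "\<alpha> \<in> cartan_dual T" "m \<ge> i" "\<alpha> rho = - of_nat m" "x \<in> RS 0 \<alpha>"
    using x by (auto simp: depth_roots_def)
  obtain \<beta> n where \<beta>: "\<beta> \<in> cartan_dual T" "n \<ge> j" "\<beta> rho = - of_nat n" "y \<in> RS 0 \<beta>"
    using y by (auto simp: depth_roots_def)
  have "br x y \<in> RS 0 (\<lambda>h. \<alpha> h + \<beta> h)" using RS_br[OF \<alpha>(4) \<beta>(4)] by simp
  moreover have "\<alpha> rho + \<beta> rho = - of_nat (m + n)" using \<alpha> \<beta> by simp
  moreover have "i + j \<le> m + n" using \<alpha> \<beta> by simp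
  ultimately show ?thesis unfolding depth_roots_def
    using dual_plus[OF \<alpha>(1) \<beta>(1)]
    by (intro CollectI bexI[of _ "\<lambda>h. \<alpha> h + \<beta> h"] exI[of _ "m + n"] conjI)
qed

text \<open>A non-zero root vector of height -i makes -i an eigenvalue of \<open>br rho\<close> on
  the finite-dimensional \<open>G 0\<close>, and there are finitely many eigenvalues.\<close>

lemma depth_roots_eventually_zero: "\<exists>J. depth_roots J \<subseteq> {0}"
proof -
  let ?E = "{c. \<exists>x\<in>G 0. x \<noteq> 0 \<and> br rho x = sg c x}"
  have "g.endo_on (G 0) (br rho)" using br_grade[OF rho_grade, of _ 0] by (intro endo_br) simp
  then have finE: "finite ?E" by (rule g.eigenvalues_finite[OF _ fin_dim_sub[OF subspace_grade]])
  have "inj (\<lambda>i::nat. - of_nat i :: complex)" by (auto simp: inj_def)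
  from finite_vimageI[OF finE this] have "finite {i::nat. - of_nat i \<in> ?E}" by (simp add: vimage_def)
  then obtain J where J: "\<forall>i\<in>{i::nat. - of_nat i \<in> ?E}. i < J"
    unfolding finite_nat_set_iff_bounded ..
  have "depth_roots J \<subseteq> {0}"
  proof
    fix y assume "y \<in> depth_roots J"
    then obtain \<alpha> i where \<alpha>: "i \<ge> J" "\<alpha> rho = - of_nat i" "y \<in> RS 0 \<alpha>" by (auto simp: depth_roots_def)
    have "br rho y = sg (- of_nat i) y" using RS_act[OF \<alpha>(3) rho_H] \<alpha>(2) by simp
    then have "y \<noteq> 0 \<Longrightarrow> - of_nat i \<in> ?E" using RS_grade[OF \<alpha>(3)] by blast
    then have "y \<noteq> 0 \<Longrightarrow> i < J" using J by blast
    then show "y \<in> {0}" using \<alpha>(1) by auto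
  qed
  then show ?thesis ..
qed

text \<open>Finitely many root vectors that span level j are adjoined one by one. The bracket of two
  elements of depth j has depth 2 j, hence at least j + 1 because j \<ge> 1, so the closure
  condition of \<open>locfin_insert\<close> holds.\<close>

lemma locfin_depth_roots_step:
  assumes j: "j \<ge> 1" and loc: "locfin (depth_roots (Suc j))"
  shows "locfin (depth_roots j)"
proof -
  obtain B where B: "B \<subseteq> depth_roots j" "g.independent B" "depth_roots j \<subseteq> g.span B"
    using g.maximal_independent_subset by blast
  obtain C where "finite C" "UNIV = g.span C" using fin_dim_g by (auto simp: fin_dim_def)
  then have "finite B" using g.independent_span_bound[of C B] B(2) by auto
  have "locfin (depth_roots (Suc j) \<union> B')" if "finite B'" "B' \<subseteq> B" for B'
    using that
  proof (induction B' rule: finite_induct)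
    case (insert x B')
    have x: "x \<in> depth_roots j" using insert.prems B(1) by blast
    then obtain \<alpha> i where \<alpha>: "\<alpha> \<in> cartan_dual T" "i \<ge> j" "\<alpha> rho = - of_nat i" "x \<in> RS 0 \<alpha>"
      by (auto simp: depth_roots_def)
    have sub: "depth_roots (Suc j) \<union> B' \<subseteq> depth_roots j"
      using depth_roots_mono[of j "Suc j"] insert.prems B(1) by auto
    have "locfin (insert x (depth_roots (Suc j) \<union> B'))"
    proof (rule locfin_insert)
      show "locfin (depth_roots (Suc j) \<union> B')" using insert by auto
      show "br a x \<in> depth_roots (Suc j) \<union> B'" if "a \<in> depth_roots (Suc j) \<union> B'" for a
        using depth_roots_br[of a j x j] that sub x depth_roots_mono[of "Suc j" "j + j"] j by auto
      have "\<alpha> rho \<noteq> 0" using \<alpha>(2,3) j by simp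
      then have "\<alpha> \<noteq> zero_fun" by auto
      then show "\<exists>n. (X 0 x ^^ n) v = 0" if "v \<in> Vc" for v
        using X_locally_nilpotent[OF \<alpha>(1) _ \<alpha>(4) that] by blast
    qed (use sub depth_roots_grade x in blast)+
    then show ?case by simp
  qed (use loc in simp)
  then have "locfin (depth_roots (Suc j) \<union> B)" using \<open>finite B\<close> by blast
  then have "locfin (g.span (depth_roots (Suc j) \<union> B))"
    by (rule locfin_span) (use B(1) depth_roots_grade in blast)
  moreover have "depth_roots j \<subseteq> g.span (depth_roots (Suc j) \<union> B)"
    using B(3) g.span_mono[of B "depth_roots (Suc j) \<union> B"] by auto
  ultimately show ?thesis by (rule locfin_mono)
qed

lemma locfin_depth_roots: "locfin (depth_roots 1)"
proof -
  obtain J where J: "depth_roots J \<subseteq> {0}" using depth_roots_eventually_zero by blast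
  have "locfin {0}"
    unfolding locfin_def
  proof
    fix v assume v: "v \<in> Vc"
    have "fin_dim sv (v.span {v})" unfolding fin_dim_def by blast
    moreover have "v.span {v} \<subseteq> Vc" using v subspace_V by (simp add: v.span_minimal)
    moreover have "X 0 a w \<in> v.span {v}" if "a \<in> {0}" "w \<in> v.span {v}" for a w
      using that X_zero calculation(2) by (auto simp: v.span_zero)
    ultimately show "\<exists>F. fin_dim sv F \<and> F \<subseteq> Vc \<and> v \<in> F \<and> (\<forall>a\<in>{0}. \<forall>w\<in>F. X 0 a w \<in> F)"
      by (intro exI[of _ "v.span {v}"]) (auto intro: v.span_base)
  qed
  \<comment> \<open>The successor ensures that the descent to depth 1 starts at depth at least
    1.\<close>
  moreover have "depth_roots (Suc J) \<subseteq> {0}" using J depth_roots_mono[of J "Suc J"] by auto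
  ultimately have "locfin (depth_roots (Suc J))" by (rule locfin_mono)
  have "locfin (depth_roots j) \<longrightarrow> locfin (depth_roots 1)" if "1 \<le> j" for j
    using that by (induction j rule: dec_induct) (use locfin_depth_roots_step in auto)
  from this[of "Suc J"] \<open>locfin (depth_roots (Suc J))\<close> show ?thesis by simp
qed

text \<open>The principal triple satisfies [rho,e] = e, [rho,f] = -f, [e,f] = 2 rho. The vector v is
  lowered a times to a last non-zero u of eigenvalue d, and u is raised b times to a last non-zero
  vector, of eigenvalue lam rho - k. Then 2 d + b = 0, and since d = lam rho - n - a this amounts to
  n + a + k = 2 lam rho.\<close>

lemma height_bound:
  assumes v: "v \<in> Vc" "v \<noteq> 0" "rh v = sv (lam rho - of_nat n) v"
  shows "of_nat n \<le> 2 * Re (lam rho)"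
proof -
  obtain e Ff where e: "e \<in> G 0" "br rho e = e" and Ff: "\<And>\<beta>. \<beta> \<in> gbase T \<Longrightarrow> Ff \<beta> \<in> RS 0 (\<lambda>h. - \<beta> h)"
    and ef: "br e (\<Sum>\<beta>\<in>gbase T. Ff \<beta>) = sg 2 rho" using principal_sl2 by blast
  define f where "f = (\<Sum>\<beta>\<in>gbase T. Ff \<beta>)"
  have "Ff \<beta> \<in> depth_roots 1" if "\<beta> \<in> gbase T" for \<beta>
    unfolding depth_roots_def using Ff[OF that] dual_uminus[OF base_dual[OF that]] base_rho[OF that]
    by (intro CollectI bexI[of _ "\<lambda>h. - \<beta> h"] exI[of _ 1]) auto
  then have fspan: "f \<in> g.span (depth_roots 1)" unfolding f_def by (intro g.span_sum g.span_base)
  then have f: "f \<in> G 0" using g.span_minimal[OF depth_roots_grade subspace_grade] by blast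
  have bf: "br rho f = - f"
    unfolding f_def br_sum sum_negf[symmetric]
    by (rule sum.cong) (auto simp: RS_act[OF Ff rho_H] base_rho)
  note endo = X_endo[OF e(1)] X_endo[OF f] X_endo[OF rho_grade]
  let ?e = "X 0 e" and ?f = "X 0 f"
  have e_eig: "rh (?e w) = sv (c + 1) (?e w)" if "w \<in> Vc" "rh w = sv c w" for w c
    using XX_no_center[OF rho_grade e(1) that(1)] that e(2) v.endo_on_scale[OF endo(1) that(1)]
    by (simp add: v.scale_left_distrib)
  have f_eig: "rh (?f w) = sv (c - 1) (?f w)" if "w \<in> Vc" "rh w = sv c w" for w c
    using XX_no_center[OF rho_grade f that(1)] that bf v.endo_on_scale[OF endo(2) that(1)] X_scale[OF f that(1), of "-1"]
    by (simp add: v.scale_left_diff_distrib)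
  have fe: "?f (?e w) = ?e (?f w) - sv (2 * c) w" if "w \<in> Vc" "rh w = sv c w" for w c
    using XX_no_center[OF e(1) f that(1)] ef that X_scale[OF rho_grade that(1), of 2] by (simp add: f_def)
  have fn: "(?f ^^ i) v \<in> Vc \<and> rh ((?f ^^ i) v) = sv (lam rho - of_nat n - of_nat i) ((?f ^^ i) v)" for i
  proof (induction i)
    case (Suc i)
    then show ?case using f_eig[of "(?f ^^ i) v" "lam rho - of_nat n - of_nat i"] v.endo_on_mem[OF endo(2)]
      by (simp add: algebra_simps)
  qed (use v in simp)
  have "locfin (g.span (depth_roots 1))" by (rule locfin_span[OF locfin_depth_roots depth_roots_grade])
  then obtain F where F: "fin_dim sv F" "F \<subseteq> Vc" "v \<in> F" "\<And>w. w \<in> F \<Longrightarrow> ?f w \<in> F"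
    unfolding locfin_def using v(1) fspan by meson
  have "(?f ^^ i) v \<in> F" for i by (induction i) (use F in auto)
  \<comment> \<open>All iterates lie in the finite-dimensional \<open>F\<close> and have pairwise
    different eigenvalues under rho.\<close>
  then have "\<exists>i. (?f ^^ i) v = 0"
    using fn endo(3) by (intro v.eigenvector_chain_zero[OF subspace_V _ F(1,2), where f = rh and c = "\<lambda>i. lam rho - of_nat n - of_nat i"])
      (auto simp: v.endo_on_def inj_def)
  then obtain i where i: "(?f ^^ i) v = 0" by blast
  define m where "m = (LEAST i. (?f ^^ i) v = 0)"
  have m0: "(?f ^^ m) v = 0" unfolding m_def using i by (rule LeastI)
  then obtain a where a: "m = Suc a" using v(2) by (cases m) auto
  define u where "u = (?f ^^ a) v"
  define d where "d = lam rho - of_nat n - of_nat a"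
  have u0: "u \<noteq> 0" using not_less_Least[of a "\<lambda>i. (?f ^^ i) v = 0"] a by (simp add: m_def u_def)
  have u: "u \<in> Vc" "rh u = sv d u" using fn[of a] by (simp_all add: u_def d_def)
  have fu: "?f u = 0" using m0 a by (simp add: u_def)
  have en: "(?e ^^ i) u \<in> Vc \<and> rh ((?e ^^ i) u) = sv (d + of_nat i) ((?e ^^ i) u)" for i
  proof (induction i)
    case (Suc i)
    then show ?case using e_eig[of "(?e ^^ i) u" "d + of_nat i"] v.endo_on_mem[OF endo(1)]
      by (simp add: algebra_simps)
  qed (use u in simp)
  \<comment> \<open>The string above a lowest vector: moving f past successive factors e contributes
    the terms 2 (d + m) for m = 0, ..., i, with total (i + 1)(2 d + i).\<close>
  have feu: "?f ((?e ^^ Suc i) u) = sv (- (of_nat (Suc i) * (2 * d + of_nat i))) ((?e ^^ i) u)" for i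
  proof (induction i)
    case 0
    then show ?case using fe[OF u] fu v.endo_on_0[OF endo(1) subspace_V] by simp
  next
    case (Suc i)
    let ?w = "(?e ^^ Suc i) u"
    have "?f (?e ?w) = ?e (?f ?w) - sv (2 * (d + of_nat (Suc i))) ?w" using fe en by blast
    also have "?e (?f ?w) = sv (- (of_nat (Suc i) * (2 * d + of_nat i))) ?w"
      unfolding Suc v.endo_on_scale[OF endo(1) conjunct1[OF en]] by simp
    also have "sv (- (of_nat (Suc i) * (2 * d + of_nat i))) ?w - sv (2 * (d + of_nat (Suc i))) ?w =
        sv (- (of_nat (Suc (Suc i)) * (2 * d + of_nat (Suc i)))) ?w"
      unfolding v.scale_left_diff_distrib[symmetric] by (simp add: algebra_simps)
    finally show ?case by simp
  qed
  \<comment> \<open>After n + a raisings the eigenvalue is lam rho, beyond which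
    \<open>rho_eigenvalue\<close> admits none; one more step must give 0.\<close>
  have "(?e ^^ (n + a + 1)) u = 0"
  proof (rule ccontr)
    assume "(?e ^^ (n + a + 1)) u \<noteq> 0"
    then obtain k :: nat where "d + of_nat (n + a + 1) = lam rho - of_nat k" using rho_eigenvalue en by blast
    then have "of_nat (k + 1) = (0::complex)" by (simp add: d_def algebra_simps)
    then show False by (metis Suc_eq_plus1 of_nat_0_eq_iff nat.distinct(1))
  qed
  define l where "l = (LEAST i. (?e ^^ i) u = 0)"
  have l0: "(?e ^^ l) u = 0" unfolding l_def using \<open>(?e ^^ (n + a + 1)) u = 0\<close> by (rule LeastI)
  then obtain b where b: "l = Suc b" using u0 by (cases l) auto
  have eb: "(?e ^^ b) u \<noteq> 0" using not_less_Least[of b "\<lambda>i. (?e ^^ i) u = 0"] b by (simp add: l_def)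
  have "sv (- (of_nat (Suc b) * (2 * d + of_nat b))) ((?e ^^ b) u) = 0"
    using feu[of b] l0 b v.endo_on_0[OF endo(2) subspace_V] by simp
  then have "- (of_nat (Suc b) * (2 * d + of_nat b)) = 0" using eb by (simp only: v.scale_eq_0_iff) simp
  then have db: "2 * d + of_nat b = 0" by (simp del: of_nat_Suc)
  obtain k :: nat where k: "d + of_nat b = lam rho - of_nat k" using rho_eigenvalue en eb by blast
  have d2: "2 * Re d + real b = 0" using arg_cong[OF db, of Re] by simp
  have k2: "Re d + real b = Re (lam rho) - real k" using arg_cong[OF k, of Re] by simp
  have n2: "Re d = Re (lam rho) - real n - real a" by (simp add: d_def)
  show ?thesis using d2 k2 n2 by simp
qed

definition weight_set :: "('g \<Rightarrow> complex) set" where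
  "weight_set = {\<alpha> \<in> cartan_dual T. \<exists>b. wtsp \<alpha> b \<noteq> {0}}"

text \<open>Every occurring weight is lam minus a natural combination of simple roots, and
  \<open>height_bound\<close> limits the sum of the coefficients. Restricting coefficient functions
  to the base makes the set of candidates finite.\<close>

lemma finite_weight_set: "finite weight_set"
proof -
  define N where "N = nat \<lfloor>2 * Re (lam rho)\<rfloor>"
  let ?w = "\<lambda>c :: _ \<Rightarrow> nat. (\<lambda>h. lam h - (\<Sum>\<beta>\<in>gbase T. of_nat (c \<beta>) * \<beta> h))"
  have "weight_set \<subseteq> ?w ` (gbase T \<rightarrow>\<^sub>E {..N})"
  proof
    fix \<alpha> assume "\<alpha> \<in> weight_set"
    then obtain b where \<alpha>: "\<alpha> \<in> cartan_dual T" "wtsp \<alpha> b \<noteq> {0}" by (auto simp: weight_set_def)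
    then obtain v where v: "v \<in> wtsp \<alpha> b" "v \<noteq> 0" using v.subspace_0[OF subspace_wtsp] by blast
    have "(\<alpha>, b) \<in> low_weights"
      by (rule wts_support[OF V_span_low low_weights_allwts]) (use v \<alpha> in auto)
    then obtain \<gamma> where \<gamma>: "nonneg_combination (gbase T) \<gamma>" "\<alpha> = (\<lambda>h. lam h - \<gamma> h)" by (auto simp: low_weights_def)
    obtain c :: "_ \<Rightarrow> nat" where c: "\<And>h. \<gamma> h = (\<Sum>\<beta>\<in>gbase T. of_nat (c \<beta>) * \<beta> h)"
      using \<gamma>(1) by (auto simp: nonneg_combination_def)
    have "\<alpha> rho = lam rho - of_nat (\<Sum>\<beta>\<in>gbase T. c \<beta>)" using \<gamma>(2) c rho_combination by simp
    then have "real (\<Sum>\<beta>\<in>gbase T. c \<beta>) \<le> 2 * Re (lam rho)"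
      using height_bound[OF wtsp_V[OF v(1)] v(2), of "\<Sum>\<beta>\<in>gbase T. c \<beta>"] wtsp_H[OF v(1) rho_H] by simp
    then have le: "(\<Sum>\<beta>\<in>gbase T. c \<beta>) \<le> N" unfolding N_def by linarith
    have "c \<beta> \<le> N" if "\<beta> \<in> gbase T" for \<beta>
      using member_le_sum[OF that, of c] finite_base le by simp
    then have "restrict c (gbase T) \<in> gbase T \<rightarrow>\<^sub>E {..N}" by auto
    moreover have "\<alpha> = ?w (restrict c (gbase T))" using \<gamma>(2) c by (simp cong: sum.cong)
    ultimately show "\<alpha> \<in> ?w ` (gbase T \<rightarrow>\<^sub>E {..N})" by blast
  qed
  then show ?thesis using finite_PiE[OF finite_base, of "\<lambda>_. {..N}"] by (meson finite_atMost finite_imageI finite_subset)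
qed

lemma V_span_weight_set: "Vc = v.span (\<Union>i\<in>weight_set \<times> range (\<lambda>r. a0 + ivec r). wts i)"
proof
  have "(\<Union>i\<in>low_weights. wts i) \<subseteq> v.span (\<Union>i\<in>weight_set \<times> range (\<lambda>r. a0 + ivec r). wts i)"
  proof clarify
    fix \<alpha> b v assume i: "(\<alpha>, b) \<in> low_weights" and v: "v \<in> wts (\<alpha>, b)"
    show "v \<in> v.span (\<Union>i\<in>weight_set \<times> range (\<lambda>r. a0 + ivec r). wts i)"
    proof (cases "v = 0")
      case False
      then have "wtsp \<alpha> b \<noteq> {0}" using v by auto
      then have "\<alpha> \<in> weight_set" using low_weights_allwts i by (auto simp: weight_set_def)
      moreover have "b \<in> range (\<lambda>r. a0 + ivec r)" using i by (auto simp: low_weights_def)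
      ultimately show ?thesis using v by (intro v.span_base) blast
    qed (simp add: v.span_zero)
  qed
  then show "Vc \<subseteq> v.span (\<Union>i\<in>weight_set \<times> range (\<lambda>r. a0 + ivec r). wts i)"
    using V_span_low v.span_minimal[of _ "v.span (\<Union>i\<in>weight_set \<times> range (\<lambda>r. a0 + ivec r). wts i)"] by simp
  show "v.span (\<Union>i\<in>weight_set \<times> range (\<lambda>r. a0 + ivec r). wts i) \<subseteq> Vc"
    using subspace_V wtsp_V by (intro v.span_minimal) blast+
qed

end

section \<open>The operators on the quotient\<close>

locale torus_quotient = torus_rep T V lam
  for T :: "('g::ab_group_add, 'n::finite) torus_data"
    and V :: "(('g, 'n) tilde, 'v::ab_group_add) lmod" and lam :: "'g \<Rightarrow> complex" +
  fixes f :: "'n \<Rightarrow> int^'n" and l :: "'n \<Rightarrow> int" and z :: "'n \<Rightarrow> 'v \<Rightarrow> 'v"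
    and V'' :: "'v set" and Q :: "(('g, 'n) mloop, 'q::ab_group_add) lmod" and \<pi> :: "'v \<Rightarrow> 'q"
  assumes red: "reduction_data T V f l z"
    and maxi: "maximal_submodule (LT_alg T) (restrict_LT V) V''"
    and V_prime_sub: "V_prime T V z \<subseteq> V''"
    and quot: "quotient_module (LT_alg T) (restrict_LT V) V'' Q \<pi>"
begin

abbreviation sq where "sq \<equiv> mscale Q"
abbreviation Qc where "Qc \<equiv> mcarrier Q"
definition Xq :: "int^'n \<Rightarrow> 'g \<Rightarrow> 'q \<Rightarrow> 'q" where "Xq k x = mact Q (Poly_Mapping.single k x)"

sublocale q: complex_vs sq
  using quot by (simp add: complex_vs_def quotient_module_def)

lemma pi_linear: "linear_on sv Vc sq \<pi>"
  and pi_image: "\<pi> ` Vc = Qc"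
  and pi_kernel: "{v \<in> Vc. \<pi> v = 0} = V''"
  and pi_act: "x \<in> LT T \<Longrightarrow> v \<in> Vc \<Longrightarrow> mact Q x (\<pi> v) = \<pi> (mact V (x, 0, 0) v)"
  using quot by (simp_all add: quotient_module_def restrict_LT_def LT_alg_def)

lemma pi_add: "v \<in> Vc \<Longrightarrow> w \<in> Vc \<Longrightarrow> \<pi> (v + w) = \<pi> v + \<pi> w"
  and pi_scale: "v \<in> Vc \<Longrightarrow> \<pi> (sv c v) = sq c (\<pi> v)"
  using pi_linear by (simp_all add: linear_on_def)

lemma pi_zero [simp]: "\<pi> 0 = 0"
  using v.linear_on_0[OF pi_linear q.vector_space_axioms v.subspace_0[OF subspace_V]] .

lemma pi_diff: "v \<in> Vc \<Longrightarrow> w \<in> Vc \<Longrightarrow> \<pi> (v - w) = \<pi> v - \<pi> w"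
  using v.linear_on_diff[OF pi_linear q.vector_space_axioms subspace_V] .

lemma pi_sum: "(\<And>i. i \<in> F \<Longrightarrow> u i \<in> Vc) \<Longrightarrow> \<pi> (\<Sum>i\<in>F. u i) = (\<Sum>i\<in>F. \<pi> (u i))"
  using v.linear_on_sum[OF pi_linear q.vector_space_axioms subspace_V] .

lemma pi_X: "x \<in> G k \<Longrightarrow> v \<in> Vc \<Longrightarrow> Xq k x (\<pi> v) = \<pi> (X k x v)"
  using pi_act[OF LT_single] by (simp add: Xq_def X_def)

lemma pi_mem: "v \<in> Vc \<Longrightarrow> \<pi> v \<in> Qc"
  using pi_image by blast

lemma Q_cases: "q \<in> Qc \<Longrightarrow> (\<And>v. v \<in> Vc \<Longrightarrow> q = \<pi> v \<Longrightarrow> thesis) \<Longrightarrow> thesis"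
  using pi_image by blast

lemma subspace_Q: "q.subspace Qc"
proof (rule q.subspaceI)
  show "0 \<in> Qc" using pi_mem[OF v.subspace_0[OF subspace_V]] by simp
  fix x y c assume "x \<in> Qc" "y \<in> Qc"
  then obtain v w where vw: "v \<in> Vc" "w \<in> Vc" "x = \<pi> v" "y = \<pi> w" using pi_image by blast
  show "x + y \<in> Qc" using pi_mem[OF v.subspace_add[OF subspace_V vw(1,2)]] vw by (simp add: pi_add)
  show "sq c x \<in> Qc" using pi_mem[OF v.subspace_scale[OF subspace_V vw(1), of c]] vw by (simp add: pi_scale)
qed

lemma Xq_endo: "x \<in> G k \<Longrightarrow> q.endo_on Qc (Xq k x)"
proof (rule q.endo_onI)
  assume x: "x \<in> G k"
  note endo = X_endo[OF x]
  show "Xq k x p \<in> Qc" if "p \<in> Qc" for p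
    using that by (rule Q_cases) (simp add: pi_X x pi_mem v.endo_on_mem[OF endo])
  show "Xq k x (sq c p) = sq c (Xq k x p)" if "p \<in> Qc" for c p
    using that
  proof (rule Q_cases)
    fix v assume v: "v \<in> Vc" "p = \<pi> v"
    then show ?thesis
      using pi_X[OF x v.subspace_scale[OF subspace_V v(1)], of c] x
      by (simp add: pi_X pi_scale v.endo_on_scale[OF endo] v.endo_on_mem[OF endo])
  qed
  show "Xq k x (p + p') = Xq k x p + Xq k x p'" if p: "p \<in> Qc" "p' \<in> Qc" for p p'
  proof -
    obtain v where "v \<in> Vc" "p = \<pi> v" using p(1) by (rule Q_cases)
    moreover obtain w where "w \<in> Vc" "p' = \<pi> w" using p(2) by (rule Q_cases)
    ultimately have vw: "v \<in> Vc" "w \<in> Vc" "p = \<pi> v" "p' = \<pi> w" by simp_all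
    then show ?thesis
      using pi_X[OF x v.subspace_add[OF subspace_V vw(1,2)]] x
      by (simp add: pi_X pi_add v.endo_on_add[OF endo] v.endo_on_mem[OF endo])
  qed
qed

lemma Xq_add: "x \<in> G k \<Longrightarrow> y \<in> G k \<Longrightarrow> p \<in> Qc \<Longrightarrow> Xq k (x + y) p = Xq k x p + Xq k y p"
  by (erule Q_cases)
    (simp add: pi_X g.subspace_add[OF subspace_grade] X_add pi_add v.endo_on_mem[OF X_endo])

lemma Xq_scale: "x \<in> G k \<Longrightarrow> p \<in> Qc \<Longrightarrow> Xq k (sg c x) p = sq c (Xq k x p)"
  by (erule Q_cases)
    (simp add: pi_X g.subspace_scale[OF subspace_grade] X_scale pi_scale v.endo_on_mem[OF X_endo])

lemma V''_sub: "V'' \<subseteq> Vc"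
  and subspace_V'': "v.subspace V''"
  and V''_X: "x \<in> G k \<Longrightarrow> v \<in> V'' \<Longrightarrow> X k x v \<in> V''"
  and V''_proper: "V'' \<noteq> Vc"
  using maxi LT_single by (auto simp: maximal_submodule_def submodule_def restrict_LT_def LT_alg_def X_def)

text \<open>Maximality can be tested with homogeneous operators, as an element of LT acts by a
  finite sum of them.\<close>

lemma V''_maximal:
  assumes W: "v.subspace W" "W \<subseteq> Vc" "V'' \<subseteq> W" and X: "\<And>k x v. x \<in> G k \<Longrightarrow> v \<in> W \<Longrightarrow> X k x v \<in> W"
    and w: "w \<in> W" "w \<notin> V''"
  shows "W = Vc"
proof -
  have "mact V (x, 0, 0) v \<in> W" if x: "x \<in> LT T" and v: "v \<in> W" for x v
  proof -
    have vV: "v \<in> Vc" using v W by blast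
    have "(0, 0, 0) \<in> lcarrier (tilde_alg T)" by (simp add: tilde_carrier)
    then have "D 0 v = 0" using act_add[of "(0,0,0)" "(0,0,0)" v] vV by (simp add: D_def)
    then have "mact V (x, 0, 0) v = (\<Sum>k\<in>Poly_Mapping.keys x. X k (Poly_Mapping.lookup x k) v)"
      using act_decompose[OF x zero_center_space vV, of 0] Z_zero[OF vV] by simp
    then show ?thesis using X[OF LT_lookup[OF x] v] W(1) by (simp add: v.subspace_sum)
  qed
  then have "submodule (LT_alg T) (restrict_LT V) W"
    using W by (simp add: submodule_def restrict_LT_def LT_alg_def)
  then have "W = V'' \<or> W = mcarrier (restrict_LT V)" using maxi W(3) unfolding maximal_submodule_def by blast
  then show ?thesis using w by (auto simp: restrict_LT_def)
qed

subsection \<open>Periodicity modulo the degree group\<close>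

text \<open>A shift of the degree by s that the quotient cannot see: each weight vector has a
  partner of the same H-weight in the shifted degree with the same image. Existence of partners
  composes, so periods add.\<close>

definition period :: "int^'n \<Rightarrow> bool" where
  "period s \<longleftrightarrow> (\<forall>\<alpha>\<in>cartan_dual T. \<forall>b. \<forall>v\<in>wtsp \<alpha> b. \<exists>v'\<in>wtsp \<alpha> (b + ivec s). \<pi> v' = \<pi> v)"

lemma period_0: "period 0"
  by (auto simp: period_def)

lemma period_add: "period s \<Longrightarrow> period t \<Longrightarrow> period (s + t)"
  unfolding period_def
proof (intro ballI allI)
  fix \<alpha> b v assume st: "\<forall>\<alpha>\<in>cartan_dual T. \<forall>b. \<forall>v\<in>wtsp \<alpha> b. \<exists>v'\<in>wtsp \<alpha> (b + ivec s). \<pi> v' = \<pi> v"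
    "\<forall>\<alpha>\<in>cartan_dual T. \<forall>b. \<forall>v\<in>wtsp \<alpha> b. \<exists>v'\<in>wtsp \<alpha> (b + ivec t). \<pi> v' = \<pi> v"
    and \<alpha>: "\<alpha> \<in> cartan_dual T" and v: "v \<in> wtsp \<alpha> b"
  obtain v' where v': "v' \<in> wtsp \<alpha> (b + ivec s)" "\<pi> v' = \<pi> v" using st(1) \<alpha> v by blast
  obtain v'' where "v'' \<in> wtsp \<alpha> (b + ivec s + ivec t)" "\<pi> v'' = \<pi> v'" using st(2) \<alpha> v'(1) by blast
  then show "\<exists>v'\<in>wtsp \<alpha> (b + ivec (s + t)). \<pi> v' = \<pi> v" using v' by (auto simp: ivec_add add.assoc)
qed

text \<open>Pairs of weight vectors of degrees differing by \<open>s\<close> with the same image in the quotient span a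
  submodule, so one pair of non-zero vectors suffices.\<close>

lemma period_if_pair:
  assumes u: "u \<in> wtsp \<alpha> b" "u \<noteq> 0" and \<alpha>: "\<alpha> \<in> cartan_dual T"
    and u': "u' \<in> wtsp \<alpha> (b + ivec s)" "\<pi> u' = \<pi> u"
  shows "period s"
proof -
  \<comment> \<open>The vectors of weight i that possess a partner. A root vector applied to both
    members of a pair gives another pair.\<close>
  define U where "U i = {w \<in> wts i. \<exists>w'\<in>wtsp (fst i) (snd i + ivec s). \<pi> w' = \<pi> w}" for i
  have subU: "v.subspace (U i)" for i
  proof (rule v.subspaceI)
    show "0 \<in> U i" using v.subspace_0[OF subspace_wtsp] by (auto simp: U_def intro!: bexI[of _ 0])
    fix v w c assume v: "v \<in> U i" and w: "w \<in> U i"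
    then obtain v' w' where vw: "v' \<in> wtsp (fst i) (snd i + ivec s)" "\<pi> v' = \<pi> v"
      "w' \<in> wtsp (fst i) (snd i + ivec s)" "\<pi> w' = \<pi> w" by (auto simp: U_def)
    have mem: "v \<in> wts i" "w \<in> wts i" using v w by (auto simp: U_def)
    have "\<pi> (v' + w') = \<pi> (v + w)" "\<pi> (sv c v') = \<pi> (sv c v)"
      using vw mem wtsp_V pi_add pi_scale by metis+
    then show "v + w \<in> U i" "sv c v \<in> U i"
      unfolding U_def using vw mem v.subspace_add[OF subspace_wtsp] v.subspace_scale[OF subspace_wtsp] by blast+
  qed
  let ?B = "\<Union>i\<in>allwts. U i"
  have BV: "?B \<subseteq> Vc" using wtsp_V by (auto simp: U_def)
  have span: "v.span ?B = Vc"
  proof (rule irreducible_span[OF BV])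
    fix k \<gamma> x w assume \<gamma>: "\<gamma> \<in> wt_roots" and x: "x \<in> RS k \<gamma>" and w: "w \<in> ?B"
    then obtain \<alpha> b w' where \<alpha>: "\<alpha> \<in> cartan_dual T" "w \<in> wtsp \<alpha> b" "w' \<in> wtsp \<alpha> (b + ivec s)" "\<pi> w' = \<pi> w"
      by (auto simp: U_def)
    have "X k x w' \<in> wtsp (\<lambda>h. \<alpha> h + \<gamma> h) (b + ivec k + ivec s)" using X_wtsp[OF x \<alpha>(3)] by (simp add: add_ac)
    moreover have "\<pi> (X k x w') = \<pi> (X k x w)" using pi_X[OF RS_grade[OF x]] wtsp_V \<alpha> by metis
    ultimately have "X k x w \<in> U (\<lambda>h. \<alpha> h + \<gamma> h, b + ivec k)" using X_wtsp[OF x \<alpha>(2)] by (auto simp: U_def)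
    then have "X k x w \<in> ?B" using dual_plus[OF \<alpha>(1) wt_roots_dual[OF \<gamma>]] by blast
    then show "X k x w \<in> v.span ?B" by (rule v.span_base)
  next
    fix d w assume w: "w \<in> ?B"
    then obtain i where "w \<in> wts i" by (auto simp: U_def)
    then show "D d w \<in> v.span ?B" using w wtsp_D by (simp add: v.span_scale v.span_base)
  next
    show "u \<in> ?B" using u u' \<alpha> by (auto simp: U_def intro!: bexI[of _ \<alpha>] exI[of _ b])
  qed (rule u(2))
  show ?thesis
    unfolding period_def
  proof (intro ballI allI)
    fix \<alpha> b v assume \<alpha>: "\<alpha> \<in> cartan_dual T" and v: "v \<in> wtsp \<alpha> b"
    have "v \<in> v.span ?B" using wtsp_V[OF v] span by simp
    then have "\<exists>F u. finite F \<and> F \<subseteq> allwts \<and> (\<forall>i\<in>F. u i \<in> U i) \<and> v = (\<Sum>i\<in>F. u i)"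
      by (intro v.span_UN_subspaces subU)
    then obtain F u where F: "finite F" "F \<subseteq> allwts" "\<forall>i\<in>F. u i \<in> U i" "v = (\<Sum>i\<in>F. u i)" by (elim exE conjE)
    \<comment> \<open>As v is itself a weight vector, only the summand of its own weight survives in
      the expansion, and that summand has a partner.\<close>
    have "(\<Sum>i\<in>F. u i) = (if (\<alpha>, b) \<in> F then u (\<alpha>, b) else 0)"
      by (rule wts_component) (use F v \<alpha> in \<open>auto simp: U_def\<close>)
    then have "v \<in> U (\<alpha>, b)" using F v.subspace_0[OF subU] by auto
    then show "\<exists>v'\<in>wtsp \<alpha> (b + ivec s). \<pi> v' = \<pi> v" by (simp add: U_def)
  qed
qed

lemma D_axis:
  assumes w: "w \<in> Vc" and ax: "\<And>i. D (axis i 1) w = sv (b $ i) w"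
  shows "D d w = sv (pairing d b) w"
proof -
  have add: "D (d + e) w = D d w + D e w" for d e
    using act_add[of "(0, 0, d)" "(0, 0, e)" w] w by (simp add: D_def tilde_carrier)
  have scale: "D (c *s d) w = sv c (D d w)" for c d
    using act_scale[of "(0, 0, d)" w c] w by (simp add: D_def tilde_carrier) (simp add: tilde_alg_def)
  have zero: "D 0 w = 0" using scale[of 0 0] by simp
  have "D (\<Sum>i\<in>F. e i) w = (\<Sum>i\<in>F. D (e i) w)" for F and e :: "'n \<Rightarrow> complex^'n"
    by (induction F rule: infinite_finite_induct) (simp_all add: zero add)
  then have "D (\<Sum>i\<in>UNIV. (d $ i) *s axis i 1) w = (\<Sum>i\<in>UNIV. sv (d $ i * b $ i) w)"
    by (simp add: scale ax)
  then show ?thesis by (simp add: basis_expansion pairing_def v.scale_sum_left)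
qed

lemma z_operator: "highest_central_operator T V (l i *s f i) (z i)"
  and z_nonzero: "\<exists>v\<in>HS. z i v \<noteq> 0"
  using red by (simp_all add: reduction_data_def)

lemma z_HS: "v \<in> HS \<Longrightarrow> z i v \<in> HS"
  and z_linear: "linear_on sv HS sv (z i)"
  and z_deriv: "v \<in> HS \<Longrightarrow> D (axis j 1) (z i v) - z i (D (axis j 1) v) = sv (of_int ((l i *s f i) $ j)) (z i v)"
  using z_operator[of i] unfolding highest_central_operator_def D_def by blast+

lemma z_wtsp:
  assumes v: "v \<in> HS" "v \<in> wtsp lam b"
  shows "z i v \<in> wtsp lam (b + ivec (l i *s f i))"
proof -
  have zV: "z i v \<in> Vc" using z_HS[OF v(1)] HS_V by blast
  have "D (axis j 1) (z i v) = sv ((b + ivec (l i *s f i)) $ j) (z i v)" for j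
  proof -
    have "z i (D (axis j 1) v) = sv (b $ j) (z i v)"
      using wtsp_D[OF v(2)] z_linear[of i] v(1) by (simp add: pairing_axis linear_on_def)
    moreover have "D (axis j 1) (z i v) = z i (D (axis j 1) v) + sv (of_int ((l i *s f i) $ j)) (z i v)"
      using z_deriv[OF v(1), of j i] by (simp add: algebra_simps)
    ultimately show ?thesis by (simp add: v.scale_left_distrib ivec_def)
  qed
  then have "D d (z i v) = sv (pairing d (b + ivec (l i *s f i))) (z i v)" for d by (rule D_axis[OF zV])
  then show ?thesis using zV HS_H[OF z_HS[OF v(1)]] by (simp add: wtsp_def)
qed

text \<open>The difference is a generator of \<open>W_plus\<close>, which \<open>V''\<close>
  contains by way of V'. The central operators thus become visible as periods.\<close>

lemma pi_z: "v \<in> HS \<Longrightarrow> \<pi> (z i v) = \<pi> v"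
proof -
  assume v: "v \<in> HS"
  have "z i v - v \<in> W_plus T V z" using v unfolding W_plus_def by (intro v.span_base) blast
  \<comment> \<open>The empty word in LT leaves the generator unchanged.\<close>
  then have "z i v - v \<in> {foldr (mact (restrict_LT V)) xs w | xs w. set xs \<subseteq> lcarrier (LT_alg T) \<and> w \<in> W_plus T V z}"
    by (intro CollectI exI[of _ "[]"] exI[of _ "z i v - v"]) simp
  then have "z i v - v \<in> V_prime T V z"
    unfolding V_prime_def envelope_span_def by (simp add: restrict_LT_def v.span_base)
  then have "z i v - v \<in> V''" using V_prime_sub by auto
  then have "\<pi> (z i v - v) = 0" using pi_kernel by blast
  then show ?thesis using pi_diff z_HS v HS_V by simp
qed

text \<open>A homogeneous u in V_+ with \<open>z i u\<close> non-zero forms a pair with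
  \<open>z i u\<close> at distance l_i f_i. The same pair read backwards gives the opposite
  period.\<close>

lemma period_generators: "period (l i *s f i)" "period (- (l i *s f i))"
proof -
  obtain v where v: "v \<in> HS" "z i v \<noteq> 0" using z_nonzero by blast
  have z0: "z i 0 = 0" using v.linear_on_0[OF z_linear v.vector_space_axioms v.subspace_0[OF subspace_HS]] .
  have "\<exists>b u. u \<in> HS \<and> u \<in> wtsp lam b \<and> z i u \<noteq> 0"
  proof (rule ccontr)
    assume no: "\<nexists>b u. u \<in> HS \<and> u \<in> wtsp lam b \<and> z i u \<noteq> 0"
    have "v \<in> HS \<and> z i v = 0" using HS_span[OF v(1)]
    proof (induction v rule: v.span_induct_alt)
      case base
      show ?case using z0 v.subspace_0[OF subspace_HS] by simp
    next
      case (step c x y)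
      then have x: "x \<in> HS" "z i x = 0" using no by auto
      have "z i (sv c x + y) = sv c (z i x) + z i y"
        using z_linear[of i] x step v.subspace_scale[OF subspace_HS] by (simp add: linear_on_def)
      then show ?case using x step subspace_HS by (simp add: v.subspace_add v.subspace_scale)
    qed
    then show False using v by simp
  qed
  then obtain b u where u: "u \<in> HS" "u \<in> wtsp lam b" "z i u \<noteq> 0" by blast
  have "u \<noteq> 0" using u(3) z0 by auto
  then show "period (l i *s f i)" by (rule period_if_pair[OF u(2) _ lam_dual z_wtsp[OF u(1,2)] pi_z[OF u(1)]])
  have "u \<in> wtsp lam (b + ivec (l i *s f i) + ivec (- (l i *s f i)))"
    using u(2) by (simp add: add.assoc ivec_add[symmetric])
  then show "period (- (l i *s f i))"
    by (rule period_if_pair[OF z_wtsp[OF u(1,2)] u(3) lam_dual _ pi_z[OF u(1), symmetric]])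
qed

lemma period_mult: "period ((a * l i) *s f i)"
proof -
  have nat: "period (of_nat n *s (s :: int^'n))" if "period s" for n s
    using that by (induction n) (simp_all add: period_0 period_add vector_sadd_rdistrib)
  show ?thesis
  proof (cases "a \<ge> 0")
    case True
    then have "(a * l i) *s f i = of_nat (nat a) *s (l i *s f i)" by (simp add: vector_smult_assoc)
    then show ?thesis using nat[OF period_generators(1)] by metis
  next
    case False
    then have "(a * l i) *s f i = of_nat (nat (- a)) *s (- (l i *s f i))"
      by (simp add: vector_smult_assoc vec_eq_iff)
    then show ?thesis using nat[OF period_generators(2)] by metis
  qed
qed

lemma period_sum: "period (\<Sum>i\<in>F. (a i * l i) *s f i)"
  by (induction F rule: infinite_finite_induct) (simp_all add: period_0 period_add period_mult)

text \<open>Representatives of Z^n modulo the lattice spanned by the l_i f_i. Absolute values occur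
  because l_i may be negative.\<close>

definition reps :: "(int^'n) set" where
  "reps = (\<lambda>c. \<Sum>i\<in>UNIV. c i *s f i) ` PiE UNIV (\<lambda>i. {0..<\<bar>l i\<bar>})"

lemma finite_reps: "finite reps"
  unfolding reps_def by (intro finite_imageI finite_PiE) auto

lemma period_reps: "\<exists>\<rho>\<in>reps. period (r - \<rho>) \<and> period (\<rho> - r)"
proof -
  have l0: "l i \<noteq> 0" for i using red by (simp add: reduction_data_def)
  obtain c where c: "r = (\<Sum>i\<in>UNIV. c i *s f i)"
    using red unfolding reduction_data_def int_basis_def by metis
  define \<rho> where "\<rho> = (\<Sum>i\<in>UNIV. (c i mod \<bar>l i\<bar>) *s f i)"
  \<comment> \<open>The sign converts a multiple of |l_i| into a multiple of l_i.\<close>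
  define q where "q i = sgn (l i) * (c i div \<bar>l i\<bar>)" for i
  have "\<rho> \<in> reps" unfolding reps_def \<rho>_def
    by (rule image_eqI[of _ _ "\<lambda>i. c i mod \<bar>l i\<bar>"]) (use l0 in auto)
  moreover have eq: "c i mod \<bar>l i\<bar> + q i * l i = c i" for i
  proof -
    have "q i * l i = (c i div \<bar>l i\<bar>) * \<bar>l i\<bar>" by (simp add: q_def abs_sgn mult_ac)
    then show ?thesis by simp
  qed
  have "r = (\<Sum>i\<in>UNIV. (c i mod \<bar>l i\<bar> + q i * l i) *s f i)" unfolding eq by (rule c)
  then have r: "r = \<rho> + (\<Sum>i\<in>UNIV. (q i * l i) *s f i)"
    by (simp add: \<rho>_def sum.distrib vector_sadd_rdistrib)
  then have "period (r - \<rho>)" using period_sum[of q UNIV] by simp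
  moreover have "\<rho> - r = (\<Sum>i\<in>UNIV. ((- q i) * l i) *s f i)"
    using r by (simp add: sum_negf[symmetric] vec_eq_iff)
  then have "period (\<rho> - r)" using period_sum[of "\<lambda>i. - q i" UNIV] by simp
  ultimately show ?thesis by blast
qed

text \<open>By periodicity every weight vector has the same image as one with degree in a0 +
  \<open>reps\<close>. Only finitely many weight spaces remain, each of finite dimension.\<close>

lemma fin_dim_Q: "fin_dim sq Qc"
proof -
  let ?W = "\<lambda>i. \<pi> ` wtsp (fst i) (a0 + ivec (snd i))"
  have fd: "fin_dim sq (?W i)" if "fst i \<in> weight_set" for i
  proof (rule v.fin_dim_image[OF _ q.vector_space_axioms])
    show "linear_on sv (wtsp (fst i) (a0 + ivec (snd i))) sq \<pi>"
      using pi_linear wtsp_V unfolding linear_on_def by blast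
    show "fin_dim sv (wtsp (fst i) (a0 + ivec (snd i)))"
      using that by (intro wtsp_fin_dim) (simp add: weight_set_def)
  qed
  have "fin_dim sq (q.span (\<Union>i\<in>weight_set \<times> reps. ?W i))"
    by (rule q.fin_dim_span_UN) (use finite_weight_set finite_reps fd in auto)
  moreover have "Qc \<subseteq> q.span (\<Union>i\<in>weight_set \<times> reps. ?W i)"
  proof
    fix p assume "p \<in> Qc"
    then obtain v where v: "v \<in> Vc" "p = \<pi> v" by (rule Q_cases)
    have "v \<in> v.span (\<Union>i\<in>weight_set \<times> range (\<lambda>r. a0 + ivec r). wts i)" using v V_span_weight_set by simp
    then have "v \<in> Vc \<and> \<pi> v \<in> q.span (\<Union>i\<in>weight_set \<times> reps. ?W i)"
    proof (induction v rule: v.span_induct_alt)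
      case base
      show ?case using v.subspace_0[OF subspace_V] by (simp add: q.span_zero)
    next
      case (step c x y)
      then obtain \<alpha> r where \<alpha>: "\<alpha> \<in> weight_set" "x \<in> wtsp \<alpha> (a0 + ivec r)" by auto
      obtain \<rho> where \<rho>: "\<rho> \<in> reps" "period (\<rho> - r)" using period_reps by blast
      have "\<alpha> \<in> cartan_dual T" using \<alpha>(1) by (simp add: weight_set_def)
      then obtain x' where "x' \<in> wtsp \<alpha> (a0 + ivec r + ivec (\<rho> - r))" "\<pi> x' = \<pi> x"
        using \<rho>(2) \<alpha>(2) unfolding period_def by blast
      moreover have "a0 + ivec r + ivec (\<rho> - r) = a0 + ivec \<rho>" by (simp add: ivec_diff)
      ultimately have "\<pi> x \<in> ?W (\<alpha>, \<rho>)" by (metis fst_conv snd_conv imageI)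
      then have "\<pi> x \<in> q.span (\<Union>i\<in>weight_set \<times> reps. ?W i)"
        using \<alpha>(1) \<rho>(1) by (intro q.span_base) blast
      then show ?case using step wtsp_V[OF \<alpha>(2)] subspace_V
        by (simp add: v.subspace_add v.subspace_scale pi_add pi_scale q.span_add q.span_scale)
    qed
    then show "p \<in> q.span (\<Union>i\<in>weight_set \<times> reps. ?W i)" using v(2) by simp
  qed
  ultimately show ?thesis using q.fin_dim_subspace subspace_Q by blast
qed

subsection \<open>The centre acts trivially\<close>

text \<open>A central element acts on the quotient by a scalar by Schur's lemma, and as a commutator; so the
  scalar is \<open>0\<close>, and its image in \<open>V\<close> is a graded submodule contained in \<open>V''\<close>.\<close>

lemma tK_zero:
  assumes k: "k \<in> Gam T" and v: "v \<in> Vc"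
  shows "Z (tK k i) v = 0"
proof -
  note zc = tK_center_space[OF k, of i]
  let ?Z = "Z (tK k i)"
  obtain p r h h' c where pr: "p \<in> Gam T" "r \<in> Gam T" "h \<in> H" "h' \<in> H"
    "\<And>v. v \<in> Vc \<Longrightarrow> ?Z v = sv c (X p h (X r h' v) - X r h' (X p h v))"
    using center_commutator[OF k, of i] by blast
  have hg: "h \<in> G p" "h' \<in> G r" using H_grade[OF pr(3)] H_grade[OF pr(4)] grade_Gam[OF pr(1)] grade_Gam[OF pr(2)] by auto
  \<comment> \<open>The scalar c is absorbed into A, so that the commutator of A and B is exactly
    the operator induced by t^k K_i on the quotient.\<close>
  define A B where "A w = sq c (Xq p h w)" and "B = Xq r h'" for w
  have A: "q.endo_on Qc A"
    using Xq_endo[OF hg(1)] subspace_Q unfolding A_def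
    by (intro q.endo_onI) (simp_all add: q.endo_on_mem q.endo_on_add q.endo_on_scale q.subspace_scale q.scale_right_distrib mult.commute)
  have B: "q.endo_on Qc B" unfolding B_def by (rule Xq_endo[OF hg(2)])
  have AB: "A (B (\<pi> v)) - B (A (\<pi> v)) = \<pi> (?Z v)" if v: "v \<in> Vc" for v
  proof -
    have m: "X r h' v \<in> Vc" "X p h v \<in> Vc" "X p h (X r h' v) \<in> Vc" "X r h' (X p h v) \<in> Vc"
      using v X_mem[OF hg(1)] X_mem[OF hg(2)] by simp_all
    have "B (A (\<pi> v)) = sq c (B (Xq p h (\<pi> v)))"
      unfolding A_def by (rule q.endo_on_scale[OF B]) (simp add: pi_X hg v m pi_mem)
    then have "A (B (\<pi> v)) - B (A (\<pi> v)) = sq c (\<pi> (X p h (X r h' v)) - \<pi> (X r h' (X p h v)))"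
      using m v hg by (simp add: A_def B_def pi_X q.scale_right_diff_distrib)
    then show ?thesis using pr(5)[OF v] m v.subspace_diff[OF subspace_V m(3,4)] by (simp add: pi_scale pi_diff)
  qed
  define C where "C w = A (B w) - B (A w)" for w
  have C: "q.endo_on Qc C"
    using A B subspace_Q unfolding C_def
    by (intro q.endo_onI) (simp_all add: q.endo_on_mem q.endo_on_add q.endo_on_scale q.subspace_diff q.scale_right_diff_distrib)
  have Qnz: "Qc \<noteq> {0}"
  proof
    assume "Qc = {0}"
    then have "\<pi> v = 0" if "v \<in> Vc" for v using pi_mem[OF that] by simp
    then show False using pi_kernel V''_proper by blast
  qed
  obtain w b where w: "w \<in> Qc" "w \<noteq> 0" "C w = sq b w" using q.eigenvector_exists[OF C fin_dim_Q Qnz] by blast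
  obtain u where u: "u \<in> Vc" "w = \<pi> u" using w(1) by (rule Q_cases)
  \<comment> \<open>Schur's lemma in the form of maximality: the preimage of an eigenspace of C is
    stable under all \<open>X\<close> and contains \<open>V''\<close> as well as the vector u
    outside it.\<close>
  let ?W = "{v \<in> Vc. \<pi> (?Z v) = sq b (\<pi> v)}"
  have Zm: "?Z v \<in> Vc" if "v \<in> Vc" for v using Z_mem[OF zc that] .
  have "?W = Vc"
  proof (rule V''_maximal)
    show "v.subspace ?W"
      using subspace_V v.endo_on_add[OF Z_endo[OF zc]] v.endo_on_scale[OF Z_endo[OF zc]] v.endo_on_0[OF Z_endo[OF zc] subspace_V] Zm
      by (intro v.subspaceI)
        (auto simp: v.subspace_0 v.subspace_add v.subspace_scale pi_add pi_scale q.scale_right_distrib mult.commute)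
    show "V'' \<subseteq> ?W"
    proof
      fix v assume v: "v \<in> V''"
      then have vV: "v \<in> Vc" using V''_sub by blast
      have "?Z v \<in> V''" unfolding pr(5)[OF vV]
        using v V''_X[OF hg(1)] V''_X[OF hg(2)] subspace_V'' by (simp add: v.subspace_scale v.subspace_diff)
      then have "\<pi> (?Z v) = 0" "\<pi> v = 0" using v pi_kernel by blast+
      then show "v \<in> ?W" using vV by simp
    qed
    fix k' x v assume x: "x \<in> G k'" and v: "v \<in> ?W"
    have vV: "v \<in> Vc" using v by simp
    have "\<pi> (?Z (X k' x v)) = Xq k' x (\<pi> (?Z v))" by (simp only: pi_X[OF x Zm[OF vV]] XZ[OF x zc vV])
    also have "\<dots> = sq b (\<pi> (X k' x v))"
      using v q.endo_on_scale[OF Xq_endo[OF x] pi_mem, of v b] pi_X[OF x, of v] by simp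
    finally show "X k' x v \<in> ?W" using X_mem[OF x] v by simp
  next
    show "u \<in> ?W" using w(3) u AB[OF u(1)] by (simp add: C_def)
    show "u \<notin> V''" using w(2) u pi_kernel by blast
  qed auto
  then have scal: "A (B x) - B (A x) = sq b x" if "x \<in> Qc" for x
    using that AB by (elim Q_cases) auto
  have "b = 0" by (rule q.commutator_scalar_zero[OF A B fin_dim_Q Qnz scal])
  then have piZ: "\<pi> (?Z v) = 0" if "v \<in> Vc" for v using AB[OF that] scal[OF pi_mem[OF that]] by simp
  have sub: "v.subspace (?Z ` Vc)"
  proof (rule v.subspaceI)
    show "0 \<in> ?Z ` Vc" using v.endo_on_0[OF Z_endo[OF zc] subspace_V] v.subspace_0[OF subspace_V] by force
    fix x y a assume "x \<in> ?Z ` Vc" "y \<in> ?Z ` Vc"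
    then obtain v w where vw: "v \<in> Vc" "w \<in> Vc" "x = ?Z v" "y = ?Z w" by blast
    show "x + y \<in> ?Z ` Vc"
      using v.endo_on_add[OF Z_endo[OF zc] vw(1,2)] v.subspace_add[OF subspace_V vw(1,2)] vw by (metis imageI)
    show "sv a x \<in> ?Z ` Vc"
      using v.endo_on_scale[OF Z_endo[OF zc] vw(1)] v.subspace_scale[OF subspace_V vw(1)] vw by (metis imageI)
  qed
  show ?thesis
  proof (rule ccontr)
    assume nz: "?Z v \<noteq> 0"
    \<comment> \<open>A non-zero image would be all of V by irreducibility, stability under D being
      due to [d, t^k K_i] being a multiple of t^k K_i; but the image lies in
      \<open>V''\<close>.\<close>
    have "?Z ` Vc = Vc"
    proof (rule irreducible_X[OF sub _ _ _ _ nz])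
      show "?Z ` Vc \<subseteq> Vc" using Zm by blast
      show "X k' x w \<in> ?Z ` Vc" if x: "x \<in> G k'" and w: "w \<in> ?Z ` Vc" for k' x w
        using w XZ[OF x zc] X_mem[OF x] by auto
      fix d w assume "w \<in> ?Z ` Vc"
      then obtain v' where v': "v' \<in> Vc" "w = ?Z v'" by blast
      then have "D d w = ?Z (D d v') + sv (pairing d (ivec k)) w" using DZ[OF k v'(1)] by simp
      moreover have "?Z (D d v') \<in> ?Z ` Vc" "sv (pairing d (ivec k)) w \<in> ?Z ` Vc"
        using D_mem[OF v'(1)] \<open>w \<in> ?Z ` Vc\<close> sub by (auto simp: v.subspace_scale)
      ultimately show "D d w \<in> ?Z ` Vc" using sub by (simp add: v.subspace_add)
    qed (use v in blast)
    moreover have "?Z ` Vc \<subseteq> V''" using piZ Zm pi_kernel by blast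
    ultimately show False using V''_sub V''_proper by blast
  qed
qed

lemma center_zero: "w \<in> center_space T \<Longrightarrow> v \<in> Vc \<Longrightarrow> Z w v = 0"
proof -
  assume w: "w \<in> center_space T" and v: "v \<in> Vc"
  have "w \<in> center_space T \<and> Z w v = 0" using w[unfolded center_space_def]
  proof (induction w rule: cen.span_induct_alt)
    case base
    show ?case using Z_zero[OF v] by simp
  next
    case (step c x y)
    then obtain k i where k: "k \<in> Gam T" "x = tK k i" by blast
    have c: "center_scale c x \<in> center_space T"
      using tK_center_space[OF k(1)] k(2) by (simp add: center_space_def cen.span_scale)
    have "Z (center_scale c x) v = 0"
      using Z_scale[OF tK_center_space[OF k(1)] v] tK_zero[OF k(1) v] k(2) by simp
    then show ?case using step Z_add[OF c _ v] c by simp (simp add: center_space_def cen.span_add)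
  qed
  then show ?thesis ..
qed

text \<open>With the centre acting by 0 the cocycle disappears, and only now is the action of LT on
  the quotient free of a projective correction.\<close>

lemma Xq_br:
  assumes x: "x \<in> G k" and y: "y \<in> G j" and p: "p \<in> Qc"
  shows "Xq (k + j) (br x y) p = Xq k x (Xq j y p) - Xq j y (Xq k x p)"
  using p
proof (rule Q_cases)
  fix v assume v: "v \<in> Vc" "p = \<pi> v"
  have cc: "center_scale (form x y) (\<Sum>i\<in>UNIV. center_scale (of_int (k $ i)) (tK (k + j) i)) \<in> center_space T"
    using cocycle_center_space[OF x y] by (simp add: cocycle_single)
  have "X k x (X j y v) = X j y (X k x v) + X (k + j) (br x y) v"
    using XX[OF x y v(1)] center_zero[OF cc v(1)] by simp
  then have "X (k + j) (br x y) v = X k x (X j y v) - X j y (X k x v)" by (simp add: algebra_simps)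
  then show ?thesis using v x y X_mem[OF x] X_mem[OF y] pi_X[OF br_grade[OF x y] v(1)]
    by (simp add: pi_X pi_diff)
qed

subsection \<open>Graded components and the maps into the loop module\<close>

text \<open>Degrees are counted from a0, which turns them into integral vectors.\<close>

definition Vr :: "int^'n \<Rightarrow> 'v set" where
  "Vr r = {v \<in> Vc. \<forall>d. D d v = sv (pairing d (a0 + ivec r)) v}"

lemma Vr_V: "v \<in> Vr r \<Longrightarrow> v \<in> Vc"
  and Vr_D: "v \<in> Vr r \<Longrightarrow> D d v = sv (pairing d (a0 + ivec r)) v"
  by (simp_all add: Vr_def)

lemma wtsp_Vr: "wtsp \<alpha> (a0 + ivec r) \<subseteq> Vr r"
  by (auto simp: wtsp_def Vr_def)

lemma subspace_Vr: "v.subspace (Vr r)"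
  using subspace_V v.endo_on_add[OF D_endo] v.endo_on_scale[OF D_endo] v.endo_on_0[OF D_endo subspace_V]
  by (intro v.subspaceI)
    (auto simp: Vr_def v.subspace_0 v.subspace_add v.subspace_scale v.scale_right_distrib mult.commute)

lemma X_Vr:
  assumes "x \<in> G k" "v \<in> Vr r"
  shows "X k x v \<in> Vr (r + k)"
proof -
  have v: "v \<in> Vc" using Vr_V assms(2) .
  have "D d (X k x v) = sv (pairing d (a0 + ivec (r + k))) (X k x v)" for d
  proof -
    have "D d (X k x v) = sv (pairing d (a0 + ivec r) + pairing d (ivec k)) (X k x v)"
      using DX[OF assms(1) v, of d] Vr_D[OF assms(2), of d] v.endo_on_scale[OF X_endo[OF assms(1)] v]
      by (simp add: v.scale_left_distrib)
    then show ?thesis by (simp only: ivec_add pairing_add2 add.assoc)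
  qed
  then show ?thesis using X_mem[OF assms(1) v] by (simp add: Vr_def)
qed

text \<open>V is identified with the finitely supported functions whose value at r lies in
  \<open>Vr r\<close>: on these \<open>total\<close> is bijective, and \<open>components\<close> is
  its inverse.\<close>

definition total :: "(int^'n \<Rightarrow>\<^sub>0 'v) \<Rightarrow> 'v" where
  "total p = (\<Sum>r\<in>Poly_Mapping.keys p. Poly_Mapping.lookup p r)"

definition graded :: "(int^'n \<Rightarrow>\<^sub>0 'v) \<Rightarrow> bool" where
  "graded p \<longleftrightarrow> (\<forall>r. Poly_Mapping.lookup p r \<in> Vr r)"

lemma total_superset: "finite F \<Longrightarrow> Poly_Mapping.keys p \<subseteq> F \<Longrightarrow> total p = (\<Sum>r\<in>F. Poly_Mapping.lookup p r)"
  unfolding total_def by (rule sum.mono_neutral_left) (auto simp: in_keys_iff)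

lemma total_add: "total (p + q) = total p + total q"
proof -
  let ?F = "Poly_Mapping.keys p \<union> Poly_Mapping.keys q"
  have "Poly_Mapping.keys (p + q) \<subseteq> ?F" by (rule Poly_Mapping.keys_add)
  then show ?thesis
    using total_superset[of ?F "p + q"] total_superset[of ?F p] total_superset[of ?F q]
    by (simp add: lookup_add sum.distrib)
qed

lemma total_single [simp]: "total (Poly_Mapping.single r v) = v"
  by (simp add: total_def)

lemma total_zero [simp]: "total 0 = 0"
  by (simp add: total_def)

lemma total_sum: "total (\<Sum>i\<in>F. p i) = (\<Sum>i\<in>F. total (p i))"
  by (induction F rule: infinite_finite_induct) (simp_all add: total_add)

lemma graded_add: "graded p \<Longrightarrow> graded q \<Longrightarrow> graded (p + q)"
  by (simp add: graded_def lookup_add v.subspace_add[OF subspace_Vr])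

lemma graded_zero [simp]: "graded 0"
  by (simp add: graded_def v.subspace_0[OF subspace_Vr])

lemma graded_sum: "(\<And>i. i \<in> F \<Longrightarrow> graded (p i)) \<Longrightarrow> graded (\<Sum>i\<in>F. p i)"
  by (induction F rule: infinite_finite_induct) (simp_all add: graded_add)

lemma graded_single: "v \<in> Vr r \<Longrightarrow> graded (Poly_Mapping.single r v)"
  by (simp add: graded_def lookup_single when_def v.subspace_0[OF subspace_Vr])

lemma graded_minus: "graded p \<Longrightarrow> graded (- p)"
  by (simp add: graded_def v.subspace_neg[OF subspace_Vr])

lemma total_inj:
  assumes p: "graded p" and t: "total p = 0"
  shows "p = 0"
proof (rule poly_mapping_eqI)
  fix r
  show "Poly_Mapping.lookup p r = Poly_Mapping.lookup 0 r"
  proof (cases "r \<in> Poly_Mapping.keys p")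
    case True
    have "Poly_Mapping.lookup p r \<in> {0}"
    proof (rule v.weight_extract[where M = Vc and H = UNIV and T = D and F = "Poly_Mapping.keys p"
          and \<mu> = "\<lambda>r d. pairing d (a0 + ivec r)" and v = "Poly_Mapping.lookup p"])
      show "\<exists>d\<in>UNIV. pairing d (a0 + ivec i) \<noteq> pairing d (a0 + ivec j)" if "i \<noteq> j" for i j
        using that pairing_eq_iff[of "a0 + ivec i" "a0 + ivec j"] by auto
      show "D d w \<in> {0}" if "w \<in> {0}" for d w using that v.endo_on_0[OF D_endo subspace_V] by simp
      show "Poly_Mapping.lookup p i \<in> Vc" for i using p Vr_V by (auto simp: graded_def)
      show "D d (Poly_Mapping.lookup p i) = sv (pairing d (a0 + ivec i)) (Poly_Mapping.lookup p i)" for i d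
        using p Vr_D by (auto simp: graded_def)
    qed (use t True subspace_V D_endo in \<open>auto simp: total_def v.endo_on_def\<close>)
    then show ?thesis by simp
  qed (simp add: in_keys_iff)
qed

lemma total_surj: "v \<in> Vc \<Longrightarrow> \<exists>p. graded p \<and> total p = v"
proof -
  assume "v \<in> Vc"
  then have "v \<in> v.span (\<Union>i\<in>weight_set \<times> range (\<lambda>r. a0 + ivec r). wts i)" using V_span_weight_set by simp
  then obtain F u where F: "finite F" "F \<subseteq> weight_set \<times> range (\<lambda>r. a0 + ivec r)" "\<forall>i\<in>F. u i \<in> wts i" "v = (\<Sum>i\<in>F. u i)"
    by (rule wts_decompose)
  have "\<forall>i\<in>F. \<exists>r. u i \<in> Vr r" using F(2,3) wtsp_Vr by fastforce
  then obtain r where "\<forall>i\<in>F. u i \<in> Vr (r i)" by metis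
  then have "graded (\<Sum>i\<in>F. Poly_Mapping.single (r i) (u i))" by (intro graded_sum graded_single) blast
  moreover have "total (\<Sum>i\<in>F. Poly_Mapping.single (r i) (u i)) = v" by (simp add: total_sum F(4))
  ultimately show ?thesis by blast
qed

definition components :: "'v \<Rightarrow> (int^'n \<Rightarrow>\<^sub>0 'v)" where
  "components v = (THE p. graded p \<and> total p = v)"

lemma total_unique: "graded p \<Longrightarrow> graded q \<Longrightarrow> total p = total q \<Longrightarrow> p = q"
  using total_inj[of "p + - q"] total_add[of "p + - q" q] graded_add[OF _ graded_minus, of p q] by simp

lemma comp_eqI: "graded p \<Longrightarrow> total p = v \<Longrightarrow> components v = p"
  unfolding components_def using total_unique by blast

lemma comp_graded: "v \<in> Vc \<Longrightarrow> graded (components v)"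
  and comp_total: "v \<in> Vc \<Longrightarrow> total (components v) = v"
  using total_surj comp_eqI by metis+

lemma comp_Vr: "v \<in> Vc \<Longrightarrow> Poly_Mapping.lookup (components v) r \<in> Vr r"
  using comp_graded by (simp add: graded_def)

lemma comp_V: "v \<in> Vc \<Longrightarrow> Poly_Mapping.lookup (components v) r \<in> Vc"
  using comp_Vr Vr_V by blast

lemma comp_add: "v \<in> Vc \<Longrightarrow> w \<in> Vc \<Longrightarrow> components (v + w) = components v + components w"
  by (rule comp_eqI) (simp_all add: graded_add comp_graded total_add comp_total)

lemma comp_homogeneous: "v \<in> Vr r \<Longrightarrow> components v = Poly_Mapping.single r v"
  by (rule comp_eqI) (simp_all add: graded_single)

lemma total_pm_weight: "total (pm_weight sv (\<lambda>_. c) p) = sv c (total p)"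
proof -
  have "Poly_Mapping.keys (pm_weight sv (\<lambda>_. c) p) \<subseteq> Poly_Mapping.keys p"
    by (auto simp: in_keys_iff lookup_pm_weight[OF v.vector_space_axioms])
  then show ?thesis
    using total_superset[of "Poly_Mapping.keys p" "pm_weight sv (\<lambda>_. c) p"]
    by (simp add: lookup_pm_weight[OF v.vector_space_axioms] total_def v.scale_sum_right)
qed

lemma comp_scale: "v \<in> Vc \<Longrightarrow> Poly_Mapping.lookup (components (sv c v)) r = sv c (Poly_Mapping.lookup (components v) r)"
proof -
  assume v: "v \<in> Vc"
  have "components (sv c v) = pm_weight sv (\<lambda>_. c) (components v)"
    by (rule comp_eqI)
      (simp_all add: total_pm_weight comp_total v graded_def lookup_pm_weight[OF v.vector_space_axioms]
        v.subspace_scale[OF subspace_Vr] comp_Vr)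
  then show ?thesis by (simp add: lookup_pm_weight[OF v.vector_space_axioms])
qed

lemma comp_D: "v \<in> Vc \<Longrightarrow> Poly_Mapping.lookup (components (D d v)) r = sv (pairing d (a0 + ivec r)) (Poly_Mapping.lookup (components v) r)"
proof -
  assume v: "v \<in> Vc"
  let ?p = "pm_weight sv (\<lambda>r. pairing d (a0 + ivec r)) (components v)"
  have "Poly_Mapping.keys ?p \<subseteq> Poly_Mapping.keys (components v)"
    by (auto simp: in_keys_iff lookup_pm_weight[OF v.vector_space_axioms])
  then have "total ?p = (\<Sum>r\<in>Poly_Mapping.keys (components v). D d (Poly_Mapping.lookup (components v) r))"
    using total_superset[of "Poly_Mapping.keys (components v)" ?p]
    by (simp add: lookup_pm_weight[OF v.vector_space_axioms] Vr_D[OF comp_Vr[OF v]])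
  also have "\<dots> = D d (total (components v))"
    unfolding total_def by (rule v.endo_on_sum[OF D_endo subspace_V, symmetric]) (rule comp_V[OF v])
  finally have "total ?p = D d v" by (simp add: comp_total v)
  then have "components (D d v) = ?p"
    by (rule comp_eqI[rotated])
      (simp add: graded_def lookup_pm_weight[OF v.vector_space_axioms] v.subspace_scale[OF subspace_Vr] comp_Vr v)
  then show ?thesis by (simp add: lookup_pm_weight[OF v.vector_space_axioms])
qed

lemma comp_X:
  assumes x: "x \<in> G k" and v: "v \<in> Vc"
  shows "Poly_Mapping.lookup (components (X k x v)) r = X k x (Poly_Mapping.lookup (components v) (r - k))"
proof -
  let ?K = "Poly_Mapping.keys (components v)"
  let ?p = "\<Sum>r\<in>?K. Poly_Mapping.single (r + k) (X k x (Poly_Mapping.lookup (components v) r))"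
  have "total ?p = (\<Sum>r\<in>?K. X k x (Poly_Mapping.lookup (components v) r))" by (simp add: total_sum)
  also have "\<dots> = X k x (total (components v))"
    unfolding total_def by (rule v.endo_on_sum[OF X_endo[OF x] subspace_V, symmetric]) (rule comp_V[OF v])
  finally have "total ?p = X k x v" by (simp add: comp_total v)
  moreover have "graded ?p" by (intro graded_sum graded_single X_Vr[OF x] comp_Vr[OF v])
  ultimately have "components (X k x v) = ?p" by (intro comp_eqI)
  also have "Poly_Mapping.lookup ?p r = (\<Sum>j\<in>?K. if j = r - k then X k x (Poly_Mapping.lookup (components v) (r - k)) else 0)"
    unfolding lookup_sum by (rule sum.cong) (auto simp: lookup_single when_def)
  also have "\<dots> = X k x (Poly_Mapping.lookup (components v) (r - k))"
    using v.endo_on_0[OF X_endo[OF x] subspace_V] by (simp add: in_keys_iff)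
  finally show ?thesis .
qed

end

section \<open>Isomorphisms of modules and grade shifts\<close>

lemma module_iso_trans:
  assumes "module_iso L A B" "module_iso L B C"
  shows "module_iso L A C"
proof -
  obtain f where f: "bij_betw f (mcarrier A) (mcarrier B)" "linear_on (mscale A) (mcarrier A) (mscale B) f"
    "\<forall>x\<in>lcarrier L. \<forall>v\<in>mcarrier A. f (mact A x v) = mact B x (f v)"
    using assms(1) unfolding module_iso_def by (elim exE conjE)
  obtain g where g: "bij_betw g (mcarrier B) (mcarrier C)" "linear_on (mscale B) (mcarrier B) (mscale C) g"
    "\<forall>x\<in>lcarrier L. \<forall>v\<in>mcarrier B. g (mact B x v) = mact C x (g v)"
    using assms(2) unfolding module_iso_def by (elim exE conjE)
  have mem: "f v \<in> mcarrier B" if "v \<in> mcarrier A" for v using f(1) that by (auto simp: bij_betw_def)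
  show ?thesis
    unfolding module_iso_def
  proof (intro exI[of _ "g \<circ> f"] conjI)
    show "bij_betw (g \<circ> f) (mcarrier A) (mcarrier C)" using f(1) g(1) by (rule bij_betw_trans)
    show "linear_on (mscale A) (mcarrier A) (mscale C) (g \<circ> f)"
      using f(2) g(2) mem by (simp add: linear_on_def)
    show "\<forall>x\<in>lcarrier L. \<forall>v\<in>mcarrier A. (g \<circ> f) (mact A x v) = mact C x ((g \<circ> f) v)"
      using f(3) g(3) mem by simp
  qed
qed

lemma module_iso_sym:
  assumes iso: "module_iso L A B"
    and A: "\<And>v w. v \<in> mcarrier A \<Longrightarrow> w \<in> mcarrier A \<Longrightarrow> v + w \<in> mcarrier A"
      "\<And>c v. v \<in> mcarrier A \<Longrightarrow> mscale A c v \<in> mcarrier A"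
      "\<And>x v. x \<in> lcarrier L \<Longrightarrow> v \<in> mcarrier A \<Longrightarrow> mact A x v \<in> mcarrier A"
  shows "module_iso L B A"
proof -
  obtain f where f: "bij_betw f (mcarrier A) (mcarrier B)" "linear_on (mscale A) (mcarrier A) (mscale B) f"
    "\<forall>x\<in>lcarrier L. \<forall>v\<in>mcarrier A. f (mact A x v) = mact B x (f v)"
    using iso unfolding module_iso_def by (elim exE conjE)
  let ?g = "inv_into (mcarrier A) f"
  have g: "?g v \<in> mcarrier A" "f (?g v) = v" if "v \<in> mcarrier B" for v
    using f(1) that by (auto simp: bij_betw_def inv_into_into f_inv_into_f)
  have gI: "?g w = v" if "v \<in> mcarrier A" "f v = w" for v w
    using f(1) that by (auto simp: bij_betw_def inv_into_f_f)
  show ?thesis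
    unfolding module_iso_def
  proof (intro exI[of _ ?g] conjI ballI)
    show "bij_betw ?g (mcarrier B) (mcarrier A)" using f(1) by (rule bij_betw_inv_into)
    show "linear_on (mscale B) (mcarrier B) (mscale A) ?g"
      unfolding linear_on_def
    proof (intro conjI ballI allI)
      fix v w assume vw: "v \<in> mcarrier B" "w \<in> mcarrier B"
      show "?g (v + w) = ?g v + ?g w"
        by (rule gI) (use A(1) f(2) g vw in \<open>auto simp: linear_on_def\<close>)
    next
      fix c v assume v: "v \<in> mcarrier B"
      show "?g (mscale B c v) = mscale A c (?g v)"
        by (rule gI) (use A(2) f(2) g v in \<open>auto simp: linear_on_def\<close>)
    qed
    fix x v assume x: "x \<in> lcarrier L" and v: "v \<in> mcarrier B"
    show "?g (mact B x v) = mact A x (?g v)"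
      by (rule gI) (use A(3) f(3) g v x in auto)
  qed
qed

lemma module_iso_grade_shift:
  assumes "module_iso (hat_alg T) A B" and closed: "\<And>x d v. x \<in> LT T \<Longrightarrow> v \<in> mcarrier A \<Longrightarrow> mact A (x, d) v \<in> mcarrier A"
    "\<And>c v. v \<in> mcarrier A \<Longrightarrow> mscale A c v \<in> mcarrier A"
  shows "module_iso (hat_alg T) (grade_shift s A) (grade_shift s B)"
proof -
  obtain f where f: "bij_betw f (mcarrier A) (mcarrier B)" "linear_on (mscale A) (mcarrier A) (mscale B) f"
    "\<forall>x\<in>lcarrier (hat_alg T). \<forall>v\<in>mcarrier A. f (mact A x v) = mact B x (f v)"
    using assms(1) unfolding module_iso_def by (elim exE conjE)
  show ?thesis
    unfolding module_iso_def
  proof (intro exI[of _ f] conjI ballI)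
    fix x v assume x: "x \<in> lcarrier (hat_alg T)" and v: "v \<in> mcarrier (grade_shift s A)"
    obtain y d where y: "x = (y, d)" "y \<in> LT T" using x by (auto simp: hat_alg_def)
    have v': "v \<in> mcarrier A" using v by (simp add: grade_shift_def)
    have "f (mact A (y, d) v + mscale A (- pairing d (ivec s)) v) =
        f (mact A (y, d) v) + mscale B (- pairing d (ivec s)) (f v)"
      using f(2) closed y v' by (simp add: linear_on_def)
    then show "f (mact (grade_shift s A) x v) = mact (grade_shift s B) x (f v)"
      using f(3) x v' y by (simp add: grade_shift_def)
  qed (use f in \<open>simp_all add: grade_shift_def\<close>)
qed

context complex_vs
begin

subsection \<open>Sums of irreducible submodules\<close>

lemma submodule_restrict_iff:
  assumes "mscale M = sc"
  shows "submodule L (M\<lparr>mcarrier := U\<rparr>) W \<longleftrightarrow>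
    W \<subseteq> U \<and> subspace W \<and> (\<forall>x\<in>lcarrier L. \<forall>v\<in>W. mact M x v \<in> W)"
  using assms by (simp add: submodule_def)

text \<open>The submodules are processed one at a time. An irreducible U meets the sum of the
  earlier ones in U or in 0; in the first case it is discarded, in the second it extends the direct
  sum.\<close>

lemma irreducible_sum_direct:
  fixes M :: "('l, 'v) lmod" and L :: "'l lie_alg"
  assumes sc: "mscale M = sc" and M: "subspace (mcarrier M)"
    and endo: "\<And>x. x \<in> lcarrier L \<Longrightarrow> endo_on (mcarrier M) (mact M x)"
    and F: "finite F" "\<And>U. U \<in> F \<Longrightarrow> submodule L M U \<and> irreducible_module L (M\<lparr>mcarrier := U\<rparr>)"
  shows "\<exists>C\<subseteq>F. direct_sum sc C id (span (\<Union>F))"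
  using F
proof (induction F rule: finite_induct)
  case empty
  show ?case by (auto simp: direct_sum_def)
next
  case (insert U F)
  then obtain C where C: "C \<subseteq> F" "direct_sum sc C id (span (\<Union>F))" by blast
  let ?S = "span (\<Union>F)"
  have S: "?S = span (\<Union>C)" using C(2) by (simp add: direct_sum_def)
  have U: "U \<subseteq> mcarrier M" "subspace U" "\<And>x v. x \<in> lcarrier L \<Longrightarrow> v \<in> U \<Longrightarrow> mact M x v \<in> U"
    using insert.prems[of U] sc by (auto simp: submodule_def)
  have FM: "\<Union>F \<subseteq> mcarrier M" using insert.prems by (auto simp: submodule_def)
  have Sst: "mact M x v \<in> ?S" if x: "x \<in> lcarrier L" and v: "v \<in> ?S" for x v
  proof (rule endo_on_span_closed[OF endo[OF x] M FM subspace_span _ v])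
    fix w assume "w \<in> \<Union>F"
    then have "mact M x w \<in> \<Union>F" using insert.prems x by (auto simp: submodule_def)
    then show "mact M x w \<in> ?S" by (rule span_base)
  qed
  have "submodule L (M\<lparr>mcarrier := U\<rparr>) (U \<inter> ?S)"
    unfolding submodule_restrict_iff[OF sc] using U Sst by (auto intro: subspace_inter subspace_span)
  then consider "U \<inter> ?S = U" | "U \<inter> ?S = {0}"
    using insert.prems[of U] by (auto simp: irreducible_module_def)
  then show ?case
  proof cases
    case 1
    then have "span (\<Union>(insert U F)) = ?S"
      by (intro subset_antisym span_minimal span_mono) (auto intro: span_base)
    then have "direct_sum sc C id (span (\<Union>(insert U F)))" using C(2) by (simp only:)
    then show ?thesis using C(1) by blast
  next
    case 2
    have "direct_sum sc (insert U C) id (span (\<Union>(insert U F)))"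
      unfolding direct_sum_def
    proof (intro conjI allI impI)
      have "span (U \<union> \<Union>F) = span (U \<union> \<Union>C)"
      proof (rule subset_antisym)
        have "\<Union>F \<subseteq> span (\<Union>C)" using S span_superset[of "\<Union>F"] by simp
        also have "\<dots> \<subseteq> span (U \<union> \<Union>C)" by (rule span_mono) simp
        finally show "span (U \<union> \<Union>F) \<subseteq> span (U \<union> \<Union>C)"
          using span_superset[of "U \<union> \<Union>C"] by (intro span_minimal) auto
        show "span (U \<union> \<Union>C) \<subseteq> span (U \<union> \<Union>F)" using C(1) by (intro span_mono) auto
      qed
      then show "span (\<Union>(insert U F)) = span (\<Union>i\<in>insert U C. id i)" by simp
      fix A x assume A: "A \<subseteq> insert U C" "finite A" "\<forall>i\<in>A. x i \<in> id i" "(\<Sum>i\<in>A. x i) = 0"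
      let ?s = "\<Sum>i\<in>A - {U}. x i"
      have sS: "?s \<in> ?S" unfolding S using A by (intro span_sum span_base) auto
      have split: "(\<Sum>i\<in>A. x i) = (if U \<in> A then x U else 0) + ?s" using A(2) by (simp add: sum.remove)
      have xU: "(if U \<in> A then x U else 0) = 0"
      proof (cases "U \<in> A")
        case True
        then have "x U = - ?s" using split A(4) by (simp add: eq_neg_iff_add_eq_0)
        then have "x U \<in> U \<inter> ?S" using sS A(3) True by (auto simp: span_neg)
        then show ?thesis using 2 by simp
      qed simp
      then have "?s = 0" using split A(4) by simp
      moreover have "A - {U} \<subseteq> C" "finite (A - {U})" using A by auto
      ultimately have "\<forall>i\<in>A - {U}. x i = 0"
        using C(2)[unfolded direct_sum_def, THEN conjunct2, rule_format, of "A - {U}" x] A(3) by blast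
      then show "\<forall>i\<in>A. x i = 0" using xU by (metis DiffI singletonD)
    qed
    moreover have "insert U C \<subseteq> insert U F" using C(1) by blast
    ultimately show ?thesis by blast
  qed
qed

lemma direct_sum_decompose:
  assumes ds: "direct_sum sc C id M" and C: "finite C" "\<And>W. W \<in> C \<Longrightarrow> subspace W" and v: "v \<in> M"
  shows "\<exists>x. (\<forall>W\<in>C. x W \<in> W) \<and> v = (\<Sum>W\<in>C. x W)"
proof -
  have "v \<in> span (\<Union>i\<in>C. id i)" using ds v by (simp add: direct_sum_def)
  then have "\<exists>F u. finite F \<and> F \<subseteq> C \<and> (\<forall>i\<in>F. u i \<in> id i) \<and> v = (\<Sum>i\<in>F. u i)"
    by (rule span_UN_subspaces[rotated]) (use C in simp)
  then obtain F u where F: "F \<subseteq> C" "\<forall>i\<in>F. u i \<in> id i" "v = (\<Sum>i\<in>F. u i)" by (elim exE conjE)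
  have "(\<Sum>W\<in>C. if W \<in> F then u W else 0) = (\<Sum>W\<in>F. if W \<in> F then u W else 0)"
    by (rule sum.mono_neutral_right) (use F(1) C(1) in auto)
  also have "\<dots> = v" unfolding F(3) by (rule sum.cong) auto
  finally show ?thesis using F(2) C(2)
    by (intro exI[of _ "\<lambda>W. if W \<in> F then u W else 0"]) (auto simp: subspace_0)
qed

text \<open>Some coordinate of the direct sum is non-zero on U. Irreducibility of U makes this
  coordinate map injective, irreducibility of the summand makes it surjective; U itself may lie
  diagonally in the sum.\<close>

lemma irreducible_iso_summand:
  fixes M :: "('l, 'v) lmod" and L :: "'l lie_alg"
  assumes sc: "mscale M = sc"
    and endo: "\<And>x. x \<in> lcarrier L \<Longrightarrow> endo_on (mcarrier M) (mact M x)"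
    and dec: "irreducible_decomposition L M C" and fin: "finite C"
    and U: "submodule L M U" "irreducible_module L (M\<lparr>mcarrier := U\<rparr>)"
  shows "\<exists>W\<in>C. module_iso L (M\<lparr>mcarrier := U\<rparr>) (M\<lparr>mcarrier := W\<rparr>)"
proof -
  have W: "W \<subseteq> mcarrier M" "subspace W" "\<And>x v. x \<in> lcarrier L \<Longrightarrow> v \<in> W \<Longrightarrow> mact M x v \<in> W"
    "irreducible_module L (M\<lparr>mcarrier := W\<rparr>)" if "W \<in> C" for W
    using dec that sc by (auto simp: irreducible_decomposition_def submodule_def)
  have ds: "direct_sum sc C id (mcarrier M)" using dec sc by (simp add: irreducible_decomposition_def)
  have Us: "U \<subseteq> mcarrier M" "subspace U" "\<And>x v. x \<in> lcarrier L \<Longrightarrow> v \<in> U \<Longrightarrow> mact M x v \<in> U"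
    using U(1) sc by (auto simp: submodule_def)
  have "\<forall>v\<in>mcarrier M. \<exists>x. (\<forall>W\<in>C. x W \<in> W) \<and> v = (\<Sum>W\<in>C. x W)"
    using direct_sum_decompose[OF ds fin W(2)] by blast
  from bchoice[OF this] obtain pr where pr: "\<forall>v\<in>mcarrier M. (\<forall>W\<in>C. pr v W \<in> W) \<and> v = (\<Sum>W\<in>C. pr v W)" ..
  \<comment> \<open>Uniqueness of coordinates is what makes the chosen \<open>pr\<close> linear and
    compatible with the action.\<close>
  have uniq: "pr v W = x W" if "v \<in> mcarrier M" "\<And>W. W \<in> C \<Longrightarrow> x W \<in> W" "v = (\<Sum>W\<in>C. x W)" "W \<in> C" for v x W
  proof -
    have "(\<Sum>W\<in>C. pr v W - x W) = 0" using pr that(1,3) by (simp add: sum_subtractf)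
    moreover have "\<forall>W\<in>C. pr v W - x W \<in> id W" using pr that(1,2) W(2) by (simp add: subspace_diff)
    ultimately have "pr v W - x W = 0"
      using ds[unfolded direct_sum_def, THEN conjunct2, rule_format, of C "\<lambda>W. pr v W - x W" W] fin that(4) by simp
    then show ?thesis by simp
  qed
  have pr_add: "pr (v + w) W = pr v W + pr w W" if v: "v \<in> U" and w: "w \<in> U" and WC: "W \<in> C" for v w W
  proof -
    have vw: "v \<in> mcarrier M" "w \<in> mcarrier M" "v + w \<in> mcarrier M" using v w Us by (auto simp: subspace_add)
    have "v + w = (\<Sum>W\<in>C. pr v W + pr w W)" using pr vw by (simp add: sum.distrib)
    then show ?thesis using uniq[OF vw(3), of "\<lambda>W. pr v W + pr w W"] pr vw W(2) WC by (simp add: subspace_add)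
  qed
  have pr_scale: "pr (sc c v) W = sc c (pr v W)" if v: "v \<in> U" and WC: "W \<in> C" for c v W
  proof -
    have vm: "v \<in> mcarrier M" "sc c v \<in> mcarrier M" using v Us by (auto simp: subspace_scale)
    have "sc c v = (\<Sum>W\<in>C. sc c (pr v W))" using pr vm by (simp add: scale_sum_right[symmetric])
    then show ?thesis using uniq[OF vm(2), of "\<lambda>W. sc c (pr v W)"] pr vm W(2) WC by (simp add: subspace_scale)
  qed
  have MS: "subspace (mcarrier M)" using ds by (simp add: direct_sum_def)
  have pr_act: "pr (mact M x v) W = mact M x (pr v W)" if x: "x \<in> lcarrier L" and v: "v \<in> U" and WC: "W \<in> C" for x v W
  proof -
    have vm: "v \<in> mcarrier M" "mact M x v \<in> mcarrier M" using v Us x by auto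
    have "mact M x (\<Sum>W\<in>C. pr v W) = (\<Sum>W\<in>C. mact M x (pr v W))"
      by (rule endo_on_sum[OF endo[OF x] MS]) (use pr vm W(1) in blast)
    then have "mact M x v = (\<Sum>W\<in>C. mact M x (pr v W))" using pr vm by simp
    then show ?thesis using uniq[OF vm(2), of "\<lambda>W. mact M x (pr v W)"] pr vm W(3)[OF _ x] WC by simp
  qed
  have U0: "0 \<in> U" using Us(2) by (rule subspace_0)
  obtain u where u: "u \<in> U" "u \<noteq> 0" using U(2) U0 by (auto simp: irreducible_module_def)
  obtain W where WC: "W \<in> C" "pr u W \<noteq> 0" using u pr Us(1) by (metis subsetD sum.neutral)
  let ?p = "\<lambda>v. pr v W"
  have p0: "?p 0 = 0" using pr_scale[OF u(1) WC(1), of 0] by simp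
  have "submodule L (M\<lparr>mcarrier := U\<rparr>) {v \<in> U. ?p v = 0}"
    unfolding submodule_restrict_iff[OF sc]
  proof (intro conjI ballI)
    show "subspace {v \<in> U. ?p v = 0}"
      using Us(2) U0 p0 pr_add pr_scale WC(1) by (intro subspaceI) (auto simp: subspace_add subspace_scale)
    fix x v assume x: "x \<in> lcarrier L" and v: "v \<in> {v \<in> U. ?p v = 0}"
    then show "mact M x v \<in> {v \<in> U. ?p v = 0}"
      using Us(3) pr_act[OF x _ WC(1)] endo_on_0[OF endo[OF x] MS] by simp
  qed auto
  then have "{v \<in> U. ?p v = 0} = {0} \<or> {v \<in> U. ?p v = 0} = U"
    using U(2) by (auto simp: irreducible_module_def)
  then have ker: "v = 0" if "v \<in> U" "?p v = 0" for v using that u WC(2) by blast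
  have "submodule L (M\<lparr>mcarrier := W\<rparr>) (?p ` U)"
    unfolding submodule_restrict_iff[OF sc]
  proof (intro conjI ballI)
    show "?p ` U \<subseteq> W" using pr Us(1) WC(1) by blast
    show "subspace (?p ` U)"
    proof (rule subspaceI)
      show "0 \<in> ?p ` U" using U0 p0 by force
      fix a b c assume "a \<in> ?p ` U" "b \<in> ?p ` U"
      then obtain v w where vw: "v \<in> U" "w \<in> U" "a = ?p v" "b = ?p w" by blast
      have "v + w \<in> U" "sc c v \<in> U" using vw Us(2) by (auto simp: subspace_add subspace_scale)
      then show "a + b \<in> ?p ` U" "sc c a \<in> ?p ` U"
        using pr_add[OF vw(1,2) WC(1)] pr_scale[OF vw(1) WC(1)] vw(3,4) by (metis imageI)+
    qed
    fix x a assume x: "x \<in> lcarrier L" and "a \<in> ?p ` U"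
    then obtain v where v: "v \<in> U" "a = ?p v" by blast
    then show "mact M x a \<in> ?p ` U" using pr_act[OF x v(1) WC(1)] Us(3)[OF x v(1)] by (metis imageI)
  qed
  then have "?p ` U = {0} \<or> ?p ` U = W" using W(4)[OF WC(1)] by (auto simp: irreducible_module_def)
  then have img: "?p ` U = W" using u(1) WC(2) by blast
  have "inj_on ?p U"
  proof (rule inj_onI)
    fix v w assume vw: "v \<in> U" "w \<in> U" "?p v = ?p w"
    have "sc (-1) w \<in> U" using vw(2) Us(2) by (simp add: subspace_scale del: scale_minus_left)
    then have "?p (v + sc (-1) w) = ?p v + ?p (sc (-1) w)" using pr_add[OF vw(1) _ WC(1)] by blast
    also have "\<dots> = ?p v + sc (-1) (?p w)" by (simp only: pr_scale[OF vw(2) WC(1)])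
    finally have "?p (v + sc (-1) w) = 0" using vw(3) by simp
    moreover have "v + sc (-1) w \<in> U" using vw(1) \<open>sc (-1) w \<in> U\<close> Us(2) by (simp only: subspace_add)
    ultimately have "v + sc (-1) w = 0" using ker by blast
    then show "v = w" by simp
  qed
  then have "module_iso L (M\<lparr>mcarrier := U\<rparr>) (M\<lparr>mcarrier := W\<rparr>)"
    unfolding module_iso_def using img pr_add pr_scale pr_act WC(1) sc
    by (intro exI[of _ ?p]) (simp add: bij_betw_def linear_on_def)
  then show ?thesis using WC(1) by blast
qed

end

context torus_quotient
begin

subsection \<open>The loop module\<close>

abbreviation LM where "LM a \<equiv> loop_module a Q"
abbreviation Lc :: "(int^'n \<Rightarrow>\<^sub>0 'q) set" where "Lc \<equiv> {p. \<forall>s. Poly_Mapping.lookup p s \<in> Qc}"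

lemma LM_carrier: "mcarrier (LM a) = Lc" and LM_scale: "mscale (LM a) = pm_scale sq"
  by (simp_all add: loop_module_def)

sublocale lm: complex_vs "pm_scale sq :: complex \<Rightarrow> (int^'n \<Rightarrow>\<^sub>0 'q) \<Rightarrow> _"
  unfolding complex_vs_def by (rule vector_space_pm_scale[OF q.vector_space_axioms])

lemmas lookup_scale [simp] = lookup_pm_weight[OF q.vector_space_axioms]

lemma subspace_Lc: "lm.subspace Lc"
  by (rule lm.subspaceI)
    (simp_all add: q.subspace_0[OF subspace_Q] lookup_add q.subspace_add[OF subspace_Q] q.subspace_scale[OF subspace_Q])

text \<open>The coefficient in degree t of the LT part of the action. Evaluating p at t - k removes
  the support of p from the formulas.\<close>

definition act :: "('g, 'n) mloop \<Rightarrow> (int^'n \<Rightarrow>\<^sub>0 'q) \<Rightarrow> int^'n \<Rightarrow> 'q" where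
  "act x p t = (\<Sum>k\<in>Poly_Mapping.keys x. Xq k (Poly_Mapping.lookup x k) (Poly_Mapping.lookup p (t - k)))"

lemma Xq_0: "x \<in> G k \<Longrightarrow> Xq k x 0 = 0"
  using q.endo_on_0[OF Xq_endo subspace_Q] .

lemma Xq_zero: "p \<in> Qc \<Longrightarrow> Xq k 0 p = 0"
  using Xq_scale[of 0 k p 0] g.subspace_0[OF subspace_grade] by simp

lemma LM_lookup:
  assumes x: "x \<in> LT T"
  shows "Poly_Mapping.lookup (mact (LM a) (x, d) p) t = act x p t + sq (pairing d (a + ivec t)) (Poly_Mapping.lookup p t)"
proof -
  have "(\<Sum>s\<in>Poly_Mapping.keys p. Poly_Mapping.lookup (Poly_Mapping.single (r + s)
      (mact Q (Poly_Mapping.single r (Poly_Mapping.lookup x r)) (Poly_Mapping.lookup p s))) t)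
      = Xq r (Poly_Mapping.lookup x r) (Poly_Mapping.lookup p (t - r))" for r
  proof -
    have "(\<Sum>s\<in>Poly_Mapping.keys p. Poly_Mapping.lookup (Poly_Mapping.single (r + s)
      (mact Q (Poly_Mapping.single r (Poly_Mapping.lookup x r)) (Poly_Mapping.lookup p s))) t) =
      (\<Sum>s\<in>Poly_Mapping.keys p. if s = t - r then Xq r (Poly_Mapping.lookup x r) (Poly_Mapping.lookup p (t - r)) else 0)"
      by (rule sum.cong) (auto simp: lookup_single when_def Xq_def)
    also have "\<dots> = Xq r (Poly_Mapping.lookup x r) (Poly_Mapping.lookup p (t - r))"
      using Xq_0[OF LT_lookup[OF x]] by (simp add: in_keys_iff)
    finally show ?thesis .
  qed
  then show ?thesis by (simp add: loop_module_def lookup_add lookup_sum act_def)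
qed

lemma act_superset:
  assumes "p \<in> Lc" "finite F" "Poly_Mapping.keys x \<subseteq> F"
  shows "act x p t = (\<Sum>k\<in>F. Xq k (Poly_Mapping.lookup x k) (Poly_Mapping.lookup p (t - k)))"
  unfolding act_def using assms by (intro sum.mono_neutral_left) (auto simp: in_keys_iff Xq_zero)

lemma act_mem: "x \<in> LT T \<Longrightarrow> p \<in> Lc \<Longrightarrow> act x p t \<in> Qc"
  unfolding act_def by (intro q.subspace_sum[OF subspace_Q]) (simp add: q.endo_on_mem[OF Xq_endo] LT_lookup)

lemma act_plus_left:
  assumes "x \<in> LT T" "y \<in> LT T" "p \<in> Lc"
  shows "act (x + y) p t = act x p t + act y p t"
proof -
  let ?F = "Poly_Mapping.keys x \<union> Poly_Mapping.keys y"
  have F: "finite ?F" "Poly_Mapping.keys (x + y) \<subseteq> ?F" "Poly_Mapping.keys x \<subseteq> ?F" "Poly_Mapping.keys y \<subseteq> ?F"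
    using Poly_Mapping.keys_add[of x y] by auto
  show ?thesis
    using assms act_superset[OF assms(3) F(1,2)] act_superset[OF assms(3) F(1,3)] act_superset[OF assms(3) F(1,4)]
    by (simp add: lookup_add Xq_add LT_lookup sum.distrib)
qed

lemma act_zero_left: "act 0 p t = 0"
  by (simp add: act_def)

lemma act_weight_left:
  assumes "x \<in> LT T" "p \<in> Lc"
  shows "act (pm_weight sg \<phi> x) p t =
    (\<Sum>k\<in>Poly_Mapping.keys x. sq (\<phi> k) (Xq k (Poly_Mapping.lookup x k) (Poly_Mapping.lookup p (t - k))))"
proof -
  have "Poly_Mapping.keys (pm_weight sg \<phi> x) \<subseteq> Poly_Mapping.keys x"
    by (auto simp: in_keys_iff lookup_pm_weight[OF g.vector_space_axioms])
  then show ?thesis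
    using assms act_superset[OF assms(2), of "Poly_Mapping.keys x" "pm_weight sg \<phi> x"]
    by (simp add: lookup_pm_weight[OF g.vector_space_axioms] Xq_scale LT_lookup)
qed

lemma act_scale_left: "x \<in> LT T \<Longrightarrow> p \<in> Lc \<Longrightarrow> act (pm_scale sg c x) p t = sq c (act x p t)"
  unfolding act_weight_left by (simp add: act_def q.scale_sum_right)

lemma LT_weight: "x \<in> LT T \<Longrightarrow> pm_weight sg \<phi> x \<in> LT T"
  by (simp add: LT_def lookup_pm_weight[OF g.vector_space_axioms] g.subspace_scale[OF subspace_grade])

lemma LT_deriv: "x \<in> LT T \<Longrightarrow> loop_deriv T d x \<in> LT T"
  unfolding loop_deriv_def by (rule LT_weight)

lemma LT_sum: "(\<And>i. i \<in> F \<Longrightarrow> x i \<in> LT T) \<Longrightarrow> (\<Sum>i\<in>F. x i) \<in> LT T"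
  by (induction F rule: infinite_finite_induct) (simp_all add: LT_add)

lemma LT_br: "x \<in> LT T \<Longrightarrow> y \<in> LT T \<Longrightarrow> loop_br T x y \<in> LT T"
  unfolding loop_br_def by (intro LT_sum LT_single br_grade LT_lookup)

lemma LT_diff: "x \<in> LT T \<Longrightarrow> y \<in> LT T \<Longrightarrow> x - y \<in> LT T"
  by (simp add: LT_def lookup_minus g.subspace_diff[OF subspace_grade])

lemma act_single: "p \<in> Lc \<Longrightarrow> act (Poly_Mapping.single k x) p t = Xq k x (Poly_Mapping.lookup p (t - k))"
  by (cases "x = 0") (simp_all add: act_def Xq_zero)

lemma act_sum_left: "(\<And>i. i \<in> F \<Longrightarrow> x i \<in> LT T) \<Longrightarrow> p \<in> Lc \<Longrightarrow> act (\<Sum>i\<in>F. x i) p t = (\<Sum>i\<in>F. act (x i) p t)"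
  by (induction F rule: infinite_finite_induct) (simp_all add: act_zero_left act_plus_left LT_sum)

lemma act_diff_left:
  assumes "x \<in> LT T" "y \<in> LT T" "p \<in> Lc"
  shows "act (x - y) p t = act x p t - act y p t"
  using act_plus_left[OF LT_diff[OF assms(1,2)] assms(2,3)] by simp

text \<open>\<open>Xq_br\<close> summed over all pairs of degrees, with the two resulting double
  sums reassembled in opposite orders.\<close>

lemma act_br:
  assumes x: "x \<in> LT T" and y: "y \<in> LT T" and p: "p \<in> Lc"
  shows "act (loop_br T x y) p t =
    (\<Sum>k\<in>Poly_Mapping.keys x. Xq k (Poly_Mapping.lookup x k) (act y p (t - k))) -
    (\<Sum>j\<in>Poly_Mapping.keys y. Xq j (Poly_Mapping.lookup y j) (act x p (t - j)))"
proof -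
  let ?x = "Poly_Mapping.lookup x" and ?y = "Poly_Mapping.lookup y" and ?p = "Poly_Mapping.lookup p"
  let ?K = "Poly_Mapping.keys x" and ?J = "Poly_Mapping.keys y"
  have xg: "?x k \<in> G k" and yg: "?y k \<in> G k" for k using x y LT_lookup by auto
  have pQ: "?p s \<in> Qc" for s using p by simp
  have pX: "Xq k (?x k) (?p s) \<in> Qc" "Xq k (?y k) (?p s) \<in> Qc" for k s
    using q.endo_on_mem[OF Xq_endo] xg yg pQ by auto
  have LTs: "Poly_Mapping.single (k + j) (br (?x k) (?y j)) \<in> LT T" for k j
    using LT_single[OF br_grade[OF xg yg]] .
  have "act (loop_br T x y) p t = (\<Sum>k\<in>?K. \<Sum>j\<in>?J. act (Poly_Mapping.single (k + j) (br (?x k) (?y j))) p t)"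
  proof -
    have "act (loop_br T x y) p t = (\<Sum>k\<in>?K. act (\<Sum>j\<in>?J. Poly_Mapping.single (k + j) (br (?x k) (?y j))) p t)"
      unfolding loop_br_def by (rule act_sum_left[OF LT_sum[OF LTs] p])
    also have "\<dots> = (\<Sum>k\<in>?K. \<Sum>j\<in>?J. act (Poly_Mapping.single (k + j) (br (?x k) (?y j))) p t)"
      by (rule sum.cong[OF refl]) (rule act_sum_left[OF LTs p])
    finally show ?thesis .
  qed
  also have "\<dots> = (\<Sum>k\<in>?K. \<Sum>j\<in>?J. Xq k (?x k) (Xq j (?y j) (?p (t - k - j))) - Xq j (?y j) (Xq k (?x k) (?p (t - j - k))))"
  proof (intro sum.cong refl)
    fix k j
    have i: "t - (k + j) = t - k - j" "t - j - k = t - k - j" by simp_all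
    show "act (Poly_Mapping.single (k + j) (br (?x k) (?y j))) p t =
        Xq k (?x k) (Xq j (?y j) (?p (t - k - j))) - Xq j (?y j) (Xq k (?x k) (?p (t - j - k)))"
      unfolding act_single[OF p] i by (rule Xq_br[OF xg yg pQ])
  qed
  also have "\<dots> = (\<Sum>k\<in>?K. \<Sum>j\<in>?J. Xq k (?x k) (Xq j (?y j) (?p (t - k - j)))) -
      (\<Sum>j\<in>?J. \<Sum>k\<in>?K. Xq j (?y j) (Xq k (?x k) (?p (t - j - k))))"
    unfolding sum_subtractf by (subst (2) sum.swap) (rule refl)
  also have "(\<Sum>k\<in>?K. \<Sum>j\<in>?J. Xq k (?x k) (Xq j (?y j) (?p (t - k - j)))) = (\<Sum>k\<in>?K. Xq k (?x k) (act y p (t - k)))"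
    unfolding act_def by (intro sum.cong refl q.endo_on_sum[OF Xq_endo subspace_Q, symmetric] xg pX)
  also have "(\<Sum>j\<in>?J. \<Sum>k\<in>?K. Xq j (?y j) (Xq k (?x k) (?p (t - j - k)))) = (\<Sum>j\<in>?J. Xq j (?y j) (act x p (t - j)))"
    unfolding act_def by (intro sum.cong refl q.endo_on_sum[OF Xq_endo subspace_Q, symmetric] yg pX)
  finally show ?thesis .
qed

lemma LM_mem: "x \<in> LT T \<Longrightarrow> p \<in> Lc \<Longrightarrow> mact (LM a) (x, d) p \<in> Lc"
  by (simp add: LM_lookup q.subspace_add[OF subspace_Q] q.subspace_scale[OF subspace_Q] act_mem)

lemma act_plus_right: "x \<in> LT T \<Longrightarrow> p \<in> Lc \<Longrightarrow> p' \<in> Lc \<Longrightarrow> act x (p + p') t = act x p t + act x p' t"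
  by (simp add: act_def lookup_add q.endo_on_add[OF Xq_endo] LT_lookup sum.distrib)

lemma act_scale_right: "x \<in> LT T \<Longrightarrow> p \<in> Lc \<Longrightarrow> act x (pm_scale sq c p) t = sq c (act x p t)"
  by (simp add: act_def q.endo_on_scale[OF Xq_endo] LT_lookup q.scale_sum_right)

lemma LM_endo: "x \<in> LT T \<Longrightarrow> lm.endo_on Lc (mact (LM a) (x, d))"
proof (rule lm.endo_onI)
  assume x: "x \<in> LT T"
  show "mact (LM a) (x, d) p \<in> Lc" if "p \<in> Lc" for p using LM_mem x that .
  show "mact (LM a) (x, d) (p + p') = mact (LM a) (x, d) p + mact (LM a) (x, d) p'" if "p \<in> Lc" "p' \<in> Lc" for p p'
    by (rule poly_mapping_eqI)
      (use x that in \<open>simp add: LM_lookup lookup_add act_plus_right q.scale_right_distrib del: mem_Collect_eq\<close>)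
  show "mact (LM a) (x, d) (pm_scale sq c p) = pm_scale sq c (mact (LM a) (x, d) p)" if "p \<in> Lc" for c p
    by (rule poly_mapping_eqI)
      (use x that in \<open>simp add: LM_lookup act_scale_right q.scale_right_distrib mult.commute del: mem_Collect_eq\<close>)
qed

lemma hat_carrier: "(x, d) \<in> lcarrier (hat_alg T) \<longleftrightarrow> x \<in> LT T"
  by (simp add: hat_alg_def)

lemma LM_bracket:
  assumes x: "x \<in> LT T" and y: "y \<in> LT T" and p: "p \<in> Lc"
  shows "mact (LM a) (lbr (hat_alg T) (x, d) (y, e)) p =
    mact (LM a) (x, d) (mact (LM a) (y, e) p) - mact (LM a) (y, e) (mact (LM a) (x, d) p)"
proof (rule poly_mapping_eqI)
  fix t
  let ?l = Poly_Mapping.lookup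
  let ?P = "\<lambda>d t. pairing d (a + ivec t)"
  have comm: "act x (mact (LM a) (y, e) p) t = (\<Sum>k\<in>Poly_Mapping.keys x. Xq k (?l x k) (act y p (t - k))) +
      (\<Sum>k\<in>Poly_Mapping.keys x. sq (?P e (t - k)) (Xq k (?l x k) (?l p (t - k))))"
    if x: "x \<in> LT T" and y: "y \<in> LT T" for x y e
    unfolding act_def[of x] LM_lookup[OF y] sum.distrib[symmetric]
    using LT_lookup[OF x] act_mem[OF y p] p subspace_Q
    by (intro sum.cong refl) (simp add: q.endo_on_add[OF Xq_endo] q.endo_on_scale[OF Xq_endo] q.subspace_scale)
  \<comment> \<open>The Leibniz rule in degree t: the eigenvalue of d there is that of the operator
    of degree k plus that in degree t - k.\<close>
  have der: "act (loop_deriv T d y) p t + (\<Sum>k\<in>Poly_Mapping.keys y. sq (?P d (t - k)) (Xq k (?l y k) (?l p (t - k)))) =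
      sq (?P d t) (act y p t)" if y: "y \<in> LT T" for y d
  proof -
    have "pairing d (ivec k) + ?P d (t - k) = ?P d t" for k by (simp add: ivec_diff pairing_add2 pairing_diff2)
    then show ?thesis
      unfolding loop_deriv_def act_weight_left[OF y p] sum.distrib[symmetric] q.scale_left_distrib[symmetric]
      by (simp add: act_def q.scale_sum_right)
  qed
  have LTz: "loop_br T x y + loop_deriv T d y - loop_deriv T e x \<in> LT T"
    using x y by (intro LT_diff LT_add LT_br LT_deriv)
  have "?l (mact (LM a) (lbr (hat_alg T) (x, d) (y, e)) p) t = act (loop_br T x y + loop_deriv T d y - loop_deriv T e x) p t"
    using LM_lookup[OF LTz, of a 0 p t] by (simp add: hat_alg_def)
  also have "\<dots> = act (loop_br T x y) p t + act (loop_deriv T d y) p t - act (loop_deriv T e x) p t"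
    using act_diff_left[OF LT_add[OF LT_br[OF x y] LT_deriv[OF y]] LT_deriv[OF x] p]
      act_plus_left[OF LT_br[OF x y] LT_deriv[OF y] p] by simp
  finally have lhs: "?l (mact (LM a) (lbr (hat_alg T) (x, d) (y, e)) p) t =
     act (loop_br T x y) p t + act (loop_deriv T d y) p t - act (loop_deriv T e x) p t" .
  have "?l (mact (LM a) (x, d) (mact (LM a) (y, e) p) - mact (LM a) (y, e) (mact (LM a) (x, d) p)) t =
      act x (mact (LM a) (y, e) p) t + sq (?P d t) (act y p t + sq (?P e t) (?l p t)) -
      (act y (mact (LM a) (x, d) p) t + sq (?P e t) (act x p t + sq (?P d t) (?l p t)))"
    by (simp only: lookup_minus LM_lookup[OF x] LM_lookup[OF y])
  also have "\<dots> = act (loop_br T x y) p t + act (loop_deriv T d y) p t - act (loop_deriv T e x) p t"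
    unfolding comm[OF x y] comm[OF y x] act_br[OF x y p] q.scale_right_distrib der[OF x, of e, symmetric] der[OF y, of d, symmetric]
    by (simp add: mult.commute algebra_simps)
  finally show "?l (mact (LM a) (lbr (hat_alg T) (x, d) (y, e)) p) t =
     ?l (mact (LM a) (x, d) (mact (LM a) (y, e) p) - mact (LM a) (y, e) (mact (LM a) (x, d) p)) t"
    using lhs by simp
qed

lemma LM_lie_module: "lie_module (hat_alg T) (LM a)"
  unfolding lie_module_def LM_carrier LM_scale
proof (intro conjI ballI)
  show "vector_space (pm_scale sq :: complex \<Rightarrow> (int^'n \<Rightarrow>\<^sub>0 'q) \<Rightarrow> _)" by (rule lm.vector_space_axioms)
  show "lm.subspace Lc" by (rule subspace_Lc)
  fix x assume x: "x \<in> lcarrier (hat_alg T)"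
  obtain y d where y: "x = (y, d)" "y \<in> LT T" using x by (auto simp: hat_alg_def)
  show "mact (LM a) x ` Lc \<subseteq> Lc" "linear_on (pm_scale sq) Lc (pm_scale sq) (mact (LM a) x)"
    using LM_endo[OF y(2), of a d] y(1) by (auto simp: lm.endo_on_def)
next
  fix p assume p: "p \<in> Lc"
  show "linear_on (lscale (hat_alg T)) (lcarrier (hat_alg T)) (pm_scale sq) (\<lambda>x. mact (LM a) x p)"
    unfolding linear_on_def
  proof (intro conjI ballI allI)
    fix x y assume "x \<in> lcarrier (hat_alg T)" "y \<in> lcarrier (hat_alg T)"
    then obtain x' d y' e where xy: "x = (x', d)" "y = (y', e)" "x' \<in> LT T" "y' \<in> LT T" by (auto simp: hat_alg_def)
    show "mact (LM a) (x + y) p = mact (LM a) x p + mact (LM a) y p"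
      by (rule poly_mapping_eqI)
        (simp add: xy LM_lookup LT_add lookup_add act_plus_left[OF xy(3,4) p] pairing_add q.scale_left_distrib)
  next
    fix c x assume "x \<in> lcarrier (hat_alg T)"
    then obtain x' d where x: "x = (x', d)" "x' \<in> LT T" by (auto simp: hat_alg_def)
    have "lscale (hat_alg T) c x = (pm_scale sg c x', c *s d)" by (simp add: hat_alg_def x)
    then show "mact (LM a) (lscale (hat_alg T) c x) p = pm_scale sq c (mact (LM a) x p)"
      by (intro poly_mapping_eqI)
        (simp add: x LM_lookup LT_weight act_scale_left[OF x(2) p] pairing_scale q.scale_right_distrib)
  qed
next
  fix x y p assume "x \<in> lcarrier (hat_alg T)" "y \<in> lcarrier (hat_alg T)" and p: "p \<in> Lc"
  then obtain x' d y' e where xy: "x = (x', d)" "y = (y', e)" "x' \<in> LT T" "y' \<in> LT T" by (auto simp: hat_alg_def)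
  then show "mact (LM a) (lbr (hat_alg T) x y) p = mact (LM a) x (mact (LM a) y p) - mact (LM a) y (mact (LM a) x p)"
    using LM_bracket p by simp
qed

lemma LM_endo_carrier: "x \<in> lcarrier (hat_alg T) \<Longrightarrow> lm.endo_on (mcarrier (LM a)) (mact (LM a) x)"
  using LM_endo unfolding LM_carrier by (cases x) (simp add: hat_carrier)

lemma LM_cartan:
  assumes h: "h \<in> H" and p: "p \<in> Lc"
  shows "Poly_Mapping.lookup (mact (LM a) (Poly_Mapping.single 0 h, d) p) t =
    Xq 0 h (Poly_Mapping.lookup p t) + sq (pairing d (a + ivec t)) (Poly_Mapping.lookup p t)"
  using LM_lookup[OF LT_single[OF H_grade[OF h]], of a d p t] act_single[OF p, of 0 h t] by simp

lemma hat_cartan_carrier: "x \<in> hat_cartan T \<Longrightarrow> x \<in> lcarrier (hat_alg T)"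
  using LT_single H_grade by (auto simp: hat_cartan_def hat_carrier)

lemma Lc_single: "q \<in> Qc \<Longrightarrow> Poly_Mapping.single s q \<in> Lc"
  by (simp add: lookup_single when_def q.subspace_0[OF subspace_Q])

text \<open>The weight of q tensor t^s for q of H-weight \<alpha>, set to 0 off the Cartan
  subalgebra as membership in \<open>dual\<close> demands.\<close>

definition hat_weight :: "complex^'n \<Rightarrow> ('g \<Rightarrow> complex) \<Rightarrow> int^'n \<Rightarrow> ('g, 'n) hat \<Rightarrow> complex" where
  "hat_weight a \<alpha> s x =
    (if x \<in> hat_cartan T then \<alpha> (Poly_Mapping.lookup (fst x) 0) + pairing (snd x) (a + ivec s) else 0)"

lemma hat_weight_cartan:
  "h \<in> H \<Longrightarrow> hat_weight a \<alpha> s (Poly_Mapping.single 0 h, d) = \<alpha> h + pairing d (a + ivec s)"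
  by (auto simp: hat_weight_def hat_cartan_def)

lemma hat_weight_dual:
  assumes \<alpha>: "\<alpha> \<in> cartan_dual T"
  shows "hat_weight a \<alpha> s \<in> dual (lscale (hat_alg T)) (hat_cartan T)"
  unfolding dual_def
proof safe
  fix x d y e assume "(x, d) \<in> hat_cartan T" "(y, e) \<in> hat_cartan T"
  then obtain h k where hk: "h \<in> H" "k \<in> H" "x = Poly_Mapping.single 0 h" "y = Poly_Mapping.single 0 k"
    by (auto simp: hat_cartan_def)
  have "(x, d) + (y, e) = (Poly_Mapping.single 0 (h + k), d + e)" by (simp add: hk single_add)
  then show "hat_weight a \<alpha> s ((x, d) + (y, e)) = hat_weight a \<alpha> s (x, d) + hat_weight a \<alpha> s (y, e)"
    using hk hat_weight_cartan[OF g.subspace_add[OF subspace_H hk(1,2)]]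
    by (simp add: hat_weight_cartan dual_add[OF \<alpha>] pairing_add)
next
  fix c x d assume "(x, d) \<in> hat_cartan T"
  then obtain h where h: "h \<in> H" "x = Poly_Mapping.single 0 h" by (auto simp: hat_cartan_def)
  have "lscale (hat_alg T) c (x, d) = (Poly_Mapping.single 0 (sg c h), c *s d)"
    by (simp add: hat_alg_def h pm_weight_single[OF g.vector_space_axioms])
  then show "hat_weight a \<alpha> s (lscale (hat_alg T) c (x, d)) = c * hat_weight a \<alpha> s (x, d)"
    using h hat_weight_cartan[OF g.subspace_scale[OF subspace_H h(1)]]
    by (simp add: hat_weight_cartan dual_scale[OF \<alpha>] pairing_scale algebra_simps)
qed (simp add: hat_weight_def)

abbreviation LM_weight where "LM_weight a \<equiv> weight_space (hat_cartan T) (LM a)"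

lemma single_LM_weight:
  assumes v: "v \<in> wtsp \<alpha> b"
  shows "Poly_Mapping.single s (\<pi> v) \<in> LM_weight a (hat_weight a \<alpha> s)"
  unfolding weight_space_def LM_carrier LM_scale
proof (intro CollectI conjI ballI)
  note vV = wtsp_V[OF v]
  have L: "Poly_Mapping.single s (\<pi> v) \<in> Lc" using Lc_single[OF pi_mem[OF vV]] .
  then show "\<forall>t. Poly_Mapping.lookup (Poly_Mapping.single s (\<pi> v)) t \<in> Qc" by simp
  fix x assume "x \<in> hat_cartan T"
  then obtain h d where x: "h \<in> H" "x = (Poly_Mapping.single 0 h, d)" by (auto simp: hat_cartan_def)
  have hv: "Xq 0 h (\<pi> v) = sq (\<alpha> h) (\<pi> v)"
    using pi_X[OF H_grade[OF x(1)] vV] wtsp_H[OF v x(1)] pi_scale[OF vV] by simp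
  show "mact (LM a) x (Poly_Mapping.single s (\<pi> v)) = pm_scale sq (hat_weight a \<alpha> s x) (Poly_Mapping.single s (\<pi> v))"
    unfolding x(2) using hv Xq_0[OF H_grade[OF x(1)]]
    by (intro poly_mapping_eqI)
      (auto simp: LM_cartan[OF x(1) L] lookup_single when_def hat_weight_cartan[OF x(1)] q.scale_left_distrib)
qed

lemma LM_span: "Lc = lm.span (\<Union>\<mu>\<in>dual (lscale (hat_alg T)) (hat_cartan T). LM_weight a \<mu>)" (is "_ = lm.span ?W")
proof
  have "?W \<subseteq> Lc" by (auto simp: weight_space_def LM_carrier)
  then show "lm.span ?W \<subseteq> Lc" by (rule lm.span_minimal[OF _ subspace_Lc])
  have single: "Poly_Mapping.single s q \<in> lm.span ?W" if "q \<in> Qc" for s q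
    using that
  proof (rule Q_cases)
    fix v assume v: "v \<in> Vc" "q = \<pi> v"
    have "v \<in> v.span (\<Union>i\<in>allwts. wts i)" using v V_span_wts by simp
    then have "v \<in> Vc \<and> Poly_Mapping.single s (\<pi> v) \<in> lm.span ?W"
    proof (induction v rule: v.span_induct_alt)
      case base
      show ?case using v.subspace_0[OF subspace_V] by (simp add: lm.span_zero)
    next
      case (step c x y)
      then obtain \<alpha> b where \<alpha>: "\<alpha> \<in> cartan_dual T" "x \<in> wtsp \<alpha> b" by auto
      have "Poly_Mapping.single s (\<pi> x) \<in> ?W"
        using single_LM_weight[OF \<alpha>(2)] hat_weight_dual[OF \<alpha>(1)] by blast
      then have xW: "Poly_Mapping.single s (\<pi> x) \<in> lm.span ?W" by (rule lm.span_base)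
      have "Poly_Mapping.single s (\<pi> (sv c x + y)) = pm_scale sq c (Poly_Mapping.single s (\<pi> x)) + Poly_Mapping.single s (\<pi> y)"
        using wtsp_V[OF \<alpha>(2)] step v.subspace_scale[OF subspace_V]
        by (simp add: pi_add pi_scale single_add pm_weight_single[OF q.vector_space_axioms])
      then show ?case using step xW wtsp_V[OF \<alpha>(2)]
        by (simp add: lm.span_add lm.span_scale v.subspace_add[OF subspace_V] v.subspace_scale[OF subspace_V])
    qed
    then show ?thesis using v by simp
  qed
  show "Lc \<subseteq> lm.span ?W"
  proof
    fix p assume p: "p \<in> Lc"
    have "(\<Sum>s\<in>Poly_Mapping.keys p. Poly_Mapping.single s (Poly_Mapping.lookup p s)) \<in> lm.span ?W"
      using single p by (intro lm.span_sum) auto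
    then show "p \<in> lm.span ?W" using poly_mapping_expand[of p] by simp
  qed
qed

lemma LM_direct_sum:
  "direct_sum (mscale (LM a)) (dual (lscale (hat_alg T)) (hat_cartan T)) (LM_weight a) (mcarrier (LM a))"
  unfolding direct_sum_def LM_carrier LM_scale
proof (intro conjI allI impI ballI)
  show "Lc = lm.span (\<Union>\<mu>\<in>dual (lscale (hat_alg T)) (hat_cartan T). LM_weight a \<mu>)" by (rule LM_span)
  fix F x \<mu> assume F: "F \<subseteq> dual (lscale (hat_alg T)) (hat_cartan T)" "finite F" "\<forall>i\<in>F. x i \<in> LM_weight a i"
    "(\<Sum>i\<in>F. x i) = 0" and \<mu>: "\<mu> \<in> F"
  have "x \<mu> \<in> {0}"
  proof (rule lm.weight_extract[where M = Lc and H = "hat_cartan T" and T = "mact (LM a)" and F = F and \<mu> = "\<lambda>\<mu>. \<mu>" and v = x])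
    show "linear_on (pm_scale sq) Lc (pm_scale sq) (mact (LM a) h)" if "h \<in> hat_cartan T" for h
      using LM_endo_carrier[OF hat_cartan_carrier[OF that]] by (simp add: LM_carrier lm.endo_on_def)
    show "mact (LM a) h w \<in> {0}" if "h \<in> hat_cartan T" "w \<in> {0}" for h w
      using lm.endo_on_0[OF LM_endo_carrier[OF hat_cartan_carrier[OF that(1)]]] that(2) subspace_Lc by (simp add: LM_carrier)
    show "x i \<in> Lc" if "i \<in> F" for i using F(3) that by (auto simp: weight_space_def LM_carrier)
    show "mact (LM a) h (x i) = pm_scale sq (i h) (x i)" if "i \<in> F" "h \<in> hat_cartan T" for i h
      using F(3) that by (auto simp: weight_space_def LM_scale)
    show "\<exists>h\<in>hat_cartan T. i h \<noteq> j h" if "i \<in> F" "j \<in> F" "i \<noteq> j" for i j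
    proof -
      obtain h where h: "i h \<noteq> j h" using \<open>i \<noteq> j\<close> by blast
      moreover have "i \<in> dual (lscale (hat_alg T)) (hat_cartan T)" "j \<in> dual (lscale (hat_alg T)) (hat_cartan T)"
        using F(1) that by blast+
      ultimately show ?thesis using dual_zero_outside by metis
    qed
  qed (use F \<mu> subspace_Lc in auto)
  then show "x \<mu> = 0" by simp
qed

lemma fin_dim_single:
  fixes s :: "int^'n"
  shows "fin_dim (pm_scale sq) (Poly_Mapping.single s ` Qc)"
proof (rule q.fin_dim_image[OF _ lm.vector_space_axioms fin_dim_Q])
  show "linear_on sq Qc (pm_scale sq) (Poly_Mapping.single s)"
    by (simp add: linear_on_def single_add pm_weight_single[OF q.vector_space_axioms])
qed

text \<open>The d_i distinguish all degrees, so a weight space is confined to a single degree, that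
  is, to one copy of the finite-dimensional quotient.\<close>

lemma LM_weight_fin_dim: "fin_dim (pm_scale sq) (LM_weight a \<mu>)"
proof -
  have "lm.subspace {p \<in> Lc. \<forall>h\<in>hat_cartan T. mact (LM a) h p = pm_scale sq (\<mu> h) p}"
    by (rule lm.subspace_common_eigenspace[OF subspace_Lc]) (use LM_endo_carrier hat_cartan_carrier in \<open>simp add: LM_carrier\<close>)
  then have sub: "lm.subspace (LM_weight a \<mu>)" by (simp add: weight_space_def LM_carrier LM_scale)
  have deg: "pairing d (a + ivec t) = \<mu> (0, d)" if p: "p \<in> LM_weight a \<mu>" and t: "Poly_Mapping.lookup p t \<noteq> 0" for p t d
  proof -
    have pL: "p \<in> Lc" using p by (auto simp: weight_space_def LM_carrier)
    have "(0, d) \<in> hat_cartan T" using g.subspace_0[OF subspace_H] unfolding hat_cartan_def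
      by (intro CollectI exI[of _ 0] exI[of _ d]) simp
    then have "mact (LM a) (0, d) p = pm_scale sq (\<mu> (0, d)) p" using p by (auto simp: weight_space_def LM_scale)
    then have "Poly_Mapping.lookup (mact (LM a) (0, d) p) t = sq (\<mu> (0, d)) (Poly_Mapping.lookup p t)" by simp
    then have "sq (pairing d (a + ivec t)) (Poly_Mapping.lookup p t) = sq (\<mu> (0, d)) (Poly_Mapping.lookup p t)"
      using LM_lookup[OF zero_LT, of a d p t] by (simp add: act_zero_left)
    then show ?thesis using t by simp
  qed
  have "\<exists>t. LM_weight a \<mu> \<subseteq> Poly_Mapping.single t ` Qc"
  proof (cases "\<exists>t. \<forall>d. pairing d (a + ivec t) = \<mu> (0, d)")
    case True
    then obtain t where t: "\<And>d. pairing d (a + ivec t) = \<mu> (0, d)" by blast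
    have "p \<in> Poly_Mapping.single t ` Qc" if p: "p \<in> LM_weight a \<mu>" for p
    proof (rule image_eqI)
      show "Poly_Mapping.lookup p t \<in> Qc" using p by (auto simp: weight_space_def LM_carrier)
      have "Poly_Mapping.lookup p r = 0" if "r \<noteq> t" for r
      proof (rule ccontr)
        assume "Poly_Mapping.lookup p r \<noteq> 0"
        then have "\<forall>d. pairing d (a + ivec r) = pairing d (a + ivec t)" using deg[OF p] t by simp
        then have "r = t" unfolding pairing_eq_iff by simp
        then show False using that by simp
      qed
      then show "p = Poly_Mapping.single t (Poly_Mapping.lookup p t)"
        by (intro poly_mapping_eqI) (auto simp: lookup_single when_def)
    qed
    then show ?thesis by blast
  next
    case False
    have "p \<in> Poly_Mapping.single 0 ` Qc" if p: "p \<in> LM_weight a \<mu>" for p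
    proof -
      have "Poly_Mapping.lookup p t = 0" for t using deg[OF p, of t] False by blast
      then have "p = 0" by (intro poly_mapping_eqI) simp
      then show ?thesis using q.subspace_0[OF subspace_Q] by (intro image_eqI[of _ _ 0]) auto
    qed
    then show ?thesis by blast
  qed
  then obtain t where "LM_weight a \<mu> \<subseteq> Poly_Mapping.single t ` Qc" ..
  then show ?thesis by (rule lm.fin_dim_subspace[OF fin_dim_single sub])
qed

lemma Xq_funpow: "x \<in> G k \<Longrightarrow> v \<in> Vc \<Longrightarrow> (Xq k x ^^ j) (\<pi> v) = \<pi> ((X k x ^^ j) v)"
  by (induction j) (simp_all add: pi_X v.endo_on_funpow[OF X_endo])

text \<open>A coefficient of the j-th iterate is the j-th iterate, on the quotient, of some
  coefficient of p. Only finitely many of these are non-zero, so a common exponent exists.\<close>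

lemma LM_nilpotent:
  assumes x: "x \<in> root_elements T" and p: "p \<in> Lc"
  shows "\<exists>j. (mact (LM a) (x, 0) ^^ j) p = 0"
proof -
  obtain k y \<alpha> where y: "x = Poly_Mapping.single k y" "\<alpha> \<in> cartan_dual T" "\<alpha> \<noteq> zero_fun" "y \<in> RS k \<alpha>"
    using x by (auto simp: root_elements_def)
  note yg = RS_grade[OF y(4)]
  let ?f = "mact (LM a) (x, 0)"
  have fL: "(?f ^^ j) p \<in> Lc" for j
    by (rule lm.endo_on_funpow[OF LM_endo p]) (simp add: y(1) LT_single[OF yg])
  have look: "\<exists>u. Poly_Mapping.lookup ((?f ^^ j) p) t = (Xq k y ^^ j) (Poly_Mapping.lookup p u)" for j t
  proof (induction j arbitrary: t)
    case (Suc j)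
    obtain u where u: "Poly_Mapping.lookup ((?f ^^ j) p) (t - k) = (Xq k y ^^ j) (Poly_Mapping.lookup p u)" using Suc by blast
    have "Poly_Mapping.lookup (?f ((?f ^^ j) p)) t = Xq k y (Poly_Mapping.lookup ((?f ^^ j) p) (t - k))"
      using LM_lookup[of x a 0 "(?f ^^ j) p" t] LT_single[OF yg] act_single[OF fL] y(1) by simp
    then show ?case using u by auto
  qed auto
  have nil: "\<exists>j. (Xq k y ^^ j) q = 0" if "q \<in> Qc" for q
    using that
  proof (rule Q_cases)
    fix v assume v: "v \<in> Vc" "q = \<pi> v"
    then obtain j where "(X k y ^^ j) v = 0" using X_locally_nilpotent[OF y(2,3,4)] by blast
    then show ?thesis using Xq_funpow[OF yg v(1), of j] v(2) by auto
  qed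
  have "\<forall>s. \<exists>j. (Xq k y ^^ j) (Poly_Mapping.lookup p s) = 0" using nil p by simp
  from choice[OF this] obtain j where j: "\<forall>s. (Xq k y ^^ j s) (Poly_Mapping.lookup p s) = 0" ..
  define N where "N = Max (insert 0 (j ` Poly_Mapping.keys p))"
  have zero: "(Xq k y ^^ m) 0 = 0" for m by (induction m) (simp_all add: Xq_0[OF yg])
  have "(Xq k y ^^ N) (Poly_Mapping.lookup p s) = 0" for s
  proof (cases "s \<in> Poly_Mapping.keys p")
    case True
    then have "j s \<le> N" by (simp add: N_def)
    then have "N = (N - j s) + j s" by simp
    then have "(Xq k y ^^ N) (Poly_Mapping.lookup p s) = (Xq k y ^^ (N - j s)) ((Xq k y ^^ j s) (Poly_Mapping.lookup p s))"
      by (metis comp_apply funpow_add)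
    then show ?thesis using j zero by simp
  qed (use zero in \<open>simp add: in_keys_iff\<close>)
  then have "(?f ^^ N) p = 0" using look[of N] by (intro poly_mapping_eqI) (metis lookup_zero)
  then show ?thesis ..
qed

lemma LM_integrable: "hat_integrable T (LM a)"
  unfolding hat_integrable_def integrable_module_def
proof (intro conjI ballI)
  fix y :: "('g, 'n) hat" and p assume "y \<in> (\<lambda>x. (x, 0)) ` root_elements T" "p \<in> mcarrier (LM a)"
  then show "\<exists>j. (mact (LM a) y ^^ j) p = 0" using LM_nilpotent LM_carrier by auto
qed (use LM_direct_sum LM_weight_fin_dim LM_scale in auto)

subsection \<open>The images of \<open>V\<close> in the loop module\<close>

definition phi :: "int^'n \<Rightarrow> 'v \<Rightarrow> (int^'n \<Rightarrow>\<^sub>0 'q)" where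
  "phi s v = (\<Sum>t\<in>Poly_Mapping.keys (components v). Poly_Mapping.single (t - s) (\<pi> (Poly_Mapping.lookup (components v) t)))"

lemma lookup_phi: "Poly_Mapping.lookup (phi s v) r = \<pi> (Poly_Mapping.lookup (components v) (r + s))"
proof -
  have "Poly_Mapping.lookup (phi s v) r =
      (\<Sum>t\<in>Poly_Mapping.keys (components v). if t = r + s then \<pi> (Poly_Mapping.lookup (components v) (r + s)) else 0)"
    unfolding phi_def lookup_sum by (rule sum.cong) (auto simp: lookup_single when_def)
  then show ?thesis by (simp add: in_keys_iff)
qed

lemma phi_Lc: "v \<in> Vc \<Longrightarrow> phi s v \<in> Lc"
  by (simp add: lookup_phi pi_mem comp_V)

lemma phi_add: "v \<in> Vc \<Longrightarrow> w \<in> Vc \<Longrightarrow> phi s (v + w) = phi s v + phi s w"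
  by (rule poly_mapping_eqI) (simp add: lookup_phi lookup_add comp_add pi_add comp_V)

lemma phi_scale: "v \<in> Vc \<Longrightarrow> phi s (sv c v) = pm_scale sq c (phi s v)"
  by (rule poly_mapping_eqI) (simp add: lookup_phi comp_scale pi_scale comp_V)

lemma phi_linear: "linear_on sv Vc (pm_scale sq) (phi s)"
  by (simp add: linear_on_def phi_add phi_scale)

lemma phi_0: "phi s 0 = 0"
  using v.linear_on_0[OF phi_linear lm.vector_space_axioms v.subspace_0[OF subspace_V]] .

lemma phi_homogeneous: "v \<in> Vr (r + s) \<Longrightarrow> phi s v = Poly_Mapping.single r (\<pi> v)"
  by (rule poly_mapping_eqI) (auto simp: lookup_phi comp_homogeneous lookup_single when_def)

lemma hat_act:
  assumes x: "x \<in> LT T" and v: "v \<in> Vc"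
  shows "mact V (x, 0, d) v = (\<Sum>k\<in>Poly_Mapping.keys x. X k (Poly_Mapping.lookup x k) v) + D d v"
  using act_decompose[OF x zero_center_space v, of d] Z_zero[OF v] by simp

lemma hat_act_mem: "x \<in> LT T \<Longrightarrow> v \<in> Vc \<Longrightarrow> mact V (x, 0, d) v \<in> Vc"
  using v.endo_on_mem[OF act_endo] by (simp add: tilde_carrier)

text \<open>The embedding commutes with LT, while the d_i are off by the coordinates of a0 + s - a.
  Such scalars do not disturb the stability of subspaces, and their dependence on s accounts for the
  grade shifts.\<close>

lemma phi_act:
  assumes x: "x \<in> LT T" and v: "v \<in> Vc"
  shows "phi s (mact V (x, 0, d) v) = mact (LM a) (x, d) (phi s v) + pm_scale sq (pairing d (a0 + ivec s - a)) (phi s v)"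
proof (rule poly_mapping_eqI)
  fix r
  let ?c = "Poly_Mapping.lookup (components v)" and ?x = "Poly_Mapping.lookup x" and ?K = "Poly_Mapping.keys x"
  have xg: "?x k \<in> G k" for k using LT_lookup[OF x] .
  have sumV: "(\<Sum>k\<in>F. X k (?x k) v) \<in> Vc" for F using X_mem[OF xg v] subspace_V by (intro v.subspace_sum)
  have "Poly_Mapping.lookup (components (\<Sum>k\<in>F. X k (?x k) v)) t = (\<Sum>k\<in>F. X k (?x k) (?c (t - k)))" for F t
  proof (induction F rule: infinite_finite_induct)
    case (insert k F)
    then show ?case using comp_add[OF X_mem[OF xg v] sumV, of k F] comp_X[OF xg v] by (simp add: lookup_add)
  qed (use comp_homogeneous[of 0 0] v.subspace_0[OF subspace_Vr] in auto)
  then have "Poly_Mapping.lookup (components (mact V (x, 0, d) v)) (r + s) =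
      (\<Sum>k\<in>?K. X k (?x k) (?c (r + s - k))) + sv (pairing d (a0 + ivec (r + s))) (?c (r + s))"
    unfolding hat_act[OF x v] comp_add[OF sumV D_mem[OF v]] by (simp add: lookup_add comp_D[OF v])
  moreover have "\<pi> (\<Sum>k\<in>?K. X k (?x k) (?c (r + s - k))) = (\<Sum>k\<in>?K. Xq k (?x k) (\<pi> (?c (r + s - k))))"
    using pi_sum[of ?K "\<lambda>k. X k (?x k) (?c (r + s - k))"] X_mem[OF xg comp_V[OF v]] pi_X[OF xg comp_V[OF v]] by simp
  moreover have "(\<Sum>k\<in>?K. X k (?x k) (?c (r + s - k))) \<in> Vc"
    using X_mem[OF xg comp_V[OF v]] subspace_V by (intro v.subspace_sum)
  ultimately have "Poly_Mapping.lookup (phi s (mact V (x, 0, d) v)) r =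
      (\<Sum>k\<in>?K. Xq k (?x k) (\<pi> (?c (r + s - k)))) + sq (pairing d (a0 + ivec (r + s))) (\<pi> (?c (r + s)))"
    using comp_V[OF v] v.subspace_scale[OF subspace_V] by (simp add: lookup_phi pi_add pi_scale)
  also have "(\<Sum>k\<in>?K. Xq k (?x k) (\<pi> (?c (r + s - k)))) = act x (phi s v) r"
    unfolding act_def lookup_phi by (rule sum.cong) (simp_all add: algebra_simps)
  also have "pairing d (a0 + ivec (r + s)) = pairing d (a + ivec r) + pairing d (a0 + ivec s - a)"
    unfolding pairing_add2[symmetric] by (rule arg_cong[of _ _ "pairing d"]) (simp add: ivec_add)
  finally show "Poly_Mapping.lookup (phi s (mact V (x, 0, d) v)) r =
     Poly_Mapping.lookup (mact (LM a) (x, d) (phi s v) + pm_scale sq (pairing d (a0 + ivec s - a)) (phi s v)) r"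
    by (simp add: lookup_add LM_lookup[OF x] lookup_phi q.scale_left_distrib add.assoc)
qed

lemma phi_X: "x \<in> G k \<Longrightarrow> v \<in> Vc \<Longrightarrow> phi s (X k x v) = mact (LM a) (Poly_Mapping.single k x, 0) (phi s v)"
  using phi_act[OF LT_single, of x k v s 0 a] by (simp add: X_def)

lemma phi_D: "v \<in> Vc \<Longrightarrow> phi s (D d v) = mact (LM a) (0, d) (phi s v) + pm_scale sq (pairing d (a0 + ivec s - a)) (phi s v)"
  using phi_act[OF zero_LT, of v s d a] by (simp add: D_def)

lemma exists_weight_vector: "\<exists>\<alpha> t v. \<alpha> \<in> cartan_dual T \<and> v \<in> wtsp \<alpha> (a0 + ivec t) \<and> \<pi> v \<noteq> 0"
proof (rule ccontr)
  assume no: "\<nexists>\<alpha> t v. \<alpha> \<in> cartan_dual T \<and> v \<in> wtsp \<alpha> (a0 + ivec t) \<and> \<pi> v \<noteq> 0"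
  have "v \<in> V''" if "v \<in> Vc" for v
  proof -
    have "(\<Union>i\<in>weight_set \<times> range (\<lambda>r. a0 + ivec r). wts i) \<subseteq> V''"
    proof
      fix v assume "v \<in> (\<Union>i\<in>weight_set \<times> range (\<lambda>r. a0 + ivec r). wts i)"
      then obtain \<alpha> t where v: "\<alpha> \<in> cartan_dual T" "v \<in> wtsp \<alpha> (a0 + ivec t)" by (auto simp: weight_set_def)
      then have "\<pi> v = 0" using no by blast
      then show "v \<in> V''" using wtsp_V[OF v(2)] pi_kernel by blast
    qed
    then show ?thesis using that V_span_weight_set v.span_minimal subspace_V'' by blast
  qed
  then show False using V''_sub V''_proper by blast
qed

text \<open>The kernel is stable under \<open>X\<close> and \<open>D\<close>, and a homogeneous
  vector with non-zero image in the quotient keeps it from being all of V.\<close>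

lemma phi_inj:
  assumes v: "v \<in> Vc" "phi s v = 0"
  shows "v = 0"
proof (rule ccontr)
  assume nz: "v \<noteq> 0"
  have "{v \<in> Vc. phi s v = 0} = Vc"
  proof (rule irreducible_X[of _ v])
    show "v.subspace {v \<in> Vc. phi s v = 0}"
      by (rule v.subspaceI)
        (simp_all add: phi_0 phi_add phi_scale v.subspace_0[OF subspace_V] v.subspace_add[OF subspace_V] v.subspace_scale[OF subspace_V])
    \<comment> \<open>The kernel is the same for every parameter of the loop module; 0 is
      taken.\<close>
    have zero: "mact (LM 0) (x, d) 0 = 0" if "x \<in> LT T" for x d
      using lm.endo_on_0[OF LM_endo[OF that] subspace_Lc] .
    show "X k x w \<in> {v \<in> Vc. phi s v = 0}" if "x \<in> G k" "w \<in> {v \<in> Vc. phi s v = 0}" for k x w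
      using that phi_X[OF that(1), of w s 0] X_mem[OF that(1)] zero[OF LT_single] by simp
    show "D d w \<in> {v \<in> Vc. phi s v = 0}" if "w \<in> {v \<in> Vc. phi s v = 0}" for d w
      using that phi_D[of w s d 0] D_mem zero by simp
  qed (use v nz in auto)
  moreover obtain \<alpha> t w where w: "w \<in> wtsp \<alpha> (a0 + ivec t)" "\<pi> w \<noteq> 0" using exists_weight_vector by blast
  have "w \<in> Vr ((t - s) + s)" using w(1) wtsp_Vr by auto
  then have "phi s w = Poly_Mapping.single (t - s) (\<pi> w)" by (rule phi_homogeneous)
  then have "phi s w \<noteq> 0" using w(2) by (metis lookup_single_eq lookup_zero)
  ultimately show False using wtsp_V[OF w(1)] by blast
qed

lemma phi_inj_on: "inj_on (phi s) Vc"
proof (rule inj_onI)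
  fix v w assume vw: "v \<in> Vc" "w \<in> Vc" "phi s v = phi s w"
  have "phi s (v - w) = phi s v - phi s w"
    using v.linear_on_diff[OF phi_linear lm.vector_space_axioms subspace_V vw(1,2)] .
  then have "v - w = 0" using vw v.subspace_diff[OF subspace_V] by (intro phi_inj[of _ s]) auto
  then show "v = w" by simp
qed

definition Ms :: "int^'n \<Rightarrow> (int^'n \<Rightarrow>\<^sub>0 'q) set" where "Ms s = phi s ` Vc"

lemma Ms_Lc: "Ms s \<subseteq> Lc"
  unfolding Ms_def using phi_Lc by blast

lemma subspace_Ms: "lm.subspace (Ms s)"
  unfolding Ms_def
proof (rule lm.subspaceI)
  show "0 \<in> phi s ` Vc" using phi_0 v.subspace_0[OF subspace_V] by (metis imageI)
  fix p p' c assume "p \<in> phi s ` Vc" "p' \<in> phi s ` Vc"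
  then obtain v w where vw: "v \<in> Vc" "w \<in> Vc" "p = phi s v" "p' = phi s w" by blast
  show "p + p' \<in> phi s ` Vc" using phi_add[OF vw(1,2)] v.subspace_add[OF subspace_V vw(1,2)] vw by (metis imageI)
  show "pm_scale sq c p \<in> phi s ` Vc" using phi_scale[OF vw(1)] v.subspace_scale[OF subspace_V vw(1)] vw by (metis imageI)
qed

lemma Ms_act:
  assumes x: "x \<in> LT T" and v: "v \<in> Vc"
  shows "mact (LM a) (x, d) (phi s v) = phi s (mact V (x, 0, d) v - sv (pairing d (a0 + ivec s - a)) v)"
    and "mact V (x, 0, d) v - sv (pairing d (a0 + ivec s - a)) v \<in> Vc"
proof -
  let ?c = "pairing d (a0 + ivec s - a)"
  have m: "mact V (x, 0, d) v \<in> Vc" "sv ?c v \<in> Vc" using hat_act_mem[OF x v] v.subspace_scale[OF subspace_V v] by auto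
  have "phi s (mact V (x, 0, d) v - sv ?c v) = phi s (mact V (x, 0, d) v) - phi s (sv ?c v)"
    by (rule v.linear_on_diff[OF phi_linear lm.vector_space_axioms subspace_V m])
  then show "mact (LM a) (x, d) (phi s v) = phi s (mact V (x, 0, d) v - sv ?c v)"
    using phi_act[OF x v, of s d a] phi_scale[OF v] by simp
  show "mact V (x, 0, d) v - sv ?c v \<in> Vc" using m by (rule v.subspace_diff[OF subspace_V])
qed

lemma Ms_submodule: "submodule (hat_alg T) (LM a) (Ms s)"
  unfolding submodule_def LM_carrier LM_scale
proof (intro conjI ballI)
  fix x p assume x: "x \<in> lcarrier (hat_alg T)" and p: "p \<in> Ms s"
  obtain y d where y: "x = (y, d)" "y \<in> LT T" using x by (auto simp: hat_alg_def)
  show "mact (LM a) x p \<in> Ms s" using p Ms_act[OF y(2)] unfolding y(1) Ms_def by (elim imageE) (metis imageI)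
qed (use Ms_Lc subspace_Ms in auto)

text \<open>A submodule of the image pulls back to a subspace of V stable under \<open>X\<close> and
  \<open>D\<close>, because \<open>phi s\<close> respects both up to scalars.\<close>

lemma Ms_irreducible: "irreducible_module (hat_alg T) ((LM a)\<lparr>mcarrier := Ms s\<rparr>)"
  unfolding irreducible_module_def
proof (intro conjI allI impI)
  obtain u where u: "u \<in> HS" "u \<noteq> 0" using highest_vector by blast
  then have "phi s u \<noteq> 0" "phi s u \<in> Ms s" using phi_inj[of u s] HS_V by (auto simp: Ms_def)
  then show "mcarrier ((LM a)\<lparr>mcarrier := Ms s\<rparr>) \<noteq> {0}" by auto
  fix U assume "submodule (hat_alg T) ((LM a)\<lparr>mcarrier := Ms s\<rparr>) U"
  then have U: "U \<subseteq> Ms s" "lm.subspace U" "\<And>x p. x \<in> lcarrier (hat_alg T) \<Longrightarrow> p \<in> U \<Longrightarrow> mact (LM a) x p \<in> U"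
    unfolding lm.submodule_restrict_iff[of "LM a", OF LM_scale] by blast+
  let ?W = "{v \<in> Vc. phi s v \<in> U}"
  have "U \<subseteq> {0} \<or> ?W = Vc"
  proof (rule disjCI)
    assume nz: "?W \<noteq> Vc"
    have "v = 0" if v: "v \<in> ?W" for v
    proof (rule ccontr)
      assume v0: "v \<noteq> 0"
      have "?W = Vc"
      proof (rule irreducible_X[OF _ _ _ _ v v0])
        show "v.subspace ?W"
          by (rule v.subspaceI)
            (simp_all add: phi_0 phi_add phi_scale lm.subspace_0[OF U(2)] lm.subspace_add[OF U(2)] lm.subspace_scale[OF U(2)]
              v.subspace_0[OF subspace_V] v.subspace_add[OF subspace_V] v.subspace_scale[OF subspace_V])
        show "X k x w \<in> ?W" if "x \<in> G k" "w \<in> ?W" for k x w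
          using that phi_X[OF that(1), of w s a] X_mem[OF that(1)] U(3) LT_single[OF that(1)] by (simp add: hat_carrier)
        show "D d w \<in> ?W" if "w \<in> ?W" for d w
          using that phi_D[of w s d a] D_mem U(3)[of "(0, d)"] lm.subspace_add[OF U(2)] lm.subspace_scale[OF U(2)]
          by (simp add: hat_carrier)
      qed auto
      then show False using nz by simp
    qed
    then show "U \<subseteq> {0}" using U(1) phi_0 unfolding Ms_def by blast
  qed
  then show "U = {0} \<or> U = mcarrier ((LM a)\<lparr>mcarrier := Ms s\<rparr>)"
    using U(1) lm.subspace_0[OF U(2)] by (auto simp: Ms_def)
qed

text \<open>Let q be the image of a weight vector x of degree t. To reach q tensor t^r, x is
  replaced by a partner of degree r + \<rho> with \<rho> in \<open>reps\<close>, which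
  \<open>phi \<rho>\<close> sends to degree r.\<close>

lemma Ms_span: "lm.span (\<Union>(Ms ` reps)) = Lc"
proof
  show "lm.span (\<Union>(Ms ` reps)) \<subseteq> Lc" using Ms_Lc by (intro lm.span_minimal[OF _ subspace_Lc]) auto
  have single: "Poly_Mapping.single r q \<in> lm.span (\<Union>(Ms ` reps))" if "q \<in> Qc" for r q
    using that
  proof (rule Q_cases)
    fix v assume v: "v \<in> Vc" "q = \<pi> v"
    have "v \<in> v.span (\<Union>i\<in>weight_set \<times> range (\<lambda>r. a0 + ivec r). wts i)" using v V_span_weight_set by simp
    then have "v \<in> Vc \<and> Poly_Mapping.single r (\<pi> v) \<in> lm.span (\<Union>(Ms ` reps))"
    proof (induction v rule: v.span_induct_alt)
      case base
      show ?case using v.subspace_0[OF subspace_V] by (simp add: lm.span_zero)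
    next
      case (step c x y)
      then obtain \<alpha> t where \<alpha>: "\<alpha> \<in> cartan_dual T" "x \<in> wtsp \<alpha> (a0 + ivec t)" by (auto simp: weight_set_def)
      \<comment> \<open>The shift from degree t to degree r + \<rho> is \<rho> - (t - r).\<close>
      obtain \<rho> where \<rho>: "\<rho> \<in> reps" "period (\<rho> - (t - r))" using period_reps by blast
      obtain x' where x': "x' \<in> wtsp \<alpha> (a0 + ivec t + ivec (\<rho> - (t - r)))" "\<pi> x' = \<pi> x"
        using \<rho>(2) \<alpha> unfolding period_def by blast
      have "a0 + ivec t + ivec (\<rho> - (t - r)) = a0 + ivec (r + \<rho>)" by (simp add: ivec_diff ivec_add algebra_simps)
      then have "x' \<in> wtsp \<alpha> (a0 + ivec (r + \<rho>))" using x'(1) by (simp only:)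
      then have "x' \<in> Vr (r + \<rho>)" using wtsp_Vr by blast
      then have "Poly_Mapping.single r (\<pi> x) = phi \<rho> x'" "x' \<in> Vc" using phi_homogeneous x'(2) Vr_V by auto
      then have "Poly_Mapping.single r (\<pi> x) \<in> \<Union>(Ms ` reps)" using \<rho>(1) by (auto simp: Ms_def)
      then have xM: "Poly_Mapping.single r (\<pi> x) \<in> lm.span (\<Union>(Ms ` reps))" by (rule lm.span_base)
      have "Poly_Mapping.single r (\<pi> (sv c x + y)) = pm_scale sq c (Poly_Mapping.single r (\<pi> x)) + Poly_Mapping.single r (\<pi> y)"
        using wtsp_V[OF \<alpha>(2)] step v.subspace_scale[OF subspace_V]
        by (simp add: pi_add pi_scale single_add pm_weight_single[OF q.vector_space_axioms])
      then show ?case using step xM wtsp_V[OF \<alpha>(2)]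
        by (simp add: lm.span_add lm.span_scale v.subspace_add[OF subspace_V] v.subspace_scale[OF subspace_V])
    qed
    then show ?thesis using v by simp
  qed
  show "Lc \<subseteq> lm.span (\<Union>(Ms ` reps))"
  proof
    fix p assume p: "p \<in> Lc"
    have "(\<Sum>s\<in>Poly_Mapping.keys p. Poly_Mapping.single s (Poly_Mapping.lookup p s)) \<in> lm.span (\<Union>(Ms ` reps))"
      using single p by (intro lm.span_sum) auto
    then show "p \<in> lm.span (\<Union>(Ms ` reps))" using poly_mapping_expand[of p] by simp
  qed
qed

lemma LM_decomposition: "\<exists>C\<subseteq>Ms ` reps. irreducible_decomposition (hat_alg T) (LM a) C"
proof -
  have "\<exists>C\<subseteq>Ms ` reps. direct_sum (pm_scale sq) C id (lm.span (\<Union>(Ms ` reps)))"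
    by (rule lm.irreducible_sum_direct[where M = "LM a" and L = "hat_alg T"])
      (use LM_scale LM_carrier subspace_Lc LM_endo_carrier finite_reps Ms_submodule Ms_irreducible in auto)
  then obtain C where C: "C \<subseteq> Ms ` reps" "direct_sum (pm_scale sq) C id Lc" unfolding Ms_span by blast
  then have "irreducible_decomposition (hat_alg T) (LM a) C"
    unfolding irreducible_decomposition_def LM_scale LM_carrier using Ms_submodule Ms_irreducible by blast
  then show ?thesis using C(1) by blast
qed

lemma irreducible_iso_Ms:
  assumes "submodule (hat_alg T) (LM a) U" "irreducible_module (hat_alg T) ((LM a)\<lparr>mcarrier := U\<rparr>)"
  shows "\<exists>s\<in>reps. module_iso (hat_alg T) ((LM a)\<lparr>mcarrier := U\<rparr>) ((LM a)\<lparr>mcarrier := Ms s\<rparr>)"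
proof -
  obtain C where C: "C \<subseteq> Ms ` reps" "irreducible_decomposition (hat_alg T) (LM a) C" using LM_decomposition by blast
  have "finite C" using C(1) finite_reps by (simp add: finite_subset)
  then show ?thesis
    using lm.irreducible_iso_summand[OF LM_scale LM_endo_carrier C(2) _ assms] C(1) by blast
qed

lemma submodule_closed:
  assumes "submodule (hat_alg T) (LM a) U"
  shows "\<And>p p'. p \<in> U \<Longrightarrow> p' \<in> U \<Longrightarrow> p + p' \<in> U" "\<And>c p. p \<in> U \<Longrightarrow> pm_scale sq c p \<in> U"
    "\<And>x p. x \<in> lcarrier (hat_alg T) \<Longrightarrow> p \<in> U \<Longrightarrow> mact (LM a) x p \<in> U" "lm.subspace U"
  using assms by (auto simp: submodule_def LM_scale lm.subspace_add lm.subspace_scale)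

text \<open>The map from \<open>phi s v\<close> to \<open>phi s' v\<close> intertwines LT exactly;
  on the d_i the two scalars of \<open>phi_act\<close> differ by -(s - s').\<close>

lemma Ms_iso_shift:
  "module_iso (hat_alg T) ((LM a)\<lparr>mcarrier := Ms s\<rparr>) (grade_shift (s - s') ((LM a)\<lparr>mcarrier := Ms s'\<rparr>))"
  unfolding module_iso_def
proof (intro exI[of _ "\<lambda>p. phi s' (inv_into Vc (phi s) p)"] conjI ballI)
  let ?i = "inv_into Vc (phi s)"
  have i: "?i (phi s v) = v" if "v \<in> Vc" for v using inv_into_f_f[OF phi_inj_on that] .
  have "bij_betw ?i (phi s ` Vc) Vc" using phi_inj_on by (simp add: bij_betw_imageI bij_betw_inv_into)
  moreover have "bij_betw (phi s') Vc (Ms s')" using phi_inj_on by (simp add: Ms_def bij_betw_imageI)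
  ultimately have "bij_betw (phi s' \<circ> ?i) (Ms s) (Ms s')" unfolding Ms_def by (rule bij_betw_trans)
  then show "bij_betw (\<lambda>p. phi s' (?i p)) (mcarrier ((LM a)\<lparr>mcarrier := Ms s\<rparr>)) (mcarrier (grade_shift (s - s') ((LM a)\<lparr>mcarrier := Ms s'\<rparr>)))"
    by (simp add: grade_shift_def o_def)
  have "phi s' (?i (p + p')) = phi s' (?i p) + phi s' (?i p')" if pp: "p \<in> Ms s" "p' \<in> Ms s" for p p'
  proof -
    obtain v w where vw: "v \<in> Vc" "w \<in> Vc" "p = phi s v" "p' = phi s w" using pp by (auto simp: Ms_def)
    have "?i (p + p') = v + w" using i[OF v.subspace_add[OF subspace_V vw(1,2)]] phi_add[OF vw(1,2)] vw by simp
    then show ?thesis using i vw phi_add by simp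
  qed
  moreover have "phi s' (?i (pm_scale sq c p)) = pm_scale sq c (phi s' (?i p))" if pp: "p \<in> Ms s" for c p
  proof -
    obtain v where v: "v \<in> Vc" "p = phi s v" using pp by (auto simp: Ms_def)
    have "?i (pm_scale sq c p) = sv c v" using i[OF v.subspace_scale[OF subspace_V v(1)]] phi_scale[OF v(1)] v by simp
    then show ?thesis using i v phi_scale by simp
  qed
  ultimately show "linear_on (mscale ((LM a)\<lparr>mcarrier := Ms s\<rparr>)) (mcarrier ((LM a)\<lparr>mcarrier := Ms s\<rparr>))
     (mscale (grade_shift (s - s') ((LM a)\<lparr>mcarrier := Ms s'\<rparr>))) (\<lambda>p. phi s' (?i p))"
    by (simp add: linear_on_def grade_shift_def LM_scale)
  fix x p assume x: "x \<in> lcarrier (hat_alg T)" and "p \<in> mcarrier ((LM a)\<lparr>mcarrier := Ms s\<rparr>)"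
  then obtain y d v where y: "x = (y, d)" "y \<in> LT T" and v: "v \<in> Vc" "p = phi s v"
    by (auto simp: hat_alg_def Ms_def)
  let ?c = "\<lambda>s. pairing d (a0 + ivec s - a)"
  have m: "mact V (y, 0, d) v \<in> Vc" "sv (?c s) v \<in> Vc" using hat_act_mem[OF y(2) v(1)] v.subspace_scale[OF subspace_V v(1)] by auto
  have "phi s' (?i (mact (LM a) x p)) = phi s' (mact V (y, 0, d) v - sv (?c s) v)"
    using Ms_act(1)[OF y(2) v(1), of a d s] i[OF Ms_act(2)[OF y(2) v(1)]] y(1) v(2) by simp
  also have "\<dots> = phi s' (mact V (y, 0, d) v) - pm_scale sq (?c s) (phi s' v)"
    using v.linear_on_diff[OF phi_linear lm.vector_space_axioms subspace_V m] phi_scale[OF v(1)] by simp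
  also have "\<dots> = mact (LM a) (y, d) (phi s' v) + (pm_scale sq (?c s') (phi s' v) - pm_scale sq (?c s) (phi s' v))"
    using phi_act[OF y(2) v(1), of s' d a] by simp
  also have "pm_scale sq (?c s') (phi s' v) - pm_scale sq (?c s) (phi s' v) = pm_scale sq (- pairing d (ivec (s - s'))) (phi s' v)"
    unfolding lm.scale_left_diff_distrib[symmetric] by (simp add: ivec_diff pairing_add2 pairing_diff2)
  finally show "phi s' (?i (mact ((LM a)\<lparr>mcarrier := Ms s\<rparr>) x p)) =
      mact (grade_shift (s - s') ((LM a)\<lparr>mcarrier := Ms s'\<rparr>)) x (phi s' (?i p))"
    using i[OF v(1)] y(1) v(2) by (simp add: grade_shift_def LM_scale)
qed

text \<open>Both modules are compared with images of V, which are grade shifts of one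
  another.\<close>

lemma irreducible_iso_up_to_shift:
  assumes U: "submodule (hat_alg T) (LM a) U" "irreducible_module (hat_alg T) ((LM a)\<lparr>mcarrier := U\<rparr>)"
    and W: "submodule (hat_alg T) (LM a) W" "irreducible_module (hat_alg T) ((LM a)\<lparr>mcarrier := W\<rparr>)"
  shows "iso_up_to_grade_shift T ((LM a)\<lparr>mcarrier := U\<rparr>) ((LM a)\<lparr>mcarrier := W\<rparr>)"
proof -
  obtain s where s: "module_iso (hat_alg T) ((LM a)\<lparr>mcarrier := U\<rparr>) ((LM a)\<lparr>mcarrier := Ms s\<rparr>)"
    using irreducible_iso_Ms[OF U] by blast
  obtain s' where s': "module_iso (hat_alg T) ((LM a)\<lparr>mcarrier := W\<rparr>) ((LM a)\<lparr>mcarrier := Ms s'\<rparr>)"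
    using irreducible_iso_Ms[OF W] by blast
  have "module_iso (hat_alg T) ((LM a)\<lparr>mcarrier := Ms s'\<rparr>) ((LM a)\<lparr>mcarrier := W\<rparr>)"
    by (rule module_iso_sym[OF s']) (simp_all add: LM_scale submodule_closed[OF W(1)])
  then have "module_iso (hat_alg T) (grade_shift (s - s') ((LM a)\<lparr>mcarrier := Ms s'\<rparr>)) (grade_shift (s - s') ((LM a)\<lparr>mcarrier := W\<rparr>))"
    by (rule module_iso_grade_shift) (simp_all add: LM_scale submodule_closed[OF Ms_submodule] hat_carrier)
  then show ?thesis
    unfolding iso_up_to_grade_shift_def using module_iso_trans[OF s] module_iso_trans[OF Ms_iso_shift] by blast
qed

text \<open>Every irreducible summand contains a non-zero vector of degree in the fundamental box \<open>reps\<close>.\<close>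

lemma decomposition_finite:
  assumes dec: "irreducible_decomposition (hat_alg T) (LM a) C"
  shows "finite C"
proof -
  let ?E = "lm.span (\<Union>r\<in>reps. Poly_Mapping.single r ` Qc)"
  have "\<exists>e\<in>U. e \<noteq> 0 \<and> e \<in> ?E" if UC: "U \<in> C" for U
  proof -
    have U: "submodule (hat_alg T) (LM a) U" "irreducible_module (hat_alg T) ((LM a)\<lparr>mcarrier := U\<rparr>)"
      using dec UC by (auto simp: irreducible_decomposition_def)
    obtain s where s: "module_iso (hat_alg T) ((LM a)\<lparr>mcarrier := U\<rparr>) ((LM a)\<lparr>mcarrier := Ms s\<rparr>)"
      using irreducible_iso_Ms[OF U] by blast
    have "module_iso (hat_alg T) ((LM a)\<lparr>mcarrier := Ms s\<rparr>) ((LM a)\<lparr>mcarrier := U\<rparr>)"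
      by (rule module_iso_sym[OF s]) (simp_all add: LM_scale submodule_closed[OF U(1)])
    then obtain \<psi> where \<psi>: "bij_betw \<psi> (Ms s) U" "linear_on (pm_scale sq) (Ms s) (pm_scale sq) \<psi>"
      "\<And>x p. x \<in> lcarrier (hat_alg T) \<Longrightarrow> p \<in> Ms s \<Longrightarrow> \<psi> (mact (LM a) x p) = mact (LM a) x (\<psi> p)"
      unfolding module_iso_def by (auto simp: LM_scale)
    obtain \<alpha> t v where v: "\<alpha> \<in> cartan_dual T" "v \<in> wtsp \<alpha> (a0 + ivec t)" "\<pi> v \<noteq> 0" using exists_weight_vector by blast
    obtain \<rho> where \<rho>: "\<rho> \<in> reps" "period (\<rho> - (t - s))" using period_reps by blast
    obtain v' where v': "v' \<in> wtsp \<alpha> (a0 + ivec t + ivec (\<rho> - (t - s)))" "\<pi> v' = \<pi> v"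
      using \<rho>(2) v unfolding period_def by blast
    have "a0 + ivec t + ivec (\<rho> - (t - s)) = a0 + ivec (\<rho> + s)" by (simp add: ivec_diff ivec_add algebra_simps)
    then have "v' \<in> wtsp \<alpha> (a0 + ivec (\<rho> + s))" using v'(1) by (simp only:)
    then have "v' \<in> Vr (\<rho> + s)" using wtsp_Vr by blast
    then have ph: "phi s v' = Poly_Mapping.single \<rho> (\<pi> v)" and v'V: "v' \<in> Vc" using phi_homogeneous v'(2) Vr_V by auto
    define p where "p = Poly_Mapping.single \<rho> (\<pi> v)"
    have pM: "p \<in> Ms s" unfolding p_def ph[symmetric] Ms_def using v'V by (rule imageI)
    have p0: "p \<noteq> 0" using v(3) by (metis p_def lookup_single_eq lookup_zero)
    have pact: "mact (LM a) (0, d) p = pm_scale sq (pairing d (a + ivec \<rho>)) p" for d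
      by (rule poly_mapping_eqI) (auto simp: LM_lookup act_zero_left p_def lookup_single when_def)
    define e where "e = \<psi> p"
    have eU: "e \<in> U" using \<psi>(1) pM by (auto simp: e_def bij_betw_def)
    have eL: "e \<in> Lc" using eU U(1) by (auto simp: submodule_def LM_carrier)
    have "\<psi> 0 = 0" using lm.linear_on_0[OF \<psi>(2) lm.vector_space_axioms pM] .
    then have e0: "e \<noteq> 0"
      using \<psi>(1) pM p0 lm.subspace_0[OF subspace_Ms] unfolding e_def bij_betw_def by (metis inj_onD)
    \<comment> \<open>The isomorphism commutes with the d_i, so e inherits the degree \<rho> of
      p.\<close>
    have ev: "mact (LM a) (0, d) e = pm_scale sq (pairing d (a + ivec \<rho>)) e" for d
      using \<psi>(3)[of "(0, d)" p] \<psi>(2) pM pact by (simp add: e_def hat_carrier linear_on_def)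
    have deg: "sq (pairing d (a + ivec r)) (Poly_Mapping.lookup e r) = sq (pairing d (a + ivec \<rho>)) (Poly_Mapping.lookup e r)" for d r
    proof -
      have "sq (pairing d (a + ivec r)) (Poly_Mapping.lookup e r) = Poly_Mapping.lookup (mact (LM a) (0, d) e) r"
        by (simp add: LM_lookup[OF zero_LT] act_zero_left)
      then show ?thesis unfolding ev lookup_scale .
    qed
    have "Poly_Mapping.lookup e r = 0" if "r \<noteq> \<rho>" for r
    proof (rule ccontr)
      assume nz: "Poly_Mapping.lookup e r \<noteq> 0"
      have "\<forall>d. pairing d (a + ivec r) = pairing d (a + ivec \<rho>)"
      proof
        fix d show "pairing d (a + ivec r) = pairing d (a + ivec \<rho>)" using deg[of d r] nz by simp
      qed
      then show False using that unfolding pairing_eq_iff by simp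
    qed
    then have "e = Poly_Mapping.single \<rho> (Poly_Mapping.lookup e \<rho>)"
      by (intro poly_mapping_eqI) (auto simp: lookup_single when_def)
    moreover have "Poly_Mapping.lookup e \<rho> \<in> Qc" using eL by simp
    ultimately have "e \<in> Poly_Mapping.single \<rho> ` Qc" by (rule image_eqI)
    then have "e \<in> (\<Union>r\<in>reps. Poly_Mapping.single r ` Qc)" using \<rho>(1) by (rule UN_I[rotated])
    then have "e \<in> ?E" by (rule lm.span_base)
    then show ?thesis using eU e0 by (intro bexI[of _ e]) auto
  qed
  then have "\<forall>U\<in>C. \<exists>e. e \<in> U \<and> e \<noteq> 0 \<and> e \<in> ?E" by blast
  from bchoice[OF this] obtain e where e: "\<forall>U\<in>C. e U \<in> U \<and> e U \<noteq> 0 \<and> e U \<in> ?E" ..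
  have ds: "direct_sum (pm_scale sq) C id Lc" using dec by (simp add: irreducible_decomposition_def LM_scale LM_carrier)
  have subU: "submodule (hat_alg T) (LM a) U" if "U \<in> C" for U using dec that by (simp add: irreducible_decomposition_def)
  \<comment> \<open>Non-zero vectors from different summands of a direct sum are independent. All of
    them lie in the finite-dimensional \<open>?E\<close>, which bounds the number of
    summands.\<close>
  have "lm.indep_family C e"
    unfolding lm.indep_family_def
  proof (intro allI impI ballI)
    fix F c U assume F: "finite F" "F \<subseteq> C" "(\<Sum>U\<in>F. pm_scale sq (c U) (e U)) = 0" "U \<in> F"
    have "\<forall>U\<in>F. pm_scale sq (c U) (e U) \<in> id U" using F(2) e submodule_closed(2)[OF subU] by auto
    then have "pm_scale sq (c U) (e U) = 0"
      using ds[unfolded direct_sum_def, THEN conjunct2, rule_format, of F "\<lambda>U. pm_scale sq (c U) (e U)" U] F by blast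
    then show "c U = 0" using e F(2,4) lm.scale_eq_0_iff by blast
  qed
  moreover have "fin_dim (pm_scale sq) ?E" by (rule lm.fin_dim_span_UN[OF finite_reps fin_dim_single])
  ultimately show ?thesis using lm.indep_family_finite e by blast
qed

text \<open>For a = a0 and s = 0 the scalars in \<open>phi_act\<close> vanish, and the embedding
  respects the d_i as well.\<close>

lemma V_iso_Ms: "module_iso (hat_alg T) (restrict_hat V) ((LM a0)\<lparr>mcarrier := Ms 0\<rparr>)"
  unfolding module_iso_def
proof (intro exI[of _ "phi 0"] conjI ballI)
  show "bij_betw (phi 0) (mcarrier (restrict_hat V)) (mcarrier ((LM a0)\<lparr>mcarrier := Ms 0\<rparr>))"
    using phi_inj_on by (simp add: restrict_hat_def Ms_def bij_betw_imageI)
  show "linear_on (mscale (restrict_hat V)) (mcarrier (restrict_hat V)) (mscale ((LM a0)\<lparr>mcarrier := Ms 0\<rparr>)) (phi 0)"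
    using phi_linear by (simp add: restrict_hat_def LM_scale)
  fix x v assume x: "x \<in> lcarrier (hat_alg T)" and "v \<in> mcarrier (restrict_hat V)"
  then obtain y d where y: "x = (y, d)" "y \<in> LT T" and v: "v \<in> Vc" by (auto simp: hat_alg_def restrict_hat_def)
  show "phi 0 (mact (restrict_hat V) x v) = mact ((LM a0)\<lparr>mcarrier := Ms 0\<rparr>) x (phi 0 v)"
    using phi_act[OF y(2) v, of 0 d a0] y(1) by (simp add: restrict_hat_def)
qed

lemma loop_module_part:
  "lie_module (hat_alg T) (LM a) \<and> completely_reducible (hat_alg T) (LM a) \<and> hat_integrable T (LM a) \<and>
   (\<forall>C. irreducible_decomposition (hat_alg T) (LM a) C \<longrightarrow> finite C \<and>
      (\<forall>M\<in>C. \<forall>N\<in>C. iso_up_to_grade_shift T ((LM a)\<lparr>mcarrier := M\<rparr>) ((LM a)\<lparr>mcarrier := N\<rparr>)))"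
proof (intro conjI allI impI ballI)
  show "completely_reducible (hat_alg T) (LM a)" using LM_decomposition unfolding completely_reducible_def by blast
  fix C M N assume "irreducible_decomposition (hat_alg T) (LM a) C" "M \<in> C" "N \<in> C"
  then show "iso_up_to_grade_shift T ((LM a)\<lparr>mcarrier := M\<rparr>) ((LM a)\<lparr>mcarrier := N\<rparr>)"
    by (intro irreducible_iso_up_to_shift) (auto simp: irreducible_decomposition_def)
qed (use LM_lie_module LM_integrable decomposition_finite in auto)

text \<open>\<open>Ms 0\<close> need not be a member of the chosen decomposition, but as an
  irreducible submodule it is isomorphic to one.\<close>

lemma realisation_part:
  "\<exists>C. irreducible_decomposition (hat_alg T) (LM a0) C \<and> finite C \<and>
     (\<exists>M\<in>C. module_iso (hat_alg T) (restrict_hat V) ((LM a0)\<lparr>mcarrier := M\<rparr>))"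
proof -
  obtain C where C: "irreducible_decomposition (hat_alg T) (LM a0) C" using LM_decomposition by blast
  have fin: "finite C" using decomposition_finite[OF C] .
  obtain M where "M \<in> C" "module_iso (hat_alg T) ((LM a0)\<lparr>mcarrier := Ms 0\<rparr>) ((LM a0)\<lparr>mcarrier := M\<rparr>)"
    using lm.irreducible_iso_summand[OF LM_scale LM_endo_carrier C fin Ms_submodule Ms_irreducible] by blast
  then show ?thesis using C fin module_iso_trans[OF V_iso_Ms] by blast
qed

end

theorem theorem6p4:
  fixes T :: "('g::ab_group_add, 'n::finite) torus_data"
    and V :: "(('g, 'n) tilde, 'v::ab_group_add) lmod"
    and lam :: "'g \<Rightarrow> complex"
    and f :: "'n \<Rightarrow> int^'n" and l :: "'n \<Rightarrow> int" and z :: "'n \<Rightarrow> 'v \<Rightarrow> 'v"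
    and V'' :: "'v set"
    and Vbar :: "(('g, 'n) mloop, 'q::ab_group_add) lmod" and \<pi> :: "'v \<Rightarrow> 'q"
  assumes "lie_torus T"
    and "lie_module (tilde_alg T) V"
    and "irreducible_module (tilde_alg T) V"
    and "tilde_integrable T V"
    and "\<forall>i. \<forall>v\<in>mcarrier V. mact V (0, tK 0 i, 0) v = 0"
    and "lam \<in> cartan_dual T"
    and "\<forall>h\<in>gcartan T. \<forall>v\<in>highest_space T V.
           mact V (Poly_Mapping.single 0 h, 0, 0) v = mscale V (lam h) v"
    and "lam \<noteq> zero_fun"
    and "reduction_data T V f l z"
    and "maximal_submodule (LT_alg T) (restrict_LT V) V''"
    and "V_prime T V z \<subseteq> V''"
    and "quotient_module (LT_alg T) (restrict_LT V) V'' Vbar \<pi>"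
  shows
    "(\<forall>a :: complex^'n.
        lie_module (hat_alg T) (loop_module a Vbar) \<and>
        completely_reducible (hat_alg T) (loop_module a Vbar) \<and>
        hat_integrable T (loop_module a Vbar) \<and>
        (\<forall>C. irreducible_decomposition (hat_alg T) (loop_module a Vbar) C \<longrightarrow>
           finite C \<and>
           (\<forall>M\<in>C. \<forall>N\<in>C. iso_up_to_grade_shift T
              ((loop_module a Vbar)\<lparr>mcarrier := M\<rparr>) ((loop_module a Vbar)\<lparr>mcarrier := N\<rparr>)))) \<and>
     (\<exists>a :: complex^'n. \<exists>C. irreducible_decomposition (hat_alg T) (loop_module a Vbar) C \<and> finite C \<and>
        (\<exists>M\<in>C. module_iso (hat_alg T) (restrict_hat V) ((loop_module a Vbar)\<lparr>mcarrier := M\<rparr>)))"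
proof -
  \<comment> \<open>The reduction data contain a highest weight vector: \<open>z i v\<close> is
    non-zero for some v in V_+, and z i is linear, so v is non-zero.\<close>
  have "\<exists>v\<in>highest_space T V. v \<noteq> 0"
  proof -
    interpret vs: complex_vs "mscale V" using assms(2) by (simp add: complex_vs_def lie_module_def)
    fix i
    have "highest_central_operator T V (l i *s f i) (z i) \<and> (\<exists>v\<in>highest_space T V. z i v \<noteq> 0)"
      using assms(9) by (simp add: reduction_data_def)
    then obtain v where v: "v \<in> highest_space T V" "z i v \<noteq> 0" "linear_on (mscale V) (highest_space T V) (mscale V) (z i)"
      unfolding highest_central_operator_def by blast
    have "z i 0 = 0" using vs.linear_on_0[OF v(3) vs.vector_space_axioms v(1)] .
    then have "v \<noteq> 0" using v(2) by auto
    then show ?thesis using v(1) by blast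
  qed
  then interpret torus_quotient T V lam f l z V'' Vbar \<pi>
    by unfold_locales (use assms in auto)
  show ?thesis by (rule conjI, rule allI, rule loop_module_part, rule exI, rule realisation_part)
qed

end
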